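(* Let $1\le p\le\infty$, let $\varphi$ be a logarithmic weight satisfying conditions (i)--(iv) (listed in the context), and suppose in addition that (v) $$\lim_{t\to\infty}\frac{t\varphi'(t)}{\left(t^3\int_t^\infty \frac{\varphi(\xi)}{\xi^4}\,d\xi\right)^{2/3}}=+\infty .$$ Let $W$, $\rho_{p,W}$ and $Q$ be associated with $\varphi$ as in the context. Then, as $s\to 0$ ($s>0$), $$\log\rho_{p,W}(s)=-(1+o(1))\,Q(s)$$ and $$\left(\mathcal F^{-1}\tfrac1W\right)(s)=(1+o(1))\sqrt{Q''(s)}\,e^{-Q(s)} .$$ Furthermore, if additionally $\varphi$ has positive lower order, i.e. (vi) $$\liminf_{t\to\infty}\frac{\log\varphi(t)}{\log t}>0,$$ then, as $s\to0$ ($s>0$), $$\log\rho_{p,W}(s)=-Q(s)+O(\log Q(s)).$$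
   Context: Conditions on the logarithmic weight $\varphi:\mathbb R\to\mathbb R$: (i) $\varphi$ is non-negative and even on $\mathbb R$; (ii) $\varphi$ increases on $(0,\infty)$ and $\lim_{t\to\infty}\varphi(t)/\log t=\infty$; (iii) $\int_{\mathbb R}\frac{\varphi(t)}{t^2+1}\,dt<\infty$; (iv) at least one of the following holds: (iv-a) the function $\tau\mapsto\varphi(e^\tau)$ is convex; (iv-b) $\varphi$ is concave on $(0,\infty)$ and $\lim_{t\to\infty}t\varphi'(t+0)=\infty$. Standing assumptions: $\varphi$ is continuous on $\mathbb R$, $C^2$ on $(0,\infty)$, and $\varphi(0)=0$. $\mathbb C_+$ is the open upper half-plane, and $H^p$ ($1\le p\le\infty$) is the usual Hardy space of analytic functions in $\mathbb C_+$. The outer weight function $W$ in $\mathbb C_+$ is $$W(z)=\exp\left\{\frac1{\pi i}\int_{\mathbb R}\left[\frac1{t-z}-\frac t{t^2+1}\right]\varphi(t)\,dt\right\},$$ so that $|W(t)|=e^{\varphi(t)}$ for boundary values on $\mathbb R$. The weighted Hardy space is $H^p(W)=\{f: f \text{ analytic in }\mathbb C_+,\ Wf\in H^p\}$ with $\|f\|_{H^p(W)}=\|Wf\|_{H^p}$. The inverse Fourier transform (of boundary values on $\mathbb R$) is $$(\mathcal F^{-1}f)(s)=\frac1{\sqrt{2\pi}}\int_{\mathbb R}f(x)e^{-isx}\,dx,$$ and $$\rho_{p,W}(s)=\sup_{\|f\|_{H^p(W)}\le1}|(\mathcal F^{-1}f)(s)| .$$ The upper Legendre transform is, for $s>0$,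 $$Q(s)=\sup_{y>0}\left[\log|W(iy)|-ys\right]=\sup_{y>0}\left[\frac{2y}{\pi}\int_0^\infty\frac{\varphi(t)\,dt}{t^2+y^2}-ys\right].$$ *)

theory Defs
  imports "HOL-Analysis.Analysis" "HOL-Library.Landau_Symbols"
begin

unbundle asymp_equiv_syntax

text \<open>
  \<open>C2\<close> on \<open>(0, \<infinity>)\<close> is spelled out as two differentiability assumptions and one continuity
  assumption. Because of it the right derivative \<open>\<phi>'(t+0)\<close> in the last assumption is just
  \<^term>\<open>deriv \<phi> t\<close>. The integrand in \<open>integrable\<close> is nonnegative, so integrability is
  finiteness of the integral. ``Increases'' is taken in the weak sense.
\<close>

locale log_weight =
  fixes \<phi> :: "real \<Rightarrow> real"
  assumes continuous: "continuous_on UNIV \<phi>"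
    and differentiable: "\<phi> differentiable_on {0<..}"
    and deriv_differentiable: "deriv \<phi> differentiable_on {0<..}"
    and deriv2_continuous: "continuous_on {0<..} (deriv (deriv \<phi>))"
    and zero: "\<phi> 0 = 0"
    and nonneg: "\<And>t. \<phi> t \<ge> 0"
    and even: "\<And>t. \<phi> (- t) = \<phi> t"
    and mono: "mono_on {0<..} \<phi>"
    and growth: "filterlim (\<lambda>t. \<phi> t / ln t) at_top at_top"
    and integrable: "integrable lborel (\<lambda>t. \<phi> t / (t\<^sup>2 + 1))"
    and convex_or_concave:
      "convex_on UNIV (\<lambda>\<tau>. \<phi> (exp \<tau>)) \<or>
       concave_on {0<..} \<phi> \<and> filterlim (\<lambda>t. t * deriv \<phi> t) at_top at_top"

definition upper_half_plane :: "complex set" where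
  "upper_half_plane = {z. Im z > 0}"

definition outer_weight :: "(real \<Rightarrow> real) \<Rightarrow> complex \<Rightarrow> complex" where
  "outer_weight \<phi> z =
     exp (1 / (of_real pi * \<i>) *
       (\<integral>t. (1 / (of_real t - z) - of_real (t / (t\<^sup>2 + 1))) * of_real (\<phi> t) \<partial>lborel))"

text \<open>
  For \<open>p < \<infinity>\<close> the integral means are taken as extended nonnegative integrals, so their
  supremum over all horizontal lines is always meaningful. Functions in the Hardy spaces have type
  \<^typ>\<open>complex \<Rightarrow> complex\<close>, but nothing below depends on their values outside the
  open upper half-plane.
\<close>

definition hardy_mean_sup :: "real \<Rightarrow> (complex \<Rightarrow> complex) \<Rightarrow> ennreal" where
  "hardy_mean_sup p f = (SUP y\<in>{0<..}. \<integral>\<^sup>+x. ennreal (cmod (f (Complex x y)) powr p) \<partial>lborel)"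

definition hardy_space :: "ennreal \<Rightarrow> (complex \<Rightarrow> complex) set" where
  "hardy_space p = {f. f holomorphic_on upper_half_plane \<and>
     (if p = \<infinity> then bounded (f ` upper_half_plane)
      else hardy_mean_sup (enn2real p) f < \<infinity>)}"

definition hardy_norm :: "ennreal \<Rightarrow> (complex \<Rightarrow> complex) \<Rightarrow> real" where
  "hardy_norm p f =
     (if p = \<infinity> then (SUP z\<in>upper_half_plane. cmod (f z))
      else enn2real (hardy_mean_sup (enn2real p) f) powr (1 / enn2real p))"

definition weighted_hardy_space :: "ennreal \<Rightarrow> (complex \<Rightarrow> complex) \<Rightarrow> (complex \<Rightarrow> complex) set" where
  "weighted_hardy_space p W =
     {f. f holomorphic_on upper_half_plane \<and> (\<lambda>z. W z * f z) \<in> hardy_space p}"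

definition weighted_hardy_norm :: "ennreal \<Rightarrow> (complex \<Rightarrow> complex) \<Rightarrow> (complex \<Rightarrow> complex) \<Rightarrow> real" where
  "weighted_hardy_norm p W f = hardy_norm p (\<lambda>z. W z * f z)"

text \<open>
  Boundary values are limits along vertical rays. For the functions considered they exist for almost
  every \<open>x\<close> only; at the exceptional points \<^const>\<open>Lim\<close> is an arbitrary number, which is why
  the Fourier integral is taken over the complete measure \<^const>\<open>lebesgue\<close>.
\<close>

definition boundary_value :: "(complex \<Rightarrow> complex) \<Rightarrow> real \<Rightarrow> complex" where
  "boundary_value f x = Lim (at_right 0) (\<lambda>y. f (Complex x y))"

definition inverse_fourier :: "(complex \<Rightarrow> complex) \<Rightarrow> real \<Rightarrow> complex" where
  "inverse_fourier f s =
     of_real (1 / sqrt (2 * pi)) *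
       (\<integral>x. boundary_value f x * exp (- \<i> * of_real s * of_real x) \<partial>lebesgue)"

text \<open>
  For a logarithmic weight the suprema below are over nonempty sets that are bounded above:
  \<open>exp (- \<phi>)\<close> decays faster than any power, so the unit ball is bounded in \<open>L1\<close>
  of the line, and \<open>log |W(iy)| = o(y)\<close> as \<open>y \<rightarrow> \<infinity>\<close>.
\<close>

definition rho :: "ennreal \<Rightarrow> (complex \<Rightarrow> complex) \<Rightarrow> real \<Rightarrow> real" where
  "rho p W s =
     (SUP f\<in>{f \<in> weighted_hardy_space p W. weighted_hardy_norm p W f \<le> 1}.
        cmod (inverse_fourier f s))"

definition legendre_Q :: "(complex \<Rightarrow> complex) \<Rightarrow> real \<Rightarrow> real" where
  "legendre_Q W s = (SUP y\<in>{0<..}. ln (cmod (W (Complex 0 y))) - y * s)"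

end

theory Submission
  imports Defs "HOL-Complex_Analysis.Complex_Analysis" "HOL-Probability.Distributions"
begin

text \<open>
  A function with bounded \<open>L\<^sup>1\<close> means on horizontal lines is a product of two functions with bounded
  \<open>L\<^sup>2\<close> means (divide on the line \<open>Im z = \<epsilon>\<close> by an outer square root, then pass to the limit by
  Montel's theorem), and the \<open>L\<^sup>2\<close> means are a convex decreasing function of the height; hence such a
  function has boundary values in \<open>L\<^sup>1\<close>, and its Fourier integral may be computed on any horizontal line.

  For \<open>1/W\<close> the line is taken through the saddle point \<open>iy\<close> with \<open>(log W(iy))' = s\<close>. Put
  \<open>U = log |W|\<close>. The radial representation of \<open>U\<close> by Poisson tails bounds \<open>U(x + iy) - U(iy)\<close> below by
  a multiple of the curvature \<open>\<sigma>\<^sup>2\<close> of \<open>U\<close> at \<open>iy\<close>, while the cubic Taylor remainder of \<open>log W\<close> is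
  controlled by \<open>q(y) / y\<^sup>3\<close> with \<open>q(y) = Q(s)\<close>. Condition (v) says that \<open>q(y) / (\<sigma> y)\<^sup>3\<close> tends to 0, so
  after rescaling by \<open>\<sigma>\<close> the integrand converges to a Gaussian, dominated by a multiple of \<open>1 / (1 + v\<^sup>2)\<close>.

  The same line bounds \<open>\<rho>\<close> above, up to powers of \<open>y\<close> and \<open>q(y)\<close>, and the function
  \<open>- 1 / (\<pi> (z + i)\<^sup>2 W(z))\<close> of the unit ball bounds it below.
\<close>

section \<open>Shifting the line of integration\<close>

text \<open>\<open>rho\<close> is defined through boundary values, which exist only almost
  everywhere, so the line of integration cannot be moved before \<open>L1\<close> convergence of a
  Hardy function to its boundary values is known. Bounded \<open>L1\<close> means alone do not
  prevent a singular limit; in \<open>L2\<close> an identity for the distance between two heights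
  gives strong convergence, and hence the factorization. With U' the derivative in y, the number
  q(y) = U(iy) - y U'(iy) has two roles: it is Q at s = U'(iy), and it is the integral of phi
  against 2 y^3 / (pi (t^2 + y^2)^2), the kernel that also majorizes the cubic remainder. Splitting
  this integral at |t| = y bounds q by the moment in (v), and the exponent 2/3 turns sigma^2 y^2 >=
  K q^(2/3) into (sigma y)^3 >= K^(3/2) q. For |x| > y the quadratic bound on U is lost; there it is
  enough that r phi'(r) >= 4, which contributes the factor (y/x)^2 to the majorant.\<close>

lemma continuous_on_Complex [continuous_intros]:
  "continuous_on S f \<Longrightarrow> continuous_on S g \<Longrightarrow> continuous_on S (\<lambda>x. Complex (f x) (g x))"
  unfolding Complex_eq by (intro continuous_intros)

text \<open>Otherwise the norm of \<open>D\<close> stays above half the norm of \<open>l\<close> on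
  a half-line, and its integral exceeds every bound.\<close>

lemma tendsto_at_top_integrable_imp_zero:
  fixes D :: "real \<Rightarrow> 'a::{banach, second_countable_topology}"
  assumes "integrable lborel D" "(D \<longlongrightarrow> l) at_top"
  shows "l = 0"
proof (rule ccontr)
  assume "l \<noteq> 0"
  have "((\<lambda>x. norm (D x)) \<longlongrightarrow> norm l) at_top"
    by (intro tendsto_intros assms)
  then have "eventually (\<lambda>x. norm (D x) > norm l / 2) at_top"
    using \<open>l \<noteq> 0\<close> by (intro order_tendstoD) auto
  then obtain N where N: "\<And>x. x \<ge> N \<Longrightarrow> norm (D x) > norm l / 2"
    by (auto simp: eventually_at_top_linorder)
  define I where "I = (\<integral>x. norm (D x) \<partial>lborel)"
  have le: "norm l / 2 * M \<le> I" if "M \<ge> 0" for M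
  proof -
    have "norm l / 2 * M = (\<integral>x. norm l / 2 * indicator {N..N+M} x \<partial>lborel)"
      using that by simp
    also have "\<dots> \<le> I"
      unfolding I_def
    proof (intro integral_mono)
      show "norm l / 2 * indicator {N..N + M} x \<le> norm (D x)" for x
        using N[of x] by (cases "x \<in> {N..N + M}") auto
      have "integrable lborel (indicat_real {N..N + M})"
        using that by (intro integrable_real_indicator) auto
      then show "integrable lborel (\<lambda>x. norm l / 2 * indicat_real {N..N + M} x)"
        by (rule integrable_mult_right)
    qed (use assms(1) in auto)
    finally show ?thesis .
  qed
  have "0 \<le> I" by (simp add: I_def)
  with le[of "I / (norm l / 2) + 1"] have "norm l / 2 * (I / (norm l / 2) + 1) \<le> I"
    by simp
  also have "norm l / 2 * (I / (norm l / 2) + 1) = I + norm l / 2"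
    using \<open>l \<noteq> 0\<close> by (simp add: distrib_left)
  finally show False
    using \<open>l \<noteq> 0\<close> by simp
qed

text \<open>Integrability of \<open>d\<close> makes \<open>D\<close> converge at infinity, and
  integrability of \<open>D\<close> itself leaves 0 as the only possible limit. The half-line form
  lets reflection supply the other half.\<close>

lemma tendsto_at_top_of_integrable_derivative:
  fixes D :: "real \<Rightarrow> complex"
  assumes D: "\<And>x. (D has_vector_derivative d x) (at x)"
    and d: "continuous_on UNIV d" "integrable lborel d"
    and "integrable lborel D"
  shows "(LBINT x:{0..}. d x) = - D 0"
proof -
  have 1: "((\<lambda>b. LBINT x:{0..b}. d x) \<longlongrightarrow> (LBINT x:{0..}. d x)) at_top"
    using d by (intro tendsto_set_lebesgue_integral_at_top) (auto simp: set_integrable_def intro!: integrable_mult_indicator)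
  have 2: "(LBINT x:{0..b}. d x) = D b - D 0" if "b \<ge> 0" for b
    unfolding set_lebesgue_integral_def using that
    by (intro integral_FTC_Icc[of 0 b D d])
       (auto intro!: continuous_on_subset[OF d(1)] has_vector_derivative_at_within D)
  have "((\<lambda>b. D 0 + (LBINT x:{0..b}. d x)) \<longlongrightarrow> D 0 + (LBINT x:{0..}. d x)) at_top"
    by (intro tendsto_intros 1)
  then have "(D \<longlongrightarrow> D 0 + (LBINT x:{0..}. d x)) at_top"
    by (rule Lim_transform_eventually)
       (auto simp: 2 eventually_at_top_linorder intro!: exI[of _ 0])
  then have "D 0 + (LBINT x:{0..}. d x) = 0"
    by (rule tendsto_at_top_integrable_imp_zero[OF assms(4)])
  then show ?thesis
    by (simp add: add_eq_0_iff)
qed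

lemma integral_derivative_eq_0:
  fixes D :: "real \<Rightarrow> complex"
  assumes D: "\<And>x. (D has_vector_derivative d x) (at x)"
    and d: "continuous_on UNIV d" "integrable lborel d"
    and int: "integrable lborel D"
  shows "(\<integral>x. d x \<partial>lborel) = 0"
proof -
  have A: "(LBINT x:{0..}. d x) = - D 0"
    by (rule tendsto_at_top_of_integrable_derivative[OF assms])
  have refl: "integrable lborel (\<lambda>x. f (- x))" if "integrable lborel f" for f :: "real \<Rightarrow> complex"
    using lborel_integrable_real_affine[OF that, of "-1" 0] by simp
  have "(LBINT x:{0..}. - d (- x)) = - D (- 0)"
  proof (rule tendsto_at_top_of_integrable_derivative)
    show "((\<lambda>x. D (- x)) has_vector_derivative - d (- x)) (at x)" for x
    proof -
      have "(uminus has_vector_derivative - 1) (at x)"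
        by (auto intro!: derivative_eq_intros)
      from vector_diff_chain_at[OF this D] show ?thesis
        by (simp add: o_def)
    qed
    show "continuous_on UNIV (\<lambda>x. - d (- x))"
      by (intro continuous_intros continuous_on_compose2[OF d(1)]) auto
  qed (use refl[OF d(2)] refl[OF int] in auto)
  then have B: "(\<integral>x. indicator {0..} x *\<^sub>R d (- x) \<partial>lborel) = D 0"
    by (simp add: set_lebesgue_integral_def)
  have C: "(\<integral>x. indicator {0..} x *\<^sub>R d (- x) \<partial>lborel) = (\<integral>x. indicator {0..} (- x) *\<^sub>R d x \<partial>lborel)"
    by (subst lborel_integral_real_affine[of "-1" _ 0]) auto
  have ind: "indicat_real {0..} (- x) = indicator {..0} x" for x :: real
    by (auto simp: indicator_def)
  have i: "integrable lborel (\<lambda>x. indicator {..0} x *\<^sub>R d x)" "integrable lborel (\<lambda>x. indicator {0..} x *\<^sub>R d x)"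
    using d(2) by (simp_all add: integrable_mult_indicator)
  have [measurable]: "d \<in> borel_measurable lborel"
    using d(2) by auto
  have "AE x in lborel. d x = indicator {..0} x *\<^sub>R d x + indicator {0..} x *\<^sub>R d x"
    using AE_lborel_singleton[of "0::real"] by eventually_elim (auto simp: indicator_def)
  then have "(\<integral>x. d x \<partial>lborel) = (\<integral>x. indicator {..0} x *\<^sub>R d x + indicator {0..} x *\<^sub>R d x \<partial>lborel)"
    by (intro integral_cong_AE) auto
  also have "\<dots> = (\<integral>x. indicator {..0} x *\<^sub>R d x \<partial>lborel) + (\<integral>x. indicator {0..} x *\<^sub>R d x \<partial>lborel)"
    by (intro Bochner_Integration.integral_add i)
  finally show ?thesis
    using A B C by (simp add: set_lebesgue_integral_def ind)
qed

lemma integrable_line: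
  fixes f :: "complex \<Rightarrow> complex"
  assumes "continuous_on S f" "\<And>x. Complex x y \<in> S"
    and "(\<integral>\<^sup>+x. norm (f (Complex x y)) \<partial>lborel) \<le> ennreal C"
  shows "integrable lborel (\<lambda>x. f (Complex x y))"
    and "continuous_on UNIV (\<lambda>x. f (Complex x y))"
proof -
  show *: "continuous_on UNIV (\<lambda>x. f (Complex x y))"
    by (rule continuous_on_compose2[OF assms(1)]) (auto intro!: continuous_intros assms)
  show "integrable lborel (\<lambda>x. f (Complex x y))"
    unfolding integrable_iff_bounded
    using assms(3) * by (auto intro!: borel_measurable_continuous_onI simp: order_le_less_trans)
qed

lemma has_vector_derivative_horizontal:
  assumes "(F has_field_derivative f) (at (Complex x y))"
  shows "((\<lambda>x. F (Complex x y)) has_vector_derivative f) (at x)"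
proof -
  have "((\<lambda>x. Complex x y) has_vector_derivative 1) (at x)"
    unfolding Complex_eq by (auto intro!: derivative_eq_intros)
  from field_vector_diff_chain_at[OF this assms] show ?thesis
    by (simp add: o_def)
qed

lemma has_vector_derivative_vertical:
  assumes "(F has_field_derivative f) (at (Complex x y))"
  shows "((\<lambda>y. F (Complex x y)) has_vector_derivative \<i> * f) (at y)"
proof -
  have "((\<lambda>y. Complex x y) has_vector_derivative \<i>) (at y)"
    unfolding Complex_eq by (auto intro!: derivative_eq_intros)
  from field_vector_diff_chain_at[OF this assms] show ?thesis
    by (simp add: o_def)
qed

lemma convex_strip: "convex {z. c < Im z \<and> Im z < d}" (is "convex ?S")
  and open_strip: "open {z. c < Im z \<and> Im z < d}"
proof -
  have "?S = {z. c < Im z} \<inter> {z. Im z < d}" by auto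
  then show "convex ?S" "open ?S"
    by (auto intro!: convex_Int open_Int convex_halfspace_Im_gt convex_halfspace_Im_lt
        open_halfspace_Im_gt open_halfspace_Im_lt)
qed

text \<open>
  The vertical sides of the rectangle contribute the difference of the values at two points of an
  integrable function with integrable derivative.
\<close>

lemma line_integral_shift:
  fixes f :: "complex \<Rightarrow> complex"
  assumes holo: "f holomorphic_on {z. c < Im z \<and> Im z < d}"
    and cd: "c < a" "a \<le> b" "b < d"
    and bnd: "\<And>y. y \<in> {a..b} \<Longrightarrow> (\<integral>\<^sup>+x. norm (f (Complex x y)) \<partial>lborel) \<le> ennreal C"
  shows "(\<integral>x. f (Complex x a) \<partial>lborel) = (\<integral>x. f (Complex x b) \<partial>lborel)"
proof -
  define S where "S = {z. c < Im z \<and> Im z < d}"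
  have S: "convex S" "open S" "f holomorphic_on S"
    using convex_strip open_strip holo by (auto simp: S_def)
  obtain F where F: "\<And>z. z \<in> S \<Longrightarrow> (F has_field_derivative f z) (at z within S)"
    using holomorphic_convex_primitive'[OF S] by blast
  have F: "(F has_field_derivative f (Complex x y)) (at (Complex x y))" if "y \<in> {a..b}" for x y
    using F[of "Complex x y"] at_within_open[of "Complex x y" S] S that cd by (auto simp: S_def)
  have cont: "continuous_on S f"
    by (rule holomorphic_on_imp_continuous_on) fact
  have line: "integrable lborel (\<lambda>x. f (Complex x y))" "continuous_on UNIV (\<lambda>x. f (Complex x y))"
    if "y \<in> {a..b}" for y
    using integrable_line[OF cont _ bnd[OF that]] that cd by (auto simp: S_def)
  \<comment> \<open>\<open>D x\<close> is the integral of f dz over the vertical segment at abscissa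
    x; its derivative is the difference of the two integrands to be compared.\<close>
  define D where "D x = F (Complex x b) - F (Complex x a)" for x
  define g where "g p = indicator (UNIV \<times> {a..b}) p *\<^sub>R f (Complex (fst p) (snd p))" for p :: "real \<times> real"
  have [measurable]: "g \<in> borel_measurable (lborel \<Otimes>\<^sub>M lborel)"
    unfolding g_def lborel_prod using cd
    by (simp, intro borel_measurable_continuous_on_indicator continuous_on_compose2[OF cont])
       (auto intro!: continuous_intros closed_Times borel_closed simp: S_def)
  have D': "(D has_vector_derivative f (Complex x b) - f (Complex x a)) (at x)" for x
    unfolding D_def using cd by (intro derivative_intros has_vector_derivative_horizontal F) auto
  have D_cont: "continuous_on UNIV D"
    using D' by (intro continuous_at_imp_continuous_on) (auto intro: has_vector_derivative_continuous)
  have "norm (D x) \<le> (\<integral>\<^sup>+y. norm (g (x, y)) \<partial>lborel)" for x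
  proof -
    have vc: "continuous_on {a..b} (\<lambda>y. f (Complex x y))"
      using cd by (intro continuous_on_compose2[OF cont] continuous_intros) (auto simp: S_def)
    have "(\<integral>y. indicator {a..b} y *\<^sub>R (\<i> * f (Complex x y)) \<partial>lborel) = D x"
      unfolding D_def using cd F
      by (intro integral_FTC_Icc)
         (auto intro!: has_vector_derivative_at_within has_vector_derivative_vertical continuous_intros vc)
    then have "norm (D x) = norm (\<integral>y. indicator {a..b} y *\<^sub>R (\<i> * f (Complex x y)) \<partial>lborel)"
      by simp
    also have "ennreal \<dots> \<le> (\<integral>\<^sup>+y. norm (indicator {a..b} y *\<^sub>R (\<i> * f (Complex x y))) \<partial>lborel)"
      by (rule integral_norm_bound_ennreal)
         (use borel_integrable_atLeastAtMost'[OF continuous_on_mult_left[OF vc, of \<i>]]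
          in \<open>auto simp: set_integrable_def\<close>)
    also have "\<dots> = (\<integral>\<^sup>+y. norm (g (x, y)) \<partial>lborel)"
      by (intro nn_integral_cong) (auto simp: g_def norm_mult indicator_def)
    finally show ?thesis .
  qed
  \<comment> \<open>By Tonelli the \<open>L1\<close> norm of \<open>D\<close> is at most the
    integral of the horizontal means over the heights, that is C (b - a).\<close>
  then have "(\<integral>\<^sup>+x. norm (D x) \<partial>lborel) \<le> (\<integral>\<^sup>+x. \<integral>\<^sup>+y. norm (g (x, y)) \<partial>lborel \<partial>lborel)"
    by (intro nn_integral_mono) auto
  also have "\<dots> = (\<integral>\<^sup>+y. \<integral>\<^sup>+x. norm (g (x, y)) \<partial>lborel \<partial>lborel)"
    by (intro lborel_pair.Fubini'[symmetric]) measurable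
  also have "\<dots> \<le> (\<integral>\<^sup>+y. ennreal C * indicator {a..b} y \<partial>lborel)"
    using bnd by (intro nn_integral_mono) (auto simp: g_def indicator_def)
  also have "\<dots> < \<infinity>"
    using cd by (subst nn_integral_cmult_indicator) (auto simp: ennreal_mult_less_top)
  finally have "integrable lborel D"
    using D_cont by (auto simp: integrable_iff_bounded intro!: borel_measurable_continuous_onI)
  then have "(\<integral>x. f (Complex x b) - f (Complex x a) \<partial>lborel) = 0"
    using cd by (intro integral_derivative_eq_0[OF D']) (auto intro!: continuous_intros line)
  then show ?thesis
    using cd line by simp
qed

section \<open>The Poisson kernel\<close>

lemma uhp_iff [simp]: "z \<in> upper_half_plane \<longleftrightarrow> Im z > 0"
  by (simp add: upper_half_plane_def)

lemma upper_half_plane: "open upper_half_plane" "convex upper_half_plane"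
  by (simp_all add: upper_half_plane_def open_halfspace_Im_gt convex_halfspace_Im_gt)

text \<open>Normalized to total mass 1, so that integrals against it are averages.\<close>

definition poisson :: "complex \<Rightarrow> real \<Rightarrow> real" where
  "poisson z t = Im z / (pi * ((t - Re z)\<^sup>2 + (Im z)\<^sup>2))"

lemma poisson_nonneg [simp]: "Im z > 0 \<Longrightarrow> poisson z t \<ge> 0"
  by (simp add: poisson_def)

lemma poisson_denominator_pos: "Im z > 0 \<Longrightarrow> (t - Re z)\<^sup>2 + (Im z)\<^sup>2 > 0"
  by (simp add: add_nonneg_pos)

lemma continuous_poisson [continuous_intros]:
  "Im z > 0 \<Longrightarrow> continuous_on S f \<Longrightarrow> continuous_on S (\<lambda>t. poisson z (f t))"
  unfolding poisson_def
  by (intro continuous_intros) (use poisson_denominator_pos in \<open>auto simp: less_imp_neq[THEN not_sym]\<close>)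

lemma measurable_poisson [measurable]: "poisson z \<in> borel_measurable borel"
  unfolding poisson_def by measurable

lemma DERIV_arctan_poisson:
  assumes "Im z > 0"
  shows "((\<lambda>t. arctan ((t - Re z) / Im z) / pi) has_real_derivative poisson z t) (at t)"
proof -
  have "((\<lambda>t. (t - Re z) / Im z) has_real_derivative 1 / Im z) (at t)"
    using assms by (auto intro!: derivative_eq_intros)
  from DERIV_cdivide[OF DERIV_chain2[OF DERIV_arctan this], of pi]
  have "((\<lambda>t. arctan ((t - Re z) / Im z) / pi) has_real_derivative
     (1 / Im z / (1 + ((t - Re z) / Im z)\<^sup>2) / pi)) (at t)"
    by (simp add: divide_inverse mult.commute)
  also have "1 + ((t - Re z) / Im z)\<^sup>2 = ((t - Re z)\<^sup>2 + (Im z)\<^sup>2) / (Im z)\<^sup>2"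
    using assms by (simp add: field_simps)
  also have "1 / Im z / (((t - Re z)\<^sup>2 + (Im z)\<^sup>2) / (Im z)\<^sup>2) / pi = poisson z t"
  proof -
    have "1 / y / (E / y\<^sup>2) / pi = y / (pi * E)" if "y > 0" for y E :: real
      using that by (simp add: power2_eq_square)
    then show ?thesis using assms by (simp add: poisson_def)
  qed
  finally show ?thesis .
qed

lemma filterlim_affine_at_top:
  "y > 0 \<Longrightarrow> filterlim (\<lambda>t::real. (t - x) / y) at_top at_top"
  by (rule filterlim_at_top_mult_tendsto_pos[of "\<lambda>_. 1 / y" "1 / y", simplified])
     (auto intro!: filterlim_tendsto_add_at_top[of "\<lambda>_. - x", simplified] filterlim_ident tendsto_const)

lemma nn_integral_poisson_atLeast:
  assumes "Im z > 0"
  shows "(\<integral>\<^sup>+t. ennreal (poisson z t) * indicator {a..} t \<partial>lborel) = ennreal (1 / 2 - arctan ((a - Re z) / Im z) / pi)"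
proof -
  have "((\<lambda>t. arctan ((t - Re z) / Im z)) \<longlongrightarrow> pi / 2) at_top"
    by (rule filterlim_compose[OF tendsto_arctan_at_top filterlim_affine_at_top[OF assms]])
  then have "((\<lambda>t. arctan ((t - Re z) / Im z) / pi) \<longlongrightarrow> pi / 2 / pi) at_top"
    by (intro tendsto_divide tendsto_const) auto
  from nn_integral_FTC_atLeast[OF measurable_poisson DERIV_arctan_poisson[OF assms] poisson_nonneg[OF assms] this, of a]
  show ?thesis by simp
qed

lemma poisson_minus: "poisson z (- t) = poisson (- cnj z) t"
  by (simp add: poisson_def power2_commute[of t] algebra_simps)
     (simp add: power2_eq_square algebra_simps)

lemma nn_integral_poisson_atMost:
  assumes "Im z > 0"
  shows "(\<integral>\<^sup>+t. ennreal (poisson z t) * indicator {..a} t \<partial>lborel) = ennreal (1 / 2 + arctan ((a - Re z) / Im z) / pi)"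
proof -
  have "(\<integral>\<^sup>+t. ennreal (poisson z t) * indicator {..a} t \<partial>lborel) = (\<integral>\<^sup>+t. ennreal (poisson (- cnj z) t) * indicator {-a..} t \<partial>lborel)"
    by (subst nn_integral_real_affine[where c="-1" and t=0])
       (auto simp: poisson_minus indicator_def intro!: nn_integral_cong)
  also have "\<dots> = ennreal (1 / 2 - arctan ((- a + Re z) / Im z) / pi)"
    using assms by (subst nn_integral_poisson_atLeast) auto
  also have "(- a + Re z) / Im z = - ((a - Re z) / Im z)"
    by (simp add: diff_divide_distrib)
  finally show ?thesis by (simp add: arctan_minus)
qed

lemma nn_integral_poisson:
  assumes "Im z > 0"
  shows "(\<integral>\<^sup>+t. poisson z t \<partial>lborel) = 1"
proof -
  have "AE t in lborel. ennreal (poisson z t) =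
     ennreal (poisson z t) * indicator {..Re z} t + ennreal (poisson z t) * indicator {Re z..} t"
    using AE_lborel_singleton[of "Re z"] by eventually_elim (auto simp: indicator_def)
  then have "(\<integral>\<^sup>+t. poisson z t \<partial>lborel) =
    (\<integral>\<^sup>+t. ennreal (poisson z t) * indicator {..Re z} t + ennreal (poisson z t) * indicator {Re z..} t \<partial>lborel)"
    by (rule nn_integral_cong_AE)
  also have "\<dots> = (\<integral>\<^sup>+t. ennreal (poisson z t) * indicator {..Re z} t \<partial>lborel) + (\<integral>\<^sup>+t. ennreal (poisson z t) * indicator {Re z..} t \<partial>lborel)"
    by (intro nn_integral_add) auto
  also have "\<dots> = ennreal (1 / 2) + ennreal (1 / 2)"
    using nn_integral_poisson_atLeast[OF assms, of "Re z"] nn_integral_poisson_atMost[OF assms, of "Re z"]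
    by simp
  also have "\<dots> = 1"
    by (subst ennreal_plus[symmetric]) auto
  finally show ?thesis .
qed

lemma integrable_poisson: "Im z > 0 \<Longrightarrow> integrable lborel (poisson z)"
  and integral_poisson: "Im z > 0 \<Longrightarrow> (\<integral>t. poisson z t \<partial>lborel) = 1"
  using nn_integral_poisson[of z] poisson_nonneg[of z]
  by (auto intro!: integrableI_nonneg simp: integral_eq_nn_integral)

text \<open>The integrand is a multiple of the Poisson kernel of x + i r. It is the standard
  integrable majorant of all later estimates on horizontal lines.\<close>

lemma nn_integral_inverse_quadratic:
  assumes "r > 0" "C \<ge> 0"
  shows "(\<integral>\<^sup>+t. ennreal (C / ((t - x)\<^sup>2 + r\<^sup>2)) \<partial>lborel) = ennreal (C * pi / r)"
    and "integrable lborel (\<lambda>t. C / ((t - x)\<^sup>2 + r\<^sup>2))"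
proof -
  have eq: "C / ((t - x)\<^sup>2 + r\<^sup>2) = (C * pi / r) * poisson (Complex x r) t" for t
    using assms by (simp add: poisson_def)
  show "(\<integral>\<^sup>+t. ennreal (C / ((t - x)\<^sup>2 + r\<^sup>2)) \<partial>lborel) = ennreal (C * pi / r)"
    using assms by (subst eq, subst ennreal_mult) (auto simp: nn_integral_cmult nn_integral_poisson)
  show "integrable lborel (\<lambda>t. C / ((t - x)\<^sup>2 + r\<^sup>2))"
    unfolding eq using assms by (intro integrable_mult_right integrable_poisson) auto
qed

text \<open>
  \<open>(h w - h z) / ((w - z) (w - cnj z))\<close> is holomorphic in \<open>w\<close> and \<open>O(1 / |w|\<^sup>2)\<close>, so its integral over
  horizontal lines is constant and tends to 0.
\<close>

lemma poisson_reproduction: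
  assumes holo: "h holomorphic_on {w. - e < Im w}" and e: "e > 0"
    and bnd: "\<And>w. - e < Im w \<Longrightarrow> norm (h w) \<le> M"
    and z: "Im z > 0"
  shows "(\<integral>t. poisson z t *\<^sub>R h (complex_of_real t) \<partial>lborel) = h z"
    and "integrable lborel (\<lambda>t. poisson z t *\<^sub>R h (complex_of_real t))"
proof -
  define y where "y = Im z"
  \<comment> \<open>With r below both e and y, h and 1 / (w - cnj z) are holomorphic on Im w > -r,
    and the closed disc of radius r around z lies in that half-plane.\<close>
  define r where "r = min e y / 2"
  have r: "r > 0" "r < e" "r < y" "y > 0" using e z by (auto simp: r_def y_def)
  have M: "M \<ge> 0" using bnd[of z] norm_ge_zero[of "h z"] z e by linarith
  define S where "S = {w. - r < Im w}"
  define q where "q w = (if w = z then deriv h z else (h w - h z) / (w - z))" for w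
  define G where "G w = q w / (w - cnj z)" for w
  have S: "open S" by (simp add: S_def open_halfspace_Im_gt)
  have hS: "h holomorphic_on S"
    by (rule holomorphic_on_subset[OF holo]) (use r in \<open>auto simp: S_def\<close>)
  have "q holomorphic_on S"
    unfolding q_def by (rule pole_lemma_open[OF hS S])
  then have G_holo: "G holomorphic_on S"
    unfolding G_def
    using r by (intro holomorphic_intros) (auto simp: S_def y_def complex_eq_iff)
  have "compact (cball z r)" by simp
  moreover have sub: "cball z r \<subseteq> S"
  proof
    fix w assume "w \<in> cball z r"
    then have "\<bar>Im z - Im w\<bar> \<le> r"
      using abs_Im_le_cmod[of "z - w"] by (auto simp: dist_norm)
    then show "w \<in> S" using r by (auto simp: S_def y_def)
  qed
  ultimately have "bounded (G ` cball z r)"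
    by (intro compact_imp_bounded compact_continuous_image holomorphic_on_imp_continuous_on
        holomorphic_on_subset[OF G_holo])
  then obtain K where K: "K > 0" "\<And>w. w \<in> cball z r \<Longrightarrow> norm (G w) \<le> K"
    by (force simp: bounded_pos)
  have G_away: "norm (G w) \<le> 2 * M / (norm (w - z) * norm (w - cnj z))" if "w \<noteq> z" "-e < Im w" for w
  proof -
    have "norm (h w - h z) \<le> 2 * M"
      using norm_triangle_ineq4[of "h w" "h z"] bnd[of w] bnd[of z] that z e by simp
    then show ?thesis
      using that by (auto simp: G_def q_def norm_divide norm_mult intro!: divide_right_mono)
  qed
  \<comment> \<open>The first summand serves the disc, where |G| is at most K and (Re w - Re z)^2 +
    r^2 at most 2 r^2. The second serves its complement, where the product of the distances to z and
    to its conjugate is at least half of (Re w - Re z)^2 + r^2.\<close>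
  define C where "C = 2 * K * r\<^sup>2 + 4 * M"
  have C: "C \<ge> 0" using K M by (simp add: C_def)
  have G_bnd: "norm (G w) \<le> C / ((Re w - Re z)\<^sup>2 + r\<^sup>2)" if "Im w \<ge> 0" for w
  proof (cases "w \<in> cball z r")
    case True
    then have "\<bar>Re w - Re z\<bar> \<le> r"
      using abs_Re_le_cmod[of "z - w"] by (auto simp: dist_norm)
    then have "(Re w - Re z)\<^sup>2 \<le> r\<^sup>2"
      using abs_le_square_iff[of "Re w - Re z" r] r by simp
    then have "K * ((Re w - Re z)\<^sup>2 + r\<^sup>2) \<le> K * (2 * r\<^sup>2)"
      using K by (intro mult_left_mono) auto
    also have "\<dots> \<le> C" using M by (simp add: C_def)
    finally have "K \<le> C / ((Re w - Re z)\<^sup>2 + r\<^sup>2)"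
      using r by (simp add: pos_le_divide_eq add_nonneg_pos)
    then show ?thesis using K(2)[OF True] by linarith
  next
    case False
    define u where "u = \<bar>Re w - Re z\<bar>"
    have 1: "norm (w - z) \<ge> u" "norm (w - cnj z) \<ge> u"
      using abs_Re_le_cmod[of "w - z"] abs_Re_le_cmod[of "w - cnj z"] unfolding u_def by simp_all
    have 2: "norm (w - z) \<ge> r" "norm (w - cnj z) \<ge> r"
      using False abs_Im_le_cmod[of "w - cnj z"] that r
      by (auto simp: dist_norm norm_minus_commute y_def)
    have "u \<ge> 0" by (simp add: u_def)
    then have "u\<^sup>2 \<le> norm (w - z) * norm (w - cnj z)" "r\<^sup>2 \<le> norm (w - z) * norm (w - cnj z)"
      unfolding power2_eq_square using 1 2 r by (auto intro!: mult_mono)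
    then have 3: "(u\<^sup>2 + r\<^sup>2) / 2 \<le> norm (w - z) * norm (w - cnj z)" by simp
    have pos: "u\<^sup>2 + r\<^sup>2 > 0" using r by (simp add: add_nonneg_pos)
    have "norm (G w) \<le> 2 * M / (norm (w - z) * norm (w - cnj z))"
      using False that e r by (intro G_away) auto
    also have "\<dots> \<le> 2 * M / ((u\<^sup>2 + r\<^sup>2) / 2)"
      using 3 M pos by (intro divide_left_mono) (auto intro!: mult_pos_pos elim: less_le_trans[rotated])
    also have "\<dots> \<le> C / (u\<^sup>2 + r\<^sup>2)"
      using pos K by (simp add: C_def divide_right_mono)
    finally show ?thesis by (simp add: u_def)
  qed
  have line_bnd: "(\<integral>\<^sup>+x. norm (G (Complex x a)) \<partial>lborel) \<le> ennreal (C * pi / r)" if "a \<ge> 0" for a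
  proof -
    have "(\<integral>\<^sup>+x. norm (G (Complex x a)) \<partial>lborel) \<le> (\<integral>\<^sup>+x. ennreal (C / ((x - Re z)\<^sup>2 + r\<^sup>2)) \<partial>lborel)"
      using G_bnd[of "Complex _ a"] that by (intro nn_integral_mono ennreal_leI) auto
    also have "\<dots> = ennreal (C * pi / r)"
      using r C by (intro nn_integral_inverse_quadratic) auto
    finally show ?thesis .
  qed
  have shift: "(\<integral>x. G (Complex x 0) \<partial>lborel) = (\<integral>x. G (Complex x Y) \<partial>lborel)" if "Y > 0" for Y
    by (rule line_integral_shift[of G "-r" "Y + 1" _ _ "C * pi / r"])
       (use that r line_bnd in \<open>auto intro!: holomorphic_on_subset[OF G_holo] simp: S_def\<close>)
  \<comment> \<open>At height Y > y the point z is nearer than its conjugate, so |G| is at most 2 M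
    / ((x - Re z)^2 + (Y - y)^2), whose integral vanishes as Y grows.\<close>
  have "norm (\<integral>x. G (Complex x 0) \<partial>lborel) \<le> 2 * M * pi / (Y - y)" if "Y > y" for Y
  proof -
    have "norm (\<integral>x. G (Complex x 0) \<partial>lborel) \<le> enn2real (\<integral>\<^sup>+x. norm (G (Complex x Y)) \<partial>lborel)"
    proof -
      have "integrable lborel (\<lambda>x. G (Complex x Y))"
        by (rule integrable_line[OF holomorphic_on_imp_continuous_on[OF G_holo] _ line_bnd])
           (use that r in \<open>auto simp: S_def\<close>)
      then have "(\<integral>x. norm (G (Complex x Y)) \<partial>lborel) = enn2real (\<integral>\<^sup>+x. norm (G (Complex x Y)) \<partial>lborel)"
        by (intro integral_eq_nn_integral) auto
      then show ?thesis
        using integral_norm_bound[of lborel "\<lambda>x. G (Complex x Y)"] shift[of Y] that r by simp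
    qed
    also have "\<dots> \<le> enn2real (\<integral>\<^sup>+x. ennreal (2 * M / ((x - Re z)\<^sup>2 + (Y - y)\<^sup>2)) \<partial>lborel)"
    proof (intro enn2real_mono nn_integral_mono ennreal_leI)
      fix x
      have "norm (Complex x Y - z) ^ 2 = (x - Re z)\<^sup>2 + (Y - y)\<^sup>2"
        by (simp add: cmod_power2 y_def)
      moreover have "norm (Complex x Y - z) \<le> norm (Complex x Y - cnj z)"
        using that r unfolding cmod_def y_def by (intro real_sqrt_le_mono) (auto intro!: power_mono)
      ultimately have le: "(x - Re z)\<^sup>2 + (Y - y)\<^sup>2 \<le> norm (Complex x Y - z) * norm (Complex x Y - cnj z)"
        by (metis norm_ge_zero mult_left_mono power2_eq_square)
      have ne: "Complex x Y \<noteq> z" using that by (auto simp: y_def)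
      have "norm (G (Complex x Y)) \<le> 2 * M / (norm (Complex x Y - z) * norm (Complex x Y - cnj z))"
        using ne that r by (intro G_away) auto
      also have "\<dots> \<le> 2 * M / ((x - Re z)\<^sup>2 + (Y - y)\<^sup>2)"
        using le M that by (intro divide_left_mono)
         (auto intro!: mult_pos_pos add_nonneg_pos less_le_trans[OF _ le])
      finally show "norm (G (Complex x Y)) \<le> 2 * M / ((x - Re z)\<^sup>2 + (Y - y)\<^sup>2)" .
    qed (use nn_integral_inverse_quadratic(1)[of "Y - y" "2 * M" "Re z"] that M in auto)
    also have "\<dots> = 2 * M * pi / (Y - y)"
      using nn_integral_inverse_quadratic(1)[of "Y - y" "2 * M" "Re z"] that M by simp
    finally show ?thesis .
  qed
  moreover have "((\<lambda>Y. 2 * M * pi / (Y - y)) \<longlongrightarrow> 0) at_top"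
    by (intro tendsto_divide_0[OF tendsto_const] filterlim_at_top_imp_at_infinity
        filterlim_affine_at_top[of 1, simplified])
  ultimately have "norm (\<integral>x. G (Complex x 0) \<partial>lborel) \<le> 0"
    by (intro tendsto_lowerbound[where F=at_top])
       (auto simp: eventually_at_top_dense intro!: exI[of _ y])
  then have G0: "(\<integral>x. G (Complex x 0) \<partial>lborel) = 0" by simp
  have G_int: "integrable lborel (\<lambda>x. G (Complex x 0))"
    using r by (intro integrable_line[OF holomorphic_on_imp_continuous_on[OF G_holo] _ line_bnd]) (auto simp: S_def)
  \<comment> \<open>For real t the product (t - z) (t - cnj z) is |t - z|^2, so on the axis G is the
    Poisson kernel times h t - h z, up to the constant y / pi.\<close>
  have G_eq: "(y / pi) *\<^sub>R G (Complex t 0) = poisson z t *\<^sub>R (h (complex_of_real t) - h z)" for t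
  proof -
    have "(Complex t 0 - z) * (Complex t 0 - cnj z) = of_real ((t - Re z)\<^sup>2 + (Im z)\<^sup>2)"
      by (simp add: complex_eq_iff power2_eq_square algebra_simps)
    moreover have "Complex t 0 \<noteq> z" using z by auto
    ultimately have "G (Complex t 0) = (h (Complex t 0) - h z) / of_real ((t - Re z)\<^sup>2 + (Im z)\<^sup>2)"
      by (simp add: G_def q_def)
    moreover have "Complex t 0 = of_real t" by (simp add: complex_of_real_def)
    ultimately show ?thesis
      by (simp add: poisson_def y_def scaleR_conv_of_real)
  qed
  have 1: "integrable lborel (\<lambda>t. poisson z t *\<^sub>R (h (complex_of_real t) - h z))"
    using integrable_scaleR_right[OF G_int, of "y / pi"] by (simp add: G_eq)
  have 2: "integrable lborel (\<lambda>t. poisson z t *\<^sub>R h z)"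
    using integrable_poisson[OF z] by simp
  show int: "integrable lborel (\<lambda>t. poisson z t *\<^sub>R h (complex_of_real t))"
    using Bochner_Integration.integrable_add[OF 1 2] by (simp add: scaleR_diff_right)
  have "(\<integral>t. poisson z t *\<^sub>R (h (complex_of_real t) - h z) \<partial>lborel) = (y / pi) *\<^sub>R (\<integral>x. G (Complex x 0) \<partial>lborel)"
    by (simp flip: G_eq)
  then have "(\<integral>t. poisson z t *\<^sub>R h (complex_of_real t) - poisson z t *\<^sub>R h z \<partial>lborel) = 0"
    by (simp add: G0 scaleR_diff_right)
  then have "(\<integral>t. poisson z t *\<^sub>R h (complex_of_real t) \<partial>lborel) = (\<integral>t. poisson z t *\<^sub>R h z \<partial>lborel)"
    using int 2 by simp
  also have "\<dots> = h z"
    by (simp add: integral_poisson[OF z] integrable_poisson[OF z])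
  finally show "(\<integral>t. poisson z t *\<^sub>R h (complex_of_real t) \<partial>lborel) = h z" .
qed

section \<open>Means on horizontal lines\<close>

text \<open>Membership in the Hardy space \<open>H1\<close> of the half-plane with norm at most
  \<open>C\<close>; the real bound keeps later estimates free of infinite values.\<close>

definition bounded_mean :: "real \<Rightarrow> (complex \<Rightarrow> complex) \<Rightarrow> bool" where
  "bounded_mean C h \<longleftrightarrow> 0 \<le> C \<and> h holomorphic_on upper_half_plane \<and>
     (\<forall>y>0. (\<integral>\<^sup>+x. ennreal (norm (h (Complex x y))) \<partial>lborel) \<le> ennreal C)"

lemma bounded_meanD:
  assumes "bounded_mean C h"
  shows "0 \<le> C" "h holomorphic_on upper_half_plane" "continuous_on upper_half_plane h"
    and "y > 0 \<Longrightarrow> (\<integral>\<^sup>+x. ennreal (norm (h (Complex x y))) \<partial>lborel) \<le> ennreal C"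
    and "y > 0 \<Longrightarrow> integrable lborel (\<lambda>x. h (Complex x y))"
    and "y > 0 \<Longrightarrow> continuous_on UNIV (\<lambda>x. h (Complex x y))"
    and "y > 0 \<Longrightarrow> (\<integral>x. norm (h (Complex x y)) \<partial>lborel) \<le> C"
proof -
  show 1: "0 \<le> C" "h holomorphic_on upper_half_plane" "continuous_on upper_half_plane h"
    and 2: "y > 0 \<Longrightarrow> (\<integral>\<^sup>+x. ennreal (norm (h (Complex x y))) \<partial>lborel) \<le> ennreal C"
    using assms by (auto simp: bounded_mean_def intro: holomorphic_on_imp_continuous_on)
  show 3: "y > 0 \<Longrightarrow> integrable lborel (\<lambda>x. h (Complex x y))"
    and "y > 0 \<Longrightarrow> continuous_on UNIV (\<lambda>x. h (Complex x y))"
    using integrable_line[OF 1(3) _ 2] by auto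
  show "(\<integral>x. norm (h (Complex x y)) \<partial>lborel) \<le> C" if "y > 0"
    using integral_eq_nn_integral[of "\<lambda>x. norm (h (Complex x y))" lborel] 2[OF that] 3[OF that] 1(1)
    by (simp add: enn2real_leI)
qed

text \<open>For a primitive F of h the increments F(w + a) - F(w) with a >= 0 are bounded by C, so
  the Cauchy inequality on a disc of radius Im z / 2 gives |h(z + a) - h(z)| <= 2 C / Im z. Hence
  |h| is at least |h z| - 2 C / Im z on the ray to the right of z, and averaging over a segment of
  length Im z adds one more C / Im z, which explains the 3.\<close>

lemma bounded_mean_pointwise:
  assumes h: "bounded_mean C h" and z: "Im z > 0"
  shows "norm (h z) \<le> 3 * C / Im z"
proof -
  define y where "y = Im z"
  have y: "y > 0" using z by (simp add: y_def)
  note hD = bounded_meanD[OF h]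
  obtain F where F: "\<And>w. w \<in> upper_half_plane \<Longrightarrow> (F has_field_derivative h w) (at w within upper_half_plane)"
    using holomorphic_convex_primitive'[OF upper_half_plane(2,1) hD(2)] by blast
  have F: "(F has_field_derivative h w) (at w)" if "Im w > 0" for w
    using F[of w] at_within_open[of w upper_half_plane] that upper_half_plane(1) by auto
  have diff: "norm (F (w + of_real a) - F w) \<le> C" if "a \<ge> 0" "Im w > 0" for a w
  proof -
    have "(\<integral>t. indicator {Re w..Re w + a} t *\<^sub>R h (Complex t (Im w)) \<partial>lborel)
      = F (Complex (Re w + a) (Im w)) - F (Complex (Re w) (Im w))"
      using that
      by (intro integral_FTC_Icc)
        (auto intro!: has_vector_derivative_at_within has_vector_derivative_horizontal F
          continuous_on_subset[OF hD(6)])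
    also have "\<dots> = F (w + of_real a) - F w"
    proof -
      have "Complex (Re w + a) (Im w) = w + of_real a" "Complex (Re w) (Im w) = w"
        by (simp_all add: complex_eq_iff)
      then show ?thesis by simp
    qed
    finally have "norm (F (w + of_real a) - F w) = norm (\<integral>t. indicator {Re w..Re w + a} t *\<^sub>R h (Complex t (Im w)) \<partial>lborel)"
      by simp
    also have "\<dots> \<le> (\<integral>t. norm (indicator {Re w..Re w + a} t *\<^sub>R h (Complex t (Im w))) \<partial>lborel)"
      by (rule integral_norm_bound)
    also have "\<dots> \<le> (\<integral>t. norm (h (Complex t (Im w))) \<partial>lborel)"
    proof (rule integral_mono)
      show "integrable lborel (\<lambda>t. norm (indicator {Re w..Re w + a} t *\<^sub>R h (Complex t (Im w))))"
        using hD(5)[OF that(2)] by (intro integrable_norm integrable_mult_indicator) auto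
    qed (use hD(5)[OF that(2)] in \<open>auto simp: indicator_def\<close>)
    also have "\<dots> \<le> C" by (rule hD(7)[OF that(2)])
    finally show ?thesis .
  qed
  have "norm (h (z + of_real a) - h z) \<le> 2 * C / y" if "a \<ge> 0" for a
  proof -
    define D where "D w = F (w + of_real a) - F w" for w
    have D': "(D has_field_derivative h (w + of_real a) - h w) (at w)" if "Im w > 0" for w
      unfolding D_def
      using that DERIV_shift[of F "h (w + of_real a)" w "of_real a"] F[of w] F[of "w + of_real a"]
      by (intro derivative_intros) auto
    have pos: "Im w > 0" if "w \<in> cball z (y / 2)" for w
      using abs_Im_le_cmod[of "z - w"] that y by (auto simp: dist_norm y_def)
    have "D holomorphic_on ball z (y / 2)" "continuous_on (cball z (y / 2)) D"
    proof -
      show "D holomorphic_on ball z (y / 2)"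
      proof (subst holomorphic_on_open; safe?)
        fix w assume "w \<in> ball z (y / 2)"
        then have "w \<in> cball z (y / 2)" by simp
        from D'[OF pos[OF this]] show "\<exists>f'. (D has_field_derivative f') (at w)" by blast
      qed simp
      show "continuous_on (cball z (y / 2)) D"
        using DERIV_isCont[OF D'[OF pos]] by (intro continuous_at_imp_continuous_on ballI) auto
    qed
    moreover have "norm (D w) \<le> C" if "norm (z - w) = y / 2" for w
      using diff[of a w] pos[of w] \<open>a \<ge> 0\<close> that by (auto simp: D_def dist_norm)
    ultimately have "norm ((deriv ^^ 1) D z) \<le> fact 1 * C / (y / 2) ^ 1"
      using y by (intro Cauchy_inequality) auto
    then show ?thesis
      using DERIV_imp_deriv[OF D'[OF z]] by (simp add: field_simps)
  qed
  then have le: "norm (h z) - 2 * C / y \<le> norm (h (Complex (Re z + a) y))" if "a \<ge> 0" for a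
  proof -
    have "z + of_real a = Complex (Re z + a) y" by (simp add: complex_eq_iff y_def)
    then show ?thesis
      using norm_triangle_ineq2[of "h z" "h (z + of_real a)"] \<open>a \<ge> 0 \<Longrightarrow> norm (h (z + of_real a) - h z) \<le> _\<close> that
      by (simp add: norm_minus_commute)
  qed
  have ind: "integrable lborel (indicat_real {Re z..Re z + y})"
    using y by (intro integrable_real_indicator) auto
  have "y * (norm (h z) - 2 * C / y) = (\<integral>t. (norm (h z) - 2 * C / y) * indicator {Re z..Re z + y} t \<partial>lborel)"
    using y by simp
  also have "\<dots> \<le> (\<integral>t. norm (h (Complex t y)) \<partial>lborel)"
  proof (rule integral_mono)
    show "(norm (h z) - 2 * C / y) * indicator {Re z..Re z + y} t \<le> norm (h (Complex t y))" for t
      using le[of "t - Re z"] by (auto simp: indicator_def)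
    show "integrable lborel (\<lambda>t. (norm (h z) - 2 * C / y) * indicator {Re z..Re z + y} t)"
      using ind by (rule integrable_mult_right)
  qed (use hD(5) y in auto)
  also have "\<dots> \<le> C" using hD(7) y by blast
  finally show ?thesis
    using y by (simp add: y_def field_simps)
qed

definition mean_square :: "(complex \<Rightarrow> complex) \<Rightarrow> real \<Rightarrow> real" where
  "mean_square a y = (\<integral>x. (norm (a (Complex x y)))\<^sup>2 \<partial>lborel)"

lemma mean_square:
  assumes a: "a holomorphic_on upper_half_plane" and C: "0 \<le> C"
    and bnd: "\<And>y. y > 0 \<Longrightarrow> (\<integral>\<^sup>+x. ennreal ((norm (a (Complex x y)))\<^sup>2) \<partial>lborel) \<le> ennreal C"
    and y: "y > 0"
  shows "integrable lborel (\<lambda>x. (norm (a (Complex x y)))\<^sup>2)" "0 \<le> mean_square a y" "mean_square a y \<le> C"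
    and "continuous_on UNIV (\<lambda>x. a (Complex x y))"
proof -
  show c: "continuous_on UNIV (\<lambda>x. a (Complex x y))"
    by (rule continuous_on_compose2[OF holomorphic_on_imp_continuous_on[OF a]])
       (use y in \<open>auto intro!: continuous_intros\<close>)
  show i: "integrable lborel (\<lambda>x. (norm (a (Complex x y)))\<^sup>2)"
    by (rule integrableI_nonneg)
       (use bnd[OF y] c in \<open>auto intro!: borel_measurable_continuous_onI continuous_intros simp: order_le_less_trans\<close>)
  show "0 \<le> mean_square a y" by (simp add: mean_square_def)
  show "mean_square a y \<le> C"
    unfolding mean_square_def using bnd[OF y] i C by (simp add: integral_eq_nn_integral enn2real_leI)
qed

text \<open>
  The inner product of the functions at heights \<open>y\<close> and \<open>y'\<close> depends on \<open>y + y'\<close> only, by shifting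
  the line of integration of \<open>a(z + iy) cnj (a (cnj (z - iy')))\<close>.
\<close>

lemma mean_square_parallelogram:
  assumes a: "a holomorphic_on upper_half_plane" and C: "0 \<le> C"
    and bnd: "\<And>y. y > 0 \<Longrightarrow> (\<integral>\<^sup>+x. ennreal ((norm (a (Complex x y)))\<^sup>2) \<partial>lborel) \<le> ennreal C"
    and y: "0 < y" "0 < y'"
  shows "(\<integral>x. (norm (a (Complex x y) - a (Complex x y')))\<^sup>2 \<partial>lborel)
    = mean_square a y + mean_square a y' - 2 * mean_square a ((y + y') / 2)"
    and "integrable lborel (\<lambda>x. (norm (a (Complex x y) - a (Complex x y')))\<^sup>2)"
proof -
  have main: "(\<integral>x. (norm (a (Complex x y) - a (Complex x y')))\<^sup>2 \<partial>lborel)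
    = mean_square a y + mean_square a y' - 2 * mean_square a ((y + y') / 2) \<and>
    integrable lborel (\<lambda>x. (norm (a (Complex x y) - a (Complex x y')))\<^sup>2)"
    if y: "0 < y" "y \<le> y'" for y y'
  proof -
    \<comment> \<open>On Im w = tau the second factor is the conjugate of a at height y' - tau; the
      double conjugation makes it holomorphic in w. At tau = 0 the integral of f is the inner
      product of the functions at heights y and y', and at tau = \<open>m\<close> both heights equal
      (y + y') / 2, which leaves a squared norm.\<close>
    define f where "f w = a (w + \<i> * of_real y) * cnj (a (cnj (w - \<i> * of_real y')))" for w
    define m where "m = (y' - y) / 2"
    have f_eq: "f (Complex x \<tau>) = a (Complex x (y + \<tau>)) * cnj (a (Complex x (y' - \<tau>)))" for x \<tau>
    proof -
      have "Complex x \<tau> + \<i> * of_real y = Complex x (y + \<tau>)"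
        "cnj (Complex x \<tau> - \<i> * of_real y') = Complex x (y' - \<tau>)"
        by (simp_all add: complex_eq_iff)
      then show ?thesis by (simp add: f_def)
    qed
    have holo: "f holomorphic_on {w. - y < Im w \<and> Im w < y'}" (is "_ holomorphic_on ?S")
    proof -
      have "(cnj \<circ> (\<lambda>w. a (w + \<i> * of_real y')) \<circ> cnj) holomorphic_on ?S"
      proof (rule holomorphic_on_compose_cnj_cnj)
        show "(\<lambda>w. a (w + \<i> * of_real y')) holomorphic_on cnj ` ?S"
          by (rule holomorphic_on_compose_gen[OF _ a, unfolded o_def]) (auto intro!: holomorphic_intros)
      qed (rule open_strip)
      moreover have "(\<lambda>w. a (w + \<i> * of_real y)) holomorphic_on ?S"
        by (rule holomorphic_on_compose_gen[OF _ a, unfolded o_def]) (auto intro!: holomorphic_intros)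
      ultimately show ?thesis
        unfolding f_def by (intro holomorphic_on_mult) (simp_all add: o_def)
    qed
    have f_bnd: "(\<integral>\<^sup>+x. ennreal (norm (f (Complex x \<tau>))) \<partial>lborel) \<le> ennreal C" if "\<tau> \<in> {0..m}" for \<tau>
    proof -
      have \<tau>: "y + \<tau> > 0" "y' - \<tau> > 0" using that y by (auto simp: m_def)
      have [measurable]: "(\<lambda>x. a (Complex x (y + \<tau>))) \<in> borel_measurable borel"
         "(\<lambda>x. a (Complex x (y' - \<tau>))) \<in> borel_measurable borel"
        using mean_square(4)[OF a C bnd] \<tau> by (auto intro!: borel_measurable_continuous_onI)
      have am: "u * v \<le> (u\<^sup>2 + v\<^sup>2) / 2" for u v :: real
        using sum_squares_bound[of u v] by simp
      have i: "integrable lborel (\<lambda>x. (norm (a (Complex x (y + \<tau>))))\<^sup>2)"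
          "integrable lborel (\<lambda>x. (norm (a (Complex x (y' - \<tau>))))\<^sup>2)"
        using mean_square(1)[OF a C bnd] \<tau> by auto
      have "(\<integral>\<^sup>+x. ennreal (norm (f (Complex x \<tau>))) \<partial>lborel)
        \<le> (\<integral>\<^sup>+x. ennreal (((norm (a (Complex x (y + \<tau>))))\<^sup>2 + (norm (a (Complex x (y' - \<tau>))))\<^sup>2) / 2) \<partial>lborel)"
        by (intro nn_integral_mono ennreal_leI) (simp only: f_eq norm_mult complex_mod_cnj am)
      also have "\<dots> = ennreal (\<integral>x. ((norm (a (Complex x (y + \<tau>))))\<^sup>2 + (norm (a (Complex x (y' - \<tau>))))\<^sup>2) / 2 \<partial>lborel)"
        using i by (intro nn_integral_eq_integral) auto
      also have "\<dots> = ennreal ((mean_square a (y + \<tau>) + mean_square a (y' - \<tau>)) / 2)"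
        using i by (simp add: mean_square_def)
      also have "\<dots> \<le> ennreal C"
        using mean_square(3)[OF a C bnd \<tau>(1)] mean_square(3)[OF a C bnd \<tau>(2)] by (intro ennreal_leI) simp
      finally show ?thesis .
    qed
    have m: "y + m = (y + y') / 2" "y' - m = (y + y') / 2" by (auto simp: m_def field_simps)
    have "(\<integral>x. f (Complex x 0) \<partial>lborel) = (\<integral>x. f (Complex x m) \<partial>lborel)"
      using y f_bnd by (intro line_integral_shift[OF holo]) (auto simp: m_def)
    also have "\<dots> = (\<integral>x. complex_of_real ((norm (a (Complex x ((y + y') / 2))))\<^sup>2) \<partial>lborel)"
      by (simp only: f_eq m add_0_left diff_0_right complex_norm_square)
    also have "\<dots> = of_real (mean_square a ((y + y') / 2))"
      by (simp only: mean_square_def integral_complex_of_real)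
    finally have cross: "(\<integral>x. f (Complex x 0) \<partial>lborel) = of_real (mean_square a ((y + y') / 2))" .
    have f_int: "integrable lborel (\<lambda>x. f (Complex x 0))"
      using y f_bnd[of 0] by (intro integrable_line[OF holomorphic_on_imp_continuous_on[OF holo]]) (auto simp: m_def)
    have eq: "(norm (a (Complex x y) - a (Complex x y')))\<^sup>2
      = (norm (a (Complex x y)))\<^sup>2 + (norm (a (Complex x y')))\<^sup>2 - 2 * Re (f (Complex x 0))" for x
      by (simp add: f_eq cmod_power2 power2_diff algebra_simps)
    have i: "integrable lborel (\<lambda>x. (norm (a (Complex x y)))\<^sup>2)" "integrable lborel (\<lambda>x. (norm (a (Complex x y')))\<^sup>2)"
      using mean_square(1)[OF a C bnd] y by auto
    have "(\<integral>x. Re (f (Complex x 0)) \<partial>lborel) = mean_square a ((y + y') / 2)"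
      using cross f_int by (simp add: integral_Re)
    then show ?thesis
      unfolding eq using i f_int by (simp add: mean_square_def)
  qed
  show "(\<integral>x. (norm (a (Complex x y) - a (Complex x y')))\<^sup>2 \<partial>lborel)
    = mean_square a y + mean_square a y' - 2 * mean_square a ((y + y') / 2)"
    "integrable lborel (\<lambda>x. (norm (a (Complex x y) - a (Complex x y')))\<^sup>2)"
    using main[of y y'] main[of y' y] y by (cases "y \<le> y'"; simp add: norm_minus_commute add.commute)+
qed

text \<open>If the function increased from x to y, midpoint convexity would repeat at least that
  increase on every further step of the same length, against the upper bound.\<close>

lemma bounded_midpoint_convex_antimono:
  fixes \<Phi> :: "real \<Rightarrow> real"
  assumes conv: "\<And>x y. 0 < x \<Longrightarrow> 0 < y \<Longrightarrow> 2 * \<Phi> ((x + y) / 2) \<le> \<Phi> x + \<Phi> y"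
    and bnd: "\<And>x. 0 < x \<Longrightarrow> \<Phi> x \<le> C"
    and "0 < x" "x \<le> y"
  shows "\<Phi> y \<le> \<Phi> x"
proof (rule ccontr)
  define d where "d = y - x"
  have d: "d \<ge> 0" using assms by (simp add: d_def)
  assume "\<not> \<Phi> y \<le> \<Phi> x"
  then have e: "\<Phi> y - \<Phi> x > 0" by simp
  have step: "\<Phi> (x + real (Suc n) * d) - \<Phi> (x + real n * d) \<ge> \<Phi> y - \<Phi> x" for n
  proof (induction n)
    case (Suc n)
    have pos: "x + real k * d > 0" for k
      using d \<open>0 < x\<close> by (simp add: add_pos_nonneg)
    have "2 * \<Phi> ((x + real n * d + (x + real (Suc (Suc n)) * d)) / 2)
      \<le> \<Phi> (x + real n * d) + \<Phi> (x + real (Suc (Suc n)) * d)"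
      using pos by (intro conv)
    also have "(x + real n * d + (x + real (Suc (Suc n)) * d)) / 2 = x + real (Suc n) * d"
      by (simp add: field_simps)
    finally show ?case using Suc by linarith
  qed (simp add: d_def)
  have "\<Phi> (x + real n * d) \<ge> \<Phi> x + real n * (\<Phi> y - \<Phi> x)" for n
  proof (induction n)
    case (Suc n)
    then show ?case using step[of n] by (simp add: algebra_simps)
  qed simp
  then have "\<Phi> x + real n * (\<Phi> y - \<Phi> x) \<le> C" for n
    using bnd[of "x + real n * d"] d \<open>0 < x\<close> by (meson add_pos_nonneg mult_nonneg_nonneg of_nat_0_le_iff order_trans)
  moreover obtain n where "real n * (\<Phi> y - \<Phi> x) > C - \<Phi> x"
    using reals_Archimedean3[OF e] by blast
  ultimately show False by (smt (verit))
qed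

text \<open>The mean square decreases with the height and is bounded, so it approaches its supremum
  M at height 0. Below a height d with \<open>mean_square a d\<close> above M - e / 2, the
  parallelogram identity bounds the squared distance by 2 M - 2 (M - e / 2) = e.\<close>

lemma mean_square_Cauchy:
  assumes a: "a holomorphic_on upper_half_plane" and C: "0 \<le> C"
    and bnd: "\<And>y. y > 0 \<Longrightarrow> (\<integral>\<^sup>+x. ennreal ((norm (a (Complex x y)))\<^sup>2) \<partial>lborel) \<le> ennreal C"
    and e: "e > 0"
  shows "\<exists>d>0. \<forall>y y'. 0 < y \<longrightarrow> y < d \<longrightarrow> 0 < y' \<longrightarrow> y' < d \<longrightarrow>
    (\<integral>x. (norm (a (Complex x y) - a (Complex x y')))\<^sup>2 \<partial>lborel) \<le> e"
proof -
  define \<Phi> where "\<Phi> = mean_square a"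
  have par: "(\<integral>x. (norm (a (Complex x y) - a (Complex x y')))\<^sup>2 \<partial>lborel) = \<Phi> y + \<Phi> y' - 2 * \<Phi> ((y + y') / 2)"
    if "0 < y" "0 < y'" for y y'
    using mean_square_parallelogram(1)[OF a C bnd that] by (simp add: \<Phi>_def)
  have le: "\<Phi> y \<le> C" if "y > 0" for y
    using mean_square(3)[OF a C bnd that] by (simp add: \<Phi>_def)
  have anti: "\<Phi> y' \<le> \<Phi> y" if "0 < y" "y \<le> y'" for y y'
  proof (rule bounded_midpoint_convex_antimono[OF _ le that])
    show "2 * \<Phi> ((x + y) / 2) \<le> \<Phi> x + \<Phi> y" if "0 < x" "0 < y" for x y
      using par[OF that] integral_nonneg_AE[of "\<lambda>t. (norm (a (Complex t x) - a (Complex t y)))\<^sup>2" lborel] by simp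
  qed
  define M where "M = (SUP y\<in>{0<..}. \<Phi> y)"
  have bdd: "bdd_above (\<Phi> ` {0<..})" using le by (auto intro!: bdd_aboveI[of _ C])
  have M: "\<Phi> y \<le> M" if "y > 0" for y
    unfolding M_def using that by (intro cSUP_upper bdd) auto
  obtain d where d: "d > 0" "\<Phi> d > M - e / 2"
    using less_cSUP_iff[of "{0<..}" \<Phi> "M - e / 2"] bdd e by (auto simp: M_def[symmetric])
  show ?thesis
  proof (intro exI[of _ d] conjI allI impI)
    fix y y' assume *: "0 < y" "y < d" "0 < y'" "y' < d"
    have "\<Phi> ((y + y') / 2) \<ge> \<Phi> d" using * by (intro anti) auto
    then show "(\<integral>x. (norm (a (Complex x y) - a (Complex x y')))\<^sup>2 \<partial>lborel) \<le> e"
      using par[of y y'] M[of y] M[of y'] * d(2) by simp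
  qed fact
qed

section \<open>Outer functions\<close>

text \<open>Differentiation under the integral sign from a quadratic remainder estimate. For the
  kernels 1 / (t - z)^n the remainder is an explicit rational function, so the hypothesis can be
  verified by algebra.\<close>

lemma has_field_derivative_integral_quadratic:
  fixes K :: "complex \<Rightarrow> real \<Rightarrow> complex"
  assumes r: "r > 0" and int: "integrable lborel (K z)" "integrable lborel K'" "integrable lborel g"
    and int': "\<And>w. norm w < r \<Longrightarrow> integrable lborel (K (z + w))"
    and bnd: "\<And>w t. norm w < r \<Longrightarrow> norm (K (z + w) t - K z t - w * K' t) \<le> (norm w)\<^sup>2 * g t"
  shows "((\<lambda>z. \<integral>t. K z t \<partial>lborel) has_field_derivative (\<integral>t. K' t \<partial>lborel)) (at z)"
  unfolding DERIV_def
proof (rule Lim_transform[OF tendsto_const])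
  let ?Q = "\<lambda>w. ((\<integral>t. K (z + w) t \<partial>lborel) - (\<integral>t. K z t \<partial>lborel)) / w"
  show "((\<lambda>w. ?Q w - (\<integral>t. K' t \<partial>lborel)) \<longlongrightarrow> 0) (at 0)"
  proof (rule Lim_null_comparison)
    show "eventually (\<lambda>w. norm (?Q w - (\<integral>t. K' t \<partial>lborel)) \<le> norm w * (\<integral>t. g t \<partial>lborel)) (at 0)"
      unfolding eventually_at
    proof (intro exI[of _ r] conjI ballI impI r)
      fix w :: complex assume "w \<noteq> 0 \<and> dist w 0 < r"
      then have w: "w \<noteq> 0" "norm w < r" by auto
      have "?Q w - (\<integral>t. K' t \<partial>lborel) = (\<integral>t. K (z + w) t - K z t - w * K' t \<partial>lborel) / w"
        using w int int'[OF w(2)] by (simp add: field_simps)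
      then have "norm (?Q w - (\<integral>t. K' t \<partial>lborel)) = norm (\<integral>t. K (z + w) t - K z t - w * K' t \<partial>lborel) / norm w"
        by (simp add: norm_divide)
      also have "\<dots> \<le> (\<integral>t. norm (K (z + w) t - K z t - w * K' t) \<partial>lborel) / norm w"
        by (intro divide_right_mono integral_norm_bound) auto
      also have "\<dots> \<le> (\<integral>t. (norm w)\<^sup>2 * g t \<partial>lborel) / norm w"
        using w int int'[OF w(2)] bnd[OF w(2)] by (intro divide_right_mono integral_mono) auto
      also have "\<dots> = norm w * (\<integral>t. g t \<partial>lborel)"
        using w by (simp add: power2_eq_square)
      finally show "norm (?Q w - (\<integral>t. K' t \<partial>lborel)) \<le> norm w * (\<integral>t. g t \<partial>lborel)" .
    qed
    have "((\<lambda>w::complex. norm w * (\<integral>t. g t \<partial>lborel)) \<longlongrightarrow> norm (0::complex) * (\<integral>t. g t \<partial>lborel)) (at 0)"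
      by (intro tendsto_mult tendsto_norm tendsto_ident_at tendsto_const)
    then show "((\<lambda>w::complex. norm w * (\<integral>t. g t \<partial>lborel)) \<longlongrightarrow> 0) (at 0)" by simp
  qed
qed

lemma norm_of_real_diff_ge: "Im z > 0 \<Longrightarrow> norm (complex_of_real t - z) \<ge> Im z"
  using abs_Im_le_cmod[of "complex_of_real t - z"] by simp

lemma norm_of_real_diff_squared: "(norm (complex_of_real t - z))\<^sup>2 = (t - Re z)\<^sup>2 + (Im z)\<^sup>2"
  by (simp add: cmod_power2)

lemma kernel_growth_le:
  assumes "Im z > 0"
  shows "t\<^sup>2 + 1 \<le> (2 + (1 + 2 * (Re z)\<^sup>2) / (Im z)\<^sup>2) * (norm (complex_of_real t - z))\<^sup>2"
proof -
  define c where "c = (1 + 2 * (Re z)\<^sup>2) / (Im z)\<^sup>2"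
  have c: "c \<ge> 0" "c * (Im z)\<^sup>2 = 1 + 2 * (Re z)\<^sup>2" using assms by (auto simp: c_def)
  have "t\<^sup>2 \<le> 2 * (t - Re z)\<^sup>2 + 2 * (Re z)\<^sup>2"
    using sum_squares_ge_zero[of "t - 2 * Re z" 0] by (simp add: power2_eq_square algebra_simps)
  then have "t\<^sup>2 + 1 \<le> 2 * (t - Re z)\<^sup>2 + c * (Im z)\<^sup>2"
    using c by simp
  also have "\<dots> \<le> (2 + c) * ((t - Re z)\<^sup>2 + (Im z)\<^sup>2)"
    using c by (simp add: algebra_simps)
  finally show ?thesis
    by (simp add: norm_of_real_diff_squared c_def)
qed

text \<open>The assumption is just integrability against 1 / (t^2 + 1), so that the same facts serve
  \<open>\<phi>\<close> and the logarithms of moduli from which outer functions are built in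
  \<open>outer_majorant\<close>.\<close>

locale poisson_integrable =
  fixes \<psi> :: "real \<Rightarrow> real"
  assumes integrable_weight: "integrable lborel (\<lambda>t. \<psi> t / (t\<^sup>2 + 1))"
begin

lemma measurable_psi [measurable]: "\<psi> \<in> borel_measurable borel"
proof -
  have "(\<lambda>t. (\<psi> t / (t\<^sup>2 + 1)) * (t\<^sup>2 + 1)) \<in> borel_measurable borel"
    using borel_measurable_integrable[OF integrable_weight] by measurable
  moreover have "(\<psi> t / (t\<^sup>2 + 1)) * (t\<^sup>2 + 1) = \<psi> t" for t
    by (simp add: add_nonneg_eq_0_iff)
  ultimately show ?thesis by simp
qed

lemma integrable_weight_bound:
  fixes f :: "real \<Rightarrow> 'b::{banach, second_countable_topology}"
  assumes "f \<in> borel_measurable borel" "\<And>t. norm (f t) \<le> c * (\<bar>\<psi> t\<bar> / (t\<^sup>2 + 1))"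
  shows "integrable lborel f"
proof (rule Bochner_Integration.integrable_bound)
  show "integrable lborel (\<lambda>t. c * (\<bar>\<psi> t\<bar> / (t\<^sup>2 + 1)))"
    using integrable_abs[OF integrable_weight] by (intro integrable_mult_right) (simp add: abs_div)
  show "AE t in lborel. norm (f t) \<le> norm (c * (\<bar>\<psi> t\<bar> / (t\<^sup>2 + 1)))"
    by (intro AE_I2 order_trans[OF assms(2)]) (metis abs_ge_self real_norm_def)
qed (use assms in auto)

lemma integrable_over_norm_squared:
  assumes "Im z > 0"
  shows "integrable lborel (\<lambda>t. \<bar>\<psi> t\<bar> / (norm (complex_of_real t - z))\<^sup>2)"
proof (rule integrable_weight_bound)
  define c where "c = 2 + (1 + 2 * (Re z)\<^sup>2) / (Im z)\<^sup>2"
  fix t :: real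
  have p: "(norm (complex_of_real t - z))\<^sup>2 > 0" "t\<^sup>2 + 1 > 0"
    using norm_of_real_diff_ge[OF assms, of t] assms by (auto simp: add_nonneg_pos)
  have "1 / (norm (complex_of_real t - z))\<^sup>2 \<le> c / (t\<^sup>2 + 1)"
    using kernel_growth_le[OF assms, of t] p by (simp add: c_def field_simps)
  then have "\<bar>\<psi> t\<bar> * (1 / (norm (complex_of_real t - z))\<^sup>2) \<le> \<bar>\<psi> t\<bar> * (c / (t\<^sup>2 + 1))"
    by (intro mult_left_mono) auto
  then show "norm (\<bar>\<psi> t\<bar> / (norm (complex_of_real t - z))\<^sup>2) \<le> c * (\<bar>\<psi> t\<bar> / (t\<^sup>2 + 1))"
    by (simp add: mult.commute)
qed measurable

lemma integrable_cauchy_power: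
  assumes "Im z > 0" "2 \<le> n"
  shows "integrable lborel (\<lambda>t. complex_of_real (\<psi> t) / (complex_of_real t - z) ^ n)"
proof (rule Bochner_Integration.integrable_bound)
  show "integrable lborel (\<lambda>t. (1 / Im z ^ (n - 2)) * (\<bar>\<psi> t\<bar> / (norm (complex_of_real t - z))\<^sup>2))"
    by (intro integrable_mult_right integrable_over_norm_squared assms)
  show "AE t in lborel. norm (complex_of_real (\<psi> t) / (complex_of_real t - z) ^ n)
    \<le> norm ((1 / Im z ^ (n - 2)) * (\<bar>\<psi> t\<bar> / (norm (complex_of_real t - z))\<^sup>2))"
  proof (rule AE_I2)
    fix t
    define N where "N = norm (complex_of_real t - z)"
    have N: "N \<ge> Im z" using norm_of_real_diff_ge assms by (simp add: N_def)
    have "N ^ n = N ^ (n - 2) * N\<^sup>2"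
      using assms by (metis le_add_diff_inverse2 power_add)
    then have "Im z ^ (n - 2) * N\<^sup>2 \<le> N ^ n"
      using N assms by (auto intro!: mult_right_mono power_mono)
    then have "\<bar>\<psi> t\<bar> / N ^ n \<le> \<bar>\<psi> t\<bar> / (Im z ^ (n - 2) * N\<^sup>2)"
      using N assms by (intro divide_left_mono mult_pos_pos) auto
    then show "norm (complex_of_real (\<psi> t) / (complex_of_real t - z) ^ n)
    \<le> norm ((1 / Im z ^ (n - 2)) * (\<bar>\<psi> t\<bar> / (norm (complex_of_real t - z))\<^sup>2))"
      using assms by (simp add: norm_divide norm_power abs_mult flip: N_def)
  qed
qed measurable

text \<open>Up to constants these are the derivatives of \<open>outer_exponent\<close>: order 2
  gives the first and order 3 the second.\<close>

definition cauchy_power :: "nat \<Rightarrow> complex \<Rightarrow> complex" where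
  "cauchy_power n z = (\<integral>t. complex_of_real (\<psi> t) / (complex_of_real t - z) ^ n \<partial>lborel)"

definition outer_exponent :: "complex \<Rightarrow> complex" where
  "outer_exponent z = 1 / (of_real pi * \<i>) *
    (\<integral>t. (1 / (of_real t - z) - of_real (t / (t\<^sup>2 + 1))) * of_real (\<psi> t) \<partial>lborel)"

lemma outer_weight_eq: "outer_weight \<psi> z = exp (outer_exponent z)"
  by (simp add: outer_weight_def outer_exponent_def)

lemma integrable_outer_kernel:
  assumes "Im z > 0"
  shows "integrable lborel (\<lambda>t. (1 / (of_real t - z) - of_real (t / (t\<^sup>2 + 1))) * complex_of_real (\<psi> t))"
proof (rule integrable_weight_bound)
  define c where "c = norm (1 + z\<^sup>2) / Im z + norm z"
  fix t :: real
  have ne: "complex_of_real t - z \<noteq> 0" using norm_of_real_diff_ge[OF assms, of t] assms by auto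
  have q: "complex_of_real (t\<^sup>2 + 1) \<noteq> 0"
    by (subst of_real_eq_0_iff) (simp add: add_nonneg_eq_0_iff)
  \<comment> \<open>The difference is (1 + t z) / ((t - z) (t^2 + 1)), and 1 + t z = (1 + z^2) + z
    (t - z); this exhibits the decay 1 / (t^2 + 1).\<close>
  have "1 / (of_real t - z) - of_real (t / (t\<^sup>2 + 1)) = ((1 + z\<^sup>2) / (of_real t - z) + z) / complex_of_real (t\<^sup>2 + 1)"
    using ne q by (simp add: divide_simps) (simp add: algebra_simps power2_eq_square)
  then have "norm ((1 / (of_real t - z) - of_real (t / (t\<^sup>2 + 1))) * complex_of_real (\<psi> t))
    = norm ((1 + z\<^sup>2) / (of_real t - z) + z) * (\<bar>\<psi> t\<bar> / (t\<^sup>2 + 1))"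
    by (simp only: norm_mult norm_divide norm_of_real) (simp add: add_nonneg_nonneg)
  also have "\<dots> \<le> c * (\<bar>\<psi> t\<bar> / (t\<^sup>2 + 1))"
  proof (rule mult_right_mono)
    have "norm ((1 + z\<^sup>2) / (of_real t - z) + z) \<le> norm (1 + z\<^sup>2) / norm (of_real t - z) + norm z"
      by (metis norm_triangle_ineq norm_divide)
    also have "norm (1 + z\<^sup>2) / norm (of_real t - z) \<le> norm (1 + z\<^sup>2) / Im z"
      using norm_of_real_diff_ge[OF assms, of t] assms ne by (intro divide_left_mono mult_pos_pos) auto
    finally show "norm ((1 + z\<^sup>2) / (of_real t - z) + z) \<le> c" by (simp add: c_def)
  qed (simp add: add_nonneg_nonneg)
  finally show "norm ((1 / (of_real t - z) - of_real (t / (t\<^sup>2 + 1))) * complex_of_real (\<psi> t))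
     \<le> c * (\<bar>\<psi> t\<bar> / (t\<^sup>2 + 1))" .
qed measurable

lemma norm_shifted_ge:
  assumes "Im z > 0" "norm w < Im z / 2"
  shows "norm (complex_of_real t - (z + w)) \<ge> norm (complex_of_real t - z) / 2"
    and "norm w \<le> norm (complex_of_real t - z) / 2"
proof -
  have "norm (complex_of_real t - (z + w)) \<ge> norm (complex_of_real t - z) - norm w"
    using norm_triangle_ineq2[of "complex_of_real t - z" w] by (simp add: algebra_simps)
  then show "norm (complex_of_real t - (z + w)) \<ge> norm (complex_of_real t - z) / 2"
     "norm w \<le> norm (complex_of_real t - z) / 2"
    using norm_of_real_diff_ge[OF assms(1), of t] assms(2) by linarith+
qed

lemma Im_shifted_pos: "Im z > 0 \<Longrightarrow> norm w < Im z / 2 \<Longrightarrow> Im (z + w) > 0"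
  using abs_Im_le_cmod[of w] by simp

lemma DERIV_outer_exponent:
  assumes z: "Im z > 0"
  shows "(outer_exponent has_field_derivative (1 / (of_real pi * \<i>) * cauchy_power 2 z)) (at z)"
  unfolding outer_exponent_def[abs_def] cauchy_power_def
proof (intro DERIV_cmult has_field_derivative_integral_quadratic[where r="Im z / 2"
   and g="\<lambda>t. (2 / Im z) * (\<bar>\<psi> t\<bar> / (norm (complex_of_real t - z))\<^sup>2)"])
  fix w :: complex and t :: real assume w: "norm w < Im z / 2"
  define u where "u = complex_of_real t - z"
  have u: "norm u \<ge> Im z" using norm_of_real_diff_ge[OF z] by (simp add: u_def)
  have n1: "norm (u - w) \<ge> norm u / 2" using norm_shifted_ge(1)[OF z w, of t] by (simp add: u_def algebra_simps)
  then have ne: "u \<noteq> 0" "u - w \<noteq> 0" using u z by auto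
  have "1 / (u - w) - 1 / u - w / u\<^sup>2 = w\<^sup>2 / (u\<^sup>2 * (u - w))"
    using ne by (simp add: divide_simps) (simp add: algebra_simps power2_eq_square power3_eq_cube)
  then have "norm (1 / (u - w) - 1 / u - w / u\<^sup>2) = (norm w)\<^sup>2 / ((norm u)\<^sup>2 * norm (u - w))"
    by (simp add: norm_divide norm_mult norm_power)
  also have "\<dots> \<le> (norm w)\<^sup>2 / ((norm u)\<^sup>2 * (Im z / 2))"
    using u n1 z ne by (intro divide_left_mono mult_left_mono) auto
  finally have "norm (1 / (u - w) - 1 / u - w / u\<^sup>2) * \<bar>\<psi> t\<bar> \<le> (norm w)\<^sup>2 / ((norm u)\<^sup>2 * (Im z / 2)) * \<bar>\<psi> t\<bar>"
    by (intro mult_right_mono) auto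
  moreover have "(1 / (of_real t - (z + w)) - of_real (t / (t\<^sup>2 + 1))) * complex_of_real (\<psi> t)
     - (1 / (of_real t - z) - of_real (t / (t\<^sup>2 + 1))) * of_real (\<psi> t)
     - w * (of_real (\<psi> t) / (of_real t - z)\<^sup>2) = (1 / (u - w) - 1 / u - w / u\<^sup>2) * of_real (\<psi> t)"
    by (simp add: u_def algebra_simps)
  ultimately show "norm ((1 / (of_real t - (z + w)) - of_real (t / (t\<^sup>2 + 1))) * complex_of_real (\<psi> t)
     - (1 / (of_real t - z) - of_real (t / (t\<^sup>2 + 1))) * of_real (\<psi> t)
     - w * (of_real (\<psi> t) / (of_real t - z)\<^sup>2)) \<le> (norm w)\<^sup>2 * ((2 / Im z) * (\<bar>\<psi> t\<bar> / (norm (of_real t - z))\<^sup>2))"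
    by (simp add: norm_mult u_def mult_ac)
qed ((rule integrable_outer_kernel integrable_cauchy_power integrable_mult_right
      integrable_over_norm_squared Im_shifted_pos z | assumption | simp add: z)+)

lemma DERIV_cauchy_power_2:
  assumes z: "Im z > 0"
  shows "(cauchy_power 2 has_field_derivative 2 * cauchy_power 3 z) (at z)"
proof -
  have "((\<lambda>z. \<integral>t. complex_of_real (\<psi> t) / (complex_of_real t - z) ^ 2 \<partial>lborel)
    has_field_derivative (\<integral>t. 2 * (complex_of_real (\<psi> t) / (complex_of_real t - z) ^ 3) \<partial>lborel)) (at z)"
  proof (rule has_field_derivative_integral_quadratic[where r="Im z / 2"
     and g="\<lambda>t. (16 / (Im z)\<^sup>2) * (\<bar>\<psi> t\<bar> / (norm (complex_of_real t - z))\<^sup>2)"])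
    fix w :: complex and t :: real assume w: "norm w < Im z / 2"
    define u where "u = complex_of_real t - z"
    have u: "norm u \<ge> Im z" using norm_of_real_diff_ge[OF z] by (simp add: u_def)
    have n1: "norm (u - w) \<ge> norm u / 2" using norm_shifted_ge(1)[OF z w, of t] by (simp add: u_def algebra_simps)
    have n2: "norm w \<le> norm u / 2" using norm_shifted_ge(2)[OF z w, of t] by (simp add: u_def)
    have ne: "u \<noteq> 0" "u - w \<noteq> 0" using n1 u z by auto
    have "1 / (u - w)\<^sup>2 - 1 / u\<^sup>2 - 2 * w / u ^ 3 = w\<^sup>2 * (3 * u - 2 * w) / (u ^ 3 * (u - w)\<^sup>2)"
      using ne by (simp add: divide_simps) (simp add: algebra_simps power2_eq_square power3_eq_cube)
    then have "norm (1 / (u - w)\<^sup>2 - 1 / u\<^sup>2 - 2 * w / u ^ 3)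
      = (norm w)\<^sup>2 * (norm (3 * u - 2 * w) / (norm u ^ 3 * (norm (u - w))\<^sup>2))"
      by (simp add: norm_divide norm_mult norm_power)
    also have "\<dots> \<le> (norm w)\<^sup>2 * (4 * norm u / (norm u ^ 3 * (norm u / 2)\<^sup>2))"
    proof (rule mult_left_mono[OF frac_le])
      show "norm (3 * u - 2 * w) \<le> 4 * norm u"
        using norm_triangle_ineq4[of "3 * u" "2 * w"] n2 by (simp add: norm_mult)
      show "norm u ^ 3 * (norm u / 2)\<^sup>2 \<le> norm u ^ 3 * (norm (u - w))\<^sup>2"
        using n1 by (intro mult_left_mono power_mono) auto
    qed (use ne in auto)
    also have "\<dots> = (norm w)\<^sup>2 * (16 / ((norm u)\<^sup>2 * (norm u)\<^sup>2))"
      using ne by (simp add: field_simps power2_eq_square power3_eq_cube)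
    also have "\<dots> \<le> (norm w)\<^sup>2 * (16 / ((Im z)\<^sup>2 * (norm u)\<^sup>2))"
      using u z ne by (intro mult_left_mono divide_left_mono mult_right_mono power_mono) auto
    finally have "norm (1 / (u - w)\<^sup>2 - 1 / u\<^sup>2 - 2 * w / u ^ 3) * \<bar>\<psi> t\<bar>
      \<le> (norm w)\<^sup>2 * (16 / ((Im z)\<^sup>2 * (norm u)\<^sup>2)) * \<bar>\<psi> t\<bar>"
      by (intro mult_right_mono) auto
    moreover have "of_real (\<psi> t) / (of_real t - (z + w))\<^sup>2 - of_real (\<psi> t) / (of_real t - z)\<^sup>2
       - w * (2 * (of_real (\<psi> t) / (of_real t - z) ^ 3)) = (1 / (u - w)\<^sup>2 - 1 / u\<^sup>2 - 2 * w / u ^ 3) * complex_of_real (\<psi> t)"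
      by (simp add: u_def algebra_simps)
    ultimately show "norm (of_real (\<psi> t) / (of_real t - (z + w))\<^sup>2 - of_real (\<psi> t) / (of_real t - z)\<^sup>2
       - w * (2 * (complex_of_real (\<psi> t) / (of_real t - z) ^ 3)))
        \<le> (norm w)\<^sup>2 * ((16 / (Im z)\<^sup>2) * (\<bar>\<psi> t\<bar> / (norm (of_real t - z))\<^sup>2))"
      by (simp add: norm_mult u_def mult_ac)
  qed ((rule integrable_outer_kernel integrable_cauchy_power integrable_mult_right
      integrable_over_norm_squared Im_shifted_pos z | assumption | simp add: z)+)
  also have "(\<integral>t. 2 * (complex_of_real (\<psi> t) / (complex_of_real t - z) ^ 3) \<partial>lborel) = 2 * cauchy_power 3 z"
    unfolding cauchy_power_def by (rule integral_mult_right_zero)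
  finally show ?thesis by (simp only: cauchy_power_def[abs_def])
qed

lemma holomorphic_outer_weight: "outer_weight \<psi> holomorphic_on upper_half_plane"
proof -
  have "outer_exponent holomorphic_on upper_half_plane"
    unfolding holomorphic_on_open[OF upper_half_plane(1)] using DERIV_outer_exponent by (metis uhp_iff)
  then show ?thesis
    unfolding outer_weight_eq[abs_def] by (intro holomorphic_intros)
qed

lemma outer_weight_nonzero: "outer_weight \<psi> z \<noteq> 0"
  by (simp add: outer_weight_eq)

lemma integrable_poisson_mult:
  assumes "Im z > 0"
  shows "integrable lborel (\<lambda>t. poisson z t * \<psi> t)"
proof (rule Bochner_Integration.integrable_bound)
  show "integrable lborel (\<lambda>t. Im z / pi * (\<bar>\<psi> t\<bar> / (norm (complex_of_real t - z))\<^sup>2))"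
    by (intro integrable_mult_right integrable_over_norm_squared assms)
qed (use assms in \<open>auto simp: poisson_def norm_of_real_diff_squared abs_mult\<close>)

lemma Re_outer_exponent:
  assumes z: "Im z > 0"
  shows "Re (outer_exponent z) = (\<integral>t. poisson z t * \<psi> t \<partial>lborel)"
proof -
  let ?K = "\<lambda>t. (1 / (of_real t - z) - of_real (t / (t\<^sup>2 + 1))) * complex_of_real (\<psi> t)"
  have "Re (outer_exponent z) = Im (\<integral>t. ?K t \<partial>lborel) / pi"
    by (simp add: outer_exponent_def Re_divide power2_eq_square)
  also have "Im (\<integral>t. ?K t \<partial>lborel) = (\<integral>t. Im (?K t) \<partial>lborel)"
    by (rule integral_Im[symmetric]) (rule integrable_outer_kernel[OF z])
  also have "\<dots> / pi = (\<integral>t. Im (?K t) / pi \<partial>lborel)"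
    by simp
  also have "(\<lambda>t. Im (?K t) / pi) = (\<lambda>t. poisson z t * \<psi> t)"
    by (auto simp: poisson_def Im_divide fun_eq_iff)
  finally show ?thesis .
qed

lemma norm_outer_weight:
  assumes "Im z > 0"
  shows "norm (outer_weight \<psi> z) = exp (\<integral>t. poisson z t * \<psi> t \<partial>lborel)"
  by (simp add: outer_weight_eq Re_outer_exponent[OF assms])

end

text \<open>After the substitution t = Re z + u Im z the kernel no longer depends on z. The
  right-hand side also makes sense for Im z = 0, where it is the value at Re z, and this provides
  the continuous extension of the Poisson integral to the real axis.\<close>

lemma poisson_scaling:
  fixes \<psi> :: "real \<Rightarrow> real"
  assumes "Im z > 0"
  shows "(\<integral>t. poisson z t * \<psi> t \<partial>lborel) = (\<integral>u. poisson \<i> u * \<psi> (Re z + Im z * u) \<partial>lborel)"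
proof -
  have 1: "(\<integral>t. poisson z t * \<psi> t \<partial>lborel) = Im z * (\<integral>u. poisson z (Re z + Im z * u) * \<psi> (Re z + Im z * u) \<partial>lborel)"
    using assms by (subst lborel_integral_real_affine[of "Im z" _ "Re z"]) auto
  have 2: "\<dots> = (\<integral>u. Im z * (poisson z (Re z + Im z * u) * \<psi> (Re z + Im z * u)) \<partial>lborel)"
    by simp
  have 3: "Im z * (poisson z (Re z + Im z * u) * \<psi> (Re z + Im z * u)) = poisson \<i> u * \<psi> (Re z + Im z * u)" for u
  proof -
    have "(Im z * u)\<^sup>2 + (Im z)\<^sup>2 = (Im z)\<^sup>2 * (u\<^sup>2 + 1)"
      by (simp add: power_mult_distrib algebra_simps)
    then show ?thesis
      using assms by (simp add: poisson_def power2_eq_square)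
  qed
  show ?thesis by (simp only: 1 2 3)
qed

lemma continuous_on_poisson_scaled:
  fixes \<psi> :: "real \<Rightarrow> real"
  assumes c: "continuous_on UNIV \<psi>" and B: "\<And>t. \<bar>\<psi> t\<bar> \<le> B"
  shows "continuous_on UNIV (\<lambda>z. \<integral>u. poisson \<i> u * \<psi> (Re z + Im z * u) \<partial>lborel)"
  unfolding continuous_on_sequentially
proof safe
  fix X :: "nat \<Rightarrow> complex" and z assume X: "X \<longlonglongrightarrow> z"
  have [measurable]: "\<psi> \<in> borel_measurable borel"
    by (rule borel_measurable_continuous_onI[OF c])
  show "((\<lambda>z. \<integral>u. poisson \<i> u * \<psi> (Re z + Im z * u) \<partial>lborel) \<circ> X)
     \<longlonglongrightarrow> (\<integral>u. poisson \<i> u * \<psi> (Re z + Im z * u) \<partial>lborel)"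
    unfolding o_def
  proof (rule integral_dominated_convergence)
    show "integrable lborel (\<lambda>u. poisson \<i> u * B)"
      by (intro integrable_mult_left integrable_poisson) auto
    show "AE u in lborel. (\<lambda>n. poisson \<i> u * \<psi> (Re (X n) + Im (X n) * u)) \<longlonglongrightarrow> poisson \<i> u * \<psi> (Re z + Im z * u)"
    proof (intro AE_I2 tendsto_mult tendsto_const)
      fix u
      have "isCont \<psi> (Re z + Im z * u)" using c by (simp add: continuous_on_eq_continuous_at)
      moreover have "(\<lambda>n. Re (X n) + Im (X n) * u) \<longlonglongrightarrow> Re z + Im z * u"
        by (intro tendsto_intros X)
      ultimately show "(\<lambda>n. \<psi> (Re (X n) + Im (X n) * u)) \<longlonglongrightarrow> \<psi> (Re z + Im z * u)"
        by (rule isCont_tendsto_compose)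
    qed
  qed (use B in \<open>auto simp: abs_mult intro!: mult_left_mono\<close>)
qed

text \<open>The square of b is, in modulus, the outer function with boundary modulus |h| + delta.
  The lower bound by |h| is a maximum principle in an unbounded region. The upper bound replaces the
  geometric mean with respect to the Poisson kernel by the arithmetic mean, whose horizontal
  integrals are under control.\<close>

lemma outer_majorant:
  assumes holo: "h holomorphic_on {w. - e < Im w}" and e: "e > 0"
    and bnd: "\<And>w. - e < Im w \<Longrightarrow> norm (h w) \<le> M" and \<delta>: "\<delta> > 0"
  obtains b where "b holomorphic_on upper_half_plane" "\<And>z. b z \<noteq> 0"
    "\<And>z. Im z > 0 \<Longrightarrow> norm (h z) \<le> (norm (b z))\<^sup>2"
    "\<And>z. Im z > 0 \<Longrightarrow> (norm (b z))\<^sup>2 \<le> (\<integral>t. poisson z t * norm (h (of_real t)) \<partial>lborel) + \<delta>"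
proof -
  \<comment> \<open>The summand 1 keeps the logarithm finite at zeros of h and makes it nonnegative;
    the boundedness of h makes it bounded. The factor \<open>\<delta>\<close> divided out here is
    restored in \<open>b\<close>.\<close>
  define \<psi> where "\<psi> t = ln (1 + norm (h (of_real t)) / \<delta>)" for t :: real
  define B where "B = ln (1 + M / \<delta>)"
  have h_cont: "continuous_on {w. - e < Im w} h"
    by (rule holomorphic_on_imp_continuous_on[OF holo])
  have hr_cont: "continuous_on UNIV (\<lambda>t. h (complex_of_real t))"
    by (rule continuous_on_compose2[OF h_cont]) (use e in \<open>auto intro!: continuous_intros\<close>)
  have pos: "1 + norm (h (of_real t)) / \<delta> \<ge> 1" for t :: real using \<delta> by simp
  have \<psi>_cont: "continuous_on UNIV \<psi>"
    unfolding \<psi>_def using \<delta> pos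
    by (intro continuous_intros hr_cont) (auto simp: add_nonneg_eq_0_iff)
  have \<psi>_nonneg: "\<psi> t \<ge> 0" for t using pos by (simp add: \<psi>_def)
  have M: "M \<ge> 0" using order_trans[OF norm_ge_zero bnd[of 0]] e by simp
  have \<psi>_le: "\<psi> t \<le> B" for t
  proof -
    have "norm (h (of_real t)) / \<delta> \<le> M / \<delta>" using bnd[of "of_real t"] e \<delta> by (simp add: divide_right_mono)
    then show ?thesis unfolding \<psi>_def B_def using pos[of t] M \<delta> by (subst ln_le_cancel_iff) (auto intro!: add_pos_nonneg)
  qed
  have exp_\<psi>: "exp (\<psi> t) = 1 + norm (h (of_real t)) / \<delta>" for t
    using pos[of t] by (simp add: \<psi>_def)
  have [measurable]: "\<psi> \<in> borel_measurable borel" by (rule borel_measurable_continuous_onI[OF \<psi>_cont])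
  have int: "integrable lborel (\<lambda>t. \<psi> t / (t\<^sup>2 + 1))"
  proof (rule Bochner_Integration.integrable_bound)
    show "integrable lborel (\<lambda>t. B / ((t - 0)\<^sup>2 + 1\<^sup>2))"
      by (rule nn_integral_inverse_quadratic) (use order_trans[OF \<psi>_nonneg \<psi>_le] in auto)
    show "AE t in lborel. norm (\<psi> t / (t\<^sup>2 + 1)) \<le> norm (B / ((t - 0)\<^sup>2 + 1\<^sup>2))"
      using \<psi>_nonneg \<psi>_le order_trans[OF \<psi>_nonneg \<psi>_le]
      by (intro AE_I2) (auto intro!: divide_right_mono simp: add_nonneg_nonneg)
  qed measurable
  interpret P: poisson_integrable \<psi> by unfold_locales (rule int)
  interpret Q: poisson_integrable "\<lambda>t. \<psi> t / 2"
    by unfold_locales (use integrable_divide[OF int, of 2] in \<open>simp add: mult.commute\<close>)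
  define V where "V z = (\<integral>u. poisson \<i> u * \<psi> (Re z + Im z * u) \<partial>lborel)" for z
  have V_cont: "continuous_on S V" for S
    using continuous_on_poisson_scaled[OF \<psi>_cont, of B] \<psi>_nonneg \<psi>_le
    by (auto simp: V_def[abs_def] intro: continuous_on_subset)
  have V_eq: "V z = (\<integral>t. poisson z t * \<psi> t \<partial>lborel)" if "Im z > 0" for z
    using poisson_scaling[OF that] by (simp add: V_def)
  have V_real: "V (of_real x) = \<psi> x" for x
    by (simp add: V_def integral_poisson integrable_poisson)
  have V_nonneg: "V z \<ge> 0" for z
    unfolding V_def using \<psi>_nonneg by (intro integral_nonneg_AE) auto
  have O: "norm (outer_weight \<psi> z) = exp (V z)" if "Im z > 0" for z
    using P.norm_outer_weight[OF that] V_eq[OF that] by simp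
  \<comment> \<open>For the quotient of h by the outer function only the modulus is known to extend
    continuously to the real axis. The maximum principle is therefore applied on Im z >= tau, and
    uniform continuity of \<open>A\<close> carries the bound from the axis to that line.\<close>
  define A where "A z = norm (h z) * exp (- V z)" for z
  have A_cont: "continuous_on {z. Im z \<ge> 0} A"
    unfolding A_def using e by (intro continuous_intros V_cont continuous_on_subset[OF h_cont]) auto
  have A_real: "A (of_real x) \<le> \<delta>" for x
  proof -
    have "A (of_real x) = norm (h (of_real x)) / (1 + norm (h (of_real x)) / \<delta>)"
      by (simp add: A_def V_real exp_minus exp_\<psi> divide_inverse)
    also have "\<dots> \<le> \<delta>"
      using pos[of x] \<delta> by (subst pos_divide_le_eq) (auto simp: field_simps add_pos_nonneg)
    finally show ?thesis .
  qed
  \<comment> \<open>Phragmen-Lindelof: the divisor 1 - i eta z has modulus at least 1 and grows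
    linearly, which controls the large arc; afterwards eta tends to 0.\<close>
  have PL: "A z0 \<le> (\<delta> + \<eta>) * norm (1 - \<i> * of_real \<eta> * z0)" if z0: "Im z0 > 0" and \<eta>: "\<eta> > 0" for z0 \<eta>
  proof -
    define D where "D z = 1 - \<i> * of_real \<eta> * z" for z :: complex
    have D1: "norm (D z) \<ge> 1" if "Im z \<ge> 0" for z
    proof -
      have "\<eta> * Im z \<ge> 0" using that \<eta> by simp
      moreover have "\<bar>1 + \<eta> * Im z\<bar> \<le> norm (D z)"
        using abs_Re_le_cmod[of "D z"] by (simp add: D_def)
      ultimately show ?thesis by linarith
    qed
    have D2: "norm (D z) \<ge> \<eta> * norm z" if "Im z \<ge> 0" for z
    proof -
      have "(norm (D z))\<^sup>2 = (1 + \<eta> * Im z)\<^sup>2 + (\<eta> * Re z)\<^sup>2"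
        by (simp add: cmod_power2 D_def)
      also have "\<dots> \<ge> (\<eta> * Im z)\<^sup>2 + (\<eta> * Re z)\<^sup>2"
        using that \<eta> by (intro add_right_mono power_mono) auto
      also have "(\<eta> * Im z)\<^sup>2 + (\<eta> * Re z)\<^sup>2 = (\<eta> * norm z)\<^sup>2"
        by (simp add: cmod_power2 power_mult_distrib algebra_simps)
      finally show ?thesis by (rule power2_le_imp_le) simp
    qed
    define q where "q z = h z / outer_weight \<psi> z / D z" for z
    have q_norm: "norm (q z) = A z / norm (D z)" if "Im z > 0" for z
      using O[OF that] by (simp add: q_def A_def norm_divide norm_mult exp_minus field_simps)
    \<comment> \<open>The first entry puts z0 inside the half-disc; the second makes M / |D z| at
      most delta on the arc |z| = R.\<close>
    define R where "R = max (norm z0 + 1) (M / (\<eta> * \<delta>))"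
    have R: "R > norm z0" "R > 0" "M \<le> R * \<eta> * \<delta>"
    proof -
      show "R > norm z0" by (simp add: R_def)
      then show "R > 0" by (meson norm_ge_zero order_le_less_trans)
      have "M / (\<eta> * \<delta>) \<le> R" by (simp add: R_def)
      then show "M \<le> R * \<eta> * \<delta>" using \<eta> \<delta> by (simp add: field_simps)
    qed
    define S0 where "S0 = {z. Im z \<ge> 0} \<inter> cball 0 R"
    have "compact S0" unfolding S0_def
      by (intro closed_Int_compact compact_cball closed_halfspace_Im_ge)
    moreover have "continuous_on S0 A" by (rule continuous_on_subset[OF A_cont]) (auto simp: S0_def)
    ultimately have "uniformly_continuous_on S0 A" by (rule compact_uniformly_continuous[rotated])
    then obtain d where d: "d > 0" "\<And>x x'. x \<in> S0 \<Longrightarrow> x' \<in> S0 \<Longrightarrow> dist x' x < d \<Longrightarrow> dist (A x') (A x) < \<eta>"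
      using \<eta> unfolding uniformly_continuous_on_def by metis
    define \<tau> where "\<tau> = min (d / 2) (Im z0 / 2)"
    have \<tau>: "\<tau> > 0" "\<tau> < d" "\<tau> < Im z0" using d z0 by (auto simp: \<tau>_def)
    define S where "S = {z. Im z \<ge> \<tau>} \<inter> cball 0 R"
    have clS: "closed S" unfolding S_def by (intro closed_Int closed_halfspace_Im_ge closed_cball)
    have subS: "S \<subseteq> upper_half_plane" using \<tau> by (auto simp: S_def)
    have q_holo: "q holomorphic_on upper_half_plane"
      unfolding q_def D_def
    proof (intro holomorphic_intros P.holomorphic_outer_weight P.outer_weight_nonzero)
      show "h holomorphic_on upper_half_plane" by (rule holomorphic_on_subset[OF holo]) (use e in auto)
      show "1 - \<i> * of_real \<eta> * z \<noteq> 0" if "z \<in> upper_half_plane" for z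
        using D1[of z] that by (auto simp: D_def)
    qed
    have "norm (q z0) \<le> \<delta> + \<eta>"
    proof (rule maximum_modulus_frontier[where f=q and S=S])
      show "q holomorphic_on interior S"
        by (rule holomorphic_on_subset[OF q_holo]) (use interior_subset subS in blast)
      show "continuous_on (closure S) q"
        unfolding closure_closed[OF clS]
        by (rule continuous_on_subset[OF holomorphic_on_imp_continuous_on[OF q_holo] subS])
      show "bounded S" by (auto simp: S_def intro: bounded_subset[OF bounded_cball])
      show "z0 \<in> S" using \<tau> R by (auto simp: S_def)
      fix z assume "z \<in> frontier S"
      then have zS: "z \<in> S" "z \<notin> interior S"
        by (auto simp: frontier_def closure_closed[OF clS])
      have zp: "Im z > 0" using zS subS by auto
      have "{z. Im z > \<tau>} \<inter> ball 0 R \<subseteq> interior S"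
        by (rule interior_maximal) (auto simp: S_def open_halfspace_Im_gt intro!: open_Int)
      then consider "norm z = R" | "Im z = \<tau>"
        using zS by (force simp: S_def)
      then show "norm (q z) \<le> \<delta> + \<eta>"
      proof cases
        case 1
        have "A z \<le> M * 1"
          unfolding A_def using bnd[of z] e zp V_nonneg[of z] M by (intro mult_mono) auto
        also have "\<dots> \<le> \<delta> * (\<eta> * norm z)" using R 1 by (simp add: mult_ac)
        also have "\<dots> \<le> \<delta> * norm (D z)" using D2[of z] zp \<delta> by (intro mult_left_mono) auto
        finally have "A z \<le> \<delta> * norm (D z)" .
        moreover have "norm (D z) > 0" using order_less_le_trans[OF zero_less_one D1[of z]] zp by simp
        ultimately have "norm (q z) \<le> \<delta>" by (simp only: q_norm[OF zp] pos_divide_le_eq)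
        then show ?thesis using \<eta> by simp
      next
        case 2
        have "of_real (Re z) \<in> S0" "z \<in> S0"
          using zS \<tau> abs_Re_le_cmod[of z] by (auto simp: S_def S0_def)
        moreover have "dist z (of_real (Re z)) = \<tau>"
          using 2 \<tau> by (simp add: dist_norm cmod_def)
        ultimately have "dist (A z) (A (of_real (Re z))) < \<eta>" using d \<tau> by auto
        then have "A z \<le> \<delta> + \<eta>" using A_real[of "Re z"] by (auto simp: dist_real_def)
        moreover have "A z / norm (D z) \<le> A z / 1"
          using D1[of z] zp by (intro divide_left_mono) (auto simp: A_def)
        ultimately show ?thesis by (simp add: q_norm[OF zp])
      qed
    qed
    then have "A z0 / norm (D z0) \<le> \<delta> + \<eta>" by (simp add: q_norm[OF z0])
    moreover have "norm (D z0) > 0" using order_less_le_trans[OF zero_less_one D1[of z0]] z0 by simp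
    ultimately show ?thesis by (simp only: pos_divide_le_eq D_def)
  qed
  have main: "norm (h z) \<le> \<delta> * exp (V z)" if z: "Im z > 0" for z
  proof -
    have "((\<lambda>\<eta>. (\<delta> + \<eta>) * norm (1 - \<i> * of_real \<eta> * z)) \<longlongrightarrow> (\<delta> + 0) * norm (1 - \<i> * of_real 0 * z)) (at_right 0)"
      by (intro tendsto_intros)
    then have "A z \<le> (\<delta> + 0) * norm (1 - \<i> * of_real 0 * z)"
      by (rule tendsto_lowerbound) (auto intro!: eventually_at_right_less[THEN eventually_mono] PL[OF z])
    then show ?thesis by (simp add: A_def exp_minus field_simps)
  qed
  \<comment> \<open>The square root is taken in the data: half of \<open>\<psi>\<close> gives an
    outer function whose square has modulus exp (V z), with no branch to choose.\<close>
  define b where "b z = of_real (sqrt \<delta>) * outer_weight (\<lambda>t. \<psi> t / 2) z" for z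
  have b_norm: "(norm (b z))\<^sup>2 = \<delta> * exp (V z)" if z: "Im z > 0" for z
  proof -
    have "(\<integral>t. poisson z t * (\<psi> t / 2) \<partial>lborel) = V z / 2"
      by (simp add: V_eq[OF z])
    then show ?thesis
      using \<delta> Q.norm_outer_weight[OF z]
      by (simp add: b_def norm_mult power_mult_distrib exp_double[symmetric])
  qed
  show ?thesis
  proof (rule that)
    show "b holomorphic_on upper_half_plane"
      unfolding b_def by (intro holomorphic_intros Q.holomorphic_outer_weight)
    show "b z \<noteq> 0" for z using \<delta> by (simp add: b_def Q.outer_weight_nonzero)
    fix z :: complex assume z: "Im z > 0"
    show "norm (h z) \<le> (norm (b z))\<^sup>2" by (simp add: b_norm[OF z] main[OF z])
    have int1: "integrable lborel (\<lambda>t. poisson z t * norm (h (of_real t)))"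
    proof (rule Bochner_Integration.integrable_bound)
      show "integrable lborel (\<lambda>t. poisson z t * M)"
        by (intro integrable_mult_left integrable_poisson z)
    qed (use z bnd e M in \<open>auto intro!: borel_measurable_continuous_onI continuous_intros hr_cont mult_left_mono simp: abs_mult\<close>)
    \<comment> \<open>Jensen's inequality, from the tangent of \<open>exp\<close> at \<open>V z\<close>.\<close>
    have "exp (V z) = (\<integral>t. poisson z t * (exp (V z) * (1 - V z)) + exp (V z) * (poisson z t * \<psi> t) \<partial>lborel)"
    proof -
      have "(\<integral>t. poisson z t * (exp (V z) * (1 - V z)) + exp (V z) * (poisson z t * \<psi> t) \<partial>lborel)
        = (\<integral>t. poisson z t * (exp (V z) * (1 - V z)) \<partial>lborel) + (\<integral>t. exp (V z) * (poisson z t * \<psi> t) \<partial>lborel)"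
        by (intro Bochner_Integration.integral_add integrable_mult_left integrable_mult_right
            integrable_poisson P.integrable_poisson_mult z)
      also have "\<dots> = exp (V z) * (1 - V z) + exp (V z) * V z"
        by (simp only: integral_mult_left_zero integral_mult_right_zero integral_poisson[OF z] V_eq[OF z] mult_1)
      finally show ?thesis by (simp add: algebra_simps)
    qed
    also have "\<dots> \<le> (\<integral>t. poisson z t + (1 / \<delta>) * (poisson z t * norm (h (of_real t))) \<partial>lborel)"
    proof (rule integral_mono)
      fix t
      have "exp (V z) * (1 + (\<psi> t - V z)) \<le> exp (V z) * exp (\<psi> t - V z)"
        by (intro mult_left_mono exp_ge_add_one_self) auto
      also have "\<dots> = 1 + norm (h (of_real t)) / \<delta>"
        by (simp add: exp_\<psi> flip: exp_add)
      finally have "poisson z t * (exp (V z) * (1 + (\<psi> t - V z))) \<le> poisson z t * (1 + norm (h (of_real t)) / \<delta>)"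
        using z by (intro mult_left_mono) auto
      then show "poisson z t * (exp (V z) * (1 - V z)) + exp (V z) * (poisson z t * \<psi> t)
        \<le> poisson z t + (1 / \<delta>) * (poisson z t * norm (h (of_real t)))"
        by (simp add: algebra_simps)
    next
      show "integrable lborel (\<lambda>t. poisson z t * (exp (V z) * (1 - V z)) + exp (V z) * (poisson z t * \<psi> t))"
        by (intro Bochner_Integration.integrable_add integrable_mult_left integrable_mult_right
            integrable_poisson P.integrable_poisson_mult z)
      show "integrable lborel (\<lambda>t. poisson z t + (1 / \<delta>) * (poisson z t * norm (h (of_real t))))"
        by (intro Bochner_Integration.integrable_add integrable_mult_right integrable_poisson int1 z)
    qed
    also have "\<dots> = 1 + (1 / \<delta>) * (\<integral>t. poisson z t * norm (h (of_real t)) \<partial>lborel)"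
      using integrable_poisson[OF z] int1 integral_poisson[OF z] by simp
    finally show "(norm (b z))\<^sup>2 \<le> (\<integral>t. poisson z t * norm (h (of_real t)) \<partial>lborel) + \<delta>"
      using \<delta> by (simp add: b_norm[OF z] field_simps)
  qed
qed

section \<open>Factorization and boundary values\<close>

lemma poisson_swap: "poisson (Complex x y) t = poisson (Complex t y) x"
  by (simp add: poisson_def power2_commute)

lemma poisson_le: "Im z > 0 \<Longrightarrow> poisson z t \<le> 1 / (pi * Im z)"
proof -
  assume z: "Im z > 0"
  have "poisson z t \<le> Im z / (pi * (Im z)\<^sup>2)"
    unfolding poisson_def using z by (intro divide_left_mono mult_pos_pos mult_left_mono) (auto simp: add_nonneg_pos)
  also have "\<dots> = 1 / (pi * Im z)" by (simp add: power2_eq_square)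
  finally show ?thesis .
qed

lemma compact_upper_half_plane_Im_ge:
  assumes "compact K" "K \<subseteq> upper_half_plane"
  obtains m where "m > 0" "\<And>z. z \<in> K \<Longrightarrow> m \<le> Im z"
proof (cases "K = {}")
  case False
  obtain z0 where "z0 \<in> K" "\<And>z. z \<in> K \<Longrightarrow> Im z0 \<le> Im z"
    using continuous_attains_inf[OF assms(1) False continuous_on_Im[OF continuous_on_id]] by blast
  then show ?thesis using that[of "Im z0"] assms(2) by auto
qed (use that[of 1] in auto)

text \<open>Fatou's lemma. The majorants obey a bound on |b|^2 with an additive constant, which is
  not integrable over a line; it is subtracted under the integral, where negative differences count
  as 0, and disappears in the limit.\<close>

lemma nn_integral_square_limit:
  assumes b: "\<And>n. b n holomorphic_on upper_half_plane" "\<And>z. z \<in> upper_half_plane \<Longrightarrow> (\<lambda>n. b n z) \<longlonglongrightarrow> g z"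
    and \<delta>: "\<delta> \<longlonglongrightarrow> 0" and y: "y > 0"
    and bnd: "\<And>n. (\<integral>\<^sup>+x. ennreal ((norm (b n (Complex x y)))\<^sup>2 - \<delta> n) \<partial>lborel) \<le> ennreal C"
  shows "(\<integral>\<^sup>+x. ennreal ((norm (g (Complex x y)))\<^sup>2) \<partial>lborel) \<le> ennreal C"
proof -
  have [measurable]: "(\<lambda>x. b n (Complex x y)) \<in> borel_measurable borel" for n
    by (intro borel_measurable_continuous_onI continuous_on_compose2[OF holomorphic_on_imp_continuous_on[OF b(1)]])
       (use y in \<open>auto intro!: continuous_intros\<close>)
  have "(\<lambda>n. ennreal ((norm (b n (Complex x y)))\<^sup>2 - \<delta> n)) \<longlonglongrightarrow> ennreal ((norm (g (Complex x y)))\<^sup>2 - 0)" for x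
    by (intro tendsto_intros \<delta> b(2)) (use y in auto)
  then have lim: "liminf (\<lambda>n. ennreal ((norm (b n (Complex x y)))\<^sup>2 - \<delta> n)) = ennreal ((norm (g (Complex x y)))\<^sup>2)" for x
    by (intro lim_imp_Liminf) auto
  have "(\<integral>\<^sup>+x. ennreal ((norm (g (Complex x y)))\<^sup>2) \<partial>lborel)
    = (\<integral>\<^sup>+x. liminf (\<lambda>n. ennreal ((norm (b n (Complex x y)))\<^sup>2 - \<delta> n)) \<partial>lborel)"
    by (simp add: lim)
  also have "\<dots> \<le> liminf (\<lambda>n. \<integral>\<^sup>+x. ennreal ((norm (b n (Complex x y)))\<^sup>2 - \<delta> n) \<partial>lborel)"
    by (rule nn_integral_liminf) measurable
  also have "\<dots> \<le> liminf (\<lambda>n. ennreal C)"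
    by (intro Liminf_mono always_eventually allI bnd)
  finally show ?thesis by (simp add: Liminf_const)
qed

text \<open>
  On the line \<open>Im z = \<epsilon>\<close> the outer function with modulus \<open>|h| + \<delta>\<close> has a square root, and both
  factors of \<open>h\<close> have modulus at most \<open>(|h| + \<delta>)^(1/2)\<close>; then \<open>\<epsilon>\<close> and \<open>\<delta>\<close> tend to 0.
\<close>

lemma bounded_mean_factorization:
  assumes h: "bounded_mean C h"
  obtains a b where "a holomorphic_on upper_half_plane" "b holomorphic_on upper_half_plane"
    "\<And>z. Im z > 0 \<Longrightarrow> h z = a z * b z"
    "\<And>y. y > 0 \<Longrightarrow> (\<integral>\<^sup>+x. ennreal ((norm (a (Complex x y)))\<^sup>2) \<partial>lborel) \<le> ennreal C"
    "\<And>y. y > 0 \<Longrightarrow> (\<integral>\<^sup>+x. ennreal ((norm (b (Complex x y)))\<^sup>2) \<partial>lborel) \<le> ennreal C"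
proof -
  note hD = bounded_meanD[OF h]
  define \<epsilon> where "\<epsilon> n = 1 / real (Suc n)" for n
  have \<epsilon>: "\<epsilon> n > 0" "\<epsilon> n \<le> 1" for n by (auto simp: \<epsilon>_def divide_simps)
  have \<epsilon>0: "\<epsilon> \<longlonglongrightarrow> 0" unfolding \<epsilon>_def by (rule LIMSEQ_Suc[OF lim_1_over_n])
  define H where "H n z = h (z + \<i> * of_real (\<epsilon> n))" for n z
  have H_real: "H n (of_real t) = h (Complex t (\<epsilon> n))" for n t
    by (simp add: H_def Complex_eq mult.commute)
  have H_holo: "H n holomorphic_on {w. - \<epsilon> n < Im w}" for n
    unfolding H_def by (rule holomorphic_on_compose_gen[OF _ hD(2), unfolded o_def]) (auto intro!: holomorphic_intros)
  have ex: "\<exists>b. b holomorphic_on upper_half_plane \<and> (\<forall>z. b z \<noteq> 0) \<and>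
    (\<forall>z. Im z > 0 \<longrightarrow> norm (H n z) \<le> (norm (b z))\<^sup>2 \<and>
      (norm (b z))\<^sup>2 \<le> (\<integral>t. poisson z t * norm (h (Complex t (\<epsilon> n))) \<partial>lborel) + \<epsilon> n)" for n
  proof -
    \<comment> \<open>Only half of the available strip is used: there the shifted argument stays
      above height eps / 2, where the pointwise estimate bounds h uniformly.\<close>
    have bd: "norm (H n w) \<le> 3 * C / (\<epsilon> n / 2)" if "- (\<epsilon> n / 2) < Im w" for w
    proof -
      have "norm (H n w) \<le> 3 * C / (Im w + \<epsilon> n)"
        unfolding H_def using bounded_mean_pointwise[OF h, of "w + \<i> * of_real (\<epsilon> n)"] that \<epsilon>(1)[of n] by simp
      also have "\<dots> \<le> 3 * C / (\<epsilon> n / 2)"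
        using that hD(1) \<epsilon>(1)[of n] by (intro divide_left_mono mult_pos_pos) auto
      finally show ?thesis .
    qed
    have "H n holomorphic_on {w. - (\<epsilon> n / 2) < Im w}"
      by (rule holomorphic_on_subset[OF H_holo]) (use \<epsilon>(1)[of n] in auto)
    moreover have "\<epsilon> n / 2 > 0" using \<epsilon>(1)[of n] by simp
    ultimately show ?thesis
      by (rule outer_majorant[OF _ _ bd \<epsilon>(1)[of n]])
         (assumption+, rule exI, intro conjI allI impI, assumption, blast, blast, simp add: H_real)
  qed
  obtain b where b: "\<And>n. b n holomorphic_on upper_half_plane" "\<And>n z. b n z \<noteq> 0"
    "\<And>n z. Im z > 0 \<Longrightarrow> norm (H n z) \<le> (norm (b n z))\<^sup>2"
    "\<And>n z. Im z > 0 \<Longrightarrow> (norm (b n z))\<^sup>2 \<le> (\<integral>t. poisson z t * norm (h (Complex t (\<epsilon> n))) \<partial>lborel) + \<epsilon> n"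
  proof -
    from ex have "\<exists>b. \<forall>n. b n holomorphic_on upper_half_plane \<and> (\<forall>z. b n z \<noteq> 0) \<and>
      (\<forall>z. Im z > 0 \<longrightarrow> norm (H n z) \<le> (norm (b n z))\<^sup>2 \<and>
      (norm (b n z))\<^sup>2 \<le> (\<integral>t. poisson z t * norm (h (Complex t (\<epsilon> n))) \<partial>lborel) + \<epsilon> n)"
      by (intro choice) blast
    then show ?thesis using that by blast
  qed
  define a where "a n z = H n z / b n z" for n z
  have a_holo: "a n holomorphic_on upper_half_plane" for n
    unfolding a_def
    by (intro holomorphic_intros b holomorphic_on_subset[OF H_holo]) (use \<epsilon>(1)[of n] in auto)
  have ab: "(norm (a n z))\<^sup>2 \<le> (norm (b n z))\<^sup>2" if "Im z > 0" for n z
  proof -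
    have "norm (a n z) \<le> norm (b n z)"
      using b(3)[OF that, of n] b(2)[of n z] by (simp add: a_def norm_divide divide_le_eq power2_eq_square)
    then show ?thesis by (intro power_mono) auto
  qed
  have int_P: "integrable lborel (\<lambda>t. poisson z t * norm (h (Complex t (\<epsilon> n))))" if "Im z > 0" for z n
  proof (rule Bochner_Integration.integrable_bound)
    show "integrable lborel (\<lambda>t. 1 / (pi * Im z) * norm (h (Complex t (\<epsilon> n))))"
      by (intro integrable_mult_right integrable_norm hD(5) \<epsilon>)
    show "AE t in lborel. norm (poisson z t * norm (h (Complex t (\<epsilon> n)))) \<le> norm (1 / (pi * Im z) * norm (h (Complex t (\<epsilon> n))))"
    proof (rule AE_I2)
      fix t
      have "poisson z t * norm (h (Complex t (\<epsilon> n))) \<le> 1 / (pi * Im z) * norm (h (Complex t (\<epsilon> n)))"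
        by (intro mult_right_mono poisson_le that) auto
      then show "norm (poisson z t * norm (h (Complex t (\<epsilon> n)))) \<le> norm (1 / (pi * Im z) * norm (h (Complex t (\<epsilon> n))))"
        using that by (simp add: abs_mult)
    qed
  qed (use hD(6)[OF \<epsilon>(1)[of n]] that in \<open>auto intro!: borel_measurable_continuous_onI continuous_intros\<close>)
  have ptw: "(norm (b n z))\<^sup>2 \<le> C / (pi * Im z) + 1" if "Im z > 0" for n z
  proof -
    have "(\<integral>t. poisson z t * norm (h (Complex t (\<epsilon> n))) \<partial>lborel) \<le> (\<integral>t. 1 / (pi * Im z) * norm (h (Complex t (\<epsilon> n))) \<partial>lborel)"
      by (intro integral_mono int_P that integrable_mult_right integrable_norm hD(5) \<epsilon> mult_right_mono poisson_le) auto
    also have "\<dots> = 1 / (pi * Im z) * (\<integral>t. norm (h (Complex t (\<epsilon> n))) \<partial>lborel)"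
      by (rule integral_mult_right_zero)
    also have "\<dots> \<le> 1 / (pi * Im z) * C"
      by (intro mult_left_mono hD(7) \<epsilon>) (use that in auto)
    finally show ?thesis using b(4)[OF that, of n] \<epsilon>(2)[of n] by simp
  qed
  \<comment> \<open>Integrating the Poisson integral over x first leaves total mass 1, because the
    kernel is symmetric in x and t.\<close>
  have mean_b: "(\<integral>\<^sup>+x. ennreal ((norm (b n (Complex x y)))\<^sup>2 - \<epsilon> n) \<partial>lborel) \<le> ennreal C" if y: "y > 0" for n y
  proof -
    have [measurable]: "(\<lambda>x. h (Complex x (\<epsilon> n))) \<in> borel_measurable borel"
      using hD(6)[OF \<epsilon>(1)[of n]] by (rule borel_measurable_continuous_onI)
    have [measurable]: "(\<lambda>(x, t). poisson (Complex x y) t) \<in> borel_measurable (lborel \<Otimes>\<^sub>M lborel)"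
      unfolding poisson_def by simp
    have "(\<integral>\<^sup>+x. ennreal ((norm (b n (Complex x y)))\<^sup>2 - \<epsilon> n) \<partial>lborel)
      \<le> (\<integral>\<^sup>+x. ennreal (\<integral>t. poisson (Complex x y) t * norm (h (Complex t (\<epsilon> n))) \<partial>lborel) \<partial>lborel)"
      using b(4)[of "Complex _ y" n] y by (intro nn_integral_mono ennreal_leI) (simp add: algebra_simps)
    also have "\<dots> = (\<integral>\<^sup>+x. \<integral>\<^sup>+t. ennreal (poisson (Complex x y) t) * ennreal (norm (h (Complex t (\<epsilon> n)))) \<partial>lborel \<partial>lborel)"
      using y int_P by (intro nn_integral_cong, subst nn_integral_eq_integral[symmetric]) (auto simp: ennreal_mult)
    also have "\<dots> = (\<integral>\<^sup>+t. \<integral>\<^sup>+x. ennreal (poisson (Complex x y) t) * ennreal (norm (h (Complex t (\<epsilon> n)))) \<partial>lborel \<partial>lborel)"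
      by (rule lborel_pair.Fubini') measurable
    also have "\<dots> = (\<integral>\<^sup>+t. ennreal (norm (h (Complex t (\<epsilon> n)))) \<partial>lborel)"
    proof (rule nn_integral_cong)
      fix t
      have "(\<integral>\<^sup>+x. ennreal (poisson (Complex x y) t) * ennreal (norm (h (Complex t (\<epsilon> n)))) \<partial>lborel)
        = (\<integral>\<^sup>+x. ennreal (poisson (Complex t y) x) \<partial>lborel) * ennreal (norm (h (Complex t (\<epsilon> n))))"
        by (subst poisson_swap, subst nn_integral_multc) auto
      then show "(\<integral>\<^sup>+x. ennreal (poisson (Complex x y) t) * ennreal (norm (h (Complex t (\<epsilon> n)))) \<partial>lborel)
        = ennreal (norm (h (Complex t (\<epsilon> n))))"
        using nn_integral_poisson[of "Complex t y"] y by simp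
    qed
    also have "\<dots> \<le> ennreal C" by (rule hD(4)[OF \<epsilon>(1)])
    finally show ?thesis .
  qed
  have mean_a: "(\<integral>\<^sup>+x. ennreal ((norm (a n (Complex x y)))\<^sup>2 - \<epsilon> n) \<partial>lborel) \<le> ennreal C" if y: "y > 0" for n y
    by (rule order_trans[OF nn_integral_mono[OF ennreal_leI] mean_b[OF y, of n]])
       (use ab[of "Complex _ y" n] y in auto)
  \<comment> \<open>The common local bound holds for all n at once: the Poisson kernel is at most 1
    / (pi Im z) and every horizontal mean of h at most C.\<close>
  define \<H> where "\<H> = {f. f holomorphic_on upper_half_plane \<and> (\<forall>z. Im z > 0 \<longrightarrow> (norm (f z))\<^sup>2 \<le> C / (pi * Im z) + 1)}"
  have normal: "\<exists>B. \<forall>f\<in>\<H>. \<forall>z\<in>K. norm (f z) \<le> B" if "compact K" "K \<subseteq> upper_half_plane" for K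
  proof -
    obtain m where m: "m > 0" "\<And>z. z \<in> K \<Longrightarrow> m \<le> Im z"
      using compact_upper_half_plane_Im_ge[OF \<open>compact K\<close> \<open>K \<subseteq> upper_half_plane\<close>] by blast
    have "norm (f z) \<le> C / (pi * m) + 2" if "f \<in> \<H>" "z \<in> K" for f z
    proof -
      have z: "Im z > 0" "m \<le> Im z" using m that(2) by force+
      have "(norm (f z))\<^sup>2 \<le> C / (pi * Im z) + 1" using that z by (auto simp: \<H>_def)
      also have "C / (pi * Im z) \<le> C / (pi * m)"
        using z m hD(1) by (intro divide_left_mono mult_left_mono mult_pos_pos) auto
      finally have "(norm (f z))\<^sup>2 \<le> C / (pi * m) + 1" by simp
      moreover have "norm (f z) \<le> (norm (f z))\<^sup>2 + 1"
        using zero_le_power2[of "norm (f z) - 1"] norm_ge_zero[of "f z"]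
        unfolding power2_diff one_power2 mult_1_right by linarith
      ultimately show ?thesis by linarith
    qed
    then show ?thesis by blast
  qed
  have b_in: "range b \<subseteq> \<H>" using b ptw by (auto simp: \<H>_def)
  have \<H>_holo: "\<And>f. f \<in> \<H> \<Longrightarrow> f holomorphic_on upper_half_plane" by (auto simp: \<H>_def)
  \<comment> \<open>Montel's theorem is applied twice, the second time along the first subsequence,
    so that both factors converge along a common one.\<close>
  have "\<exists>\<beta> r1. \<beta> holomorphic_on upper_half_plane \<and> strict_mono (r1 :: nat \<Rightarrow> nat) \<and>
    (\<forall>z\<in>upper_half_plane. (\<lambda>n. b (r1 n) z) \<longlonglongrightarrow> \<beta> z)"
    by (rule Montel[OF upper_half_plane(1) \<H>_holo normal b_in])
       (assumption+, intro exI conjI ballI, assumption, assumption, blast)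
  then obtain \<beta> r1 where \<beta>: "\<beta> holomorphic_on upper_half_plane" "strict_mono (r1 :: nat \<Rightarrow> nat)"
    "\<And>z. z \<in> upper_half_plane \<Longrightarrow> (\<lambda>n. b (r1 n) z) \<longlonglongrightarrow> \<beta> z"
    by blast
  have "a n \<in> \<H>" for n
    unfolding \<H>_def using a_holo order_trans[OF ab ptw] by blast
  then have a_in: "range (\<lambda>n. a (r1 n)) \<subseteq> \<H>" by auto
  have "\<exists>\<alpha> r2. \<alpha> holomorphic_on upper_half_plane \<and> strict_mono (r2 :: nat \<Rightarrow> nat) \<and>
    (\<forall>z\<in>upper_half_plane. (\<lambda>n. a (r1 (r2 n)) z) \<longlonglongrightarrow> \<alpha> z)"
    by (rule Montel[OF upper_half_plane(1) \<H>_holo normal a_in])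
       (assumption+, intro exI conjI ballI, assumption, assumption, blast)
  then obtain \<alpha> r2 where \<alpha>: "\<alpha> holomorphic_on upper_half_plane" "strict_mono (r2 :: nat \<Rightarrow> nat)"
    "\<And>z. z \<in> upper_half_plane \<Longrightarrow> (\<lambda>n. a (r1 (r2 n)) z) \<longlonglongrightarrow> \<alpha> z"
    by blast
  have \<beta>': "(\<lambda>n. b (r1 (r2 n)) z) \<longlonglongrightarrow> \<beta> z" if "z \<in> upper_half_plane" for z
    using LIMSEQ_subseq_LIMSEQ[OF \<beta>(3)[OF that] \<alpha>(2)] by (simp add: o_def)
  have \<epsilon>': "(\<lambda>n. \<epsilon> (r1 (r2 n))) \<longlonglongrightarrow> 0"
    using LIMSEQ_subseq_LIMSEQ[OF LIMSEQ_subseq_LIMSEQ[OF \<epsilon>0 \<beta>(2)] \<alpha>(2)] by (simp add: o_def)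
  show ?thesis
  proof (rule that[OF \<alpha>(1) \<beta>(1)])
    fix z :: complex assume z: "Im z > 0"
    have "(\<lambda>n. a (r1 (r2 n)) z * b (r1 (r2 n)) z) \<longlonglongrightarrow> \<alpha> z * \<beta> z"
      using z by (intro tendsto_mult \<alpha> \<beta>') auto
    moreover have "a n z * b n z = h (z + \<i> * of_real (\<epsilon> n))" for n
      using b(2)[of n z] by (simp add: a_def H_def)
    moreover have "(\<lambda>n. h (z + \<i> * of_real (\<epsilon> (r1 (r2 n))))) \<longlonglongrightarrow> h z"
    proof (rule isCont_tendsto_compose[of z h])
      show "isCont h z"
        using hD(3) upper_half_plane(1) z by (simp add: continuous_on_eq_continuous_at)
      have "(\<lambda>n. z + \<i> * of_real (\<epsilon> (r1 (r2 n)))) \<longlonglongrightarrow> z + \<i> * of_real 0"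
        by (intro tendsto_intros \<epsilon>')
      then show "(\<lambda>n. z + \<i> * of_real (\<epsilon> (r1 (r2 n)))) \<longlonglongrightarrow> z" by simp
    qed
    ultimately show "h z = \<alpha> z * \<beta> z"
      using LIMSEQ_unique by fastforce
  next
    fix y :: real assume y: "y > 0"
    show "(\<integral>\<^sup>+x. ennreal ((norm (\<alpha> (Complex x y)))\<^sup>2) \<partial>lborel) \<le> ennreal C"
      by (rule nn_integral_square_limit[OF a_holo \<alpha>(3) \<epsilon>' y mean_a[OF y]])
    show "(\<integral>\<^sup>+x. ennreal ((norm (\<beta> (Complex x y)))\<^sup>2) \<partial>lborel) \<le> ennreal C"
      by (rule nn_integral_square_limit[OF b(1) \<beta>' \<epsilon>' y mean_b[OF y]])
  qed
qed

text \<open>With h = a b the difference of two heights is a (b - b') + b' (a - a'), a product of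
  something bounded and something small in \<open>L2\<close> in each summand.\<close>

lemma bounded_mean_Cauchy:
  assumes h: "bounded_mean C h" and e: "e > 0"
  shows "\<exists>d>0. \<forall>y y'. 0 < y \<longrightarrow> y < d \<longrightarrow> 0 < y' \<longrightarrow> y' < d \<longrightarrow>
    (\<integral>x. norm (h (Complex x y) - h (Complex x y')) \<partial>lborel) \<le> e"
proof -
  obtain a b where a: "a holomorphic_on upper_half_plane" and b: "b holomorphic_on upper_half_plane"
    and hab: "\<And>z. Im z > 0 \<Longrightarrow> h z = a z * b z"
    and am: "\<And>y. y > 0 \<Longrightarrow> (\<integral>\<^sup>+x. ennreal ((norm (a (Complex x y)))\<^sup>2) \<partial>lborel) \<le> ennreal C"
    and bm: "\<And>y. y > 0 \<Longrightarrow> (\<integral>\<^sup>+x. ennreal ((norm (b (Complex x y)))\<^sup>2) \<partial>lborel) \<le> ennreal C"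
    by (rule bounded_mean_factorization[OF h]) blast
  have C: "C \<ge> 0" by (rule bounded_meanD(1)[OF h])
  \<comment> \<open>The weighted inequality \<open>amgm\<close> replaces Cauchy-Schwarz. The bounded
    factors contribute \<open>\<kappa>\<close> C, at most e / 2, and the tolerance
    \<open>\<kappa> * e / 2\<close> of the small factors cancels the 1 / \<open>\<kappa>\<close>,
    leaving e / 2.\<close>
  define \<kappa> where "\<kappa> = e / (2 * C + 1)"
  have \<kappa>: "\<kappa> > 0" "\<kappa> * C \<le> e / 2"
    using e C by (auto simp: \<kappa>_def field_simps)
  have e2: "\<kappa> * e / 2 > 0" using \<kappa> e by simp
  obtain d1 where d1: "d1 > 0" "\<And>y y'. 0 < y \<Longrightarrow> y < d1 \<Longrightarrow> 0 < y' \<Longrightarrow> y' < d1 \<Longrightarrow>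
    (\<integral>x. (norm (a (Complex x y) - a (Complex x y')))\<^sup>2 \<partial>lborel) \<le> \<kappa> * e / 2"
    using mean_square_Cauchy[OF a C am e2] by blast
  obtain d2 where d2: "d2 > 0" "\<And>y y'. 0 < y \<Longrightarrow> y < d2 \<Longrightarrow> 0 < y' \<Longrightarrow> y' < d2 \<Longrightarrow>
    (\<integral>x. (norm (b (Complex x y) - b (Complex x y')))\<^sup>2 \<partial>lborel) \<le> \<kappa> * e / 2"
    using mean_square_Cauchy[OF b C bm e2] by blast
  have amgm: "u * v \<le> (\<kappa> * u\<^sup>2 + v\<^sup>2 / \<kappa>) / 2" for u v :: real
  proof -
    have "0 \<le> (\<kappa> * u - v)\<^sup>2 / \<kappa>" using \<kappa> by simp
    also have "\<dots> = \<kappa> * u\<^sup>2 + v\<^sup>2 / \<kappa> - 2 * u * v"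
      using \<kappa> by (simp add: power2_diff power_mult_distrib field_simps) (simp add: power2_eq_square)
    finally show ?thesis by simp
  qed
  show ?thesis
  proof (intro exI[of _ "min d1 d2"] conjI allI impI)
    show "min d1 d2 > 0" using d1 d2 by simp
    fix y y' assume y: "0 < y" "y < min d1 d2" "0 < y'" "y' < min d1 d2"
    define A where "A x = (norm (a (Complex x y)))\<^sup>2" for x
    define B where "B x = (norm (b (Complex x y')))\<^sup>2" for x
    define A' where "A' x = (norm (a (Complex x y) - a (Complex x y')))\<^sup>2" for x
    define B' where "B' x = (norm (b (Complex x y) - b (Complex x y')))\<^sup>2" for x
    have int: "integrable lborel A" "integrable lborel B" "integrable lborel A'" "integrable lborel B'"
      unfolding A_def B_def A'_def B'_def
      using mean_square(1)[OF a C am] mean_square(1)[OF b C bm]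
        mean_square_parallelogram(2)[OF a C am] mean_square_parallelogram(2)[OF b C bm] y by auto
    have le: "integral\<^sup>L lborel A \<le> C" "integral\<^sup>L lborel B \<le> C"
       "integral\<^sup>L lborel A' \<le> \<kappa> * e / 2" "integral\<^sup>L lborel B' \<le> \<kappa> * e / 2"
      unfolding A_def B_def A'_def B'_def
      using mean_square(3)[OF a C am, unfolded mean_square_def] mean_square(3)[OF b C bm, unfolded mean_square_def] d1 d2 y by auto
    have "(\<integral>x. norm (h (Complex x y) - h (Complex x y')) \<partial>lborel)
      \<le> (\<integral>x. \<kappa> / 2 * A x + 1 / (2 * \<kappa>) * B' x + (\<kappa> / 2 * B x + 1 / (2 * \<kappa>) * A' x) \<partial>lborel)"
    proof (rule integral_mono)
      fix x
      have "h (Complex x y) - h (Complex x y')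
        = a (Complex x y) * (b (Complex x y) - b (Complex x y')) + b (Complex x y') * (a (Complex x y) - a (Complex x y'))"
        using y by (simp add: hab algebra_simps)
      then have "norm (h (Complex x y) - h (Complex x y'))
        \<le> norm (a (Complex x y)) * norm (b (Complex x y) - b (Complex x y'))
         + norm (b (Complex x y')) * norm (a (Complex x y) - a (Complex x y'))"
        by (metis norm_triangle_ineq norm_mult)
      also have "\<dots> \<le> (\<kappa> * A x + B' x / \<kappa>) / 2 + (\<kappa> * B x + A' x / \<kappa>) / 2"
        unfolding A_def B_def A'_def B'_def by (intro add_mono amgm)
      also have "\<dots> = \<kappa> / 2 * A x + 1 / (2 * \<kappa>) * B' x + (\<kappa> / 2 * B x + 1 / (2 * \<kappa>) * A' x)"
        using \<kappa> by (simp add: field_simps)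
      finally show "norm (h (Complex x y) - h (Complex x y')) \<le> \<kappa> / 2 * A x + 1 / (2 * \<kappa>) * B' x + (\<kappa> / 2 * B x + 1 / (2 * \<kappa>) * A' x)" .
    next
      show "integrable lborel (\<lambda>x. norm (h (Complex x y) - h (Complex x y')))"
        using y by (intro integrable_norm Bochner_Integration.integrable_diff bounded_meanD(5)[OF h])
      show "integrable lborel (\<lambda>x. \<kappa> / 2 * A x + 1 / (2 * \<kappa>) * B' x + (\<kappa> / 2 * B x + 1 / (2 * \<kappa>) * A' x))"
        by (intro Bochner_Integration.integrable_add integrable_mult_right int)
    qed
    also have "\<dots> = \<kappa> / 2 * integral\<^sup>L lborel A + 1 / (2 * \<kappa>) * integral\<^sup>L lborel B'
       + (\<kappa> / 2 * integral\<^sup>L lborel B + 1 / (2 * \<kappa>) * integral\<^sup>L lborel A')"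
      using int by simp
    also have "\<dots> \<le> \<kappa> / 2 * C + 1 / (2 * \<kappa>) * (\<kappa> * e / 2) + (\<kappa> / 2 * C + 1 / (2 * \<kappa>) * (\<kappa> * e / 2))"
      using le \<kappa> by (intro add_mono mult_left_mono) auto
    also have "\<dots> = \<kappa> * C + e / 2"
      using \<kappa> by (simp add: field_simps)
    also have "\<dots> \<le> e" using \<kappa> by simp
    finally show "(\<integral>x. norm (h (Complex x y) - h (Complex x y')) \<partial>lborel) \<le> e" .
  qed
qed

section \<open>Fatou's theorem and the boundary values of functions with bounded means\<close>

lemma integrable_indicator_Icc [simp]: "integrable lborel (indicat_real {a..b::real})"
  using emeasure_bounded_finite[of "{a..b}"] by (intro integrable_real_indicator) auto

text \<open>This writes the Poisson kernel, as a function of the distance s to the centre, as a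
  positive superposition of indicator functions of the intervals [-r, r]: the density is minus its
  radial derivative.\<close>

lemma nn_integral_layer:
  assumes y: "y > 0" and s: "s \<ge> 0"
  shows "(\<integral>\<^sup>+r. ennreal (2 * y * r / (pi * (r\<^sup>2 + y\<^sup>2)\<^sup>2)) * indicator {s..} r \<partial>lborel) = ennreal (y / (pi * (s\<^sup>2 + y\<^sup>2)))"
proof -
  have pos: "r\<^sup>2 + y\<^sup>2 > 0" for r using y by (simp add: add_nonneg_pos)
  have "((\<lambda>r. - y / pi * inverse (r\<^sup>2 + y\<^sup>2)) has_real_derivative 2 * y * r / (pi * (r\<^sup>2 + y\<^sup>2)\<^sup>2)) (at r)" for r
    using pos[of r] by (auto intro!: derivative_eq_intros simp: divide_simps power2_eq_square)
  moreover have "((\<lambda>r. - y / pi * inverse (r\<^sup>2 + y\<^sup>2)) \<longlongrightarrow> - y / pi * 0) at_top"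
  proof (intro tendsto_mult tendsto_const tendsto_inverse_0_at_top)
    have "filterlim (\<lambda>r::real. r\<^sup>2) at_top at_top"
      by (intro filterlim_pow_at_top filterlim_ident) auto
    then show "filterlim (\<lambda>r. r\<^sup>2 + y\<^sup>2) at_top at_top"
      by (subst add.commute) (intro filterlim_tendsto_add_at_top[OF tendsto_const])
  qed
  ultimately have "(\<integral>\<^sup>+r. ennreal (2 * y * r / (pi * (r\<^sup>2 + y\<^sup>2)\<^sup>2)) * indicator {s..} r \<partial>lborel)
    = ennreal (- y / pi * 0 - (- y / pi * inverse (s\<^sup>2 + y\<^sup>2)))"
    using y s by (intro nn_integral_FTC_atLeast) auto
  then show ?thesis by (simp add: divide_inverse mult.assoc)
qed

text \<open>The hypothesis concerns the norm of the integral over symmetric intervals, not the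
  integral of the norm; that is what differentiation of an indefinite integral delivers. It suffices
  because the kernel is a superposition of such intervals.\<close>

lemma poisson_integral_vertical_limit:
  fixes g :: "real \<Rightarrow> complex"
  assumes g: "integrable lborel g"
    and diff: "\<And>e. e > 0 \<Longrightarrow> \<exists>d>0. \<forall>r. 0 < r \<longrightarrow> r < d \<longrightarrow>
       norm (\<integral>t. indicator {x - r..x + r} t *\<^sub>R (g t - g x) \<partial>lborel) \<le> e * r"
  shows "((\<lambda>y. \<integral>t. poisson (Complex x y) t *\<^sub>R g t \<partial>lborel) \<longlongrightarrow> g x) (at_right 0)"
proof -
  have [measurable]: "g \<in> borel_measurable borel" using g by auto
  define \<Gamma> where "\<Gamma> r = (\<integral>t. indicator {x - r..x + r} t *\<^sub>R (g t - g x) \<partial>lborel)" for r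
  define G where "G = (\<integral>t. norm (g t) \<partial>lborel)"
  have ind_int: "integrable lborel (\<lambda>t. indicator {a..b} t *\<^sub>R (c::complex))" for a b :: real and c
    by (intro integrable_scaleR_left integrable_indicator_Icc; auto)
  have ind_int_g: "integrable lborel (\<lambda>t. indicator {x - r..x + r} t *\<^sub>R (g t - g x))" for r
    unfolding scaleR_diff_right
    by (intro Bochner_Integration.integrable_diff integrable_mult_indicator g ind_int) auto
  have \<Gamma>_crude: "norm (\<Gamma> r) \<le> G + 2 * r * norm (g x)" if "r \<ge> 0" for r
  proof -
    have "norm (\<Gamma> r) \<le> (\<integral>t. norm (indicator {x - r..x + r} t *\<^sub>R (g t - g x)) \<partial>lborel)"
      unfolding \<Gamma>_def by (rule integral_norm_bound)
    also have "\<dots> \<le> (\<integral>t. norm (g t) + indicator {x - r..x + r} t * norm (g x) \<partial>lborel)"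
    proof (rule integral_mono)
      show "integrable lborel (\<lambda>t. norm (indicator {x - r..x + r} t *\<^sub>R (g t - g x)))"
        by (rule integrable_norm[OF ind_int_g])
      show "integrable lborel (\<lambda>t. norm (g t) + indicator {x - r..x + r} t * norm (g x))"
        by (intro Bochner_Integration.integrable_add integrable_norm g integrable_mult_left integrable_indicator_Icc; auto)
    qed (auto simp: indicator_def norm_triangle_ineq4)
    also have "\<dots> = (\<integral>t. norm (g t) \<partial>lborel) + (\<integral>t. indicator {x - r..x + r} t * norm (g x) \<partial>lborel)"
      by (intro Bochner_Integration.integral_add integrable_norm g integrable_mult_left integrable_indicator_Icc; auto)
    also have "\<dots> = G + 2 * r * norm (g x)"
      using that by (simp add: G_def)
    finally show ?thesis .
  qed
  have G: "G \<ge> 0" by (simp add: G_def)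
  define k where "k y r = 2 * y * r / (pi * (r\<^sup>2 + y\<^sup>2)\<^sup>2)" for y r :: real
  have [measurable]: "k y \<in> borel_measurable borel" for y unfolding k_def[abs_def] by measurable
  have P_int: "integrable lborel (\<lambda>t. poisson (Complex x y) t *\<^sub>R g t)" if "y > 0" for y
  proof (rule Bochner_Integration.integrable_bound)
    show "integrable lborel (\<lambda>t. 1 / (pi * y) * norm (g t))"
      by (intro integrable_mult_right integrable_norm g)
    show "AE t in lborel. norm (poisson (Complex x y) t *\<^sub>R g t) \<le> norm (1 / (pi * y) * norm (g t))"
    proof (rule AE_I2)
      fix t
      have "poisson (Complex x y) t * norm (g t) \<le> 1 / (pi * y) * norm (g t)"
        using poisson_le[of "Complex x y" t] that by (intro mult_right_mono) auto
      then show "norm (poisson (Complex x y) t *\<^sub>R g t) \<le> norm (1 / (pi * y) * norm (g t))"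
        using that by (simp add: abs_mult)
    qed
  qed measurable
  have Pd_int: "integrable lborel (\<lambda>t. poisson (Complex x y) t *\<^sub>R (g t - g x))" if "y > 0" for y
    unfolding scaleR_diff_right
    using that by (intro Bochner_Integration.integrable_diff P_int integrable_scaleR_left integrable_poisson) auto
  \<comment> \<open>Fubini with the layer density \<open>k y\<close> expresses the error by the
    integrals \<open>\<Gamma> r\<close> over symmetric intervals.\<close>
  have layer: "(\<integral>t. poisson (Complex x y) t *\<^sub>R g t \<partial>lborel) - g x
     = (\<integral>r. indicator {0..} r *\<^sub>R (k y r *\<^sub>R \<Gamma> r) \<partial>lborel)" if y: "y > 0" for y
  proof -
    define F where "F t r = (indicator {\<bar>t - x\<bar>..} r * k y r) *\<^sub>R (g t - g x)" for t r
    have F_meas [measurable]: "case_prod F \<in> borel_measurable (lborel \<Otimes>\<^sub>M lborel)"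
    proof -
      have "case_prod F = (\<lambda>p. (if \<bar>fst p - x\<bar> \<le> snd p then k y (snd p) else 0) *\<^sub>R (g (fst p) - g x))"
        by (auto simp: F_def fun_eq_iff indicator_def)
      also have "\<dots> \<in> borel_measurable (lborel \<Otimes>\<^sub>M lborel)" by measurable
      finally show ?thesis .
    qed
    have k_nonneg: "r \<ge> 0 \<Longrightarrow> k y r \<ge> 0" for r using y by (simp add: k_def)
    have ik_nonneg: "indicat_real {\<bar>t - x\<bar>..} r * k y r \<ge> 0" for t r
      using k_nonneg by (auto simp: indicator_def)
    have nn: "(\<integral>\<^sup>+r. ennreal (indicator {\<bar>t - x\<bar>..} r * k y r) \<partial>lborel) = ennreal (poisson (Complex x y) t)" for t
    proof -
      have "(\<integral>\<^sup>+r. ennreal (indicator {\<bar>t - x\<bar>..} r * k y r) \<partial>lborel)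
        = (\<integral>\<^sup>+r. ennreal (k y r) * indicator {\<bar>t - x\<bar>..} r \<partial>lborel)"
        by (intro nn_integral_cong) (auto simp: indicator_def)
      also have "\<dots> = ennreal (poisson (Complex x y) t)"
        unfolding k_def using y by (subst nn_integral_layer) (auto simp: poisson_def)
      finally show ?thesis .
    qed
    have inner_int: "integrable lborel (\<lambda>r. indicator {\<bar>t - x\<bar>..} r * k y r)" for t
      using ik_nonneg nn by (intro integrableI_nonneg) auto
    have inner: "(\<integral>r. indicator {\<bar>t - x\<bar>..} r * k y r \<partial>lborel) = poisson (Complex x y) t" for t
      using ik_nonneg nn[of t] y by (subst integral_eq_nn_integral) auto
    have "integrable (lborel \<Otimes>\<^sub>M lborel) (case_prod F)"
    proof (rule lborel_pair.Fubini_integrable)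
      show "AE t in lborel. integrable lborel (\<lambda>r. case_prod F (t, r))"
        unfolding F_def using inner_int by (auto intro!: integrable_scaleR_left)
      have "(\<integral>r. norm (case_prod F (t, r)) \<partial>lborel) = norm (poisson (Complex x y) t *\<^sub>R (g t - g x))" for t
      proof -
        have "norm (case_prod F (t, r)) = (indicator {\<bar>t - x\<bar>..} r * k y r) * norm (g t - g x)" for r
          by (simp only: F_def prod.case norm_scaleR abs_of_nonneg[OF ik_nonneg])
        then show ?thesis using y by (simp add: inner)
      qed
      then show "integrable lborel (\<lambda>t. \<integral>r. norm (case_prod F (t, r)) \<partial>lborel)"
        using integrable_norm[OF Pd_int[OF y]] by simp
    qed measurable
    then have "(\<integral>r. (\<integral>t. F t r \<partial>lborel) \<partial>lborel) = (\<integral>t. (\<integral>r. F t r \<partial>lborel) \<partial>lborel)"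
      by (rule lborel_pair.Fubini_integral)
    also have "\<dots> = (\<integral>t. poisson (Complex x y) t *\<^sub>R (g t - g x) \<partial>lborel)"
      by (simp add: F_def inner inner_int)
    also have "\<dots> = (\<integral>t. poisson (Complex x y) t *\<^sub>R g t \<partial>lborel) - (\<integral>t. poisson (Complex x y) t *\<^sub>R g x \<partial>lborel)"
      unfolding scaleR_diff_right using y
      by (intro Bochner_Integration.integral_diff P_int integrable_scaleR_left integrable_poisson) auto
    also have "(\<integral>t. poisson (Complex x y) t *\<^sub>R g x \<partial>lborel) = g x"
      using y by (simp add: integrable_poisson integral_poisson)
    finally have 1: "(\<integral>t. poisson (Complex x y) t *\<^sub>R g t \<partial>lborel) - g x = (\<integral>r. (\<integral>t. F t r \<partial>lborel) \<partial>lborel)" ..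
    have 2: "(\<integral>t. F t r \<partial>lborel) = indicator {0..} r *\<^sub>R (k y r *\<^sub>R \<Gamma> r)" for r
    proof -
      have "F t r = (indicator {0..} r * k y r) *\<^sub>R (indicator {x - r..x + r} t *\<^sub>R (g t - g x))" for t
        by (auto simp: F_def indicator_def)
      then have "(\<integral>t. F t r \<partial>lborel) = (\<integral>t. (indicator {0..} r * k y r) *\<^sub>R (indicator {x - r..x + r} t *\<^sub>R (g t - g x)) \<partial>lborel)"
        by (simp only:)
      also have "\<dots> = (indicator {0..} r * k y r) *\<^sub>R \<Gamma> r"
        unfolding \<Gamma>_def by (rule integral_scaleR_right)
      finally show ?thesis by simp
    qed
    show ?thesis by (simp only: 1 2)
  qed
  \<comment> \<open>For r < d the hypothesis gives a small multiple of r and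
    \<open>k y r * r\<close> has bounded integral. For r >= d the crude estimate gives
    \<open>\<Gamma> r\<close> = O(r), with a constant depending on d, and there
    \<open>k y r * r\<close> is O(y) times an integrable function.\<close>
  have bound: "norm ((\<integral>t. poisson (Complex x y) t *\<^sub>R g t \<partial>lborel) - g x) \<le> 2 * e + 2 * y * (G / d + 2 * norm (g x)) * (1 + 1 / d\<^sup>2)"
    if d: "d > 0" "e > 0" and le: "\<And>r. 0 < r \<Longrightarrow> r < d \<Longrightarrow> norm (\<Gamma> r) \<le> e * r" and y: "y > 0" for d e y
  proof -
    define K where "K = G / d + 2 * norm (g x)"
    have K: "K \<ge> 0" using G d by (simp add: K_def)
    have kr: "k y r * r \<le> 2 * poisson (Complex 0 y) r" for r
    proof -
      have "k y r * r = 2 * y * r\<^sup>2 / (pi * (r\<^sup>2 + y\<^sup>2)\<^sup>2)" by (simp add: k_def power2_eq_square)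
      also have "\<dots> \<le> 2 * y * (r\<^sup>2 + y\<^sup>2) / (pi * (r\<^sup>2 + y\<^sup>2)\<^sup>2)"
        using y by (intro divide_right_mono mult_left_mono) auto
      also have "\<dots> = 2 * poisson (Complex 0 y) r"
        using y by (simp add: poisson_def power2_eq_square add_nonneg_eq_0_iff)
      finally show ?thesis .
    qed
    have kr2: "k y r * r \<le> 2 * y * (1 + 1 / d\<^sup>2) * poisson \<i> r" if "r \<ge> d" for r
    proof -
      have r: "r > 0" using that d by simp
      have "k y r * r \<le> 2 * poisson (Complex 0 y) r" by (rule kr)
      also have "\<dots> \<le> 2 * y / (pi * r\<^sup>2)"
        unfolding poisson_def using y r by (auto intro!: divide_left_mono mult_pos_pos simp: add_pos_nonneg)
      also have "1 / r\<^sup>2 \<le> (1 + 1 / d\<^sup>2) / (r\<^sup>2 + 1)"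
      proof -
        have "1 * d\<^sup>2 \<le> r\<^sup>2" using that d by (simp add: power_mono)
        then have "1 \<le> r\<^sup>2 / d\<^sup>2" using d by (simp add: field_simps)
        then have "r\<^sup>2 + 1 \<le> (1 + 1 / d\<^sup>2) * r\<^sup>2" by (simp add: algebra_simps)
        then show ?thesis using r by (simp add: field_simps add_nonneg_pos)
      qed
      then have "2 * y / (pi * r\<^sup>2) \<le> 2 * y / pi * ((1 + 1 / d\<^sup>2) / (r\<^sup>2 + 1))"
        using y mult_left_mono[of "1 / r\<^sup>2" "(1 + 1 / d\<^sup>2) / (r\<^sup>2 + 1)" "2 * y / pi"] by simp
      also have "\<dots> = 2 * y * (1 + 1 / d\<^sup>2) * poisson \<i> r"
        by (simp add: poisson_def)
      finally show ?thesis by simp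
    qed
    have pointwise: "norm (indicator {0..} r *\<^sub>R (k y r *\<^sub>R \<Gamma> r)) \<le> 2 * e * poisson (Complex 0 y) r + 2 * y * K * (1 + 1 / d\<^sup>2) * poisson \<i> r" for r
    proof -
      have nn: "2 * e * poisson (Complex 0 y) r \<ge> 0" "2 * y * K * (1 + 1 / d\<^sup>2) * poisson \<i> r \<ge> 0"
        using y d K by (auto intro!: mult_nonneg_nonneg add_nonneg_nonneg)
      have kp: "k y r \<ge> 0" if "r > 0" using that y by (simp add: k_def)
      consider "r \<le> 0" | "0 < r" "r < d" | "d \<le> r" "r > 0" using d by linarith
      then show ?thesis
      proof cases
        case 1
        then have "norm (indicator {0..} r *\<^sub>R (k y r *\<^sub>R \<Gamma> r)) = 0"
          by (auto simp: indicator_def k_def)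
        then show ?thesis using nn by linarith
      next
        case 2
        then have "norm (indicator {0..} r *\<^sub>R (k y r *\<^sub>R \<Gamma> r)) \<le> k y r * (e * r)"
          using kp le[of r] by (simp add: abs_mult mult_left_mono)
        also have "\<dots> = e * (k y r * r)" by simp
        also have "\<dots> \<le> e * (2 * poisson (Complex 0 y) r)" using d kr by (intro mult_left_mono) auto
        also have "\<dots> = 2 * e * poisson (Complex 0 y) r" by simp
        finally show ?thesis using nn by linarith
      next
        case 3
        have "norm (\<Gamma> r) \<le> G + 2 * r * norm (g x)" using 3 by (intro \<Gamma>_crude) auto
        also have "G \<le> G / d * r"
          using mult_left_mono[of 1 "r / d" G] 3 d G by simp
        finally have "norm (\<Gamma> r) \<le> K * r" by (simp add: K_def algebra_simps)
        then have "norm (indicator {0..} r *\<^sub>R (k y r *\<^sub>R \<Gamma> r)) \<le> k y r * (K * r)"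
          using kp 3 by (simp add: abs_mult mult_left_mono)
        also have "\<dots> = K * (k y r * r)" by simp
        also have "\<dots> \<le> K * (2 * y * (1 + 1 / d\<^sup>2) * poisson \<i> r)" using K kr2 3 by (intro mult_left_mono) auto
        also have "\<dots> = 2 * y * K * (1 + 1 / d\<^sup>2) * poisson \<i> r" by simp
        finally show ?thesis using nn by linarith
      qed
    qed
    have int: "integrable lborel (\<lambda>r. 2 * e * poisson (Complex 0 y) r + 2 * y * K * (1 + 1 / d\<^sup>2) * poisson \<i> r)"
      using y by (intro Bochner_Integration.integrable_add integrable_mult_right integrable_poisson) auto
    have "norm ((\<integral>t. poisson (Complex x y) t *\<^sub>R g t \<partial>lborel) - g x)
      \<le> (\<integral>r. 2 * e * poisson (Complex 0 y) r + 2 * y * K * (1 + 1 / d\<^sup>2) * poisson \<i> r \<partial>lborel)"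
    proof (cases "integrable lborel (\<lambda>r. indicator {0..} r *\<^sub>R (k y r *\<^sub>R \<Gamma> r))")
      case True
      have "norm (\<integral>r. indicator {0..} r *\<^sub>R (k y r *\<^sub>R \<Gamma> r) \<partial>lborel)
        \<le> (\<integral>r. norm (indicator {0..} r *\<^sub>R (k y r *\<^sub>R \<Gamma> r)) \<partial>lborel)"
        by (rule integral_norm_bound)
      also have "\<dots> \<le> (\<integral>r. 2 * e * poisson (Complex 0 y) r + 2 * y * K * (1 + 1 / d\<^sup>2) * poisson \<i> r \<partial>lborel)"
        by (intro integral_mono integrable_norm True int pointwise)
      finally show ?thesis unfolding layer[OF y] .
    next
      case False
      \<comment> \<open>A non-integrable function has integral 0 by convention, and then the layer
        identity makes the error 0.\<close>
      have "0 \<le> (\<integral>r. 2 * e * poisson (Complex 0 y) r + 2 * y * K * (1 + 1 / d\<^sup>2) * poisson \<i> r \<partial>lborel)"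
        by (intro integral_nonneg_AE AE_I2 order_trans[OF norm_ge_zero pointwise])
      then show ?thesis unfolding layer[OF y] using False by (simp add: not_integrable_integral_eq)
    qed
    also have "\<dots> = 2 * e + 2 * y * K * (1 + 1 / d\<^sup>2)"
      using y by (subst Bochner_Integration.integral_add) (auto intro!: integrable_mult_right integrable_poisson simp: integral_poisson)
    finally show ?thesis by (simp add: K_def)
  qed
  show ?thesis
    unfolding tendsto_iff
  proof (intro allI impI)
    fix \<epsilon> :: real assume \<epsilon>: "\<epsilon> > 0"
    then obtain d where d: "d > 0" "\<And>r. 0 < r \<Longrightarrow> r < d \<Longrightarrow> norm (\<Gamma> r) \<le> \<epsilon> / 4 * r"
      using diff[of "\<epsilon> / 4"] unfolding \<Gamma>_def by auto
    have "((\<lambda>y. 2 * y * (G / d + 2 * norm (g x)) * (1 + 1 / d\<^sup>2)) \<longlongrightarrow> 2 * 0 * (G / d + 2 * norm (g x)) * (1 + 1 / d\<^sup>2)) (at_right 0)"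
      by (intro tendsto_intros)
    then have "eventually (\<lambda>y. 2 * y * (G / d + 2 * norm (g x)) * (1 + 1 / d\<^sup>2) < \<epsilon> / 2) (at_right 0)"
      using \<epsilon> by (intro order_tendstoD(2)[where y=0]) auto
    then show "eventually (\<lambda>y. dist (\<integral>t. poisson (Complex x y) t *\<^sub>R g t \<partial>lborel) (g x) < \<epsilon>) (at_right 0)"
      using eventually_at_right_less[of "0::real"]
    proof eventually_elim
      case (elim y)
      then show ?case using bound[OF d(1) _ d(2), of y] \<epsilon> by (simp add: dist_norm)
    qed
  qed
qed

lemma AE_uminus:
  assumes "AE x in lborel. P (x::real)"
  shows "AE x in lborel. P (- x)"
proof -
  have "AE x in distr lborel borel uminus. P x"
    unfolding lborel_distr_uminus by (rule assms)
  then obtain N where N: "N \<in> null_sets (distr lborel borel (uminus :: real \<Rightarrow> real))" "{x. \<not> P x} \<subseteq> N"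
    by (auto simp: eventually_ae_filter)
  have "uminus -` N \<in> null_sets lborel"
    using N(1) by (simp add: null_sets_distr_iff)
  moreover have "{x. \<not> P (- x)} \<subseteq> uminus -` N" using N(2) by auto
  ultimately show ?thesis by (auto simp: eventually_ae_filter)
qed

text \<open>Lebesgue differentiation for gauge integrals over boxes whose lower corner is the point,
  hence one-sided; the negligible set belongs to the completed measure and is transferred to
  \<open>lborel\<close>.\<close>

lemma AE_right_derivative_of_integral:
  fixes g :: "real \<Rightarrow> complex"
  assumes g: "integrable lborel g"
  shows "AE x in lborel. \<forall>e>0. \<exists>d>0. \<forall>r. 0 < r \<longrightarrow> r < d \<longrightarrow>
     norm (\<integral>t. indicator {x..x + r} t *\<^sub>R (g t - g x) \<partial>lborel) \<le> e * r"
proof -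
  have si: "set_integrable lborel {a..b} g" for a b
    unfolding set_integrable_def using g by (intro integrable_mult_indicator) auto
  have HK: "g integrable_on cbox a b" "integral (cbox a b) g = (\<integral>t. indicator {a..b} t *\<^sub>R g t \<partial>lborel)" for a b
    using set_borel_integral_eq_integral[OF si[of a b]] by (simp_all add: set_lebesgue_integral_def)
  obtain N where N: "negligible N" "\<And>x e. \<lbrakk>x \<notin> N; 0 < e\<rbrakk> \<Longrightarrow> \<exists>d>0. \<forall>h. 0 < h \<and> h < d \<longrightarrow>
      norm (integral (cbox x (x + h *\<^sub>R One)) g /\<^sub>R h ^ DIM(real) - g x) < e"
    using integrable_ccontinuous_explicit[of g] HK(1) by blast
  have "AE x in lebesgue. x \<notin> N"
    using N(1) by (simp add: negligible_iff_null_sets AE_not_in)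
  then have "AE x in lborel. x \<notin> N"
    by (simp add: AE_completion_iff)
  then show ?thesis
  proof eventually_elim
    case (elim x)
    show ?case
    proof (intro allI impI)
      fix e :: real assume "e > 0"
      then obtain d where d: "d > 0" "\<And>h. 0 < h \<Longrightarrow> h < d \<Longrightarrow>
         norm (integral (cbox x (x + h *\<^sub>R One)) g /\<^sub>R h ^ DIM(real) - g x) < e"
        using N(2)[OF elim] by blast
      have "norm (\<integral>t. indicator {x..x + r} t *\<^sub>R (g t - g x) \<partial>lborel) \<le> e * r" if r: "0 < r" "r < d" for r
      proof -
        have "(\<integral>t. indicator {x..x + r} t *\<^sub>R (g t - g x) \<partial>lborel)
          = (\<integral>t. indicator {x..x + r} t *\<^sub>R g t \<partial>lborel) - (\<integral>t. indicator {x..x + r} t *\<^sub>R g x \<partial>lborel)"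
          unfolding scaleR_diff_right
          by (intro Bochner_Integration.integral_diff g integrable_scaleR_left[OF integrable_indicator_Icc] integrable_mult_indicator[OF _ g]; auto)
        also have "(\<integral>t. indicator {x..x + r} t *\<^sub>R g x \<partial>lborel) = r *\<^sub>R g x"
          using r by simp
        also have "(\<integral>t. indicator {x..x + r} t *\<^sub>R g t \<partial>lborel) - r *\<^sub>R g x
          = r *\<^sub>R ((\<integral>t. indicator {x..x + r} t *\<^sub>R g t \<partial>lborel) /\<^sub>R r - g x)"
          using r by (simp add: scaleR_diff_right)
        finally have "norm (\<integral>t. indicator {x..x + r} t *\<^sub>R (g t - g x) \<partial>lborel)
          = r * norm ((\<integral>t. indicator {x..x + r} t *\<^sub>R g t \<partial>lborel) /\<^sub>R r - g x)"
          using r by simp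
        also have "norm ((\<integral>t. indicator {x..x + r} t *\<^sub>R g t \<partial>lborel) /\<^sub>R r - g x) \<le> e"
          using d(2)[OF r] HK(2)[of x "x + r"] by simp
        finally show ?thesis using r by (simp add: mult.commute)
      qed
      with d(1) show "\<exists>d>0. \<forall>r. 0 < r \<longrightarrow> r < d \<longrightarrow>
        norm (\<integral>t. indicator {x..x + r} t *\<^sub>R (g t - g x) \<partial>lborel) \<le> e * r" by blast
    qed
  qed
qed

text \<open>The left half of the interval is the right half for the reflected function at the
  reflected point.\<close>

lemma AE_symmetric_derivative_of_integral:
  fixes g :: "real \<Rightarrow> complex"
  assumes g: "integrable lborel g"
  shows "AE x in lborel. \<forall>e>0. \<exists>d>0. \<forall>r. 0 < r \<longrightarrow> r < d \<longrightarrow>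
     norm (\<integral>t. indicator {x - r..x + r} t *\<^sub>R (g t - g x) \<partial>lborel) \<le> e * r"
proof -
  have [measurable]: "g \<in> borel_measurable borel" using g by auto
  have g': "integrable lborel (\<lambda>t. g (- t))"
    using lborel_integrable_real_affine[OF g, of "-1" 0] by simp
  from AE_right_derivative_of_integral[OF g] AE_uminus[OF AE_right_derivative_of_integral[OF g']]
  show ?thesis
  proof eventually_elim
    case (elim x)
    show ?case
    proof (intro allI impI)
      fix e :: real assume "e > 0"
      then have e: "e / 2 > 0" by simp
      obtain d1 where d1: "d1 > 0" "\<And>r. 0 < r \<Longrightarrow> r < d1 \<Longrightarrow>
        norm (\<integral>t. indicator {x..x + r} t *\<^sub>R (g t - g x) \<partial>lborel) \<le> e / 2 * r"
        using elim(1) e by blast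
      obtain d2 where d2: "d2 > 0" "\<And>r. 0 < r \<Longrightarrow> r < d2 \<Longrightarrow>
        norm (\<integral>t. indicator {-x..-x + r} t *\<^sub>R (g (- t) - g (- (- x))) \<partial>lborel) \<le> e / 2 * r"
        using elim(2) e by blast
      have "norm (\<integral>t. indicator {x - r..x + r} t *\<^sub>R (g t - g x) \<partial>lborel) \<le> e * r" if r: "0 < r" "r < min d1 d2" for r
      proof -
        have int: "integrable lborel (\<lambda>t. indicator {a..b} t *\<^sub>R (g t - g x))" for a b
          unfolding scaleR_diff_right
          by (intro Bochner_Integration.integrable_diff g integrable_scaleR_left[OF integrable_indicator_Icc] integrable_mult_indicator[OF _ g]; auto)
        have "AE t in lborel. indicator {x - r..x + r} t *\<^sub>R (g t - g x)
          = indicator {x - r..x} t *\<^sub>R (g t - g x) + indicator {x..x + r} t *\<^sub>R (g t - g x)"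
          using AE_lborel_singleton[of x] by eventually_elim (use r in \<open>auto simp: indicator_def\<close>)
        then have "(\<integral>t. indicator {x - r..x + r} t *\<^sub>R (g t - g x) \<partial>lborel)
          = (\<integral>t. indicator {x - r..x} t *\<^sub>R (g t - g x) + indicator {x..x + r} t *\<^sub>R (g t - g x) \<partial>lborel)"
          by (intro integral_cong_AE) auto
        also have "\<dots> = (\<integral>t. indicator {x - r..x} t *\<^sub>R (g t - g x) \<partial>lborel) + (\<integral>t. indicator {x..x + r} t *\<^sub>R (g t - g x) \<partial>lborel)"
          by (intro Bochner_Integration.integral_add int)
        also have "(\<integral>t. indicator {x - r..x} t *\<^sub>R (g t - g x) \<partial>lborel)
          = (\<integral>t. indicator {-x..-x + r} t *\<^sub>R (g (- t) - g (- (- x))) \<partial>lborel)"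
          by (subst lborel_integral_real_affine[of "-1" _ 0]) (auto intro!: Bochner_Integration.integral_cong simp: indicator_def)
        finally show ?thesis
          using norm_triangle_ineq[of "\<integral>t. indicator {-x..-x + r} t *\<^sub>R (g (- t) - g (- (- x))) \<partial>lborel"
            "\<integral>t. indicator {x..x + r} t *\<^sub>R (g t - g x) \<partial>lborel"] d1(2)[of r] d2(2)[of r] r by simp
      qed
      with d1(1) d2(1) show "\<exists>d>0. \<forall>r. 0 < r \<longrightarrow> r < d \<longrightarrow>
        norm (\<integral>t. indicator {x - r..x + r} t *\<^sub>R (g t - g x) \<partial>lborel) \<le> e * r"
        by (intro exI[of _ "min d1 d2"]) auto
    qed
  qed
qed

text \<open>Completeness of \<open>L1\<close> by hand: a subsequence of heights converges almost
  everywhere, and Fatou's lemma transfers the Cauchy estimate to its limit, which gives convergence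
  along all heights.\<close>

lemma bounded_mean_L1_boundary:
  assumes h: "bounded_mean C h"
  obtains g where "integrable lborel g"
    "\<And>e. e > 0 \<Longrightarrow> \<exists>d>0. \<forall>y. 0 < y \<longrightarrow> y < d \<longrightarrow> (\<integral>x. norm (h (Complex x y) - g x) \<partial>lborel) \<le> e"
proof -
  note hD = bounded_meanD[OF h]
  define \<epsilon> where "\<epsilon> n = 1 / real (Suc n)" for n
  have \<epsilon>: "\<epsilon> n > 0" for n by (auto simp: \<epsilon>_def)
  have \<epsilon>0: "\<epsilon> \<longlonglongrightarrow> 0" unfolding \<epsilon>_def by (rule LIMSEQ_Suc[OF lim_1_over_n])
  define s where "s n x = h (Complex x (\<epsilon> n))" for n x
  have s_int: "integrable lborel (s n)" for n
    unfolding s_def by (rule hD(5)[OF \<epsilon>])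
  have small: "eventually (\<lambda>n. \<epsilon> n < d) sequentially" if "d > 0" for d
    using order_tendstoD(2)[OF \<epsilon>0 that] .
  have "\<exists>N. \<forall>i\<ge>N. \<forall>j\<ge>N. (\<integral>x. norm (s i x - s j x) \<partial>lborel) < e" if "e > 0" for e
  proof -
    obtain d where d: "d > 0" "\<And>y y'. 0 < y \<Longrightarrow> y < d \<Longrightarrow> 0 < y' \<Longrightarrow> y' < d \<Longrightarrow>
      (\<integral>x. norm (h (Complex x y) - h (Complex x y')) \<partial>lborel) \<le> e / 2"
      using bounded_mean_Cauchy[OF h half_gt_zero[OF \<open>e > 0\<close>]] by blast
    obtain N where "\<And>n. n \<ge> N \<Longrightarrow> \<epsilon> n < d"
      using small[OF d(1)] by (auto simp: eventually_sequentially)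
    then have "(\<integral>x. norm (s i x - s j x) \<partial>lborel) \<le> e / 2" if "i \<ge> N" "j \<ge> N" for i j
      unfolding s_def using d(2)[of "\<epsilon> i" "\<epsilon> j"] \<epsilon> that by simp
    moreover have "e / 2 < e" using that by simp
    ultimately show ?thesis by (meson order_le_less_trans)
  qed
  from cauchy_L1_AE_cauchy_subseq[OF s_int this]
  obtain r where r: "strict_mono r" "AE x in lborel. Cauchy (\<lambda>i. s (r i) x)" by blast
  define g where "g x = lim (\<lambda>i. s (r i) x)" for x
  have [measurable]: "s n \<in> borel_measurable borel" for n using s_int[of n] by auto
  have [measurable]: "g \<in> borel_measurable borel"
    unfolding g_def[abs_def] by measurable
  have lim: "AE x in lborel. (\<lambda>i. s (r i) x) \<longlonglongrightarrow> g x"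
    using r(2) by eventually_elim (auto simp: g_def Cauchy_convergent_iff convergent_LIMSEQ_iff)
  have key: "(\<integral>\<^sup>+x. ennreal (norm (h (Complex x y) - g x)) \<partial>lborel) \<le> ennreal e"
    if d: "d > 0" "\<And>y y'. 0 < y \<Longrightarrow> y < d \<Longrightarrow> 0 < y' \<Longrightarrow> y' < d \<Longrightarrow>
      (\<integral>x. norm (h (Complex x y) - h (Complex x y')) \<partial>lborel) \<le> e" and y: "0 < y" "y < d" for d e y
  proof -
    have [measurable]: "(\<lambda>x. h (Complex x y)) \<in> borel_measurable borel"
      using hD(5)[OF y(1)] by auto
    have "AE x in lborel. liminf (\<lambda>i. ennreal (norm (h (Complex x y) - s (r i) x))) = ennreal (norm (h (Complex x y) - g x))"
      using lim
    proof eventually_elim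
      case (elim x)
      have "(\<lambda>i. ennreal (norm (h (Complex x y) - s (r i) x))) \<longlonglongrightarrow> ennreal (norm (h (Complex x y) - g x))"
        by (intro tendsto_intros elim)
      then show ?case by (intro lim_imp_Liminf) auto
    qed
    then have "(\<integral>\<^sup>+x. ennreal (norm (h (Complex x y) - g x)) \<partial>lborel)
      = (\<integral>\<^sup>+x. liminf (\<lambda>i. ennreal (norm (h (Complex x y) - s (r i) x))) \<partial>lborel)"
      by (intro nn_integral_cong_AE) (auto elim: eventually_mono)
    also have "\<dots> \<le> liminf (\<lambda>i. \<integral>\<^sup>+x. ennreal (norm (h (Complex x y) - s (r i) x)) \<partial>lborel)"
      by (rule nn_integral_liminf) measurable
    also have "\<dots> \<le> liminf (\<lambda>i. ennreal e)"
    proof (rule Liminf_mono)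
      have "eventually (\<lambda>i. \<epsilon> (r i) < d) sequentially"
        using small[OF d(1)] r(1) by (rule eventually_subseq[rotated])
      then show "eventually (\<lambda>i. (\<integral>\<^sup>+x. ennreal (norm (h (Complex x y) - s (r i) x)) \<partial>lborel) \<le> ennreal e) sequentially"
      proof eventually_elim
        case (elim i)
        have "(\<integral>\<^sup>+x. ennreal (norm (h (Complex x y) - s (r i) x)) \<partial>lborel)
          = ennreal (\<integral>x. norm (h (Complex x y) - s (r i) x) \<partial>lborel)"
          by (intro nn_integral_eq_integral integrable_norm Bochner_Integration.integrable_diff hD(5) y s_int) auto
        also have "\<dots> \<le> ennreal e"
          unfolding s_def using d(2)[OF y \<epsilon> elim] by (intro ennreal_leI)
        finally show ?case .
      qed
    qed
    finally show ?thesis by (simp add: Liminf_const)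
  qed
  have diff_int: "integrable lborel (\<lambda>x. h (Complex x y) - g x)"
    if d: "d > 0" "\<And>y y'. 0 < y \<Longrightarrow> y < d \<Longrightarrow> 0 < y' \<Longrightarrow> y' < d \<Longrightarrow>
      (\<integral>x. norm (h (Complex x y) - h (Complex x y')) \<partial>lborel) \<le> e" and y: "0 < y" "y < d" for d e y
  proof -
    have [measurable]: "(\<lambda>x. h (Complex x y)) \<in> borel_measurable borel"
      using hD(5)[OF y(1)] by auto
    show ?thesis
      unfolding integrable_iff_bounded using key[OF that] by (auto simp: order_le_less_trans)
  qed
  show ?thesis
  proof (rule that)
    obtain d where d: "d > 0" "\<And>y y'. 0 < y \<Longrightarrow> y < d \<Longrightarrow> 0 < y' \<Longrightarrow> y' < d \<Longrightarrow>
      (\<integral>x. norm (h (Complex x y) - h (Complex x y')) \<partial>lborel) \<le> 1"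
      using bounded_mean_Cauchy[OF h, of 1] by auto
    have y: "0 < d / 2" "d / 2 < d" using d(1) by auto
    have "integrable lborel (\<lambda>x. h (Complex x (d / 2)) - (h (Complex x (d / 2)) - g x))"
      by (intro Bochner_Integration.integrable_diff diff_int[OF d y] hD(5)[OF y(1)])
    then show "integrable lborel g" by simp
    fix e :: real assume e: "e > 0"
    obtain d where d: "d > 0" "\<And>y y'. 0 < y \<Longrightarrow> y < d \<Longrightarrow> 0 < y' \<Longrightarrow> y' < d \<Longrightarrow>
      (\<integral>x. norm (h (Complex x y) - h (Complex x y')) \<partial>lborel) \<le> e"
      using bounded_mean_Cauchy[OF h e] by auto
    have "(\<integral>x. norm (h (Complex x y) - g x) \<partial>lborel) \<le> e" if y: "0 < y" "y < d" for y
      using key[OF d y] diff_int[OF d y] e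
      by (simp add: nn_integral_eq_integral)
    with d(1) show "\<exists>d>0. \<forall>y. 0 < y \<longrightarrow> y < d \<longrightarrow> (\<integral>x. norm (h (Complex x y) - g x) \<partial>lborel) \<le> e" by blast
  qed
qed

text \<open>A shift upwards makes h bounded and holomorphic across the axis, so reproduction
  applies. The shift can be removed because the kernel at z is bounded and the boundary data
  converge in \<open>L1\<close>.\<close>

lemma bounded_mean_poisson_boundary:
  assumes h: "bounded_mean C h" and g: "integrable lborel g"
    and lim: "\<And>e. e > 0 \<Longrightarrow> \<exists>d>0. \<forall>y. 0 < y \<longrightarrow> y < d \<longrightarrow> (\<integral>x. norm (h (Complex x y) - g x) \<partial>lborel) \<le> e"
    and z: "Im z > 0"
  shows "h z = (\<integral>t. poisson z t *\<^sub>R g t \<partial>lborel)"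
proof -
  note hD = bounded_meanD[OF h]
  have [measurable]: "g \<in> borel_measurable borel" using g by auto
  have int_P: "integrable lborel (\<lambda>t. poisson z t *\<^sub>R f t)" if f: "integrable lborel f" for f :: "real \<Rightarrow> complex"
  proof (rule Bochner_Integration.integrable_bound)
    have [measurable]: "f \<in> borel_measurable borel" using f by auto
    show "(\<lambda>t. poisson z t *\<^sub>R f t) \<in> borel_measurable lborel" by measurable
    show "integrable lborel (\<lambda>t. 1 / (pi * Im z) * norm (f t))"
      by (intro integrable_mult_right integrable_norm f)
    show "AE t in lborel. norm (poisson z t *\<^sub>R f t) \<le> norm (1 / (pi * Im z) * norm (f t))"
    proof (rule AE_I2)
      fix t
      have "poisson z t * norm (f t) \<le> 1 / (pi * Im z) * norm (f t)"
        using poisson_le[OF z] by (intro mult_right_mono) auto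
      then show "norm (poisson z t *\<^sub>R f t) \<le> norm (1 / (pi * Im z) * norm (f t))"
        using z by (simp add: abs_mult)
    qed
  qed
  have repr: "h (z + \<i> * of_real \<epsilon>) = (\<integral>t. poisson z t *\<^sub>R h (Complex t \<epsilon>) \<partial>lborel)" if \<epsilon>: "\<epsilon> > 0" for \<epsilon>
  proof -
    define H where "H w = h (w + \<i> * of_real \<epsilon>)" for w
    have "(\<integral>t. poisson z t *\<^sub>R H (complex_of_real t) \<partial>lborel) = H z"
    proof (rule poisson_reproduction(1))
      show "H holomorphic_on {w. - (\<epsilon> / 2) < Im w}"
        unfolding H_def using \<epsilon> by (intro holomorphic_on_compose_gen[OF _ hD(2), unfolded o_def]) (auto intro!: holomorphic_intros)
      show "norm (H w) \<le> 3 * C / (\<epsilon> / 2)" if "- (\<epsilon> / 2) < Im w" for w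
      proof -
        have "norm (H w) \<le> 3 * C / (Im w + \<epsilon>)"
          unfolding H_def using bounded_mean_pointwise[OF h, of "w + \<i> * of_real \<epsilon>"] that \<epsilon> by simp
        also have "\<dots> \<le> 3 * C / (\<epsilon> / 2)"
          using that hD(1) \<epsilon> by (intro divide_left_mono mult_pos_pos) auto
        finally show ?thesis .
      qed
    qed (use \<epsilon> z in auto)
    moreover have "complex_of_real t + \<i> * of_real \<epsilon> = Complex t \<epsilon>" for t
      by (simp add: complex_eq_iff)
    ultimately show ?thesis by (simp add: H_def)
  qed
  have "((\<lambda>\<epsilon>. h (z + \<i> * of_real \<epsilon>)) \<longlongrightarrow> (\<integral>t. poisson z t *\<^sub>R g t \<partial>lborel)) (at_right 0)"
    unfolding tendsto_iff
  proof (intro allI impI)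
    fix e :: real assume e: "e > 0"
    define e' where "e' = e * (pi * Im z) / 2"
    have e': "e' > 0" using e z by (simp add: e'_def)
    obtain d where d: "d > 0" "\<And>y. 0 < y \<Longrightarrow> y < d \<Longrightarrow> (\<integral>x. norm (h (Complex x y) - g x) \<partial>lborel) \<le> e'"
      using lim[OF e'] by blast
    have "dist (h (z + \<i> * of_real y)) (\<integral>t. poisson z t *\<^sub>R g t \<partial>lborel) < e" if y: "0 < y" "y < d" for y
    proof -
      have hy: "integrable lborel (\<lambda>t. h (Complex t y))" by (rule hD(5)[OF y(1)])
      have "h (z + \<i> * of_real y) - (\<integral>t. poisson z t *\<^sub>R g t \<partial>lborel)
        = (\<integral>t. poisson z t *\<^sub>R (h (Complex t y) - g t) \<partial>lborel)"
        unfolding repr[OF y(1)] scaleR_diff_right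
        by (intro Bochner_Integration.integral_diff[symmetric] int_P hy g)
      then have "norm (h (z + \<i> * of_real y) - (\<integral>t. poisson z t *\<^sub>R g t \<partial>lborel))
        \<le> (\<integral>t. norm (poisson z t *\<^sub>R (h (Complex t y) - g t)) \<partial>lborel)"
        by (simp only: integral_norm_bound)
      also have "\<dots> \<le> (\<integral>t. 1 / (pi * Im z) * norm (h (Complex t y) - g t) \<partial>lborel)"
      proof (intro integral_mono integrable_norm int_P integrable_mult_right Bochner_Integration.integrable_diff hy g)
        fix t
        have "poisson z t * norm (h (Complex t y) - g t) \<le> 1 / (pi * Im z) * norm (h (Complex t y) - g t)"
          using poisson_le[OF z] by (intro mult_right_mono) auto
        then show "norm (poisson z t *\<^sub>R (h (Complex t y) - g t)) \<le> 1 / (pi * Im z) * norm (h (Complex t y) - g t)"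
          using z by simp
      qed
      also have "\<dots> = 1 / (pi * Im z) * (\<integral>t. norm (h (Complex t y) - g t) \<partial>lborel)"
        by (rule integral_mult_right_zero)
      also have "\<dots> \<le> 1 / (pi * Im z) * e'"
        using d(2)[OF y] z by (intro mult_left_mono) auto
      also have "\<dots> < e" using z e by (simp add: e'_def)
      finally show ?thesis by (simp add: dist_norm)
    qed
    then show "eventually (\<lambda>y. dist (h (z + \<i> * of_real y)) (\<integral>t. poisson z t *\<^sub>R g t \<partial>lborel) < e) (at_right 0)"
      using d(1) by (auto simp: eventually_at_right_field)
  qed
  moreover have "((\<lambda>\<epsilon>. h (z + \<i> * of_real \<epsilon>)) \<longlongrightarrow> h z) (at_right 0)"
  proof (rule isCont_tendsto_compose[of z h])
    show "isCont h z"
      using hD(3) upper_half_plane(1) z by (simp add: continuous_on_eq_continuous_at)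
    have "((\<lambda>\<epsilon>. z + \<i> * of_real \<epsilon>) \<longlongrightarrow> z + \<i> * of_real 0) (at_right 0)"
      by (intro tendsto_intros)
    then show "((\<lambda>\<epsilon>. z + \<i> * of_real \<epsilon>) \<longlongrightarrow> z) (at_right 0)" by simp
  qed
  ultimately show ?thesis
    by (metis tendsto_unique trivial_limit_at_right_real)
qed

text \<open>\<open>boundary_value\<close> takes arbitrary values on a null set and need not be Borel
  measurable; completeness of the measure repairs this.\<close>

lemma measurable_lebesgue_AE:
  fixes f g :: "real \<Rightarrow> complex"
  assumes [measurable]: "g \<in> borel_measurable borel" and ae: "AE x in lborel. f x = g x"
  shows "f \<in> borel_measurable lebesgue"
proof (rule measurableI)
  fix T :: "complex set" assume T [measurable]: "T \<in> sets borel"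
  define N where "N = {x. f x \<noteq> g x}"
  have N: "N \<in> null_sets lebesgue"
    using AE_completion[OF ae] by (simp add: N_def completion.AE_iff_null_sets)
  have "f -` T \<inter> N \<in> sets lebesgue"
    using completion.complete2[OF _ N, of "f -` T \<inter> N"] by (auto simp: null_sets_def)
  moreover have "g -` T - N \<in> sets lebesgue"
  proof (intro sets.Diff)
    show "g -` T \<in> sets lebesgue" using measurable_sets[OF assms(1) T] by simp
    show "N \<in> sets lebesgue" using N by auto
  qed
  ultimately have "(f -` T \<inter> N) \<union> (g -` T - N) \<in> sets lebesgue" by (rule sets.Un)
  also have "(f -` T \<inter> N) \<union> (g -` T - N) = f -` T \<inter> space lebesgue" by (auto simp: N_def)
  finally show "f -` T \<inter> space lebesgue \<in> sets lebesgue" .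
qed auto

text \<open>Vertical limits identify the boundary value with g almost everywhere, \<open>L1\<close>
  convergence makes the integral over the axis the limit of those at heights v tending to 0, and the
  shift of the line makes the latter independent of v. For either sign of s the exponential is at
  most exp (|s| y) in the strip.\<close>

theorem inverse_fourier_line:
  assumes h: "bounded_mean C h" and y: "y > 0"
  shows "inverse_fourier h s = of_real (1 / sqrt (2 * pi)) *
    (\<integral>x. h (Complex x y) * exp (- \<i> * of_real s * Complex x y) \<partial>lborel)"
proof -
  note hD = bounded_meanD[OF h]
  obtain g where g: "integrable lborel g"
    and lim: "\<And>e. e > 0 \<Longrightarrow> \<exists>d>0. \<forall>y. 0 < y \<longrightarrow> y < d \<longrightarrow> (\<integral>x. norm (h (Complex x y) - g x) \<partial>lborel) \<le> e"
    using bounded_mean_L1_boundary[OF h] by metis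
  have [measurable]: "g \<in> borel_measurable borel" using g by auto
  define E where "E z = exp (- \<i> * of_real s * z)" for z
  have E_norm: "norm (E (Complex x y)) = exp (s * y)" for x y
    by (simp add: E_def)
  have E_meas [measurable]: "(\<lambda>x. E (Complex x y)) \<in> borel_measurable borel" for y
    unfolding E_def by (intro borel_measurable_continuous_onI continuous_intros)
  have E0: "E (Complex x 0) = exp (- \<i> * of_real s * of_real x)" for x
    by (simp add: E_def complex_of_real_def)
  have "AE x in lborel. boundary_value h x = g x"
    using AE_symmetric_derivative_of_integral[OF g]
  proof eventually_elim
    case (elim x)
    have "((\<lambda>y. \<integral>t. poisson (Complex x y) t *\<^sub>R g t \<partial>lborel) \<longlongrightarrow> g x) (at_right 0)"
      by (rule poisson_integral_vertical_limit[OF g]) (use elim in blast)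
    then have "((\<lambda>y. h (Complex x y)) \<longlongrightarrow> g x) (at_right 0)"
    proof (rule Lim_transform_eventually)
      show "eventually (\<lambda>y. (\<integral>t. poisson (Complex x y) t *\<^sub>R g t \<partial>lborel) = h (Complex x y)) (at_right 0)"
        using eventually_at_right_less[of "0::real"]
        by eventually_elim (simp add: bounded_mean_poisson_boundary[OF h g lim])
    qed
    then show ?case
      unfolding boundary_value_def by (intro tendsto_Lim) auto
  qed
  then have ae: "AE x in lborel. boundary_value h x * exp (- \<i> * of_real s * of_real x) = g x * E (Complex x 0)"
    by eventually_elim (simp add: E0)
  have "(\<integral>x. boundary_value h x * exp (- \<i> * of_real s * of_real x) \<partial>lebesgue) = (\<integral>x. g x * E (Complex x 0) \<partial>lebesgue)"
  proof (rule integral_cong_AE)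
    show "(\<lambda>x. boundary_value h x * exp (- \<i> * of_real s * of_real x)) \<in> borel_measurable lebesgue"
      by (rule measurable_lebesgue_AE[OF _ ae]) measurable
    show "(\<lambda>x. g x * E (Complex x 0)) \<in> borel_measurable lebesgue"
      by (intro measurable_completion) measurable
    show "AE x in lebesgue. boundary_value h x * exp (- \<i> * of_real s * of_real x) = g x * E (Complex x 0)"
      by (rule AE_completion[OF ae])
  qed
  also have "\<dots> = (\<integral>x. g x * E (Complex x 0) \<partial>lborel)"
    by (rule integral_completion) measurable
  also have "\<dots> = (\<integral>x. h (Complex x y) * E (Complex x y) \<partial>lborel)"
  proof -
    define I where "I = (\<integral>x. h (Complex x y) * E (Complex x y) \<partial>lborel)"
    have int_E: "integrable lborel (\<lambda>x. f x * E (Complex x y'))" if f: "integrable lborel f" for f y'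
    proof (rule Bochner_Integration.integrable_bound)
      have [measurable]: "f \<in> borel_measurable borel" using f by auto
      show "(\<lambda>x. f x * E (Complex x y')) \<in> borel_measurable lborel" by measurable
      show "integrable lborel (\<lambda>x. exp (s * y') *\<^sub>R f x)" using f by simp
    qed (simp add: norm_mult E_norm)
    have shift: "(\<integral>x. h (Complex x y') * E (Complex x y') \<partial>lborel) = I" if y': "0 < y'" "y' \<le> y" for y'
      unfolding I_def
    proof (rule line_integral_shift)
      show "(\<lambda>z. h z * E z) holomorphic_on {z. 0 < Im z \<and> Im z < y + 1}"
        unfolding E_def by (intro holomorphic_intros holomorphic_on_subset[OF hD(2)]) auto
      show "(\<integral>\<^sup>+x. ennreal (norm (h (Complex x v) * E (Complex x v))) \<partial>lborel) \<le> ennreal (C * exp (\<bar>s\<bar> * y))" if v: "v \<in> {y'..y}" for v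
      proof -
        have [measurable]: "(\<lambda>x. h (Complex x v)) \<in> borel_measurable borel"
          using hD(6)[of v] v y' by (intro borel_measurable_continuous_onI) auto
        have "s * v \<le> \<bar>s\<bar> * y" using v y' by (intro mult_mono) auto
        then have "(\<integral>\<^sup>+x. ennreal (norm (h (Complex x v) * E (Complex x v))) \<partial>lborel)
          \<le> (\<integral>\<^sup>+x. ennreal (norm (h (Complex x v))) * ennreal (exp (\<bar>s\<bar> * y)) \<partial>lborel)"
          by (intro nn_integral_mono) (simp add: norm_mult E_norm mult_left_mono flip: ennreal_mult)
        also have "\<dots> = (\<integral>\<^sup>+x. ennreal (norm (h (Complex x v))) \<partial>lborel) * ennreal (exp (\<bar>s\<bar> * y))"
          by (rule nn_integral_multc) measurable
        also have "\<dots> \<le> ennreal C * ennreal (exp (\<bar>s\<bar> * y))"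
          using v y' by (intro mult_right_mono hD(4)) auto
        finally show ?thesis using hD(1) by (simp add: ennreal_mult)
      qed
    qed (use y' in auto)
    have "((\<lambda>v. exp (s * v) * (\<integral>x. norm (h (Complex x v) - g x) \<partial>lborel) + \<bar>exp (s * v) - 1\<bar> * 0) \<longlongrightarrow> exp (s * 0) * 0 + \<bar>exp (s * 0) - 1\<bar> * 0) (at_right 0)"
    proof (intro tendsto_intros)
      show "((\<lambda>v. \<integral>x. norm (h (Complex x v) - g x) \<partial>lborel) \<longlongrightarrow> 0) (at_right 0)"
        unfolding tendsto_iff
      proof (intro allI impI)
        fix e :: real assume "e > 0"
        then obtain d where d: "d > 0" "\<And>y. 0 < y \<Longrightarrow> y < d \<Longrightarrow> (\<integral>x. norm (h (Complex x y) - g x) \<partial>lborel) \<le> e / 2"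
          using lim[of "e / 2"] by auto
        have "dist (\<integral>x. norm (h (Complex x v) - g x) \<partial>lborel) 0 < e" if "0 < v" "v < d" for v
        proof -
          have "0 \<le> (\<integral>x. norm (h (Complex x v) - g x) \<partial>lborel)" by simp
          then show ?thesis using d(2)[OF that] \<open>e > 0\<close> by (simp add: dist_real_def)
        qed
        then show "eventually (\<lambda>v. dist (\<integral>x. norm (h (Complex x v) - g x) \<partial>lborel) 0 < e) (at_right 0)"
          using d(1) by (auto simp: eventually_at_right_field)
      qed
    qed
    then have l1: "((\<lambda>v. exp (s * v) * (\<integral>x. norm (h (Complex x v) - g x) \<partial>lborel)) \<longlongrightarrow> 0) (at_right 0)" by simp
    \<comment> \<open>The modulus does not depend on x, because the two exponentials differ by the
      real factor exp (s v); so the change of the exponential is uniform along the line.\<close>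
    have EE: "norm (E (Complex x v) - E (Complex x 0)) = \<bar>exp (s * v) - 1\<bar>" for x v
    proof -
      have "E (Complex x v) = E (Complex x 0) * of_real (exp (s * v))"
        unfolding E_def by (simp add: exp_of_real[symmetric] exp_add[symmetric] Complex_eq algebra_simps)
      then have "E (Complex x v) - E (Complex x 0) = E (Complex x 0) * of_real (exp (s * v) - 1)"
        by (simp add: algebra_simps)
      then show ?thesis by (simp only: norm_mult E_norm norm_of_real) simp
    qed
    have "((\<lambda>v. \<bar>exp (s * v) - 1\<bar> * (\<integral>x. norm (g x) \<partial>lborel)) \<longlongrightarrow> \<bar>exp (s * 0) - 1\<bar> * (\<integral>x. norm (g x) \<partial>lborel)) (at_right 0)"
      by (intro tendsto_intros)
    then have l2: "((\<lambda>v. \<bar>exp (s * v) - 1\<bar> * (\<integral>x. norm (g x) \<partial>lborel)) \<longlongrightarrow> 0) (at_right 0)" by simp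
    have le: "norm (I - (\<integral>x. g x * E (Complex x 0) \<partial>lborel))
      \<le> exp (s * v) * (\<integral>x. norm (h (Complex x v) - g x) \<partial>lborel) + \<bar>exp (s * v) - 1\<bar> * (\<integral>x. norm (g x) \<partial>lborel)"
      if v: "0 < v" "v < y" for v
    proof -
      have hv: "integrable lborel (\<lambda>x. h (Complex x v))" by (rule hD(5)[OF v(1)])
      have hg: "integrable lborel (\<lambda>x. h (Complex x v) - g x)" by (intro Bochner_Integration.integrable_diff hv g)
      have eq: "h (Complex x v) * E (Complex x v) - g x * E (Complex x 0)
        = (h (Complex x v) - g x) * E (Complex x v) + g x * (E (Complex x v) - E (Complex x 0))" for x
        by (simp add: algebra_simps)
      have i2: "integrable lborel (\<lambda>x. g x * (E (Complex x v) - E (Complex x 0)))"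
        unfolding right_diff_distrib by (intro Bochner_Integration.integrable_diff int_E g)
      have "I - (\<integral>x. g x * E (Complex x 0) \<partial>lborel) = (\<integral>x. h (Complex x v) * E (Complex x v) - g x * E (Complex x 0) \<partial>lborel)"
        using shift[of v] v int_E[OF hv] int_E[OF g] by simp
      also have "\<dots> = (\<integral>x. (h (Complex x v) - g x) * E (Complex x v) \<partial>lborel) + (\<integral>x. g x * (E (Complex x v) - E (Complex x 0)) \<partial>lborel)"
        unfolding eq by (intro Bochner_Integration.integral_add int_E hg i2)
      finally have "norm (I - (\<integral>x. g x * E (Complex x 0) \<partial>lborel))
        \<le> norm (\<integral>x. (h (Complex x v) - g x) * E (Complex x v) \<partial>lborel) + norm (\<integral>x. g x * (E (Complex x v) - E (Complex x 0)) \<partial>lborel)"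
        by (simp only: norm_triangle_ineq)
      also have "\<dots> \<le> (\<integral>x. norm ((h (Complex x v) - g x) * E (Complex x v)) \<partial>lborel) + (\<integral>x. norm (g x * (E (Complex x v) - E (Complex x 0))) \<partial>lborel)"
        by (intro add_mono integral_norm_bound)
      also have "\<dots> = exp (s * v) * (\<integral>x. norm (h (Complex x v) - g x) \<partial>lborel) + \<bar>exp (s * v) - 1\<bar> * (\<integral>x. norm (g x) \<partial>lborel)"
        by (simp only: norm_mult E_norm EE integral_mult_left_zero) (simp only: mult.commute)
      finally show ?thesis .
    qed
    have "norm (I - (\<integral>x. g x * E (Complex x 0) \<partial>lborel)) \<le> 0 + 0"
    proof (rule tendsto_lowerbound[OF tendsto_add[OF l1 l2]])
      show "eventually (\<lambda>v. norm (I - (\<integral>x. g x * E (Complex x 0) \<partial>lborel))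
      \<le> exp (s * v) * (\<integral>x. norm (h (Complex x v) - g x) \<partial>lborel) + \<bar>exp (s * v) - 1\<bar> * (\<integral>x. norm (g x) \<partial>lborel)) (at_right 0)"
        using le y by (auto simp: eventually_at_right_field)
    qed auto
    then show ?thesis by (simp add: I_def)
  qed
  finally show ?thesis by (simp add: inverse_fourier_def E_def)
qed

section \<open>The logarithm of the weight\<close>

text \<open>The Poisson measure of \<open>{t. r \<le> |t|}\<close> as seen from \<open>x + i y\<close>.\<close>

definition poisson_tail :: "real \<Rightarrow> real \<Rightarrow> real \<Rightarrow> real" where
  "poisson_tail x y r = 1 - (arctan ((r - x) / y) + arctan ((r + x) / y)) / pi"

lemma poisson_tail_nonneg: "poisson_tail x y r \<ge> 0"
proof -
  have "arctan ((r - x) / y) + arctan ((r + x) / y) \<le> pi / 2 + pi / 2"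
    using arctan_ubound[of "(r - x) / y"] arctan_ubound[of "(r + x) / y"] by linarith
  then show ?thesis by (simp add: poisson_tail_def)
qed

lemma poisson_tail_uminus: "poisson_tail (- x) y r = poisson_tail x y r"
  by (simp add: poisson_tail_def add.commute)

lemma measurable_poisson_tail [measurable]: "poisson_tail x y \<in> borel_measurable borel"
  unfolding poisson_tail_def[abs_def] by measurable

lemma nn_integral_poisson_tail:
  assumes y: "y > 0" and r: "r > 0"
  shows "(\<integral>\<^sup>+t. ennreal (poisson (Complex x y) t) * indicator {0..\<bar>t\<bar>} r \<partial>lborel) = ennreal (poisson_tail x y r)"
proof -
  let ?P = "poisson (Complex x y)"
  have "(\<integral>\<^sup>+t. ennreal (?P t) * indicator {0..\<bar>t\<bar>} r \<partial>lborel)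
    = (\<integral>\<^sup>+t. ennreal (?P t) * indicator {r..} t + ennreal (?P t) * indicator {..-r} t \<partial>lborel)"
    using r by (intro nn_integral_cong) (auto simp: indicator_def)
  also have "\<dots> = (\<integral>\<^sup>+t. ennreal (?P t) * indicator {r..} t \<partial>lborel) + (\<integral>\<^sup>+t. ennreal (?P t) * indicator {..-r} t \<partial>lborel)"
    by (rule nn_integral_add) auto
  also have "\<dots> = ennreal (1 / 2 - arctan ((r - x) / y) / pi) + ennreal (1 / 2 + arctan ((- r - x) / y) / pi)"
    using y by (simp add: nn_integral_poisson_atLeast nn_integral_poisson_atMost)
  also have "\<dots> = ennreal ((1 / 2 - arctan ((r - x) / y) / pi) + (1 / 2 + arctan ((- r - x) / y) / pi))"
    using arctan_ubound[of "(r - x) / y"] arctan_lbound[of "(- r - x) / y"]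
    by (intro ennreal_plus[symmetric]) (auto simp: field_simps)
  also have "(1 / 2 - arctan ((r - x) / y) / pi) + (1 / 2 + arctan ((- r - x) / y) / pi) = poisson_tail x y r"
  proof -
    have "arctan ((- r - x) / y) = - arctan ((r + x) / y)"
      using arctan_minus[of "(r + x) / y"] by (simp add: minus_divide_left)
    then show ?thesis by (simp add: poisson_tail_def add_divide_distrib)
  qed
  finally show ?thesis .
qed

lemma DERIV_poisson_tail:
  assumes y: "y > 0"
  shows "((\<lambda>x. poisson_tail x y r) has_real_derivative
    4 * x * r * y / (pi * (((r - x)\<^sup>2 + y\<^sup>2) * ((r + x)\<^sup>2 + y\<^sup>2)))) (at x)"
proof -
  have pos: "(r - x)\<^sup>2 + y\<^sup>2 > 0" "(r + x)\<^sup>2 + y\<^sup>2 > 0" using y by (auto simp: add_nonneg_pos)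
  have 1: "((\<lambda>x. (r - x) / y) has_real_derivative (- 1 / y)) (at x)"
    using y by (auto intro!: derivative_eq_intros)
  have 2: "((\<lambda>x. (r + x) / y) has_real_derivative (1 / y)) (at x)"
    using y by (auto intro!: derivative_eq_intros)
  have "((\<lambda>x. poisson_tail x y r) has_real_derivative
    0 - (inverse (1 + ((r - x) / y)\<^sup>2) * (- 1 / y) + inverse (1 + ((r + x) / y)\<^sup>2) * (1 / y)) / pi) (at x)"
    unfolding poisson_tail_def
    by (intro DERIV_diff DERIV_const DERIV_cdivide DERIV_add DERIV_chain2[OF DERIV_arctan 1] DERIV_chain2[OF DERIV_arctan 2])
  moreover have "inverse (1 + (w / y)\<^sup>2) * (c / y) = c * y / (w\<^sup>2 + y\<^sup>2)" for w c
  proof -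
    have "inverse (1 + (w / y)\<^sup>2) = y\<^sup>2 / (w\<^sup>2 + y\<^sup>2)"
      using y by (simp add: field_simps)
    then show ?thesis using y by (simp add: power2_eq_square)
  qed
  ultimately have "((\<lambda>x. poisson_tail x y r) has_real_derivative
    0 - ((- 1) * y / ((r - x)\<^sup>2 + y\<^sup>2) + 1 * y / ((r + x)\<^sup>2 + y\<^sup>2)) / pi) (at x)"
    by (simp only:)
  then have "((\<lambda>x. poisson_tail x y r) has_real_derivative
    (y / ((r - x)\<^sup>2 + y\<^sup>2) - y / ((r + x)\<^sup>2 + y\<^sup>2)) / pi) (at x)"
    by (simp add: diff_divide_distrib)
  also have "(y / ((r - x)\<^sup>2 + y\<^sup>2) - y / ((r + x)\<^sup>2 + y\<^sup>2)) / pi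
    = 4 * x * r * y / (pi * (((r - x)\<^sup>2 + y\<^sup>2) * ((r + x)\<^sup>2 + y\<^sup>2)))"
  proof -
    have "y / ((r - x)\<^sup>2 + y\<^sup>2) - y / ((r + x)\<^sup>2 + y\<^sup>2)
      = (y * ((r + x)\<^sup>2 + y\<^sup>2) - y * ((r - x)\<^sup>2 + y\<^sup>2)) / (((r - x)\<^sup>2 + y\<^sup>2) * ((r + x)\<^sup>2 + y\<^sup>2))"
      using pos by (subst diff_frac_eq) auto
    also have "y * ((r + x)\<^sup>2 + y\<^sup>2) - y * ((r - x)\<^sup>2 + y\<^sup>2) = 4 * x * r * y"
      by (simp add: power2_eq_square algebra_simps)
    finally show ?thesis by (simp add: mult.commute)
  qed
  finally show ?thesis .
qed

lemma poisson_tail_mono: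
  assumes "y > 0" "r \<ge> 0" "0 \<le> x" "x \<le> x'"
  shows "poisson_tail x y r \<le> poisson_tail x' y r"
proof (rule DERIV_nonneg_imp_nondecreasing[OF assms(4)])
  fix u assume u: "x \<le> u" "u \<le> x'"
  show "\<exists>d. ((\<lambda>x. poisson_tail x y r) has_real_derivative d) (at u) \<and> 0 \<le> d"
    by (rule exI, rule conjI, rule DERIV_poisson_tail[OF assms(1)])
       (use assms u in \<open>auto intro!: divide_nonneg_nonneg mult_nonneg_nonneg\<close>)
qed

text \<open>For u <= y each of (r - u)^2 + y^2 and (r + u)^2 + y^2 is comparable with r^2 + y^2, and
  their product lies between a third of its square and 6 times its square. This removes u from the
  denominator.\<close>

lemma poisson_tail_derivative_bounds:
  assumes "y > 0" "r \<ge> 0" "0 \<le> u" "u \<le> y"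
  shows "4 * u * r * y / (pi * (((r - u)\<^sup>2 + y\<^sup>2) * ((r + u)\<^sup>2 + y\<^sup>2))) \<ge> 2 / 3 * u * (r * y / (r\<^sup>2 + y\<^sup>2)\<^sup>2) / pi"
    and "4 * u * r * y / (pi * (((r - u)\<^sup>2 + y\<^sup>2) * ((r + u)\<^sup>2 + y\<^sup>2))) \<le> 12 * u * (r * y / (r\<^sup>2 + y\<^sup>2)\<^sup>2) / pi"
proof -
  define D where "D = r\<^sup>2 + y\<^sup>2"
  define D1 where "D1 = (r - u)\<^sup>2 + y\<^sup>2"
  define D2 where "D2 = (r + u)\<^sup>2 + y\<^sup>2"
  have pos: "D > 0" "D1 > 0" "D2 > 0" using assms by (auto simp: D_def D1_def D2_def add_nonneg_pos)
  have uy: "u\<^sup>2 \<le> y\<^sup>2" using assms by (intro power_mono) auto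
  have ru: "r * u \<ge> 0" using assms by simp
  have "2 * (r * u) \<le> r\<^sup>2 + u\<^sup>2" using sum_squares_bound[of r u] by simp
  then have D2u: "D2 \<le> 3 * D"   proof -
    have "R + W + 2 * Z + Y \<le> 3 * (R + Y)" if "2 * Z \<le> R + W" "W \<le> Y" "0 \<le> R" for R W Z Y :: real
      using that by simp
    from this[OF \<open>2 * (r * u) \<le> r\<^sup>2 + u\<^sup>2\<close> uy] show ?thesis
      by (simp add: D2_def D_def power2_sum mult.assoc)
  qed
  have D1u: "D1 \<le> 2 * D"   proof -
    have "R + W - 2 * Z + Y \<le> 2 * (R + Y)" if "0 \<le> Z" "W \<le> Y" "0 \<le> R" for R W Z Y :: real
      using that by simp
    from this[OF ru uy] show ?thesis
      by (simp add: D1_def D_def power2_diff mult.assoc)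
  qed
  have D2l: "D \<le> D2" using ru by (simp add: D2_def D_def power2_sum)
  have "r\<^sup>2 \<le> 2 * (r - u)\<^sup>2 + 2 * u\<^sup>2"
    using sum_squares_ge_zero[of "r - 2 * u" 0] by (simp add: power2_eq_square algebra_simps)
  moreover have "R + Y \<le> 3 * (A + Y)" if "R \<le> 2 * A + 2 * W" "W \<le> Y" "0 \<le> A" for R A W Y :: real
    using that by simp
  ultimately have D1l: "D \<le> 3 * D1"
    unfolding D1_def D_def using uy zero_le_power2 by blast
  have "D1 * D2 \<le> (2 * D) * (3 * D)" using D1u D2u pos by (intro mult_mono) auto
  then have up: "D1 * D2 \<le> 6 * D\<^sup>2" by (simp add: power2_eq_square)
  have "D * D \<le> (3 * D1) * D2" using D1l D2l pos by (intro mult_mono) auto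
  then have lo: "D\<^sup>2 \<le> 3 * (D1 * D2)" by (simp add: power2_eq_square)
  define c where "c = 4 * u * r * y / pi"
  have c: "c \<ge> 0" using assms by (simp add: c_def)
  have "c / (6 * D\<^sup>2) \<le> c / (D1 * D2)"
    using up pos c by (intro divide_left_mono) auto
  then show "4 * u * r * y / (pi * (((r - u)\<^sup>2 + y\<^sup>2) * ((r + u)\<^sup>2 + y\<^sup>2))) \<ge> 2 / 3 * u * (r * y / (r\<^sup>2 + y\<^sup>2)\<^sup>2) / pi"
    by (simp add: c_def mult_ac flip: D_def D1_def D2_def)
  have "c / (D1 * D2) \<le> c / (D\<^sup>2 / 3)"
    using lo pos c by (intro divide_left_mono) auto
  then show "4 * u * r * y / (pi * (((r - u)\<^sup>2 + y\<^sup>2) * ((r + u)\<^sup>2 + y\<^sup>2))) \<le> 12 * u * (r * y / (r\<^sup>2 + y\<^sup>2)\<^sup>2) / pi"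
    by (simp add: c_def mult_ac flip: D_def D1_def D2_def)
qed

text \<open>Integration of the derivative bounds in u from 0 to x: 2/3 u becomes 1/3 x^2 and 12 u
  becomes 6 x^2. The resulting quadratic control reaches all the way to x = y, far beyond the range
  of a Taylor expansion.\<close>

lemma poisson_tail_increment:
  assumes y: "y > 0" and r: "r \<ge> 0" and x: "0 \<le> x" "x \<le> y"
  shows "1 / (3 * pi) * x\<^sup>2 * (r * y / (r\<^sup>2 + y\<^sup>2)\<^sup>2) \<le> poisson_tail x y r - poisson_tail 0 y r"
    and "poisson_tail x y r - poisson_tail 0 y r \<le> 6 / pi * x\<^sup>2 * (r * y / (r\<^sup>2 + y\<^sup>2)\<^sup>2)"
proof -
  define k where "k = r * y / (r\<^sup>2 + y\<^sup>2)\<^sup>2"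
  have sq: "((\<lambda>x. c * x\<^sup>2 * k) has_real_derivative 2 * c * u * k) (at u)" for c u
    by (auto intro!: derivative_eq_intros)
  have "poisson_tail 0 y r - 1 / (3 * pi) * 0\<^sup>2 * k \<le> poisson_tail x y r - 1 / (3 * pi) * x\<^sup>2 * k"
  proof (rule DERIV_nonneg_imp_nondecreasing[OF x(1)])
    fix u assume u: "0 \<le> u" "u \<le> x"
    show "\<exists>d. ((\<lambda>x. poisson_tail x y r - 1 / (3 * pi) * x\<^sup>2 * k) has_real_derivative d) (at u) \<and> 0 \<le> d"
    proof (intro exI conjI)
      show "((\<lambda>x. poisson_tail x y r - 1 / (3 * pi) * x\<^sup>2 * k) has_real_derivative
        4 * u * r * y / (pi * (((r - u)\<^sup>2 + y\<^sup>2) * ((r + u)\<^sup>2 + y\<^sup>2))) - 2 * (1 / (3 * pi)) * u * k) (at u)"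
        by (intro DERIV_diff DERIV_poisson_tail y sq)
      show "0 \<le> 4 * u * r * y / (pi * (((r - u)\<^sup>2 + y\<^sup>2) * ((r + u)\<^sup>2 + y\<^sup>2))) - 2 * (1 / (3 * pi)) * u * k"
        using poisson_tail_derivative_bounds(1)[of y r u] y r u x by (simp add: k_def mult_ac)
    qed
  qed
  then show "1 / (3 * pi) * x\<^sup>2 * (r * y / (r\<^sup>2 + y\<^sup>2)\<^sup>2) \<le> poisson_tail x y r - poisson_tail 0 y r"
    by (simp add: k_def)
  have "6 / pi * 0\<^sup>2 * k - poisson_tail 0 y r \<le> 6 / pi * x\<^sup>2 * k - poisson_tail x y r"
  proof (rule DERIV_nonneg_imp_nondecreasing[OF x(1)])
    fix u assume u: "0 \<le> u" "u \<le> x"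
    show "\<exists>d. ((\<lambda>x. 6 / pi * x\<^sup>2 * k - poisson_tail x y r) has_real_derivative d) (at u) \<and> 0 \<le> d"
    proof (intro exI conjI)
      show "((\<lambda>x. 6 / pi * x\<^sup>2 * k - poisson_tail x y r) has_real_derivative
        2 * (6 / pi) * u * k - 4 * u * r * y / (pi * (((r - u)\<^sup>2 + y\<^sup>2) * ((r + u)\<^sup>2 + y\<^sup>2)))) (at u)"
        by (intro DERIV_diff DERIV_poisson_tail y sq)
      show "0 \<le> 2 * (6 / pi) * u * k - 4 * u * r * y / (pi * (((r - u)\<^sup>2 + y\<^sup>2) * ((r + u)\<^sup>2 + y\<^sup>2)))"
        using poisson_tail_derivative_bounds(2)[of y r u] y r u x by (simp add: k_def mult_ac)
    qed
  qed
  then show "poisson_tail x y r - poisson_tail 0 y r \<le> 6 / pi * x\<^sup>2 * (r * y / (r\<^sup>2 + y\<^sup>2)\<^sup>2)"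
    by (simp add: k_def)
qed

lemma poisson_tail_ge_quarter:
  assumes "y > 0" "r \<le> x + y"
  shows "poisson_tail x y r \<ge> 1 / 4"
proof -
  have "(r - x) / y \<le> 1" using assms by (simp add: field_simps)
  then have "arctan ((r - x) / y) \<le> arctan 1" using arctan_le_iff[of "(r - x) / y" 1] by blast
  then have "arctan ((r - x) / y) + arctan ((r + x) / y) \<le> pi / 4 + pi / 2"
    using arctan_ubound[of "(r + x) / y"] by (simp add: arctan_one)
  then have "(arctan ((r - x) / y) + arctan ((r + x) / y)) / pi \<le> (pi / 4 + pi / 2) / pi"
    by (intro divide_right_mono) auto
  then show ?thesis by (simp add: poisson_tail_def add_divide_distrib)
qed

lemma poisson_tail_ge_half:
  assumes "y > 0" "r \<le> x"
  shows "poisson_tail x y r \<ge> 1 / 2"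
proof -
  have "(r - x) / y \<le> 0" using assms by (simp add: divide_nonpos_pos)
  then have "arctan ((r - x) / y) + arctan ((r + x) / y) \<le> 0 + pi / 2"
    using arctan_ubound[of "(r + x) / y"] by (intro add_mono) auto
  then have "(arctan ((r - x) / y) + arctan ((r + x) / y)) / pi \<le> (pi / 2) / pi"
    by (intro divide_right_mono) auto
  then show ?thesis by (simp add: poisson_tail_def)
qed

lemma pi_half_minus_arctan_le:
  assumes "w > 0"
  shows "pi / 2 - arctan w \<le> 1 / w"
proof -
  have "arctan (1 / w) = pi / 2 - arctan w"
    using arctan_inverse[of w] assms by (simp add: inverse_eq_divide)
  moreover have "arctan (1 / w) \<le> 1 / w" using assms by (intro arctan_le_self) auto
  ultimately show ?thesis by simp
qed

text \<open>For r >= 2 y the distance r - y is at least r / 2, so pi / 2 - arctan w <= 1 / w gives a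
  multiple of y / r; for smaller r the right-hand side exceeds 1, the total mass.\<close>

lemma poisson_tail_diagonal_le:
  assumes y: "y > 0" and r: "r \<ge> y"
  shows "poisson_tail y y r \<le> 2 * y / r"
proof (cases "r \<ge> 2 * y")
  case True
  have "r - y > 0" using y True by linarith
  then have "pi / 2 - arctan ((r - y) / y) \<le> y / (r - y)"
    using pi_half_minus_arctan_le[of "(r - y) / y"] y by simp
  also have "\<dots> \<le> y / (r / 2)" using True y by (intro divide_left_mono) auto
  finally have 1: "pi / 2 - arctan ((r - y) / y) \<le> 2 * y / r" by simp
  have "pi / 2 - arctan ((r + y) / y) \<le> y / (r + y)"
    using pi_half_minus_arctan_le[of "(r + y) / y"] y r by simp
  also have "\<dots> \<le> y / r" using y r by (intro divide_left_mono) auto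
  finally have 2: "pi / 2 - arctan ((r + y) / y) \<le> y / r" .
  have "poisson_tail y y r = ((pi / 2 - arctan ((r - y) / y)) + (pi / 2 - arctan ((r + y) / y))) / pi"
    by (simp add: poisson_tail_def field_simps)
  also have "\<dots> \<le> (2 * y / r + y / r) / pi" using 1 2 by (intro divide_right_mono) auto
  also have "\<dots> = (3 / pi) * (y / r)" by simp
  also have "\<dots> \<le> 2 * (y / r)" using y r pi_gt3 by (intro mult_right_mono) (auto simp: field_simps)
  finally show ?thesis by simp
next
  case False
  have "(r - y) / y \<ge> 0" "(r + y) / y \<ge> 0" using y r by auto
  then have "arctan ((r - y) / y) + arctan ((r + y) / y) \<ge> 0" by simp
  then have "poisson_tail y y r \<le> 1" by (simp add: poisson_tail_def)
  also have "1 \<le> 2 * y / r" using False y r by (simp add: field_simps)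
  finally show ?thesis .
qed

section \<open>The radial representation of log |W| by Poisson tails\<close>

context log_weight
begin

text \<open>Set to 0 off the positive axis, where the derivative is not assumed to exist; the result
  is a nonnegative Borel function, and integrals over the whole line need no restriction.\<close>

definition slope :: "real \<Rightarrow> real" where
  "slope r = (if r > 0 then deriv \<phi> r else 0)"

lemma DERIV_phi: "t > 0 \<Longrightarrow> (\<phi> has_real_derivative deriv \<phi> t) (at t)"
  using differentiable by (metis DERIV_deriv_iff_real_differentiable differentiable_on_eq_differentiable_at greaterThan_iff open_greaterThan)

lemma continuous_deriv: "continuous_on {0<..} (deriv \<phi>)"
  by (rule differentiable_imp_continuous_on[OF deriv_differentiable])

lemma slope_nonneg: "slope r \<ge> 0"
proof (cases "r > 0")
  case True
  have "deriv \<phi> r \<ge> 0"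
    using mono_on_imp_deriv_nonneg[OF mono DERIV_phi[OF True]] True by (simp add: interior_open)
  then show ?thesis by (simp add: slope_def)
qed (simp add: slope_def)

lemma measurable_slope [measurable]: "slope \<in> borel_measurable borel"
proof -
  have "(\<lambda>r. indicator {0<..} r *\<^sub>R deriv \<phi> r) \<in> borel_measurable borel"
    by (rule borel_measurable_continuous_on_indicator[OF _ continuous_deriv]) auto
  also have "(\<lambda>r. indicator {0<..} r *\<^sub>R deriv \<phi> r) = slope"
    by (auto simp: slope_def indicator_def fun_eq_iff)
  finally show ?thesis .
qed

lemma phi_abs: "\<phi> \<bar>t\<bar> = \<phi> t"
  using even[of t] by (cases "t \<ge> 0") auto

lemma phi_mono: "0 \<le> s \<Longrightarrow> s \<le> t \<Longrightarrow> \<phi> s \<le> \<phi> t"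
  using mono_onD[OF mono, of s t] zero nonneg[of t] by (cases "s = 0") auto

text \<open>The derivative may be unbounded near 0, so the fundamental theorem is used on the open
  interval: the sign of the derivative and the one-sided limits give both its integrability and the
  value.\<close>

lemma nn_integral_slope: "(\<integral>\<^sup>+r. ennreal (slope r) * indicator {0..\<bar>t\<bar>} r \<partial>lborel) = ennreal (\<phi> t)"
proof (cases "t = 0")
  case True
  have "AE r in lborel. ennreal (slope r) * indicator {0..\<bar>t\<bar>} r = (0 :: ennreal)"
    using AE_lborel_singleton[of "0::real"] by eventually_elim (use True in \<open>auto simp: indicator_def\<close>)
  then show ?thesis using True zero by (simp add: nn_integral_0_iff_AE)
next
  case False
  define T where "T = \<bar>t\<bar>"
  have T: "T > 0" using False by (simp add: T_def)
  have cont: "isCont \<phi> x" for x using continuous by (simp add: continuous_on_eq_continuous_at)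
  have d_cont: "isCont (deriv \<phi>) x" if "x > 0" for x
    using continuous_deriv that by (simp add: continuous_on_eq_continuous_at)
  have 1: "set_integrable lborel (einterval (ereal 0) (ereal T)) (deriv \<phi>)"
    and 2: "(LBINT x=ereal 0..ereal T. deriv \<phi> x) = \<phi> T - \<phi> 0"
  proof -
    have a: "((\<phi> \<circ> real_of_ereal) \<longlongrightarrow> \<phi> 0) (at_right (ereal 0))" "((\<phi> \<circ> real_of_ereal) \<longlongrightarrow> \<phi> T) (at_left (ereal T))"
      using cont by (auto simp: ereal_tendsto_simps continuous_at_imp_continuous_at_within isCont_def
          intro: filterlim_mono[OF _ order_refl at_le])
    have b: "AE x in lborel. ereal 0 < ereal x \<longrightarrow> ereal x < ereal T \<longrightarrow> 0 \<le> deriv \<phi> x"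
    proof (intro AE_I2 impI)
      fix x :: real assume "ereal 0 < ereal x"
      then show "0 \<le> deriv \<phi> x" using slope_nonneg[of x] by (simp add: slope_def)
    qed
    show "set_integrable lborel (einterval (ereal 0) (ereal T)) (deriv \<phi>)"
      "(LBINT x=ereal 0..ereal T. deriv \<phi> x) = \<phi> T - \<phi> 0"
      using interval_integral_FTC_nonneg[OF _ DERIV_phi d_cont b a] T by auto
  qed
  have eq: "indicator (einterval (ereal 0) (ereal T)) r *\<^sub>R deriv \<phi> r = slope r * indicator {0<..<T} r" for r
    by (auto simp: einterval_def slope_def indicator_def)
  have int: "integrable lborel (\<lambda>r. slope r * indicator {0<..<T} r)"
    using 1 unfolding set_integrable_def eq .
  have "(\<integral>r. slope r * indicator {0<..<T} r \<partial>lborel) = \<phi> T"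
    using 2 T zero unfolding interval_lebesgue_integral_def set_lebesgue_integral_def eq by simp
  then have "(\<integral>\<^sup>+r. ennreal (slope r * indicator {0<..<T} r) \<partial>lborel) = ennreal (\<phi> T)"
    using slope_nonneg by (subst nn_integral_eq_integral[OF int]) auto
  moreover have "(\<integral>\<^sup>+r. ennreal (slope r) * indicator {0..T} r \<partial>lborel) = (\<integral>\<^sup>+r. ennreal (slope r * indicator {0<..<T} r) \<partial>lborel)"
  proof (rule nn_integral_cong_AE)
    show "AE r in lborel. ennreal (slope r) * indicator {0..T} r = ennreal (slope r * indicator {0<..<T} r)"
      using AE_lborel_singleton[of "0::real"] AE_lborel_singleton[of T]
      by eventually_elim (auto simp: indicator_def)
  qed
  ultimately show ?thesis by (simp add: T_def phi_abs)
qed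

sublocale poisson_integrable \<phi>
  by unfold_locales (rule integrable)

text \<open>This is log |W(x + iy)| by \<open>norm_outer_weight\<close>.\<close>

definition U :: "real \<Rightarrow> real \<Rightarrow> real" where
  "U x y = (\<integral>t. poisson (Complex x y) t * \<phi> t \<partial>lborel)"

lemma U_nonneg: "y > 0 \<Longrightarrow> U x y \<ge> 0"
  unfolding U_def using nonneg by (intro integral_nonneg_AE) auto

text \<open>Tonelli after writing the even function \<open>\<phi>\<close> as the integral of
  \<open>slope\<close> over [0, |t|]. Since \<open>slope\<close> is nonnegative, inequalities
  between the values of U at two points of a line follow from inequalities between tails for each
  single r.\<close>

lemma nn_integral_U:
  assumes y: "y > 0"
  shows "(\<integral>\<^sup>+r. ennreal (slope r * poisson_tail x y r) \<partial>lborel) = ennreal (U x y)"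
proof -
  let ?P = "poisson (Complex x y)"
  have "ennreal (U x y) = (\<integral>\<^sup>+t. ennreal (?P t * \<phi> t) \<partial>lborel)"
    unfolding U_def using y nonneg
    by (intro nn_integral_eq_integral[symmetric] integrable_poisson_mult) auto
  also have "\<dots> = (\<integral>\<^sup>+t. \<integral>\<^sup>+r. ennreal (?P t) * (ennreal (slope r) * indicator {0..\<bar>t\<bar>} r) \<partial>lborel \<partial>lborel)"
    using y nonneg by (intro nn_integral_cong) (simp add: nn_integral_cmult nn_integral_slope ennreal_mult)
  also have "\<dots> = (\<integral>\<^sup>+r. \<integral>\<^sup>+t. ennreal (?P t) * (ennreal (slope r) * indicator {0..\<bar>t\<bar>} r) \<partial>lborel \<partial>lborel)"
  proof (rule lborel_pair.Fubini'[symmetric])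
    have "(\<lambda>(t, r). ennreal (?P t) * (ennreal (slope r) * indicator {0..\<bar>t\<bar>} r))
      = (\<lambda>p. ennreal (?P (fst p)) * (ennreal (slope (snd p)) * (if 0 \<le> snd p \<and> snd p \<le> \<bar>fst p\<bar> then 1 else 0)))"
      by (auto simp: fun_eq_iff indicator_def)
    also have "\<dots> \<in> borel_measurable (lborel \<Otimes>\<^sub>M lborel)" by measurable
    finally show "(\<lambda>(t, r). ennreal (?P t) * (ennreal (slope r) * indicator {0..\<bar>t\<bar>} r)) \<in> borel_measurable (lborel \<Otimes>\<^sub>M lborel)" .
  qed
  also have "\<dots> = (\<integral>\<^sup>+r. ennreal (slope r * poisson_tail x y r) \<partial>lborel)"
  proof (rule nn_integral_cong)
    fix r
    have "(\<integral>\<^sup>+t. ennreal (?P t) * (ennreal (slope r) * indicator {0..\<bar>t\<bar>} r) \<partial>lborel)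
      = (\<integral>\<^sup>+t. ennreal (slope r) * (ennreal (?P t) * indicator {0..\<bar>t\<bar>} r) \<partial>lborel)"
      by (simp add: mult_ac)
    also have "\<dots> = ennreal (slope r) * (\<integral>\<^sup>+t. ennreal (?P t) * indicator {0..\<bar>t\<bar>} r \<partial>lborel)"
    proof (rule nn_integral_cmult)
      have "(\<lambda>t. ennreal (?P t) * indicator {0..\<bar>t\<bar>} r) = (\<lambda>t. ennreal (?P t) * (if 0 \<le> r \<and> r \<le> \<bar>t\<bar> then 1 else 0))"
        by (auto simp: fun_eq_iff indicator_def)
      also have "\<dots> \<in> borel_measurable lborel" by measurable
      finally show "(\<lambda>t. ennreal (?P t) * indicator {0..\<bar>t\<bar>} r) \<in> borel_measurable lborel" .
    qed
    also have "\<dots> = ennreal (slope r * poisson_tail x y r)"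
    proof (cases "r > 0")
      case True
      then show ?thesis using y slope_nonneg poisson_tail_nonneg
        by (simp add: nn_integral_poisson_tail ennreal_mult)
    qed (simp add: slope_def)
    finally show "(\<integral>\<^sup>+t. ennreal (?P t) * (ennreal (slope r) * indicator {0..\<bar>t\<bar>} r) \<partial>lborel) = ennreal (slope r * poisson_tail x y r)" .
  qed
  finally show ?thesis ..
qed

lemma integrable_slope_tail: "y > 0 \<Longrightarrow> integrable lborel (\<lambda>r. slope r * poisson_tail x y r)"
  and U_eq: "y > 0 \<Longrightarrow> U x y = (\<integral>r. slope r * poisson_tail x y r \<partial>lborel)"
proof -
  assume y: "y > 0"
  show "integrable lborel (\<lambda>r. slope r * poisson_tail x y r)"
    using nn_integral_U[OF y] slope_nonneg poisson_tail_nonneg by (intro integrableI_nonneg) auto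
  show "U x y = (\<integral>r. slope r * poisson_tail x y r \<partial>lborel)"
    using nn_integral_U[OF y] slope_nonneg poisson_tail_nonneg U_nonneg[OF y]
    by (subst integral_eq_nn_integral) auto
qed

lemma U_uminus: "y > 0 \<Longrightarrow> U (- x) y = U x y"
  by (simp add: U_eq poisson_tail_uminus)

lemma U_abs: "y > 0 \<Longrightarrow> U \<bar>x\<bar> y = U x y"
  using U_uminus by (cases "x \<ge> 0") auto

text \<open>Seen from x + iy, the set |t| >= r has Poisson measure at least 1/4 for every r up to x
  + y.\<close>

lemma U_ge_phi:
  assumes y: "y > 0" and x: "x \<ge> 0"
  shows "U x y \<ge> \<phi> (x + y) / 4"
proof -
  have "ennreal (\<phi> (x + y) / 4) = ennreal (1 / 4) * (\<integral>\<^sup>+r. ennreal (slope r) * indicator {0..\<bar>x + y\<bar>} r \<partial>lborel)"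
    using nonneg by (subst nn_integral_slope) (simp flip: ennreal_mult)
  also have "\<dots> = (\<integral>\<^sup>+r. ennreal (1 / 4) * (ennreal (slope r) * indicator {0..\<bar>x + y\<bar>} r) \<partial>lborel)"
    by (rule nn_integral_cmult[symmetric]) measurable
  also have "\<dots> \<le> (\<integral>\<^sup>+r. ennreal (slope r * poisson_tail x y r) \<partial>lborel)"
  proof (rule nn_integral_mono)
    fix r
    show "ennreal (1 / 4) * (ennreal (slope r) * indicator {0..\<bar>x + y\<bar>} r) \<le> ennreal (slope r * poisson_tail x y r)"
    proof (cases "r \<in> {0..\<bar>x + y\<bar>}")
      case True
      then have "1 / 4 \<le> poisson_tail x y r" using x y by (intro poisson_tail_ge_quarter) auto
      then have "1 / 4 * slope r \<le> slope r * poisson_tail x y r"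
        using slope_nonneg[of r] by (subst mult.commute) (rule mult_left_mono)
      then show ?thesis using True slope_nonneg by (simp add: ennreal_leI flip: ennreal_mult del: ennreal_half)
    qed auto
  qed
  also have "\<dots> = ennreal (U x y)" by (rule nn_integral_U[OF y])
  finally show ?thesis using U_nonneg[OF y, of x] by (simp add: ennreal_le_iff)
qed

text \<open>The kernel is the one by which the increments of the tails are estimated. The integral
  is comparable with the second derivative \<open>sig2\<close> but has a nonnegative integrand, so
  it can be bounded below by restricting r to an interval.\<close>

definition curvature_bound :: "real \<Rightarrow> real" where
  "curvature_bound y = (\<integral>r. slope r * (r * y / (r\<^sup>2 + y\<^sup>2)\<^sup>2) \<partial>lborel)"

text \<open>The kernel is dominated by the increment of the tails from x = 0 to x = y, and products
  of tails with \<open>slope\<close> are already known to be integrable.\<close>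

lemma integrable_curvature_bound:
  assumes y: "y > 0"
  shows "integrable lborel (\<lambda>r. slope r * (r * y / (r\<^sup>2 + y\<^sup>2)\<^sup>2))"
proof (rule Bochner_Integration.integrable_bound)
  show "integrable lborel (\<lambda>r. 3 * pi / y\<^sup>2 * (slope r * poisson_tail y y r - slope r * poisson_tail 0 y r))"
    by (intro integrable_mult_right Bochner_Integration.integrable_diff integrable_slope_tail y)
  show "AE r in lborel. norm (slope r * (r * y / (r\<^sup>2 + y\<^sup>2)\<^sup>2))
     \<le> norm (3 * pi / y\<^sup>2 * (slope r * poisson_tail y y r - slope r * poisson_tail 0 y r))"
  proof (rule AE_I2)
    fix r
    show "norm (slope r * (r * y / (r\<^sup>2 + y\<^sup>2)\<^sup>2))
     \<le> norm (3 * pi / y\<^sup>2 * (slope r * poisson_tail y y r - slope r * poisson_tail 0 y r))"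
    proof (cases "r > 0")
      case True
      define k where "k = r * y / (r\<^sup>2 + y\<^sup>2)\<^sup>2"
      have k: "k \<ge> 0" using True y by (simp add: k_def)
      have "1 / (3 * pi) * y\<^sup>2 * k \<le> poisson_tail y y r - poisson_tail 0 y r"
        unfolding k_def using True y by (intro poisson_tail_increment) auto
      then have "(3 * pi / y\<^sup>2) * (1 / (3 * pi) * y\<^sup>2 * k) \<le> (3 * pi / y\<^sup>2) * (poisson_tail y y r - poisson_tail 0 y r)"
        by (intro mult_left_mono) auto
      then have "k \<le> 3 * pi / y\<^sup>2 * (poisson_tail y y r - poisson_tail 0 y r)" using y by simp
      then have "slope r * k \<le> slope r * (3 * pi / y\<^sup>2 * (poisson_tail y y r - poisson_tail 0 y r))"
        by (intro mult_left_mono slope_nonneg)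
      also have "\<dots> = 3 * pi / y\<^sup>2 * (slope r * poisson_tail y y r - slope r * poisson_tail 0 y r)"
      proof -
        have "s * (c * (A - B)) = c * (s * A - s * B)" for s c A B :: real
          by (simp add: algebra_simps)
        then show ?thesis .
      qed
      finally have "slope r * k \<le> 3 * pi / y\<^sup>2 * (slope r * poisson_tail y y r - slope r * poisson_tail 0 y r)" .
      moreover have "0 \<le> slope r * k" by (intro mult_nonneg_nonneg slope_nonneg k)
      ultimately show ?thesis unfolding k_def real_norm_def by linarith
    qed (simp add: slope_def)
  qed
qed measurable

lemma U_increment:
  assumes y: "y > 0" and x: "0 \<le> x" "x \<le> y"
  shows "1 / (3 * pi) * x\<^sup>2 * curvature_bound y \<le> U x y - U 0 y"
    and "U x y - U 0 y \<le> 6 / pi * x\<^sup>2 * curvature_bound y"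
proof -
  define k where "k r = r * y / (r\<^sup>2 + y\<^sup>2)\<^sup>2" for r
  have int: "integrable lborel (\<lambda>r. slope r * k r)"
    unfolding k_def by (rule integrable_curvature_bound[OF y])
  have diff: "U x y - U 0 y = (\<integral>r. slope r * poisson_tail x y r - slope r * poisson_tail 0 y r \<partial>lborel)"
    using integrable_slope_tail[OF y] by (simp add: U_eq[OF y])
  have cb: "c * curvature_bound y = (\<integral>r. c * (slope r * k r) \<partial>lborel)" for c
    by (simp only: curvature_bound_def k_def integral_mult_right_zero)
  have k: "1 / (3 * pi) * x\<^sup>2 * (slope r * k r) \<le> slope r * poisson_tail x y r - slope r * poisson_tail 0 y r"
    "slope r * poisson_tail x y r - slope r * poisson_tail 0 y r \<le> 6 / pi * x\<^sup>2 * (slope r * k r)" for r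
  proof -
    have "1 / (3 * pi) * x\<^sup>2 * (slope r * k r) \<le> slope r * poisson_tail x y r - slope r * poisson_tail 0 y r
     \<and> slope r * poisson_tail x y r - slope r * poisson_tail 0 y r \<le> 6 / pi * x\<^sup>2 * (slope r * k r)"
    proof (cases "r > 0")
      case True
      then show ?thesis
        using mult_left_mono[OF poisson_tail_increment(1)[OF y _ x, of r] slope_nonneg[of r]]
          mult_left_mono[OF poisson_tail_increment(2)[OF y _ x, of r] slope_nonneg[of r]]
        by (simp add: k_def right_diff_distrib mult_ac)
    qed (simp add: slope_def)
    then show "1 / (3 * pi) * x\<^sup>2 * (slope r * k r) \<le> slope r * poisson_tail x y r - slope r * poisson_tail 0 y r"
    "slope r * poisson_tail x y r - slope r * poisson_tail 0 y r \<le> 6 / pi * x\<^sup>2 * (slope r * k r)" by auto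
  qed
  show "1 / (3 * pi) * x\<^sup>2 * curvature_bound y \<le> U x y - U 0 y"
    unfolding diff cb
    by (intro integral_mono integrable_mult_right int Bochner_Integration.integrable_diff integrable_slope_tail y k)
  show "U x y - U 0 y \<le> 6 / pi * x\<^sup>2 * curvature_bound y"
    unfolding diff cb
    by (intro integral_mono integrable_mult_right int Bochner_Integration.integrable_diff integrable_slope_tail y k)
qed

text \<open>For y <= r <= x the tail is at least 1/2 at x but at most 2 y / r at y. With slope at
  least 4 / r the increase of U is therefore at least 2 log (x / y) up to a constant, and exp (- U)
  gains the integrable factor (y / x)^2.\<close>

lemma U_tail:
  assumes y: "y > 0" and x: "y \<le> x" and sl: "\<And>r. r \<ge> y \<Longrightarrow> slope r \<ge> 4 / r"
  shows "U x y - U y y \<ge> 2 * ln (x / y) - 8"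
proof -
  \<comment> \<open>This is (4 / r) (1/2 - 2 y / r), the minimal slope times the minimal increase of
    the tail; its primitive produces 2 ln (x / y) and the loss of at most 8.\<close>
  define f where "f r = 2 / r - 8 * y / r\<^sup>2" for r :: real
  have "((\<lambda>r. 2 * ln r + 8 * y * inverse r) has_vector_derivative f r) (at r within {y..x})" if "y \<le> r" for r
  proof -
    have "((\<lambda>r. 2 * ln r + 8 * y * inverse r) has_real_derivative f r) (at r)"
      using that y unfolding f_def
      by (auto intro!: derivative_eq_intros simp: power2_eq_square divide_inverse)
    then show ?thesis
      unfolding has_real_derivative_iff_has_vector_derivative[symmetric]
      by (rule has_field_derivative_at_within)
  qed
  moreover have fc: "continuous_on {y..x} f"
    unfolding f_def using y by (intro continuous_intros) auto
  ultimately have int: "(\<integral>r. indicator {y..x} r *\<^sub>R f r \<partial>lborel) = (2 * ln x + 8 * y * inverse x) - (2 * ln y + 8 * y * inverse y)"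
    using x by (intro integral_FTC_Icc) auto
  have "2 * ln (x / y) - 8 \<le> (\<integral>r. indicator {y..x} r *\<^sub>R f r \<partial>lborel)"
  proof -
    have "8 * y * inverse x \<ge> 0" "8 * y * inverse y = 8" using x y by auto
    moreover have "ln (x / y) = ln x - ln y" using x y by (simp add: ln_div)
    ultimately show ?thesis unfolding int by linarith
  qed
  also have "\<dots> \<le> (\<integral>r. slope r * poisson_tail x y r - slope r * poisson_tail y y r \<partial>lborel)"
  proof (intro integral_mono Bochner_Integration.integrable_diff integrable_slope_tail y)
    show "integrable lborel (\<lambda>r. indicator {y..x} r *\<^sub>R f r)"
      using borel_integrable_atLeastAtMost'[OF fc] by (simp add: set_integrable_def)
    fix r
    show "indicator {y..x} r *\<^sub>R f r \<le> slope r * poisson_tail x y r - slope r * poisson_tail y y r"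
    proof (cases "r \<in> {y..x}")
      case True
      then have r: "y \<le> r" "r \<le> x" "r > 0" using y by auto
      define D where "D = poisson_tail x y r - poisson_tail y y r"
      have D0: "D \<ge> 0" unfolding D_def using poisson_tail_mono[of y r y x] r y x by simp
      have D1: "D \<ge> 1 / 2 - 2 * y / r"
        unfolding D_def using poisson_tail_ge_half[OF y r(2)] poisson_tail_diagonal_le[OF y r(1)] by linarith
      have "f r = (4 / r) * (1 / 2 - 2 * y / r)"
        using r by (simp add: f_def field_simps power2_eq_square)
      also have "\<dots> \<le> (4 / r) * D" using D1 r by (intro mult_left_mono) auto
      also have "\<dots> \<le> slope r * D" using sl[OF r(1)] D0 by (intro mult_right_mono) auto
      finally show ?thesis using True by (simp add: D_def right_diff_distrib)
    next
      case False
      have "slope r * poisson_tail x y r \<ge> slope r * poisson_tail y y r"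
        using x y poisson_tail_mono[of y r y x] slope_nonneg[of r]
        by (cases "r > 0") (auto simp: slope_def intro!: mult_left_mono)
      then show ?thesis using False by simp
    qed
  qed
  also have "\<dots> = U x y - U y y"
    using integrable_slope_tail[OF y] by (simp add: U_eq[OF y])
  finally show ?thesis .
qed

end

section \<open>Expansion of log W at a point of the imaginary axis\<close>

lemma integral_odd_conj:
  fixes f :: "real \<Rightarrow> complex"
  assumes "\<And>t. f (- t) = - cnj (f t)"
  shows "Re (\<integral>t. f t \<partial>lborel) = 0"
proof -
  have "(\<integral>t. f t \<partial>lborel) = (\<integral>t. f (- t) \<partial>lborel)"
    by (subst lborel_integral_real_affine[of "-1" _ 0]) auto
  also have "\<dots> = - cnj (\<integral>t. f t \<partial>lborel)"
    by (simp add: assms integral_cnj)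
  finally have "Re (\<integral>t. f t \<partial>lborel) = Re (- cnj (\<integral>t. f t \<partial>lborel))" by simp
  then show ?thesis by simp
qed

lemma integral_even_conj:
  fixes f :: "real \<Rightarrow> complex"
  assumes "\<And>t. f (- t) = cnj (f t)"
  shows "Im (\<integral>t. f t \<partial>lborel) = 0"
proof -
  have "(\<integral>t. f t \<partial>lborel) = (\<integral>t. f (- t) \<partial>lborel)"
    by (subst lborel_integral_real_affine[of "-1" _ 0]) auto
  also have "\<dots> = cnj (\<integral>t. f t \<partial>lborel)"
    by (simp add: assms integral_cnj)
  finally have "Im (\<integral>t. f t \<partial>lborel) = Im (cnj (\<integral>t. f t \<partial>lborel))" by simp
  then show ?thesis by simp
qed

context log_weight
begin

text \<open>
  The saddle point parametrizes \<open>s = dP y = (log |W(iy)|)'\<close>; in terms of it \<open>Q(s) = q y\<close> and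
  \<open>Q''(s) = 1 / sig2 y\<close>.
\<close>

definition dP :: "real \<Rightarrow> real" where
  "dP y = Re (cauchy_power 2 (Complex 0 y)) / pi"

definition sig2 :: "real \<Rightarrow> real" where
  "sig2 y = 2 * Im (cauchy_power 3 (Complex 0 y)) / pi"

definition q :: "real \<Rightarrow> real" where
  "q y = U 0 y - y * dP y"

text \<open>Evenness of \<open>\<phi>\<close> and the symmetry of the imaginary axis under t to -t
  conjugate the integrand, up to the sign (-1)^n, so order 2 is real and order 3 purely
  imaginary.\<close>

lemma cauchy_power_2_eq: "cauchy_power 2 (Complex 0 y) = of_real (pi * dP y)"
proof -
  have e: "complex_of_real (- t) - Complex 0 y = - cnj (complex_of_real t - Complex 0 y)" for t
    by (simp add: complex_eq_iff)
  have "Im (cauchy_power 2 (Complex 0 y)) = 0"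
    unfolding cauchy_power_def
    by (intro integral_even_conj) (simp only: e even power2_minus complex_cnj_divide complex_cnj_power complex_cnj_complex_of_real)
  then show ?thesis by (simp add: complex_eq_iff dP_def)
qed

lemma cauchy_power_3_eq: "cauchy_power 3 (Complex 0 y) = \<i> * of_real (pi * sig2 y / 2)"
proof -
  have e: "complex_of_real (- t) - Complex 0 y = - cnj (complex_of_real t - Complex 0 y)" for t
    by (simp add: complex_eq_iff)
  have "Re (cauchy_power 3 (Complex 0 y)) = 0"
    unfolding cauchy_power_def
  proof (rule integral_odd_conj)
    fix t
    have "(- c) ^ 3 = - (c ^ 3)" for c :: complex by (simp add: power3_eq_cube)
    then show "complex_of_real (\<phi> (- t)) / (complex_of_real (- t) - Complex 0 y) ^ 3
      = - cnj (complex_of_real (\<phi> t) / (complex_of_real t - Complex 0 y) ^ 3)"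
      by (simp only: e even complex_cnj_divide complex_cnj_power complex_cnj_complex_of_real divide_minus_right)
  qed
  then show ?thesis by (simp add: complex_eq_iff sig2_def)
qed

lemma outer_exponent_imaginary: "y > 0 \<Longrightarrow> outer_exponent (Complex 0 y) = of_real (U 0 y)"
proof -
  assume y: "y > 0"
  have e: "(1 / (complex_of_real (- t) - Complex 0 y) - of_real ((- t) / ((- t)\<^sup>2 + 1))) * of_real (\<phi> (- t))
    = - cnj ((1 / (complex_of_real t - Complex 0 y) - of_real (t / (t\<^sup>2 + 1))) * of_real (\<phi> t))" for t
  proof -
    have "complex_of_real (- t) - Complex 0 y = - cnj (complex_of_real t - Complex 0 y)"
      by (simp add: complex_eq_iff)
    then show ?thesis
      by (simp only: even power2_minus divide_minus_right complex_cnj_mult complex_cnj_diff complex_cnj_divide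
          complex_cnj_one complex_cnj_complex_of_real) (simp add: algebra_simps)
  qed
  have "Re (\<integral>t. (1 / (of_real t - Complex 0 y) - of_real (t / (t\<^sup>2 + 1))) * of_real (\<phi> t) \<partial>lborel) = 0"
    by (rule integral_odd_conj) (rule e)
  then have "Im (outer_exponent (Complex 0 y)) = 0"
    by (simp add: outer_exponent_def Im_divide)
  moreover have "Re (outer_exponent (Complex 0 y)) = U 0 y"
    using y by (simp add: Re_outer_exponent U_def)
  ultimately show ?thesis by (simp add: complex_eq_iff)
qed

lemma DERIV_U:
  assumes y: "y > 0"
  shows "((\<lambda>y. U 0 y) has_real_derivative dP y) (at y)"
proof -
  have "((\<lambda>y. outer_exponent (Complex 0 y)) has_vector_derivative \<i> * (1 / (of_real pi * \<i>) * cauchy_power 2 (Complex 0 y))) (at y)"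
    by (intro has_vector_derivative_vertical DERIV_outer_exponent) (use y in simp)
  then have "((\<lambda>y. Re (outer_exponent (Complex 0 y))) has_vector_derivative
      Re (\<i> * (1 / (of_real pi * \<i>) * cauchy_power 2 (Complex 0 y)))) (at y)"
    by (rule bounded_linear.has_vector_derivative[OF bounded_linear_Re])
  moreover have "Re (\<i> * (1 / (of_real pi * \<i>) * cauchy_power 2 (Complex 0 y))) = dP y"
    by (simp add: cauchy_power_2_eq)
  ultimately have "((\<lambda>y. Re (outer_exponent (Complex 0 y))) has_real_derivative dP y) (at y)"
    by (simp add: has_real_derivative_iff_has_vector_derivative)
  then show ?thesis
  proof (rule has_field_derivative_transform_within)
    show "dist v y < y \<Longrightarrow> Re (outer_exponent (Complex 0 v)) = U 0 v" for v
      using y by (simp add: outer_exponent_imaginary dist_real_def)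
  qed (use y in auto)
qed

lemma DERIV_dP:
  assumes y: "y > 0"
  shows "(dP has_real_derivative - sig2 y) (at y)"
proof -
  have "((\<lambda>y. cauchy_power 2 (Complex 0 y)) has_vector_derivative \<i> * (2 * cauchy_power 3 (Complex 0 y))) (at y)"
    by (intro has_vector_derivative_vertical DERIV_cauchy_power_2) (use y in simp)
  then have "((\<lambda>y. Re (cauchy_power 2 (Complex 0 y))) has_vector_derivative
      Re (\<i> * (2 * cauchy_power 3 (Complex 0 y)))) (at y)"
    by (rule bounded_linear.has_vector_derivative[OF bounded_linear_Re])
  then have "((\<lambda>y. Re (cauchy_power 2 (Complex 0 y))) has_real_derivative - (pi * sig2 y)) (at y)"
    by (simp add: has_real_derivative_iff_has_vector_derivative cauchy_power_3_eq)
  from DERIV_cdivide[OF this, of pi] show ?thesis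
    by (simp add: dP_def[abs_def])
qed

lemma DERIV_q: "y > 0 \<Longrightarrow> (q has_real_derivative y * sig2 y) (at y)"
  unfolding q_def[abs_def]
  by (auto intro!: derivative_eq_intros DERIV_U DERIV_dP)

lemma integrable_fourth:
  assumes y: "y > 0"
  shows "integrable lborel (\<lambda>t. \<phi> t / (t\<^sup>2 + y\<^sup>2)\<^sup>2)"
proof (rule Bochner_Integration.integrable_bound)
  show "integrable lborel (\<lambda>t. 1 / y\<^sup>2 * (\<bar>\<phi> t\<bar> / (norm (complex_of_real t - Complex 0 y))\<^sup>2))"
    by (intro integrable_mult_right integrable_over_norm_squared) (use y in simp)
  show "AE t in lborel. norm (\<phi> t / (t\<^sup>2 + y\<^sup>2)\<^sup>2) \<le> norm (1 / y\<^sup>2 * (\<bar>\<phi> t\<bar> / (norm (complex_of_real t - Complex 0 y))\<^sup>2))"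
  proof (rule AE_I2)
    fix t
    have p: "t\<^sup>2 + y\<^sup>2 > 0" using y by (simp add: add_nonneg_pos)
    have "y\<^sup>2 * (t\<^sup>2 + y\<^sup>2) \<le> (t\<^sup>2 + y\<^sup>2)\<^sup>2"
      unfolding power2_eq_square[of "t\<^sup>2 + y\<^sup>2"] using p by (intro mult_right_mono) auto
    then have "\<phi> t / (t\<^sup>2 + y\<^sup>2)\<^sup>2 \<le> \<phi> t / (y\<^sup>2 * (t\<^sup>2 + y\<^sup>2))"
      using p y nonneg by (intro divide_left_mono mult_pos_pos) auto
    then show "norm (\<phi> t / (t\<^sup>2 + y\<^sup>2)\<^sup>2) \<le> norm (1 / y\<^sup>2 * (\<bar>\<phi> t\<bar> / (norm (complex_of_real t - Complex 0 y))\<^sup>2))"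
      using nonneg[of t] p by (simp add: norm_of_real_diff_squared abs_mult)
  qed
qed measurable

text \<open>The kernels of U and y U' combine by 1 / D - (t^2 - y^2) / D^2 = 2 y^2 / D^2 with D =
  t^2 + y^2. The positive kernel is what allows q to be compared with the Taylor remainder, with
  \<open>\<phi>\<close> and with the moment in (v).\<close>

lemma q_eq:
  assumes y: "y > 0"
  shows "q y = 2 * y ^ 3 / pi * (\<integral>t. \<phi> t / (t\<^sup>2 + y\<^sup>2)\<^sup>2 \<partial>lborel)"
proof -
  let ?z = "Complex 0 y"
  have z: "Im ?z > 0" using y by simp
  have C2: "integrable lborel (\<lambda>t. complex_of_real (\<phi> t) / (complex_of_real t - ?z)\<^sup>2)"
    by (rule integrable_cauchy_power[OF z]) simp
  have "dP y = (\<integral>t. Re (complex_of_real (\<phi> t) / (complex_of_real t - ?z)\<^sup>2) / pi \<partial>lborel)"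
    using C2 by (simp add: dP_def cauchy_power_def integral_Re)
  moreover have i1: "integrable lborel (\<lambda>t. poisson ?z t * \<phi> t)" by (rule integrable_poisson_mult[OF z])
  moreover have i2: "integrable lborel (\<lambda>t. y * (Re (complex_of_real (\<phi> t) / (complex_of_real t - ?z)\<^sup>2) / pi))"
    using C2 by (intro integrable_mult_right integrable_divide integrable_Re)
  ultimately have "q y = (\<integral>t. poisson ?z t * \<phi> t - y * (Re (complex_of_real (\<phi> t) / (complex_of_real t - ?z)\<^sup>2) / pi) \<partial>lborel)"
    unfolding q_def U_def by (simp only: Bochner_Integration.integral_diff[OF i1 i2] integral_mult_right_zero)
  also have "(\<lambda>t. poisson ?z t * \<phi> t - y * (Re (complex_of_real (\<phi> t) / (complex_of_real t - ?z)\<^sup>2) / pi))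
    = (\<lambda>t. 2 * y ^ 3 / pi * (\<phi> t / (t\<^sup>2 + y\<^sup>2)\<^sup>2))"
  proof
    fix t
    define w where "w = (complex_of_real t - ?z)\<^sup>2"
    define D where "D = t\<^sup>2 + y\<^sup>2"
    have D: "D > 0" using y by (simp add: D_def add_nonneg_pos)
    have w: "Re w = t\<^sup>2 - y\<^sup>2" "Im w = - 2 * t * y"
      by (simp_all add: w_def power2_eq_square)
    have "(Re w)\<^sup>2 + (Im w)\<^sup>2 = D\<^sup>2"
      unfolding w D_def by (simp add: power2_eq_square algebra_simps)
    then have "Re (complex_of_real (\<phi> t) / w) = \<phi> t * (t\<^sup>2 - y\<^sup>2) / D\<^sup>2"
      by (simp add: Re_divide w)
    moreover have "poisson ?z t = y / (pi * D)" by (simp add: poisson_def D_def)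
    moreover have "y / (pi * D) * f - y * ((f * e / D') / pi) = (f * y / pi) * (1 / D - e / D')" for f e D' :: real
      by (simp add: right_diff_distrib mult.commute)
    ultimately have "poisson ?z t * \<phi> t - y * (Re (complex_of_real (\<phi> t) / w) / pi)
      = (\<phi> t * y / pi) * (1 / D - (t\<^sup>2 - y\<^sup>2) / D\<^sup>2)"
      by (simp only:)
    also have "1 / D - (t\<^sup>2 - y\<^sup>2) / D\<^sup>2 = (D - (t\<^sup>2 - y\<^sup>2)) / D\<^sup>2"
      using D by (simp add: diff_divide_distrib power2_eq_square)
    also have "D - (t\<^sup>2 - y\<^sup>2) = 2 * y\<^sup>2" by (simp add: D_def)
    finally show "poisson ?z t * \<phi> t - y * (Re (complex_of_real (\<phi> t) / (complex_of_real t - ?z)\<^sup>2) / pi)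
      = 2 * y ^ 3 / pi * (\<phi> t / (t\<^sup>2 + y\<^sup>2)\<^sup>2)"
      by (simp add: w_def D_def power2_eq_square power3_eq_cube)
  qed
  finally show ?thesis by (simp only: integral_mult_right_zero)
qed

lemma q_nonneg: "y > 0 \<Longrightarrow> q y \<ge> 0"
  unfolding q_eq using nonneg by (intro mult_nonneg_nonneg integral_nonneg_AE AE_I2) auto

text \<open>The kernel of sig2 has numerator 3 t^2 - y^2, at most 3 (t^2 + y^2), which leaves the
  kernel of q. This limits how large the curvature can be in the lower bound for
  \<open>rho\<close>.\<close>

lemma sig2_le:
  assumes y: "y > 0"
  shows "sig2 y * y\<^sup>2 \<le> 3 * q y"
proof -
  let ?z = "Complex 0 y"
  have z: "Im ?z > 0" using y by simp
  have C3: "integrable lborel (\<lambda>t. complex_of_real (\<phi> t) / (complex_of_real t - ?z) ^ 3)"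
    by (rule integrable_cauchy_power[OF z]) simp
  have "Im (cauchy_power 3 ?z) = (\<integral>t. Im (complex_of_real (\<phi> t) / (complex_of_real t - ?z) ^ 3) \<partial>lborel)"
    using C3 by (simp add: cauchy_power_def integral_Im)
  also have "\<dots> \<le> (\<integral>t. 3 * y * (\<phi> t / (t\<^sup>2 + y\<^sup>2)\<^sup>2) \<partial>lborel)"
  proof (intro integral_mono integrable_mult_right integrable_fourth y integrable_Im C3)
    fix t
    define w where "w = (complex_of_real t - ?z) ^ 3"
    define D where "D = t\<^sup>2 + y\<^sup>2"
    have D: "D > 0" using y by (simp add: D_def add_nonneg_pos)
    have w: "Re w = t ^ 3 - 3 * t * y\<^sup>2" "Im w = y ^ 3 - 3 * t\<^sup>2 * y"
      by (simp_all add: w_def power3_eq_cube power2_eq_square algebra_simps)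
    have "(Re w)\<^sup>2 + (Im w)\<^sup>2 = D ^ 3"
      unfolding w D_def by (simp add: power2_eq_square power3_eq_cube algebra_simps)
    then have "Im (complex_of_real (\<phi> t) / w) = - \<phi> t * Im w / D ^ 3"
      by (simp add: Im_divide)
    moreover have "- \<phi> t * Im w = \<phi> t * (y * (3 * t\<^sup>2 - y\<^sup>2))"
      unfolding w(2) by (simp add: algebra_simps power2_eq_square power3_eq_cube)
    ultimately have "Im (complex_of_real (\<phi> t) / w) = \<phi> t * (y * (3 * t\<^sup>2 - y\<^sup>2)) / D ^ 3"
      by (simp only:)
    also have "\<dots> \<le> \<phi> t * (y * (3 * D)) / D ^ 3"
      using nonneg y D by (intro divide_right_mono mult_left_mono) (auto simp: D_def)
    also have "\<dots> = 3 * y * (\<phi> t / D\<^sup>2)"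
      using D by (simp add: power2_eq_square power3_eq_cube)
    finally show "Im (complex_of_real (\<phi> t) / (complex_of_real t - ?z) ^ 3) \<le> 3 * y * (\<phi> t / (t\<^sup>2 + y\<^sup>2)\<^sup>2)"
      by (simp add: w_def D_def)
  qed
  also have "\<dots> = 3 * y * (\<integral>t. \<phi> t / (t\<^sup>2 + y\<^sup>2)\<^sup>2 \<partial>lborel)" by (rule integral_mult_right_zero)
  finally have "2 * y\<^sup>2 / pi * Im (cauchy_power 3 ?z) \<le> 2 * y\<^sup>2 / pi * (3 * y * (\<integral>t. \<phi> t / (t\<^sup>2 + y\<^sup>2)\<^sup>2 \<partial>lborel))"
    by (intro mult_left_mono) auto
  also have "\<dots> = 3 * q y"
    by (simp add: q_eq[OF y] power2_eq_square power3_eq_cube)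
  finally show ?thesis by (simp add: sig2_def mult_ac)
qed

text \<open>With u = t - iy the remainder of the kernel is exactly x^3 / (u^3 (u - x)). Since |x| is
  at most y / 2, hence at most |u| / 2, its modulus is at most 2 |x|^3 / (t^2 + y^2)^2, and
  integration against \<open>\<phi>\<close> gives q. The sign of the quadratic term comes from
  harmonicity of U.\<close>

lemma outer_exponent_taylor:
  assumes y: "y > 0" and x: "\<bar>x\<bar> \<le> y / 2"
  shows "norm (outer_exponent (Complex x y) - (of_real (U 0 y + sig2 y * x\<^sup>2 / 2) - \<i> * of_real (x * dP y)))
    \<le> \<bar>x\<bar> ^ 3 * q y / y ^ 3"
proof -
  let ?z = "Complex 0 y" and ?w = "Complex x y"
  have z: "Im ?z > 0" "Im ?w > 0" using y by auto
  let ?K = "\<lambda>z t. (1 / (complex_of_real t - z) - of_real (t / (t\<^sup>2 + 1))) * complex_of_real (\<phi> t)"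
  let ?C = "\<lambda>n t. complex_of_real (\<phi> t) / (complex_of_real t - ?z) ^ n"
  define R where "R t = ?K ?w t - ?K ?z t - of_real x * ?C 2 t - of_real (x\<^sup>2) * ?C 3 t" for t
  have int: "integrable lborel (?K ?w)" "integrable lborel (?K ?z)" "integrable lborel (?C 2)" "integrable lborel (?C 3)"
    using integrable_outer_kernel[OF z(2)] integrable_outer_kernel[OF z(1)]
      integrable_cauchy_power[OF z(1), of 2] integrable_cauchy_power[OF z(1), of 3] by simp_all
  have R_int: "(\<integral>t. R t \<partial>lborel) = (\<integral>t. ?K ?w t \<partial>lborel) - (\<integral>t. ?K ?z t \<partial>lborel)
     - of_real x * cauchy_power 2 ?z - of_real (x\<^sup>2) * cauchy_power 3 ?z"
    unfolding R_def cauchy_power_def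
    by (simp only: Bochner_Integration.integral_diff integral_mult_right_zero integrable_mult_right
        Bochner_Integration.integrable_diff int)
  have "outer_exponent ?w - (of_real (U 0 y + sig2 y * x\<^sup>2 / 2) - \<i> * of_real (x * dP y))
     = 1 / (of_real pi * \<i>) * (\<integral>t. R t \<partial>lborel)"
  proof -
    have a: "1 / (of_real pi * \<i>) * (\<integral>t. ?K ?w t \<partial>lborel) = outer_exponent ?w" by (simp add: outer_exponent_def)
    have b: "1 / (of_real pi * \<i>) * (\<integral>t. ?K ?z t \<partial>lborel) = of_real (U 0 y)"
      using outer_exponent_imaginary[OF y] by (simp add: outer_exponent_def)
    have c: "1 / (of_real pi * \<i>) * (of_real x * cauchy_power 2 ?z) = - \<i> * of_real (x * dP y)"
      by (simp add: cauchy_power_2_eq divide_simps)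
    have d: "1 / (of_real pi * \<i>) * (of_real (x\<^sup>2) * cauchy_power 3 ?z) = of_real (sig2 y * x\<^sup>2 / 2)"
      by (simp add: cauchy_power_3_eq divide_simps)
    show ?thesis
      unfolding R_int right_diff_distrib a b c d by (simp add: algebra_simps)
  qed
  then have "norm (outer_exponent ?w - (of_real (U 0 y + sig2 y * x\<^sup>2 / 2) - \<i> * of_real (x * dP y)))
     = 1 / pi * norm (\<integral>t. R t \<partial>lborel)"
    by (simp add: norm_mult norm_divide)
  also have "\<dots> \<le> 1 / pi * (\<integral>t. norm (R t) \<partial>lborel)"
    by (intro mult_left_mono integral_norm_bound) auto
  also have "\<dots> \<le> 1 / pi * (\<integral>t. 2 * \<bar>x\<bar> ^ 3 * (\<phi> t / (t\<^sup>2 + y\<^sup>2)\<^sup>2) \<partial>lborel)"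
  proof (intro mult_left_mono integral_mono integrable_norm integrable_mult_right integrable_fourth y)
    show "integrable lborel R"
      unfolding R_def by (intro Bochner_Integration.integrable_diff integrable_mult_right int)
    fix t
    define u where "u = complex_of_real t - ?z"
    have u2: "(norm u)\<^sup>2 = t\<^sup>2 + y\<^sup>2" by (simp add: u_def norm_of_real_diff_squared)
    have uy: "norm u \<ge> y" using norm_of_real_diff_ge[OF z(1), of t] by (simp add: u_def)
    have "norm (u - of_real x) \<ge> norm u - \<bar>x\<bar>"
      using norm_triangle_ineq2[of u "of_real x"] by simp
    then have ux: "norm (u - of_real x) \<ge> norm u / 2" using x uy by linarith
    have ne: "u \<noteq> 0" "u - of_real x \<noteq> 0" using ux uy y by auto
    have "complex_of_real t - ?w = u - of_real x" by (simp add: u_def complex_eq_iff)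
    then have "R t = (1 / (u - of_real x) - 1 / u - of_real x / u\<^sup>2 - of_real (x\<^sup>2) / u ^ 3) * of_real (\<phi> t)"
      by (simp add: R_def u_def[symmetric] algebra_simps)
    also have "1 / (u - of_real x) - 1 / u - of_real x / u\<^sup>2 - of_real (x\<^sup>2) / u ^ 3 = of_real x ^ 3 / (u ^ 3 * (u - of_real x))"
      using ne by (simp add: divide_simps) (simp add: algebra_simps power2_eq_square power3_eq_cube)
    finally have "norm (R t) = \<bar>x\<bar> ^ 3 * \<phi> t / (norm u ^ 3 * norm (u - of_real x))"
      using nonneg[of t] by (simp add: norm_mult norm_divide norm_power)
    also have "\<dots> \<le> \<bar>x\<bar> ^ 3 * \<phi> t / (norm u ^ 3 * (norm u / 2))"
      using ux ne nonneg[of t] by (intro divide_left_mono mult_left_mono mult_pos_pos) auto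
    also have "\<dots> = 2 * \<bar>x\<bar> ^ 3 * (\<phi> t / ((norm u)\<^sup>2)\<^sup>2)"
      by (simp add: power2_eq_square power3_eq_cube mult_ac)
    finally show "norm (R t) \<le> 2 * \<bar>x\<bar> ^ 3 * (\<phi> t / (t\<^sup>2 + y\<^sup>2)\<^sup>2)" by (simp only: u2)
  qed auto
  also have "\<dots> = \<bar>x\<bar> ^ 3 * q y / y ^ 3"
    unfolding integral_mult_right_zero using y by (simp add: q_eq[OF y])
  finally show ?thesis .
qed

lemma U_eq_Re: "y > 0 \<Longrightarrow> U x y = Re (outer_exponent (Complex x y))"
  by (simp add: Re_outer_exponent U_def)

text \<open>Two descriptions of U(x, y) - U(0, y) are compared: the Taylor expansion with cubic
  error and the two-sided quadratic bounds from the tails. Division by x^2 and x tending to 0 give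
  the constants.\<close>

lemma sig2_curvature_bound:
  assumes y: "y > 0"
  shows "2 / (3 * pi) * curvature_bound y \<le> sig2 y" and "sig2 y \<le> 12 / pi * curvature_bound y"
proof -
  have tay: "\<bar>U x y - U 0 y - sig2 y * x\<^sup>2 / 2\<bar> \<le> x ^ 3 * q y / y ^ 3" if "0 \<le> x" "x \<le> y / 2" for x
  proof -
    have "\<bar>Re (outer_exponent (Complex x y) - (of_real (U 0 y + sig2 y * x\<^sup>2 / 2) - \<i> * of_real (x * dP y)))\<bar>
      \<le> norm (outer_exponent (Complex x y) - (of_real (U 0 y + sig2 y * x\<^sup>2 / 2) - \<i> * of_real (x * dP y)))"
      by (rule abs_Re_le_cmod)
    also have "\<dots> \<le> \<bar>x\<bar> ^ 3 * q y / y ^ 3" using that by (intro outer_exponent_taylor y) auto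
    finally show ?thesis using that by (simp add: U_eq_Re[OF y, of x])
  qed
  have lim: "((\<lambda>x. c + x * q y / y ^ 3) \<longlongrightarrow> c + 0 * q y / y ^ 3) (at_right 0)" for c
    by (intro tendsto_intros) (use y in auto)
  have ev: "eventually (\<lambda>x. 0 < x \<and> x < y / 2) (at_right 0)"
    using y by (auto simp: eventually_at_right_field intro!: exI[of _ "y / 2"])
  have 1: "1 / (3 * pi) * curvature_bound y \<le> sig2 y / 2 + x * q y / y ^ 3"
    and 2: "sig2 y / 2 \<le> 6 / pi * curvature_bound y + x * q y / y ^ 3" if "0 < x \<and> x < y / 2" for x
  proof -
    have x: "0 \<le> x" "x \<le> y" "x \<le> y / 2" "x\<^sup>2 > 0" using that by auto
    have e: "x ^ 3 * q y / y ^ 3 = x\<^sup>2 * (x * q y / y ^ 3)" by (simp add: power2_eq_square power3_eq_cube)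
    have "1 / (3 * pi) * x\<^sup>2 * curvature_bound y \<le> sig2 y * x\<^sup>2 / 2 + x\<^sup>2 * (x * q y / y ^ 3)"
      using tay[OF x(1,3)] U_increment(1)[OF y x(1,2)] unfolding e by linarith
    then have "x\<^sup>2 * (1 / (3 * pi) * curvature_bound y) \<le> x\<^sup>2 * (sig2 y / 2 + x * q y / y ^ 3)"
      by (simp add: algebra_simps)
    then show "1 / (3 * pi) * curvature_bound y \<le> sig2 y / 2 + x * q y / y ^ 3"
      using x(4) by (rule mult_left_le_imp_le)
    have "sig2 y * x\<^sup>2 / 2 \<le> 6 / pi * x\<^sup>2 * curvature_bound y + x\<^sup>2 * (x * q y / y ^ 3)"
      using tay[OF x(1,3)] U_increment(2)[OF y x(1,2)] unfolding e by linarith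
    then have "x\<^sup>2 * (sig2 y / 2) \<le> x\<^sup>2 * (6 / pi * curvature_bound y + x * q y / y ^ 3)"
      by (simp add: algebra_simps)
    then show "sig2 y / 2 \<le> 6 / pi * curvature_bound y + x * q y / y ^ 3"
      using x(4) by (rule mult_left_le_imp_le)
  qed
  have "1 / (3 * pi) * curvature_bound y \<le> sig2 y / 2 + 0 * q y / y ^ 3"
    by (rule tendsto_lowerbound[OF lim]) (use ev 1 in \<open>auto elim: eventually_mono\<close>)
  then show "2 / (3 * pi) * curvature_bound y \<le> sig2 y" by simp
  have "sig2 y / 2 \<le> 6 / pi * curvature_bound y + 0 * q y / y ^ 3"
    by (rule tendsto_lowerbound[OF lim]) (use ev 2 in \<open>auto elim: eventually_mono\<close>)
  then show "sig2 y \<le> 12 / pi * curvature_bound y" by simp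
qed

lemma curvature_bound_nonneg: "y > 0 \<Longrightarrow> curvature_bound y \<ge> 0"
  unfolding curvature_bound_def
proof (intro integral_nonneg_AE AE_I2)
  fix r assume "y > 0"
  then show "0 \<le> slope r * (r * y / (r\<^sup>2 + y\<^sup>2)\<^sup>2)"
    using slope_nonneg[of r] by (cases "r > 0") (auto simp: slope_def intro!: mult_nonneg_nonneg)
qed

lemma sig2_nonneg: "y > 0 \<Longrightarrow> sig2 y \<ge> 0"
  using sig2_curvature_bound(1)[of y] curvature_bound_nonneg[of y]
  by (meson divide_nonneg_pos mult_nonneg_nonneg order_trans pi_gt_zero mult_pos_pos zero_le_numeral zero_less_numeral)

text \<open>The constant is 1 / (3 pi) times pi / 12. The bound holds up to |x| = y, so it dominates
  the integrand also where the Taylor remainder is not small.\<close>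

lemma U_quadratic_lower:
  assumes y: "y > 0" and x: "\<bar>x\<bar> \<le> y"
  shows "U x y - U 0 y \<ge> sig2 y * x\<^sup>2 / 36"
proof -
  have "curvature_bound y \<ge> pi / 12 * sig2 y"
    using sig2_curvature_bound(2)[OF y] by (simp add: field_simps)
  then have "1 / (3 * pi) * x\<^sup>2 * (pi / 12 * sig2 y) \<le> 1 / (3 * pi) * x\<^sup>2 * curvature_bound y"
    by (intro mult_left_mono) auto
  also have "\<dots> \<le> U \<bar>x\<bar> y - U 0 y"
    using U_increment(1)[OF y, of "\<bar>x\<bar>"] x by simp
  finally show ?thesis by (simp add: U_abs[OF y] mult_ac)
qed

section \<open>Comparison of the curvature and of q with the weight and the moment in (v)\<close>

lemma curvature_bound_ge:
  assumes y: "y > 0" and a: "a > 0" and m: "m \<ge> 0" "\<And>r. a \<le> r \<Longrightarrow> r \<le> 2 * a \<Longrightarrow> r * slope r \<ge> m"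
  shows "curvature_bound y \<ge> a * m * y / (4 * a\<^sup>2 + y\<^sup>2)\<^sup>2"
proof -
  define c where "c = m * y / (4 * a\<^sup>2 + y\<^sup>2)\<^sup>2"
  have "a * c = (\<integral>r. c * indicator {a..2 * a} r \<partial>lborel)" using a by simp
  also have "\<dots> \<le> curvature_bound y"
    unfolding curvature_bound_def
  proof (intro integral_mono integrable_curvature_bound y integrable_mult_right integrable_indicator_Icc)
    fix r
    show "c * indicator {a..2 * a} r \<le> slope r * (r * y / (r\<^sup>2 + y\<^sup>2)\<^sup>2)"
    proof (cases "r \<in> {a..2 * a}")
      case True
      have "r\<^sup>2 \<le> (2 * a)\<^sup>2" using True a by (intro power_mono) auto
      then have le: "r\<^sup>2 + y\<^sup>2 \<le> 4 * a\<^sup>2 + y\<^sup>2" by (simp add: power_mult_distrib)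
      have p: "r\<^sup>2 + y\<^sup>2 > 0" using y by (simp add: add_nonneg_pos)
      have "c \<le> m * y / (r\<^sup>2 + y\<^sup>2)\<^sup>2"
        unfolding c_def using m y p le by (intro divide_left_mono power_mono mult_pos_pos zero_less_power) auto
      also have "\<dots> \<le> (r * slope r) * y / (r\<^sup>2 + y\<^sup>2)\<^sup>2"
        using m(2)[of r] True y by (intro divide_right_mono mult_right_mono) auto
      finally show ?thesis using True by (simp add: mult_ac)
    next
      case False
      have "0 \<le> slope r * (r * y / (r\<^sup>2 + y\<^sup>2)\<^sup>2)"
        using slope_nonneg[of r] y by (cases "r > 0") (auto simp: slope_def intro!: mult_nonneg_nonneg)
      then show ?thesis using False by simp
    qed
  qed
  finally show ?thesis by (simp add: c_def mult_ac)
qed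

lemma q_mono:
  assumes "0 < y" "y \<le> y'"
  shows "q y \<le> q y'"
proof (rule DERIV_nonneg_imp_nondecreasing[OF assms(2)])
  fix u assume "y \<le> u"
  with assms(1) show "\<exists>d. (q has_real_derivative d) (at u) \<and> 0 \<le> d"
    using DERIV_q[of u] sig2_nonneg[of u] by (intro exI[of _ "u * sig2 u"]) auto
qed

text \<open>Only t between y and 2 y is kept, where (t^2 + y^2)^2 <= 25 y^4; then 25 pi <= 80 gives
  the constant.\<close>

lemma q_ge_phi:
  assumes y: "y > 0"
  shows "q y \<ge> \<phi> y / 40"
proof -
  have "y * (\<phi> y / (25 * y ^ 4)) = (\<integral>t. \<phi> y / (25 * y ^ 4) * indicator {y..2 * y} t \<partial>lborel)"
    using y by simp
  also have "\<dots> \<le> (\<integral>t. \<phi> t / (t\<^sup>2 + y\<^sup>2)\<^sup>2 \<partial>lborel)"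
  proof (intro integral_mono integrable_fourth y integrable_mult_right integrable_indicator_Icc)
    fix t
    show "\<phi> y / (25 * y ^ 4) * indicator {y..2 * y} t \<le> \<phi> t / (t\<^sup>2 + y\<^sup>2)\<^sup>2"
    proof (cases "t \<in> {y..2 * y}")
      case True
      have p: "t\<^sup>2 + y\<^sup>2 > 0" using y by (simp add: add_nonneg_pos)
      have "t\<^sup>2 \<le> (2 * y)\<^sup>2" using True y by (intro power_mono) auto
      then have "t\<^sup>2 + y\<^sup>2 \<le> 5 * y\<^sup>2" by (simp add: power_mult_distrib)
      then have "(t\<^sup>2 + y\<^sup>2)\<^sup>2 \<le> (5 * y\<^sup>2)\<^sup>2" using p by (intro power_mono) auto
      then have "(t\<^sup>2 + y\<^sup>2)\<^sup>2 \<le> 25 * y ^ 4" by (simp add: power_mult_distrib)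
      then have "\<phi> y / (25 * y ^ 4) \<le> \<phi> t / (t\<^sup>2 + y\<^sup>2)\<^sup>2"
        using phi_mono[of y t] True y p nonneg by (intro frac_le) auto
      then show ?thesis using True by simp
    next
      case False then show ?thesis using nonneg by simp
    qed
  qed
  finally have "2 * y ^ 3 / pi * (y * (\<phi> y / (25 * y ^ 4))) \<le> q y"
    unfolding q_eq[OF y] using y by (intro mult_left_mono) auto
  also have "2 * y ^ 3 / pi * (y * (\<phi> y / (25 * y ^ 4))) = 2 * \<phi> y / (25 * pi)"
    using y by (simp add: power3_eq_cube power4_eq_xxxx)
  also have "\<phi> y / 40 \<le> 2 * \<phi> y / (25 * pi)"
  proof -
    have "25 * pi \<le> 80" using pi_less_4 pi_approx(2) by simp
    then have "2 * \<phi> y / 80 \<le> 2 * \<phi> y / (25 * pi)" using nonneg by (intro divide_left_mono) auto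
    then show ?thesis by simp
  qed
  finally show ?thesis .
qed

text \<open>The quantity whose power 2/3 is the denominator in (v).\<close>

definition tail_moment :: "real \<Rightarrow> real" where
  "tail_moment t = t ^ 3 * (LBINT \<xi>:{t..}. \<phi> \<xi> / \<xi> ^ 4)"

lemma integrable_tail_moment:
  assumes y: "y > 0"
  shows "integrable lborel (\<lambda>t. indicator {y..} t * (\<phi> t / t ^ 4))"
proof (rule integrable_weight_bound[where c="(1 / y\<^sup>2) * (1 + 1 / y\<^sup>2)"])
  fix t
  show "norm (indicator {y..} t * (\<phi> t / t ^ 4)) \<le> (1 / y\<^sup>2) * (1 + 1 / y\<^sup>2) * (\<bar>\<phi> t\<bar> / (t\<^sup>2 + 1))"
  proof (cases "t \<ge> y")
    case True
    have t: "t > 0" using True y by simp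
    have yt: "y\<^sup>2 \<le> t\<^sup>2" using True y by (intro power_mono) auto
    then have "1 \<le> t\<^sup>2 / y\<^sup>2" using y by simp
    then have "t\<^sup>2 + 1 \<le> (1 + 1 / y\<^sup>2) * t\<^sup>2" by (simp add: algebra_simps)
    then have "y\<^sup>2 * (t\<^sup>2 + 1) \<le> t\<^sup>2 * ((1 + 1 / y\<^sup>2) * t\<^sup>2)"
      using yt by (intro mult_mono) (auto simp: add_nonneg_nonneg)
    then have le: "y\<^sup>2 * (t\<^sup>2 + 1) \<le> (1 + 1 / y\<^sup>2) * t ^ 4"
      by (simp add: power4_eq_xxxx power2_eq_square mult_ac)
    have pos: "1 + 1 / y\<^sup>2 > 0" "y\<^sup>2 * (t\<^sup>2 + 1) > 0" "t\<^sup>2 + 1 > 0"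
      using y by (auto intro!: add_pos_nonneg mult_pos_pos add_nonneg_pos)
    have "1 / t ^ 4 = (1 + 1 / y\<^sup>2) / ((1 + 1 / y\<^sup>2) * t ^ 4)" using pos by simp
    also have "\<dots> \<le> (1 + 1 / y\<^sup>2) / (y\<^sup>2 * (t\<^sup>2 + 1))"
      using le pos t by (intro divide_left_mono mult_pos_pos) auto
    finally have "1 / t ^ 4 \<le> (1 / y\<^sup>2) * (1 + 1 / y\<^sup>2) / (t\<^sup>2 + 1)" by simp
    from mult_left_mono[OF this nonneg[of t]] show ?thesis
      using True nonneg[of t] t by (simp add: mult_ac)
  qed (simp add: add_nonneg_nonneg)
qed measurable

lemma phi_le_tail_moment:
  assumes y: "y > 0"
  shows "\<phi> y \<le> 16 * tail_moment y"
proof -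
  have "y * (\<phi> y / (16 * y ^ 4)) = (\<integral>t. \<phi> y / (16 * y ^ 4) * indicator {y..2 * y} t \<partial>lborel)"
    using y by simp
  also have "\<dots> \<le> (\<integral>t. indicator {y..} t * (\<phi> t / t ^ 4) \<partial>lborel)"
  proof (intro integral_mono integrable_tail_moment y integrable_mult_right integrable_indicator_Icc)
    fix t
    show "\<phi> y / (16 * y ^ 4) * indicator {y..2 * y} t \<le> indicator {y..} t * (\<phi> t / t ^ 4)"
    proof (cases "t \<in> {y..2 * y}")
      case True
      have "t ^ 4 \<le> (2 * y) ^ 4" using True y by (intro power_mono) auto
      then have "\<phi> y / (16 * y ^ 4) \<le> \<phi> t / t ^ 4"
        using phi_mono[of y t] True y nonneg by (intro frac_le) (auto simp: power_mult_distrib)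
      then show ?thesis using True by simp
    next
      case False then show ?thesis using nonneg by (simp add: indicator_def)
    qed
  qed
  finally have "16 * y ^ 3 * (y * (\<phi> y / (16 * y ^ 4))) \<le> 16 * y ^ 3 * (\<integral>t. indicator {y..} t * (\<phi> t / t ^ 4) \<partial>lborel)"
    using y by (intro mult_left_mono) auto
  then show ?thesis
    using y by (simp add: tail_moment_def set_lebesgue_integral_def power3_eq_cube power4_eq_xxxx)
qed

text \<open>The integral for q is split at |t| = y. The two outer parts give the moment; the inner
  part is at most a multiple of \<open>\<phi> y\<close> and is absorbed by
  \<open>phi_le_tail_moment\<close>. The constant is (4 * 16 + 4) / pi, below 22.\<close>

lemma q_le_tail_moment:
  assumes y: "y > 0"
  shows "q y \<le> 22 * tail_moment y"
proof -
  let ?f = "\<lambda>t. indicator {y..} t * (\<phi> t / t ^ 4)"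
  have i1: "integrable lborel ?f" by (rule integrable_tail_moment[OF y])
  have i2: "integrable lborel (\<lambda>t. ?f (- t))"
    using lborel_integrable_real_affine[OF i1, of "-1" 0] by simp
  have e2: "(\<integral>t. ?f (- t) \<partial>lborel) = (\<integral>t. ?f t \<partial>lborel)"
    by (subst (2) lborel_integral_real_affine[of "-1" _ 0]) auto
  have i3: "integrable lborel (\<lambda>t. \<phi> y / y ^ 4 * indicator {- y..y} t)"
    by (intro integrable_mult_right integrable_indicator_Icc)
  define J where "J = (\<integral>t. ?f t \<partial>lborel)"
  have J: "y ^ 3 * J = tail_moment y" by (simp add: J_def tail_moment_def set_lebesgue_integral_def)
  have "(\<integral>t. \<phi> t / (t\<^sup>2 + y\<^sup>2)\<^sup>2 \<partial>lborel) \<le> (\<integral>t. \<phi> y / y ^ 4 * indicator {- y..y} t + (?f t + ?f (- t)) \<partial>lborel)"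
  proof (intro integral_mono integrable_fourth y Bochner_Integration.integrable_add i1 i2 i3)
    fix t
    have nn: "?f t \<ge> 0" "?f (- t) \<ge> 0" "\<phi> y / y ^ 4 * indicator {- y..y} t \<ge> 0"
      using nonneg by (auto simp: indicator_def)
    have p: "t\<^sup>2 + y\<^sup>2 > 0" using y by (simp add: add_nonneg_pos)
    show "\<phi> t / (t\<^sup>2 + y\<^sup>2)\<^sup>2 \<le> \<phi> y / y ^ 4 * indicator {- y..y} t + (?f t + ?f (- t))"
    proof (cases "\<bar>t\<bar> \<le> y")
      case True
      have "(y\<^sup>2)\<^sup>2 \<le> (t\<^sup>2 + y\<^sup>2)\<^sup>2" by (intro power_mono) auto
      then have "y ^ 4 \<le> (t\<^sup>2 + y\<^sup>2)\<^sup>2" by simp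
      moreover have "\<phi> t \<le> \<phi> y" using phi_mono[of "\<bar>t\<bar>" y] True by (simp add: phi_abs)
      ultimately have "\<phi> t / (t\<^sup>2 + y\<^sup>2)\<^sup>2 \<le> \<phi> y / y ^ 4"
        using y nonneg by (intro frac_le) auto
      moreover have "t \<in> {- y..y}" using True by auto
      ultimately show ?thesis using nn by simp
    next
      case False
      have "(t\<^sup>2)\<^sup>2 \<le> (t\<^sup>2 + y\<^sup>2)\<^sup>2" by (intro power_mono) auto
      then have "t ^ 4 \<le> (t\<^sup>2 + y\<^sup>2)\<^sup>2" by simp
      moreover have "t \<noteq> 0" using False y by auto
      ultimately have le: "\<phi> t / (t\<^sup>2 + y\<^sup>2)\<^sup>2 \<le> \<phi> t / t ^ 4"
        using nonneg p by (intro divide_left_mono mult_pos_pos) auto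
      consider "t \<ge> y" | "- t \<ge> y" using False by linarith
      then have "\<phi> t / t ^ 4 \<le> ?f t + ?f (- t)"
      proof cases
        case 1 then have "?f t = \<phi> t / t ^ 4" by simp
        then show ?thesis using nn by linarith
      next
        case 2 then have "?f (- t) = \<phi> t / t ^ 4" by (simp add: even)
        then show ?thesis using nn by linarith
      qed
      then show ?thesis using le nn by linarith
    qed
  qed
  also have "\<dots> = \<phi> y / y ^ 4 * (2 * y) + (J + J)"
  proof -
    have "(\<integral>t. \<phi> y / y ^ 4 * indicator {- y..y} t \<partial>lborel) = \<phi> y / y ^ 4 * (2 * y)"
      using y by simp
    then show ?thesis
      by (simp only: Bochner_Integration.integral_add[OF i3 Bochner_Integration.integrable_add[OF i1 i2]]
          Bochner_Integration.integral_add[OF i1 i2] e2 J_def)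
  qed
  finally have "q y \<le> 2 * y ^ 3 / pi * (\<phi> y / y ^ 4 * (2 * y) + (J + J))"
    unfolding q_eq[OF y] using y by (intro mult_left_mono) auto
  also have "\<dots> = (4 * \<phi> y + 4 * (y ^ 3 * J)) / pi"
    using y by (simp add: field_simps power3_eq_cube power4_eq_xxxx)
  also have "\<dots> \<le> (4 * (16 * tail_moment y) + 4 * tail_moment y) / pi"
    unfolding J using phi_le_tail_moment[OF y] by (intro divide_right_mono) auto
  also have "\<dots> = 68 / pi * tail_moment y" by simp
  also have "\<dots> \<le> 22 * tail_moment y"
  proof (rule mult_right_mono)
    have "68 \<le> 22 * pi" using pi_approx(1) by simp
    then show "68 / pi \<le> 22" by (simp add: field_simps)
    show "0 \<le> tail_moment y" using phi_le_tail_moment[OF y] nonneg[of y] by linarith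
  qed
  finally show ?thesis .
qed

end

section \<open>The saddle point\<close>

lemma exp_uminus_le_inverse: "w \<ge> 0 \<Longrightarrow> exp (- w) \<le> 1 / (1 + w)" for w :: real
  using exp_ge_add_one_self[of w] by (simp add: exp_minus divide_inverse le_imp_inverse_le add_pos_nonneg)

locale regular_log_weight = log_weight +
  assumes regular: "filterlim (\<lambda>t. t * deriv \<phi> t / (t ^ 3 * (LBINT \<xi>:{t..}. \<phi> \<xi> / \<xi> ^ 4)) powr (2 / 3)) at_top at_top"
begin

lemma phi_at_top: "filterlim \<phi> at_top at_top"
proof (rule filterlim_at_top_mono[OF ln_at_top])
  have "eventually (\<lambda>t. \<phi> t / ln t \<ge> 1) at_top"
    using growth by (simp add: filterlim_at_top)
  then show "eventually (\<lambda>t. ln t \<le> \<phi> t) at_top"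
    using eventually_gt_at_top[of 1] by eventually_elim (simp add: field_simps)
qed

lemma q_at_top: "filterlim q at_top at_top"
proof (rule filterlim_at_top_mono)
  show "filterlim (\<lambda>t. \<phi> t / 40) at_top at_top"
    using filterlim_at_top_mult_tendsto_pos[OF tendsto_const[of "1 / 40"] _ phi_at_top] by simp
  show "eventually (\<lambda>t. \<phi> t / 40 \<le> q t) at_top"
    using eventually_gt_at_top[of 0] by eventually_elim (rule q_ge_phi)
qed

text \<open>Condition (v), with the moment replaced by q and, q being increasing, with q frozen at y
  for all r >= y. In this form it serves both the curvature, through r in [y, 2 y], and the tail
  estimate, through all r >= y. The factor 22 comes from \<open>q_le_tail_moment\<close>.\<close>

lemma eventually_slope_ge:
  assumes K: "K \<ge> 0"
  shows "eventually (\<lambda>y. \<forall>r\<ge>y. r * slope r \<ge> K * q y powr (2 / 3)) at_top"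
proof -
  have "eventually (\<lambda>t. t * deriv \<phi> t / tail_moment t powr (2 / 3) \<ge> 22 * K) at_top"
    using regular by (simp add: filterlim_at_top tail_moment_def)
  moreover have "eventually (\<lambda>t. \<phi> t > 0) at_top"
    using phi_at_top by (simp add: filterlim_at_top_dense)
  ultimately have "eventually (\<lambda>t. t * slope t \<ge> K * q t powr (2 / 3)) at_top"
    using eventually_gt_at_top[of 0]
  proof eventually_elim
    case (elim t)
    have A: "tail_moment t > 0" using phi_le_tail_moment[OF elim(3)] elim(2) by linarith
    have "q t powr (2 / 3) \<le> (22 * tail_moment t) powr (2 / 3)"
      using q_le_tail_moment[OF elim(3)] q_nonneg[OF elim(3)] by (intro powr_mono2) auto
    also have "\<dots> = 22 powr (2 / 3) * tail_moment t powr (2 / 3)"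
      using A by (simp add: powr_mult)
    also have "\<dots> \<le> 22 * tail_moment t powr (2 / 3)"
      using powr_mono[of "2 / 3" 1 "22 :: real"] by (intro mult_right_mono) auto
    finally have "K * q t powr (2 / 3) \<le> K * (22 * tail_moment t powr (2 / 3))"
      using K by (intro mult_left_mono)
    also have "\<dots> \<le> t * deriv \<phi> t"
      using elim(1) A by (simp add: pos_le_divide_eq mult_ac)
    finally show ?case using elim(3) by (simp add: slope_def)
  qed
  then obtain N where N: "\<And>t. t \<ge> N \<Longrightarrow> t * slope t \<ge> K * q t powr (2 / 3)"
    by (auto simp: eventually_at_top_linorder)
  show ?thesis
    using eventually_ge_at_top[of N] eventually_gt_at_top[of 0]
  proof eventually_elim
    case (elim y)
    show ?case
    proof (intro allI impI)
      fix r assume r: "y \<le> r"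
      have "K * q y powr (2 / 3) \<le> K * q r powr (2 / 3)"
        using K q_mono[OF elim(2) r] q_nonneg[OF elim(2)] by (intro mult_left_mono powr_mono2) auto
      also have "\<dots> \<le> r * slope r" using N[of r] elim r by simp
      finally show "K * q y powr (2 / 3) \<le> r * slope r" .
    qed
  qed
qed

lemma eventually_q_ge: "eventually (\<lambda>y. q y \<ge> c) at_top"
  using q_at_top by (simp add: filterlim_at_top)

lemma eventually_sig2_ge:
  assumes K: "K \<ge> 0"
  shows "eventually (\<lambda>y. sig2 y * y\<^sup>2 \<ge> K * q y powr (2 / 3)) at_top"
proof -
  \<comment> \<open>Compensates the factor 2 / (3 pi) between the curvature integral and sig2, and
    the 25 from (4 y^2 + y^2)^2 = 25 y^4.\<close>
  define L where "L = 75 * pi / 2 * K"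
  have L: "L \<ge> 0" using K by (simp add: L_def)
  show ?thesis
    using eventually_slope_ge[OF L] eventually_gt_at_top[of 0]
  proof eventually_elim
    case (elim y)
    define m where "m = L * q y powr (2 / 3)"
    have "y * m * y / (4 * y\<^sup>2 + y\<^sup>2)\<^sup>2 \<le> curvature_bound y"
      using elim L by (intro curvature_bound_ge) (auto simp: m_def)
    also have "y * m * y / (4 * y\<^sup>2 + y\<^sup>2)\<^sup>2 = m / (25 * y\<^sup>2)"
      using elim(2) by (simp add: power2_eq_square field_simps)
    finally have "2 / (3 * pi) * (m / (25 * y\<^sup>2)) \<le> 2 / (3 * pi) * curvature_bound y"
      by (intro mult_left_mono) auto
    also have "\<dots> \<le> sig2 y" by (rule sig2_curvature_bound[OF elim(2)])
    finally have "2 / (3 * pi) * (m / (25 * y\<^sup>2)) * y\<^sup>2 \<le> sig2 y * y\<^sup>2"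
      by (intro mult_right_mono) auto
    also have "2 / (3 * pi) * (m / (25 * y\<^sup>2)) * y\<^sup>2 = K * q y powr (2 / 3)"
      using elim(2) by (simp add: m_def L_def)
    finally show ?case .
  qed
qed

text \<open>One interval [a, 2 a] on which the slope is positive is seen from every height, so
  positivity holds for all y and not only for large ones.\<close>

lemma sig2_pos:
  assumes y: "y > 0"
  shows "sig2 y > 0"
proof -
  have "eventually (\<lambda>a. (\<forall>r\<ge>a. r * slope r \<ge> 1 * q a powr (2 / 3)) \<and> q a \<ge> 1 \<and> a > 0) at_top"
    using eventually_slope_ge[of 1] by (intro eventually_conj eventually_q_ge eventually_gt_at_top) auto
  then obtain a where a: "\<And>r. r \<ge> a \<Longrightarrow> r * slope r \<ge> 1 * q a powr (2 / 3)" "q a \<ge> 1" "a > 0"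
    using eventually_happens'[OF trivial_limit_at_top_linorder] by blast
  have "1 * 1 \<le> 1 * q a powr (2 / 3)" using a(2) by (simp add: ge_one_powr_ge_zero)
  then have "a * 1 * y / (4 * a\<^sup>2 + y\<^sup>2)\<^sup>2 \<le> curvature_bound y"
    using a y by (intro curvature_bound_ge) (auto intro: order_trans)
  moreover have "a * 1 * y / (4 * a\<^sup>2 + y\<^sup>2)\<^sup>2 > 0"
    using a y by (intro divide_pos_pos mult_pos_pos zero_less_power add_pos_pos) auto
  ultimately have "2 / (3 * pi) * curvature_bound y > 0" by simp
  then show ?thesis using sig2_curvature_bound(1)[OF y] by linarith
qed

text \<open>The ratio of the height y to the width 1 / sigma of the saddle; the Gaussian
  approximation is good when this is large.\<close>

definition S :: "real \<Rightarrow> real" where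
  "S y = sqrt (sig2 y) * y"

lemma S_pos: "y > 0 \<Longrightarrow> S y > 0"
  using sig2_pos[of y] by (simp add: S_def)

lemma S_squared: "y > 0 \<Longrightarrow> (S y)\<^sup>2 = sig2 y * y\<^sup>2"
  using sig2_nonneg[of y] by (simp add: S_def power_mult_distrib)

lemma eventually_S_ge: "eventually (\<lambda>y. S y \<ge> c) at_top"
proof -
  have "eventually (\<lambda>y. sig2 y * y\<^sup>2 \<ge> c\<^sup>2 * q y powr (2 / 3)) at_top"
    by (rule eventually_sig2_ge) simp
  then show ?thesis
    using eventually_q_ge[of 1] eventually_gt_at_top[of 0]
  proof eventually_elim
    case (elim y)
    have "c\<^sup>2 * 1 \<le> c\<^sup>2 * q y powr (2 / 3)"
      using elim(2) by (intro mult_left_mono) (auto simp: ge_one_powr_ge_zero)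
    then have "c\<^sup>2 \<le> (S y)\<^sup>2" using elim by (simp add: S_squared)
    then show ?case using S_pos[OF elim(3)] by (metis less_eq_real_def power2_le_imp_le)
  qed
qed

lemma S_at_top: "filterlim S at_top at_top"
  using eventually_S_ge by (simp add: filterlim_at_top)

text \<open>The power 3/2 of the curvature bound; it explains the exponent 2/3 in (v). The quotient
  is the coefficient of |v|^3 in the rescaled Taylor remainder.\<close>

lemma q_over_S_cubed: "((\<lambda>y. q y / S y ^ 3) \<longlongrightarrow> 0) at_top"
  unfolding tendsto_iff
proof (intro allI impI)
  fix e :: real assume e: "e > 0"
  define K where "K = (2 / e) powr (2 / 3)"
  have K: "K > 0" using e by (simp add: K_def)
  have "eventually (\<lambda>y. sig2 y * y\<^sup>2 \<ge> K * q y powr (2 / 3)) at_top"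
    by (rule eventually_sig2_ge) (use K in simp)
  then show "eventually (\<lambda>y. dist (q y / S y ^ 3) 0 < e) at_top"
    using eventually_q_ge[of 1] eventually_gt_at_top[of 0]
  proof eventually_elim
    case (elim y)
    have S: "S y > 0" by (rule S_pos[OF elim(3)])
    have "(2 / e * q y) powr (2 / 3) = K * q y powr (2 / 3)"
      unfolding K_def by (rule powr_mult)
    then have "(2 / e * q y) powr (2 / 3) \<le> (S y)\<^sup>2"
      using elim(1,3) by (simp add: S_squared)
    then have "((2 / e * q y) powr (2 / 3)) powr (3 / 2) \<le> ((S y)\<^sup>2) powr (3 / 2)"
      by (intro powr_mono2) auto
    moreover have "((S y)\<^sup>2) powr (3 / 2) = S y ^ 3"
    proof -
      have "(S y)\<^sup>2 = S y powr 2" using S by (simp add: powr_numeral)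
      then have "((S y)\<^sup>2) powr (3 / 2) = S y powr 3" by (simp add: powr_powr)
      also have "\<dots> = S y ^ 3" using S by (simp add: powr_numeral)
      finally show ?thesis .
    qed
    ultimately have "2 / e * q y \<le> S y ^ 3" using e elim(2) by (simp add: powr_powr)
    then have "2 * (q y / S y ^ 3) \<le> e" using S e by (simp add: field_simps)
    moreover have "q y / S y ^ 3 > 0" using S elim(2) by simp
    ultimately show ?case by (simp add: dist_real_def)
  qed
qed

text \<open>The Fourier integrand of 1 / W on the line at height y, for s = \<open>dP y\<close>, in
  the variable v = sigma x and divided by its value at the saddle point; the linear phase is
  removed.\<close>

definition G :: "real \<Rightarrow> real \<Rightarrow> complex" where
  "G y v = exp (- (outer_exponent (Complex (v / sqrt (sig2 y)) y) - of_real (U 0 y) + \<i> * of_real (v / sqrt (sig2 y) * dP y)))"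

lemma norm_G: "y > 0 \<Longrightarrow> norm (G y v) = exp (- (U (v / sqrt (sig2 y)) y - U 0 y))"
  by (simp add: G_def U_eq_Re)

lemma continuous_outer_exponent:
  assumes "y > 0"
  shows "continuous_on UNIV (\<lambda>x. outer_exponent (Complex x y))"
proof -
  have "continuous_on upper_half_plane outer_exponent"
    using DERIV_outer_exponent by (intro continuous_at_imp_continuous_on ballI) (auto intro: DERIV_isCont)
  then show ?thesis
    by (rule continuous_on_compose2) (use assms in \<open>auto intro!: continuous_intros\<close>)
qed

lemma measurable_G [measurable]: "y > 0 \<Longrightarrow> G y \<in> borel_measurable borel"
proof -
  assume y: "y > 0"
  have "continuous_on UNIV (\<lambda>v. outer_exponent (Complex (v / sqrt (sig2 y)) y))"
    by (rule continuous_on_compose2[OF continuous_outer_exponent[OF y]]) (use sig2_pos[OF y] in \<open>auto intro!: continuous_intros\<close>)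
  then show ?thesis
    unfolding G_def[abs_def] by (intro borel_measurable_continuous_onI continuous_intros) (use sig2_pos[OF y] in auto)
qed

text \<open>36 is the constant of the quadratic lower bound, exp 8 is the loss in
  \<open>U_tail\<close>, and 2 turns 1 / v^2 into 1 / (1 + v^2) for v^2 >= 1.\<close>

definition G_const :: real where
  "G_const = 72 * exp 8"

lemma eventually_norm_G_le: "eventually (\<lambda>y. \<forall>v. norm (G y v) \<le> G_const / (1 + v\<^sup>2)) at_top"
proof -
  have "eventually (\<lambda>y. (\<forall>r\<ge>y. r * slope r \<ge> 4 * q y powr (2 / 3))) at_top"
    by (rule eventually_slope_ge) simp
  then show ?thesis
    using eventually_q_ge[of 1] eventually_gt_at_top[of 0] eventually_S_ge[of 1]
  proof eventually_elim
    case (elim y)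
    have sl: "slope r \<ge> 4 / r" if "r \<ge> y" for r
    proof -
      have "4 * 1 \<le> 4 * q y powr (2 / 3)" using elim(2) by (simp add: ge_one_powr_ge_zero)
      also have "\<dots> \<le> r * slope r" using elim(1) that by blast
      finally show ?thesis using that elim(3) by (simp add: field_simps)
    qed
    show ?case
    proof
      fix v
      define x where "x = v / sqrt (sig2 y)"
      have sp: "sig2 y > 0" by (rule sig2_pos[OF elim(3)])
      have sx: "sig2 y * x\<^sup>2 = v\<^sup>2" using sp by (simp add: x_def power_divide)
      have n: "norm (G y v) = exp (- (U x y - U 0 y))" using norm_G[OF elim(3)] by (simp add: x_def)
      have "exp 8 \<ge> (1::real)" by simp
      then have c: "G_const \<ge> 36" unfolding G_const_def by linarith
      have p: "1 + v\<^sup>2 > 0" by (simp add: add_pos_nonneg)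
      show "norm (G y v) \<le> G_const / (1 + v\<^sup>2)"
      proof (cases "\<bar>x\<bar> \<le> y")
        case True
        have "norm (G y v) \<le> exp (- (v\<^sup>2 / 36))"
          using U_quadratic_lower[OF elim(3) True] by (simp add: n sx)
        also have "\<dots> \<le> 1 / (1 + v\<^sup>2 / 36)" by (rule exp_uminus_le_inverse) simp
        also have "\<dots> = 36 / (36 + v\<^sup>2)" by (simp add: field_simps)
        also have "\<dots> \<le> G_const / (1 + v\<^sup>2)" using c p by (intro frac_le) auto
        finally show ?thesis .
      next
        case False
        then have xy: "y \<le> \<bar>x\<bar>" "\<bar>x\<bar> > 0" using elim(3) by auto
        \<comment> \<open>The gain of U at the edge x = y of the quadratic region. In the variable v
          the factor (y / x)^2 of the tail estimate equals S^2 / v^2, and the growing S^2 is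
          absorbed by exp (- w), since w exp (- w) is at most 1.\<close>
        define w where "w = (S y)\<^sup>2 / 36"
        have w: "w \<ge> 0" by (simp add: w_def)
        have "U y y - U 0 y \<ge> w"
          using U_quadratic_lower[OF elim(3), of y] elim(3) by (simp add: w_def S_squared)
        moreover have "U x y - U y y \<ge> 2 * ln (\<bar>x\<bar> / y) - 8"
          using U_tail[OF elim(3) xy(1) sl] by (simp add: U_abs[OF elim(3)])
        ultimately have "norm (G y v) \<le> exp (8 + (- 2 * ln (\<bar>x\<bar> / y)) + (- w))"
          by (simp add: n)
        also have "\<dots> = exp 8 * exp (- 2 * ln (\<bar>x\<bar> / y)) * exp (- w)"
          by (simp only: exp_add)
        also have "exp (- 2 * ln (\<bar>x\<bar> / y)) = (y / \<bar>x\<bar>)\<^sup>2"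
        proof -
          have pos: "\<bar>x\<bar> / y > 0" using xy elim(3) by simp
          have "exp (- 2 * ln (\<bar>x\<bar> / y)) = inverse (exp (ln (\<bar>x\<bar> / y)) ^ 2)"
            by (simp add: exp_minus exp_double)
          also have "\<dots> = inverse ((\<bar>x\<bar> / y)\<^sup>2)" using pos by simp
          also have "\<dots> = (y / \<bar>x\<bar>)\<^sup>2" by (simp add: power_divide)
          finally show ?thesis .
        qed
        also have "(y / \<bar>x\<bar>)\<^sup>2 = (S y)\<^sup>2 / v\<^sup>2"
        proof -
          have "(S y)\<^sup>2 / v\<^sup>2 = (sig2 y * y\<^sup>2) / (sig2 y * x\<^sup>2)" by (simp add: S_squared[OF elim(3)] sx)
          also have "\<dots> = (y / \<bar>x\<bar>)\<^sup>2" using sp by (simp add: power_divide)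
          finally show ?thesis by simp
        qed
        also have "exp 8 * ((S y)\<^sup>2 / v\<^sup>2) * exp (- w) = 36 * exp 8 / v\<^sup>2 * (w * exp (- w))"
          by (simp add: w_def)
        also have "\<dots> \<le> 36 * exp 8 / v\<^sup>2 * 1"
        proof (rule mult_left_mono)
          have "w * exp (- w) \<le> w * (1 / (1 + w))" by (intro mult_left_mono exp_uminus_le_inverse w)
          also have "\<dots> \<le> 1" using w by (simp add: field_simps)
          finally show "w * exp (- w) \<le> 1" .
        qed auto
        also have "\<dots> \<le> G_const / (1 + v\<^sup>2)"
        proof -
          have "(S y)\<^sup>2 \<le> v\<^sup>2"
          proof -
            have "y\<^sup>2 \<le> x\<^sup>2" using xy elim(3) by (simp add: abs_le_square_iff[symmetric])
            then show ?thesis using sp mult_left_mono[of "y\<^sup>2" "x\<^sup>2" "sig2 y"] by (simp add: S_squared[OF elim(3)] sx)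
          qed
          moreover have "1 \<le> (S y)\<^sup>2" using elim(4) by (simp add: one_le_power)
          ultimately have v: "1 \<le> v\<^sup>2" by linarith
          have "36 * exp 8 / v\<^sup>2 = 72 * exp 8 / (2 * v\<^sup>2)" by simp
          also have "\<dots> \<le> 72 * exp 8 / (1 + v\<^sup>2)" using v by (intro divide_left_mono mult_pos_pos) auto
          finally show ?thesis by (simp add: G_const_def)
        qed
        finally show ?thesis .
      qed
    qed
  qed
qed

text \<open>For fixed v the abscissa v / sigma eventually lies within y / 2, where the Taylor
  formula applies; its error becomes |v|^3 q / S^3.\<close>

lemma G_tendsto: "((\<lambda>y. G y v) \<longlongrightarrow> exp (- (of_real (v\<^sup>2 / 2)))) at_top"
proof -
  define R where "R y = outer_exponent (Complex (v / sqrt (sig2 y)) y) - of_real (U 0 y) + \<i> * of_real (v / sqrt (sig2 y) * dP y) - of_real (v\<^sup>2 / 2)" for y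
  have "(R \<longlongrightarrow> 0) at_top"
  proof (rule Lim_null_comparison)
    show "eventually (\<lambda>y. norm (R y) \<le> \<bar>v\<bar> ^ 3 * (q y / S y ^ 3)) at_top"
      using eventually_S_ge[of "2 * \<bar>v\<bar>"] eventually_gt_at_top[of 0]
    proof eventually_elim
      case (elim y)
      define x where "x = v / sqrt (sig2 y)"
      have sp: "sig2 y > 0" by (rule sig2_pos[OF elim(2)])
      have sx: "sig2 y * x\<^sup>2 = v\<^sup>2" using sp by (simp add: x_def power_divide)
      have x: "\<bar>x\<bar> \<le> y / 2" using elim sp by (simp add: x_def S_def field_simps)
      have "R y = outer_exponent (Complex x y) - (of_real (U 0 y + sig2 y * x\<^sup>2 / 2) - \<i> * of_real (x * dP y))"
        by (simp add: R_def x_def[symmetric] sx)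
      then have "norm (R y) \<le> \<bar>x\<bar> ^ 3 * q y / y ^ 3"
        using outer_exponent_taylor[OF elim(2) x] by simp
      also have "\<dots> = \<bar>v\<bar> ^ 3 * (q y / S y ^ 3)"
        using sp by (simp add: x_def S_def power_divide power_mult_distrib)
      finally show ?case .
    qed
    have "((\<lambda>y. \<bar>v\<bar> ^ 3 * (q y / S y ^ 3)) \<longlongrightarrow> \<bar>v\<bar> ^ 3 * 0) at_top"
      by (intro tendsto_intros q_over_S_cubed)
    then show "((\<lambda>y. \<bar>v\<bar> ^ 3 * (q y / S y ^ 3)) \<longlongrightarrow> 0) at_top" by simp
  qed
  then have "((\<lambda>y. exp (- (R y + of_real (v\<^sup>2 / 2)))) \<longlongrightarrow> exp (- (0 + of_real (v\<^sup>2 / 2)))) at_top"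
    by (intro tendsto_intros)
  then show ?thesis by (simp add: R_def G_def)
qed

lemma gaussian_integral: "(\<integral>v. exp (- (complex_of_real (v\<^sup>2 / 2))) \<partial>lborel) = of_real (sqrt (2 * pi))"
proof -
  have "(\<integral>v. std_normal_density v \<partial>lborel) = 1"
    by (rule integral_normal_density) simp
  then have "(\<integral>v. 1 / sqrt (2 * pi) * exp (- v\<^sup>2 / 2) \<partial>lborel) = 1"
    by (simp only: std_normal_density_def)
  then have "1 / sqrt (2 * pi) * (\<integral>v. exp (- v\<^sup>2 / 2) \<partial>lborel) = 1"
    by (simp only: integral_mult_right_zero)
  moreover have "c * (1 / c * X) = X" if "c > 0" for c X :: real
    using that by simp
  ultimately have "(\<integral>v. exp (- v\<^sup>2 / 2) \<partial>lborel) = sqrt (2 * pi)"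
    by (metis mult.right_neutral pi_gt_zero real_sqrt_gt_zero mult_pos_pos zero_less_numeral)
  moreover have "exp (- (complex_of_real (v\<^sup>2 / 2))) = of_real (exp (- v\<^sup>2 / 2))" for v
    by (simp add: exp_of_real[symmetric])
  ultimately show ?thesis by (simp only: integral_complex_of_real)
qed

text \<open>The factor M leaves room for an amplitude that varies slowly on the scale of the saddle:
  it is 1 for 1 / W and a normalized test factor for the lower bound of \<open>rho\<close>.\<close>

lemma saddle_limit:
  fixes M :: "real \<Rightarrow> real \<Rightarrow> complex"
  assumes M: "\<And>y. y > 0 \<Longrightarrow> M y \<in> borel_measurable borel" "\<And>y v. y > 0 \<Longrightarrow> norm (M y v) \<le> 1"
    and lim: "\<And>v. ((\<lambda>y. M y v) \<longlongrightarrow> 1) at_top"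
  shows "((\<lambda>y. \<integral>v. M y v * G y v \<partial>lborel) \<longlongrightarrow> of_real (sqrt (2 * pi))) at_top"
proof -
  \<comment> \<open>Dominated convergence asks for measurability for every y, including the heights
    y <= 0 that are irrelevant for the limit.\<close>
  define M' where "M' y = (if y > 0 then M y else (\<lambda>_. 0))" for y
  define G' where "G' y = (if y > 0 then G y else (\<lambda>_. 0))" for y
  have [measurable]: "M' y \<in> borel_measurable borel" "G' y \<in> borel_measurable borel" for y
    using M(1)[of y] measurable_G[of y] by (auto simp: M'_def G'_def)
  have ev: "eventually (\<lambda>y. M' y = M y \<and> G' y = G y) at_top"
    using eventually_gt_at_top[of 0] by eventually_elim (simp add: M'_def G'_def)
  have "((\<lambda>y. \<integral>v. M' y v * G' y v \<partial>lborel) \<longlongrightarrow> (\<integral>v. 1 * exp (- (complex_of_real (v\<^sup>2 / 2))) \<partial>lborel)) at_top"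
  proof (rule integral_dominated_convergence_at_top)
    show "(\<lambda>v. 1 * exp (- (complex_of_real (v\<^sup>2 / 2)))) \<in> borel_measurable lborel" by measurable
    show "(\<lambda>v. M' y v * G' y v) \<in> borel_measurable lborel" for y by measurable
    have "integrable lborel (\<lambda>v. G_const / ((v - 0)\<^sup>2 + 1\<^sup>2))"
      by (rule nn_integral_inverse_quadratic) (auto simp: G_const_def)
    then show "integrable lborel (\<lambda>v. G_const / (1 + v\<^sup>2))" by (simp add: add.commute)
    show "eventually (\<lambda>y. AE v in lborel. norm (M' y v * G' y v) \<le> G_const / (1 + v\<^sup>2)) at_top"
      using eventually_norm_G_le eventually_gt_at_top[of 0] ev
    proof eventually_elim
      case (elim y)
      show ?case
      proof (rule AE_I2)
        fix v
        have "norm (M' y v * G' y v) \<le> 1 * (G_const / (1 + v\<^sup>2))"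
          unfolding norm_mult using elim M(2)[of y v] by (intro mult_mono) auto
        then show "norm (M' y v * G' y v) \<le> G_const / (1 + v\<^sup>2)" by simp
      qed
    qed
    show "AE v in lborel. ((\<lambda>y. M' y v * G' y v) \<longlongrightarrow> 1 * exp (- (complex_of_real (v\<^sup>2 / 2)))) at_top"
    proof (intro AE_I2 tendsto_mult)
      fix v
      show "((\<lambda>y. M' y v) \<longlongrightarrow> 1) at_top"
        by (rule Lim_transform_eventually[OF lim[of v]]) (use ev in \<open>auto elim: eventually_mono\<close>)
      show "((\<lambda>y. G' y v) \<longlongrightarrow> exp (- (complex_of_real (v\<^sup>2 / 2)))) at_top"
        by (rule Lim_transform_eventually[OF G_tendsto[of v]]) (use ev in \<open>auto elim: eventually_mono\<close>)
    qed
  qed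
  then have "((\<lambda>y. \<integral>v. M' y v * G' y v \<partial>lborel) \<longlongrightarrow> of_real (sqrt (2 * pi))) at_top"
    by (simp only: mult_1 gaussian_integral)
  then show ?thesis
    by (rule Lim_transform_eventually) (use ev in \<open>auto elim: eventually_mono\<close>)
qed

end

section \<open>The Legendre transform through its saddle point\<close>

context regular_log_weight
begin

text \<open>Together with q >= 0 this says |y dP y| <= U(0, y), so that dP tends to 0 along with U /
  y.\<close>

lemma q_le_U:
  assumes y: "y > 0"
  shows "q y \<le> 2 * U 0 y"
proof -
  have "q y = (\<integral>t. 2 * y ^ 3 / pi * (\<phi> t / (t\<^sup>2 + y\<^sup>2)\<^sup>2) \<partial>lborel)"
    unfolding q_eq[OF y] by (rule integral_mult_right_zero[symmetric])
  also have "\<dots> \<le> (\<integral>t. 2 * (poisson (Complex 0 y) t * \<phi> t) \<partial>lborel)"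
  proof (intro integral_mono integrable_mult_right integrable_fourth integrable_poisson_mult y)
    fix t
    define D where "D = t\<^sup>2 + y\<^sup>2"
    have D: "D > 0" "y\<^sup>2 \<le> D" using y by (auto simp: D_def add_nonneg_pos)
    have "2 * y * \<phi> t / pi * (y\<^sup>2 / D\<^sup>2) \<le> 2 * y * \<phi> t / pi * (D / D\<^sup>2)"
      using D y nonneg by (intro mult_left_mono divide_right_mono) auto
    also have "D / D\<^sup>2 = 1 / D" using D by (simp add: power2_eq_square)
    finally show "2 * y ^ 3 / pi * (\<phi> t / (t\<^sup>2 + y\<^sup>2)\<^sup>2) \<le> 2 * (poisson (Complex 0 y) t * \<phi> t)"
      by (simp add: poisson_def D_def power2_eq_square power3_eq_cube mult_ac)
  qed (use y in simp)
  also have "\<dots> = 2 * U 0 y" unfolding U_def by (rule integral_mult_right_zero)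
  finally show ?thesis .
qed

text \<open>Here (iii) enters: U / y integrates \<open>\<phi>\<close> against 1 / (pi (t^2 + y^2)),
  which for y >= 1 is dominated by 1 / (t^2 + 1) and tends to 0 pointwise.\<close>

lemma U_over_y: "((\<lambda>y. U 0 y / y) \<longlongrightarrow> 0) at_top"
proof -
  have "((\<lambda>y. \<integral>t. \<phi> t / (pi * (t\<^sup>2 + y\<^sup>2)) \<partial>lborel) \<longlongrightarrow> integral\<^sup>L lborel (\<lambda>t::real. 0)) at_top"
  proof (rule integral_dominated_convergence_at_top)
    show "integrable lborel (\<lambda>t. \<phi> t / (t\<^sup>2 + 1))" by (rule integrable)
    show "(\<lambda>t. \<phi> t / (pi * (t\<^sup>2 + y\<^sup>2))) \<in> borel_measurable lborel" for y by measurable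
    show "eventually (\<lambda>y. AE t in lborel. norm (\<phi> t / (pi * (t\<^sup>2 + y\<^sup>2))) \<le> \<phi> t / (t\<^sup>2 + 1)) at_top"
      using eventually_ge_at_top[of 1]
    proof eventually_elim
      case (elim y)
      show ?case
      proof (rule AE_I2)
        fix t :: real
        have p: "t\<^sup>2 + 1 > 0" by (simp add: add_nonneg_pos)
        have "1 * (t\<^sup>2 + 1) \<le> pi * (t\<^sup>2 + y\<^sup>2)"
          using elim pi_gt3 p by (intro mult_mono) (auto simp: one_le_power)
        then have "\<phi> t / (pi * (t\<^sup>2 + y\<^sup>2)) \<le> \<phi> t / (t\<^sup>2 + 1)"
          using nonneg[of t] p elim by (intro divide_left_mono mult_pos_pos add_nonneg_pos) auto
        then show "norm (\<phi> t / (pi * (t\<^sup>2 + y\<^sup>2))) \<le> \<phi> t / (t\<^sup>2 + 1)"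
          using nonneg[of t] by simp
      qed
    qed
    show "AE t in lborel. ((\<lambda>y. \<phi> t / (pi * (t\<^sup>2 + y\<^sup>2))) \<longlongrightarrow> 0) at_top"
    proof (rule AE_I2)
      fix t
      have "filterlim (\<lambda>y::real. pi * (t\<^sup>2 + y\<^sup>2)) at_top at_top"
        by (intro filterlim_tendsto_pos_mult_at_top[OF tendsto_const] filterlim_tendsto_add_at_top[OF tendsto_const]
            filterlim_pow_at_top filterlim_ident) auto
      then show "((\<lambda>y. \<phi> t / (pi * (t\<^sup>2 + y\<^sup>2))) \<longlongrightarrow> 0) at_top"
        by (intro tendsto_divide_0[OF tendsto_const] filterlim_at_top_imp_at_infinity)
    qed
  qed simp
  then have "((\<lambda>y. \<integral>t. \<phi> t / (pi * (t\<^sup>2 + y\<^sup>2)) \<partial>lborel) \<longlongrightarrow> 0) at_top" by simp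
  then show ?thesis
  proof (rule Lim_transform_eventually)
    show "eventually (\<lambda>y. (\<integral>t. \<phi> t / (pi * (t\<^sup>2 + y\<^sup>2)) \<partial>lborel) = U 0 y / y) at_top"
      using eventually_gt_at_top[of 0]
    proof eventually_elim
      case (elim y)
      have "U 0 y = (\<integral>t. y * (\<phi> t / (pi * (t\<^sup>2 + y\<^sup>2))) \<partial>lborel)"
        unfolding U_def by (simp add: poisson_def)
      also have "\<dots> = y * (\<integral>t. \<phi> t / (pi * (t\<^sup>2 + y\<^sup>2)) \<partial>lborel)" by (rule integral_mult_right_zero)
      finally show ?case using elim by simp
    qed
  qed
qed

lemma dP_tendsto_0: "(dP \<longlongrightarrow> 0) at_top"
proof (rule Lim_null_comparison[OF _ U_over_y])
  show "eventually (\<lambda>y. norm (dP y) \<le> U 0 y / y) at_top"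
    using eventually_gt_at_top[of 0]
  proof eventually_elim
    case (elim y)
    have "\<bar>y * dP y\<bar> \<le> U 0 y"
      using q_le_U[OF elim] q_nonneg[OF elim] by (simp add: q_def)
    then show ?case using elim by (simp add: abs_mult field_simps)
  qed
qed

lemma dP_strict_antimono:
  assumes "0 < y" "y < y'"
  shows "dP y' < dP y"
proof (rule DERIV_neg_imp_decreasing[OF assms(2)])
  fix u assume "y \<le> u"
  with assms(1) show "\<exists>d. (dP has_real_derivative d) (at u) \<and> d < 0"
    using DERIV_dP[of u] sig2_pos[of u] by (intro exI[of _ "- sig2 u"]) auto
qed

lemma dP_inj: "0 < y \<Longrightarrow> 0 < y' \<Longrightarrow> dP y = dP y' \<Longrightarrow> y = y'"
  using dP_strict_antimono[of y y'] dP_strict_antimono[of y' y] by (cases y y' rule: linorder_cases) auto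

lemma dP_pos:
  assumes y: "y > 0"
  shows "dP y > 0"
proof -
  have "dP (y + 1) \<ge> 0"
  proof (rule tendsto_upperbound[OF dP_tendsto_0])
    show "eventually (\<lambda>x. dP x \<le> dP (y + 1)) at_top"
      using eventually_gt_at_top[of "y + 1"]
      by eventually_elim (use y dP_strict_antimono[of "y + 1"] in \<open>auto intro: less_imp_le\<close>)
  qed simp
  then show ?thesis using dP_strict_antimono[of y "y + 1"] y by linarith
qed

text \<open>The inverse of the strictly decreasing function \<open>dP\<close>. Only 0 < s < dP 1 is
  used, where the intermediate value theorem gives existence and Y s > 1.\<close>

definition Y :: "real \<Rightarrow> real" where
  "Y s = (THE y. y > 0 \<and> dP y = s)"

lemma Y_dP: "y > 0 \<Longrightarrow> Y (dP y) = y"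
  unfolding Y_def by (intro the_equality) (auto intro: dP_inj)

lemma Y:
  assumes s: "0 < s" "s < dP 1"
  shows "Y s > 1" "dP (Y s) = s"
proof -
  have "eventually (\<lambda>y. dP y < s \<and> y > 1) at_top"
    using order_tendstoD(2)[OF dP_tendsto_0 s(1)] eventually_gt_at_top[of 1] by eventually_elim auto
  then obtain b where b: "dP b < s" "b > 1"
    using eventually_happens'[OF trivial_limit_at_top_linorder] by blast
  have "continuous_on {1..b} dP"
    by (intro continuous_at_imp_continuous_on ballI DERIV_isCont[OF DERIV_dP]) auto
  then obtain y where y: "1 \<le> y" "y \<le> b" "dP y = s"
    using IVT2'[of dP b s 1] b s by auto
  have "y \<noteq> 1" using y s by auto
  with y show "Y s > 1" "dP (Y s) = s" using Y_dP[of y] by auto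
qed

lemma Y_at_top: "filterlim Y at_top (at_right 0)"
  unfolding filterlim_at_top_dense
proof
  fix N :: real
  define N' where "N' = max N 1"
  have N': "N' \<ge> 1" "N' \<ge> N" by (auto simp: N'_def)
  have "dP N' > 0" by (rule dP_pos) (use N' in simp)
  then have "eventually (\<lambda>s. 0 < s \<and> s < dP N') (at_right 0)"
    by (auto simp: eventually_at_right_field intro!: exI[of _ "dP N'"])
  then show "eventually (\<lambda>s. Y s > N) (at_right 0)"
  proof eventually_elim
    case (elim s)
    have "dP N' \<le> dP 1" using N' dP_strict_antimono[of 1 N'] by (cases "N' = 1") auto
    then have s: "0 < s" "s < dP 1" using elim by auto
    have "Y s > N'"
    proof (rule ccontr)
      assume "\<not> Y s > N'"
      then have "dP N' \<le> dP (Y s)"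
        using Y(1)[OF s] dP_strict_antimono[of "Y s" N'] by (cases "Y s = N'") auto
      then show False using Y(2)[OF s] elim by simp
    qed
    then show ?case using N' by simp
  qed
qed

lemma eventually_dP_Y: "eventually (\<lambda>s. 0 < s \<and> s < dP 1) (at_right 0)"
  using dP_pos[of 1] by (auto simp: eventually_at_right_field intro!: exI[of _ "dP 1"])

text \<open>The function to be maximized has derivative dP y - s, which changes from positive to
  negative at Y s.\<close>

lemma legendre_Q_eq:
  assumes s: "0 < s" "s < dP 1"
  shows "legendre_Q (outer_weight \<phi>) s = q (Y s)"
proof -
  define k where "k y = U 0 y - y * s" for y
  have k': "(k has_real_derivative dP y - s) (at y)" if "y > 0" for y
    unfolding k_def[abs_def] using that by (auto intro!: derivative_eq_intros DERIV_U)
  note Y = Y[OF s]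
  have max: "k y \<le> k (Y s)" if y: "y > 0" for y
  proof (cases "y \<le> Y s")
    case True
    show ?thesis
    proof (rule DERIV_nonneg_imp_nondecreasing[OF True])
      fix u assume u: "y \<le> u" "u \<le> Y s"
      then have "dP u \<ge> s"
        using dP_strict_antimono[of u "Y s"] y Y(2) by (cases "u = Y s") auto
      then show "\<exists>d. (k has_real_derivative d) (at u) \<and> 0 \<le> d"
        using k'[of u] u y by (intro exI[of _ "dP u - s"]) auto
    qed
  next
    case False
    then have le: "Y s \<le> y" by simp
    show ?thesis
    proof (rule DERIV_nonpos_imp_nonincreasing[OF le])
      fix u assume u: "Y s \<le> u" "u \<le> y"
      then have "dP u \<le> s"
        using dP_strict_antimono[of "Y s" u] Y by (cases "u = Y s") auto
      then show "\<exists>d. (k has_real_derivative d) (at u) \<and> d \<le> 0"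
        using k'[of u] u Y by (intro exI[of _ "dP u - s"]) auto
    qed
  qed
  have eq: "ln (cmod (outer_weight \<phi> (Complex 0 y))) - y * s = k y" if "y > 0" for y
    using that by (simp add: norm_outer_weight U_def k_def)
  have "legendre_Q (outer_weight \<phi>) s = (SUP y\<in>{0<..}. k y)"
    unfolding legendre_Q_def by (intro SUP_cong) (auto simp: eq)
  also have "\<dots> = k (Y s)"
    by (rule cSup_eq_maximum) (use Y max in auto)
  also have "\<dots> = q (Y s)" using Y by (simp add: k_def q_def)
  finally show ?thesis .
qed

lemma DERIV_Y:
  assumes s: "0 < s" "s < dP 1"
  shows "(Y has_real_derivative - 1 / sig2 (Y s)) (at s)"
proof -
  note Y1 = Y[OF s]
  have "isCont Y (dP (Y s))"
  \<comment> \<open>Since Y s > 1, the radius 1/2 keeps the neighbourhood inside the positive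
    heights, where \<open>Y\<close> inverts \<open>dP\<close>.\<close>
  proof (rule isCont_inverse_function[where d="1/2" and f=dP and x="Y s"])
    show "\<bar>z - Y s\<bar> \<le> 1 / 2 \<Longrightarrow> Y (dP z) = z" for z
      using Y1 by (intro Y_dP) linarith
    show "\<bar>z - Y s\<bar> \<le> 1 / 2 \<Longrightarrow> isCont dP z" for z
      using Y1 by (intro DERIV_isCont[OF DERIV_dP]) linarith
  qed simp
  moreover have p: "Y s > 0" using Y1 by simp
  moreover have "- sig2 (Y s) \<noteq> 0" using sig2_pos[OF p] by simp
  ultimately have "(Y has_real_derivative inverse (- sig2 (Y s))) (at s)"
    using Y(2) s by (intro DERIV_inverse_function[where f=dP and a=0 and b="dP 1"] DERIV_dP) (simp_all add: Y1)
  then show ?thesis by (simp add: inverse_eq_divide)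
qed

text \<open>In q'(Y) Y' = (Y sig2(Y)) (- 1 / sig2(Y)) the curvature cancels.\<close>

lemma deriv_legendre_Q:
  assumes s: "0 < s" "s < dP 1"
  shows "deriv (legendre_Q (outer_weight \<phi>)) s = - Y s"
proof (rule DERIV_imp_deriv)
  have "((\<lambda>s. q (Y s)) has_real_derivative (Y s * sig2 (Y s)) * (- 1 / sig2 (Y s))) (at s)"
    using Y(1)[OF s] by (intro DERIV_chain2[OF DERIV_q DERIV_Y[OF s]]) simp
  also have "(Y s * sig2 (Y s)) * (- 1 / sig2 (Y s)) = - Y s"
    using sig2_pos[of "Y s"] Y(1)[OF s] by simp
  finally show "(legendre_Q (outer_weight \<phi>) has_real_derivative - Y s) (at s)"
    by (rule has_field_derivative_transform_within_open[where S="{0<..<dP 1}"])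
       (use s in \<open>auto simp: legendre_Q_eq\<close>)
qed

lemma deriv2_legendre_Q:
  assumes s: "0 < s" "s < dP 1"
  shows "deriv (deriv (legendre_Q (outer_weight \<phi>))) s = 1 / sig2 (Y s)"
proof (rule DERIV_imp_deriv)
  have "((\<lambda>s. - Y s) has_real_derivative - (- 1 / sig2 (Y s))) (at s)"
    by (intro DERIV_minus DERIV_Y s)
  then have "((\<lambda>s. - Y s) has_real_derivative 1 / sig2 (Y s)) (at s)" by simp
  then show "(deriv (legendre_Q (outer_weight \<phi>)) has_real_derivative 1 / sig2 (Y s)) (at s)"
    by (rule has_field_derivative_transform_within_open[where S="{0<..<dP 1}"])
       (use s in \<open>auto simp: deriv_legendre_Q\<close>)
qed

end

section \<open>The extremal problem\<close>

text \<open>A substitute for Hoelder's inequality with a bound independent of p: u w <= w + K u^r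
  for u >= 0 and r >= 1, whether u is below or above 1.\<close>

lemma hardy_unit_ball:
  assumes p: "1 \<le> p" and g: "g \<in> hardy_space p" "hardy_norm p g \<le> 1"
    and y: "y > 0" and w: "w \<in> borel_measurable borel" "\<And>x. 0 \<le> w x" "\<And>x. w x \<le> K"
  shows "(\<integral>\<^sup>+x. ennreal (norm (g (Complex x y)) * w x) \<partial>lborel) \<le> (\<integral>\<^sup>+x. ennreal (w x) \<partial>lborel) + ennreal K"
proof (cases "p = \<infinity>")
  case True
  have bdd: "bounded (g ` upper_half_plane)" using g(1) True by (simp add: hardy_space_def)
  then have "bdd_above ((\<lambda>z. cmod (g z)) ` upper_half_plane)"
    unfolding bounded_iff bdd_above_def by (auto simp: upper_half_plane_def)
  then have "norm (g z) \<le> 1" if "Im z > 0" for z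
    using g(2) that cSUP_upper[of z upper_half_plane "\<lambda>z. cmod (g z)"] True by (simp add: hardy_norm_def)
  then have "norm (g (Complex x y)) * w x \<le> w x" for x
    using w(2)[of x] y mult_right_mono[of "norm (g (Complex x y))" 1 "w x"] by simp
  then have "(\<integral>\<^sup>+x. ennreal (norm (g (Complex x y)) * w x) \<partial>lborel) \<le> (\<integral>\<^sup>+x. ennreal (w x) \<partial>lborel)"
    by (intro nn_integral_mono ennreal_leI) auto
  also have "\<dots> \<le> (\<integral>\<^sup>+x. ennreal (w x) \<partial>lborel) + ennreal K" by simp
  finally show ?thesis .
next
  case False
  define r where "r = enn2real p"
  have r: "r \<ge> 1" unfolding r_def
    using enn2real_mono[of 1 p] p False by (simp add: less_top)
  define H where "H = hardy_mean_sup r g"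
  have H: "H < \<infinity>" using g(1) False by (simp add: hardy_space_def r_def H_def)
  have "enn2real H powr (1 / r) \<le> 1" using g(2) False by (simp add: hardy_norm_def r_def H_def)
  then have "(enn2real H powr (1 / r)) powr r \<le> 1 powr r"
    using r by (intro powr_mono2) auto
  then have "enn2real H \<le> 1" using r by (simp add: powr_powr)
  then have "ennreal (enn2real H) \<le> ennreal 1" by (rule ennreal_leI)
  then have H1: "H \<le> 1" using H by simp
  have holo: "g holomorphic_on upper_half_plane" using g(1) by (simp add: hardy_space_def)
  have [measurable]: "(\<lambda>x. g (Complex x y)) \<in> borel_measurable borel"
    by (intro borel_measurable_continuous_onI continuous_on_compose2[OF holomorphic_on_imp_continuous_on[OF holo]])
       (use y in \<open>auto intro!: continuous_intros\<close>)
  have [measurable]: "w \<in> borel_measurable borel" by (rule w)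
  have K: "K \<ge> 0" using w(2,3) order_trans by blast
  have le: "norm (g (Complex x y)) * w x \<le> w x + K * norm (g (Complex x y)) powr r" for x
  proof (cases "norm (g (Complex x y)) \<le> 1")
    case True
    then have "norm (g (Complex x y)) * w x \<le> 1 * w x" using w(2) by (intro mult_right_mono)
    also have "\<dots> \<le> w x + K * norm (g (Complex x y)) powr r" using K by simp
    finally show ?thesis .
  next
    case F: False
    have "norm (g (Complex x y)) = norm (g (Complex x y)) powr 1" using F by simp
    also have "\<dots> \<le> norm (g (Complex x y)) powr r" using F r by (intro powr_mono) auto
    finally have "norm (g (Complex x y)) * w x \<le> norm (g (Complex x y)) powr r * K"
      using w(2,3) by (intro mult_mono) auto
    then show ?thesis using w(2)[of x] by (simp add: mult.commute)
  qed
  have "(\<integral>\<^sup>+x. ennreal (norm (g (Complex x y)) * w x) \<partial>lborel)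
    \<le> (\<integral>\<^sup>+x. ennreal (w x) + ennreal K * ennreal (norm (g (Complex x y)) powr r) \<partial>lborel)"
    using le w(2) K by (intro nn_integral_mono) (simp add: ennreal_leI flip: ennreal_mult ennreal_plus)
  also have "\<dots> = (\<integral>\<^sup>+x. ennreal (w x) \<partial>lborel) + ennreal K * (\<integral>\<^sup>+x. ennreal (norm (g (Complex x y)) powr r) \<partial>lborel)"
    by (subst nn_integral_add) (auto simp: nn_integral_cmult)
  also have "(\<integral>\<^sup>+x. ennreal (norm (g (Complex x y)) powr r) \<partial>lborel) \<le> H"
    unfolding H_def hardy_mean_sup_def using y by (intro SUP_upper) auto
  also have "H \<le> 1" by (rule H1)
  finally show ?thesis by (simp add: add_left_mono mult_left_mono)
qed

text \<open>Its modulus is bounded by 1 and, on every line above the axis, by the Poisson kernel of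
  i, which places it in the unit ball for all p at once. On the imaginary axis it is the positive
  number 1 / (pi (y + 1)^2), so it costs the lower bound for \<open>rho\<close> only a power of
  y.\<close>

definition test_factor :: "complex \<Rightarrow> complex" where
  "test_factor z = - 1 / (of_real pi * (z + \<i>)\<^sup>2)"

lemma test_factor_holomorphic: "test_factor holomorphic_on upper_half_plane"
proof -
  have "of_real pi * (z + \<i>)\<^sup>2 \<noteq> 0" if "z \<in> upper_half_plane" for z
  proof -
    have "z + \<i> \<noteq> 0" using that by (auto simp: complex_eq_iff)
    then show ?thesis by simp
  qed
  then show ?thesis unfolding test_factor_def by (intro holomorphic_intros) auto
qed

lemma norm_test_factor_le:
  assumes "y > 0"
  shows "norm (test_factor (Complex x y)) \<le> 1 / (pi * (1 + x\<^sup>2))"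
proof -
  have "(norm (Complex x y + \<i>))\<^sup>2 = x\<^sup>2 + (y + 1)\<^sup>2" by (simp add: cmod_power2)
  moreover have "1 \<le> (y + 1)\<^sup>2" using assms by (simp add: one_le_power)
  moreover have "1 + x\<^sup>2 > 0" by (simp add: add_pos_nonneg)
  ultimately show ?thesis
    by (simp add: test_factor_def norm_divide norm_mult norm_power) (intro divide_left_mono mult_left_mono mult_pos_pos, auto)
qed

lemma norm_test_factor_le_1:
  assumes "Im z > 0"
  shows "norm (test_factor z) \<le> 1"
proof -
  have "norm (test_factor z) \<le> 1 / (pi * (1 + (Re z)\<^sup>2))"
    using norm_test_factor_le[of "Im z" "Re z"] assms by simp
  also have "\<dots> \<le> 1 / 1"
  proof (rule divide_left_mono)
    have "1 * 1 \<le> pi * (1 + (Re z)\<^sup>2)" using pi_gt3 by (intro mult_mono) auto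
    then show "1 \<le> pi * (1 + (Re z)\<^sup>2)" by simp
  qed (auto intro!: mult_pos_pos add_pos_nonneg)
  finally show ?thesis by simp
qed

text \<open>For modulus at most 1 the r-th power is at most the modulus itself, which lies below a
  kernel of mass 1.\<close>

lemma test_factor_in_hardy_ball:
  assumes p: "1 \<le> p"
  shows "test_factor \<in> hardy_space p" "hardy_norm p test_factor \<le> 1"
proof -
  have "test_factor \<in> hardy_space p \<and> hardy_norm p test_factor \<le> 1"
  proof (cases "p = \<infinity>")
    case True
    have "bounded (test_factor ` upper_half_plane)"
      unfolding bounded_iff using norm_test_factor_le_1 by (intro exI[of _ 1]) auto
    moreover have "(SUP z\<in>upper_half_plane. cmod (test_factor z)) \<le> 1"
      by (rule cSUP_least) (auto simp: norm_test_factor_le_1 upper_half_plane_def intro: exI[of _ \<i>])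
    ultimately show ?thesis
      using True test_factor_holomorphic by (simp add: hardy_space_def hardy_norm_def)
  next
    case False
    define r where "r = enn2real p"
    have r: "r \<ge> 1" unfolding r_def
      using enn2real_mono[of 1 p] p False by (simp add: less_top)
    have "hardy_mean_sup r test_factor \<le> 1"
      unfolding hardy_mean_sup_def
    proof (rule SUP_least)
      fix y :: real assume "y \<in> {0<..}"
      then have y: "y > 0" by simp
      have "norm (test_factor (Complex x y)) powr r \<le> poisson \<i> x" for x
      proof -
        have "norm (test_factor (Complex x y)) powr r \<le> norm (test_factor (Complex x y)) powr 1"
          using r norm_test_factor_le_1[of "Complex x y"] y
          by (intro powr_mono') auto
        also have "\<dots> \<le> 1 / (pi * (1 + x\<^sup>2))" using norm_test_factor_le[OF y, of x] by simp
        also have "\<dots> = poisson \<i> x" by (simp add: poisson_def add.commute)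
        finally show ?thesis .
      qed
      then have "(\<integral>\<^sup>+x. ennreal (norm (test_factor (Complex x y)) powr r) \<partial>lborel) \<le> (\<integral>\<^sup>+x. ennreal (poisson \<i> x) \<partial>lborel)"
        by (intro nn_integral_mono ennreal_leI)
      then show "(\<integral>\<^sup>+x. ennreal (norm (test_factor (Complex x y)) powr r) \<partial>lborel) \<le> 1"
        by (simp add: nn_integral_poisson)
    qed
    moreover from this have "enn2real (hardy_mean_sup r test_factor) powr (1 / r) \<le> 1 powr (1 / r)"
      using r by (intro powr_mono2 enn2real_leI) auto
    ultimately show ?thesis
      using False test_factor_holomorphic by (auto simp: hardy_space_def hardy_norm_def r_def[symmetric] order_le_less_trans)
  qed
  then show "test_factor \<in> hardy_space p" "hardy_norm p test_factor \<le> 1" by auto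
qed

section \<open>Fourier integrals of quotients by W at the saddle point\<close>

context regular_log_weight
begin

abbreviation W :: "complex \<Rightarrow> complex" where "W \<equiv> outer_weight \<phi>"

lemma norm_inverse_W: "y > 0 \<Longrightarrow> norm (1 / W (Complex x y)) = exp (- U x y)"
proof -
  assume "y > 0"
  then have "norm (W (Complex x y)) = exp (U x y)" by (simp add: norm_outer_weight U_def)
  then show ?thesis by (simp only: norm_divide norm_one exp_minus inverse_eq_divide)
qed

text \<open>Eventually \<open>\<phi>\<close> is at least 8 log t, and U is at least a quarter of
  \<open>\<phi>\<close>; hence |1/W| is at most 1 / x^2 far out, uniformly in the height. The bound
  1 serves the remaining x.\<close>

lemma norm_inverse_W_le:
  obtains C where "C > 0" "\<And>x y. y > 0 \<Longrightarrow> norm (1 / W (Complex x y)) \<le> C / (1 + x\<^sup>2)"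
proof -
  have "eventually (\<lambda>t. \<phi> t / ln t \<ge> 8) at_top"
    using growth by (simp add: filterlim_at_top)
  then obtain R0 where R0: "\<And>t. t \<ge> R0 \<Longrightarrow> \<phi> t / ln t \<ge> 8"
    by (auto simp: eventually_at_top_linorder)
  define R where "R = max R0 2"
  have R: "R \<ge> 2" "\<And>t. t \<ge> R \<Longrightarrow> \<phi> t \<ge> 8 * ln t"
  proof -
    show "\<phi> t \<ge> 8 * ln t" if "t \<ge> R" for t
    proof -
      have "ln t > 0" using that by (simp add: R_def)
      then show ?thesis using R0[of t] that by (simp add: R_def pos_le_divide_eq)
    qed
  qed (simp add: R_def)
  define C where "C = R\<^sup>2 + 2"
  have "norm (1 / W (Complex x y)) \<le> C / (1 + x\<^sup>2)" if y: "y > 0" for x y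
  proof (cases "\<bar>x\<bar> \<ge> R")
    case True
    have x: "\<bar>x\<bar> > 0" using True R by linarith
    have x2: "x\<^sup>2 \<ge> 1" using True R one_le_power[of "\<bar>x\<bar>" 2] by simp
    have "\<phi> \<bar>x\<bar> \<le> \<phi> (\<bar>x\<bar> + y)" using y by (intro phi_mono) auto
    then have "2 * ln \<bar>x\<bar> \<le> U x y"
      using R(2)[OF True] U_ge_phi[OF y, of "\<bar>x\<bar>"] by (simp add: U_abs[OF y])
    then have "norm (1 / W (Complex x y)) \<le> exp (- (2 * ln \<bar>x\<bar>))"
      by (simp add: norm_inverse_W[OF y])
    also have "\<dots> = 1 / x\<^sup>2"
      using x by (simp add: exp_minus exp_double divide_inverse)
    also have "\<dots> = 2 / (2 * x\<^sup>2)" by simp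
    also have "\<dots> \<le> C / (1 + x\<^sup>2)"
      using x2 by (intro frac_le) (auto simp: C_def add_pos_nonneg)
    finally show ?thesis .
  next
    case False
    have "x\<^sup>2 \<le> R\<^sup>2" using False R by (intro power2_le_iff_abs_le[THEN iffD2]) auto
    then have "1 \<le> C / (1 + x\<^sup>2)" by (simp add: C_def pos_le_divide_eq add_pos_nonneg)
    moreover have "norm (1 / W (Complex x y)) \<le> 1"
      using U_nonneg[OF y, of x] by (simp add: norm_inverse_W[OF y])
    ultimately show ?thesis by linarith
  qed
  moreover have "C > 0" by (simp add: C_def add_nonneg_pos)
  ultimately show ?thesis using that by blast
qed

lemma measurable_W_line:
  assumes "y > 0"
  shows "(\<lambda>x. W (Complex x y)) \<in> borel_measurable borel"
proof (rule borel_measurable_continuous_onI)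
  show "continuous_on UNIV (\<lambda>x. W (Complex x y))"
    by (rule continuous_on_compose2[OF holomorphic_on_imp_continuous_on[OF holomorphic_outer_weight]])
       (use assms in \<open>auto intro!: continuous_intros\<close>)
qed

text \<open>With weight |1/W|, which is bounded and uniformly integrable over lines by
  \<open>norm_inverse_W_le\<close>, the estimate \<open>hardy_unit_ball\<close> for W f becomes an
  \<open>L1\<close> bound for f.\<close>

lemma bounded_mean_over_W:
  assumes p: "1 \<le> p" and f: "f \<in> weighted_hardy_space p W" "weighted_hardy_norm p W f \<le> 1"
  obtains C where "bounded_mean C f"
proof -
  obtain C where C: "C > 0" "\<And>x y. y > 0 \<Longrightarrow> norm (1 / W (Complex x y)) \<le> C / (1 + x\<^sup>2)"
    using norm_inverse_W_le by blast
  have "(\<integral>\<^sup>+x. ennreal (norm (f (Complex x y))) \<partial>lborel) \<le> ennreal (C * pi + 1)" if y: "y > 0" for y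
  proof -
    define w where "w x = norm (1 / W (Complex x y))" for x
    have [measurable]: "(\<lambda>x. W (Complex x y)) \<in> borel_measurable borel" by (rule measurable_W_line[OF y])
    have w: "w \<in> borel_measurable borel" unfolding w_def by measurable
    have w1: "w x \<le> 1" for x using U_nonneg[OF y, of x] by (simp add: w_def norm_inverse_W[OF y])
    have "norm (f (Complex x y)) = norm (W (Complex x y) * f (Complex x y)) * w x" for x
      using outer_weight_nonzero[of "Complex x y"] by (simp add: w_def norm_mult norm_divide)
    then have "(\<integral>\<^sup>+x. ennreal (norm (f (Complex x y))) \<partial>lborel)
      = (\<integral>\<^sup>+x. ennreal (norm (W (Complex x y) * f (Complex x y)) * w x) \<partial>lborel)"
      by simp
    also have "\<dots> \<le> (\<integral>\<^sup>+x. ennreal (w x) \<partial>lborel) + ennreal 1"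
      using f w1 by (intro hardy_unit_ball[OF p, of "\<lambda>z. W z * f z"] y w)
        (auto simp: weighted_hardy_space_def weighted_hardy_norm_def w_def)
    also have "(\<integral>\<^sup>+x. ennreal (w x) \<partial>lborel) \<le> (\<integral>\<^sup>+x. ennreal (C / ((x - 0)\<^sup>2 + 1\<^sup>2)) \<partial>lborel)"
      using C(2)[OF y] by (intro nn_integral_mono ennreal_leI) (simp add: w_def add.commute)
    also have "\<dots> = ennreal (C * pi / 1)" using C by (intro nn_integral_inverse_quadratic) auto
    finally show ?thesis using C by (simp flip: ennreal_plus ennreal_1 add: add_right_mono)
  qed
  then have "bounded_mean (C * pi + 1) f"
    using f C by (simp add: bounded_mean_def weighted_hardy_space_def)
  then show ?thesis by (rule that)
qed

lemma bounded_mean_quotient: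
  assumes m: "m holomorphic_on upper_half_plane" "\<And>z. Im z > 0 \<Longrightarrow> norm (m z) \<le> 1"
  obtains C where "bounded_mean C (\<lambda>z. m z / W z)"
proof -
  obtain C where C: "C > 0" "\<And>x y. y > 0 \<Longrightarrow> norm (1 / W (Complex x y)) \<le> C / (1 + x\<^sup>2)"
    using norm_inverse_W_le by blast
  have "(\<integral>\<^sup>+x. ennreal (norm (m (Complex x y) / W (Complex x y))) \<partial>lborel) \<le> ennreal (C * pi / 1)" if y: "y > 0" for y
  proof -
    have "norm (m (Complex x y) / W (Complex x y)) \<le> C / ((x - 0)\<^sup>2 + 1\<^sup>2)" for x
    proof -
      have "norm (m (Complex x y) / W (Complex x y)) = norm (m (Complex x y)) * norm (1 / W (Complex x y))"
        by (simp add: norm_divide)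
      also have "\<dots> \<le> 1 * (C / (1 + x\<^sup>2))" using m(2)[of "Complex x y"] C(2)[OF y, of x] y by (intro mult_mono) auto
      finally show ?thesis by (simp add: add.commute)
    qed
    then have "(\<integral>\<^sup>+x. ennreal (norm (m (Complex x y) / W (Complex x y))) \<partial>lborel) \<le> (\<integral>\<^sup>+x. ennreal (C / ((x - 0)\<^sup>2 + 1\<^sup>2)) \<partial>lborel)"
      by (intro nn_integral_mono ennreal_leI)
    also have "\<dots> = ennreal (C * pi / 1)" using C by (intro nn_integral_inverse_quadratic) auto
    finally show ?thesis .
  qed
  moreover have "(\<lambda>z. m z / W z) holomorphic_on upper_half_plane"
    by (intro holomorphic_intros m holomorphic_outer_weight outer_weight_nonzero)
  ultimately have "bounded_mean (C * pi / 1) (\<lambda>z. m z / W z)"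
    using C by (simp add: bounded_mean_def)
  then show ?thesis by (rule that)
qed

text \<open>The choice s = \<open>dP y\<close> makes the linear phases cancel, and the constant in
  the exponent is - U + y dP = - q.\<close>

lemma inverse_W_eq_G:
  assumes y: "y > 0"
  shows "1 / W (Complex x y) * exp (- \<i> * of_real (dP y) * Complex x y) = of_real (exp (- q y)) * G y (sqrt (sig2 y) * x)"
proof -
  have s: "sqrt (sig2 y) > 0" using sig2_pos[OF y] by simp
  have "1 / W (Complex x y) = exp (- outer_exponent (Complex x y))"
    by (simp add: outer_weight_eq exp_minus divide_inverse)
  then have "1 / W (Complex x y) * exp (- \<i> * of_real (dP y) * Complex x y)
    = exp (- outer_exponent (Complex x y) + (- \<i> * of_real (dP y) * Complex x y))"
    by (simp only: exp_add)
  also have "- outer_exponent (Complex x y) + (- \<i> * of_real (dP y) * Complex x y)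
    = of_real (- q y) + (- (outer_exponent (Complex x y) - of_real (U 0 y) + \<i> * of_real (x * dP y)))"
    by (simp add: q_def complex_eq_iff algebra_simps)
  also have "exp \<dots> = of_real (exp (- q y)) * exp (- (outer_exponent (Complex x y) - of_real (U 0 y) + \<i> * of_real (x * dP y)))"
    by (simp only: exp_add exp_of_real)
  also have "exp (- (outer_exponent (Complex x y) - of_real (U 0 y) + \<i> * of_real (x * dP y))) = G y (sqrt (sig2 y) * x)"
    using s by (simp add: G_def)
  finally show ?thesis .
qed

lemma inverse_fourier_saddle:
  assumes m: "m holomorphic_on upper_half_plane" "\<And>z. Im z > 0 \<Longrightarrow> norm (m z) \<le> 1" and y: "y > 0"
  shows "inverse_fourier (\<lambda>z. m z / W z) (dP y) = of_real (1 / sqrt (2 * pi) * (exp (- q y) / sqrt (sig2 y))) *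
    (\<integral>v. m (Complex (v / sqrt (sig2 y)) y) * G y v \<partial>lborel)"
proof -
  define \<sigma> where "\<sigma> = sqrt (sig2 y)"
  have s: "\<sigma> > 0" using sig2_pos[OF y] by (simp add: \<sigma>_def)
  obtain C where C: "bounded_mean C (\<lambda>z. m z / W z)"
    using bounded_mean_quotient[OF m] by blast
  have "(\<integral>x. m (Complex x y) / W (Complex x y) * exp (- \<i> * of_real (dP y) * Complex x y) \<partial>lborel)
    = (\<integral>x. of_real (exp (- q y)) * (m (Complex x y) * G y (\<sigma> * x)) \<partial>lborel)"
  proof (rule Bochner_Integration.integral_cong)
    fix x
    have "m (Complex x y) / W (Complex x y) * exp (- \<i> * of_real (dP y) * Complex x y)
      = m (Complex x y) * (1 / W (Complex x y) * exp (- \<i> * of_real (dP y) * Complex x y))" by simp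
    also have "\<dots> = of_real (exp (- q y)) * (m (Complex x y) * G y (\<sigma> * x))"
      by (subst inverse_W_eq_G[OF y]) (simp add: \<sigma>_def)
    finally show "m (Complex x y) / W (Complex x y) * exp (- \<i> * of_real (dP y) * Complex x y) = of_real (exp (- q y)) * (m (Complex x y) * G y (\<sigma> * x))" .
  qed simp
  also have "\<dots> = of_real (exp (- q y)) * (\<integral>x. m (Complex x y) * G y (\<sigma> * x) \<partial>lborel)"
    by (rule integral_mult_right_zero)
  also have "(\<integral>x. m (Complex x y) * G y (\<sigma> * x) \<partial>lborel) = \<bar>1 / \<sigma>\<bar> *\<^sub>R (\<integral>v. m (Complex (0 + 1 / \<sigma> * v) y) * G y (\<sigma> * (0 + 1 / \<sigma> * v)) \<partial>lborel)"
    by (rule lborel_integral_real_affine) (use s in simp)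
  also have "\<dots> = of_real (1 / \<sigma>) * (\<integral>v. m (Complex (v / \<sigma>) y) * G y v \<partial>lborel)"
    using s by (simp add: scaleR_conv_of_real)
  finally show ?thesis
    unfolding inverse_fourier_line[OF C y] by (simp add: \<sigma>_def)
qed

lemma inverse_fourier_inverse_W_limit:
  "((\<lambda>y. inverse_fourier (\<lambda>z. 1 / W z) (dP y) / of_real (exp (- q y) / sqrt (sig2 y))) \<longlongrightarrow> 1) at_top"
proof -
  have "((\<lambda>y. of_real (1 / sqrt (2 * pi)) * (\<integral>v. 1 * G y v \<partial>lborel)) \<longlongrightarrow> of_real (1 / sqrt (2 * pi)) * of_real (sqrt (2 * pi))) at_top"
    by (intro tendsto_mult tendsto_const saddle_limit) auto
  moreover have "of_real (1 / sqrt (2 * pi)) * of_real (sqrt (2 * pi)) = (1 :: complex)"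
    by (simp flip: of_real_mult)
  ultimately have "((\<lambda>y. of_real (1 / sqrt (2 * pi)) * (\<integral>v. 1 * G y v \<partial>lborel)) \<longlongrightarrow> 1) at_top" by simp
  then show ?thesis
  proof (rule Lim_transform_eventually)
    show "eventually (\<lambda>y. of_real (1 / sqrt (2 * pi)) * (\<integral>v. 1 * G y v \<partial>lborel)
       = inverse_fourier (\<lambda>z. 1 / W z) (dP y) / of_real (exp (- q y) / sqrt (sig2 y))) at_top"
      using eventually_gt_at_top[of 0]
    proof eventually_elim
      case (elim y)
      have ne: "exp (- q y) / sqrt (sig2 y) \<noteq> 0" using sig2_pos[OF elim] by simp
      then have ne': "complex_of_real (exp (- q y) / sqrt (sig2 y)) \<noteq> 0" by (simp only: of_real_eq_0_iff not_False_eq_True)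
      have "inverse_fourier (\<lambda>z. 1 / W z) (dP y) = of_real (1 / sqrt (2 * pi) * (exp (- q y) / sqrt (sig2 y))) *
        (\<integral>v. 1 * G y v \<partial>lborel)"
        using inverse_fourier_saddle[of "\<lambda>_. 1" y] elim by simp
      then show ?case using ne' by (simp only: of_real_mult) (simp add: field_simps)
    qed
  qed
qed

text \<open>From z + i = i (y + 1) (1 - i x / (y + 1)): the relative change is governed by x / (y +
  1), and the last factor has modulus at least 1.\<close>

lemma test_factor_ratio:
  assumes "y > 0"
  shows "test_factor (Complex x y) / test_factor (Complex 0 y) = (1 / (1 - \<i> * of_real (x / (y + 1))))\<^sup>2"
    and "norm (test_factor (Complex x y) / test_factor (Complex 0 y)) \<le> 1"
proof -
  have z: "Complex x y + \<i> = (\<i> * of_real (y + 1)) * (1 - \<i> * of_real (x / (y + 1)))"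
    using assms by (simp add: complex_eq_iff)
  have z0: "Complex 0 y + \<i> = \<i> * of_real (y + 1)" by (simp add: complex_eq_iff)
  have ne: "\<i> * of_real (y + 1) \<noteq> (0 :: complex)" using assms by (simp add: complex_eq_iff)
  have ne2: "1 - \<i> * of_real (x / (y + 1)) \<noteq> 0" by (simp add: complex_eq_iff)
  show eq: "test_factor (Complex x y) / test_factor (Complex 0 y) = (1 / (1 - \<i> * of_real (x / (y + 1))))\<^sup>2"
    unfolding test_factor_def z z0 using ne ne2 by (simp add: power_mult_distrib power_divide)
  have "1 \<le> norm (1 - \<i> * of_real (x / (y + 1)))"
    using abs_Re_le_cmod[of "1 - \<i> * of_real (x / (y + 1))"] by simp
  moreover have "1 / n \<le> 1" if "1 \<le> n" for n :: real
    using that by simp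
  ultimately have "norm (1 / (1 - \<i> * of_real (x / (y + 1)))) \<le> 1"
    by (simp only: norm_divide norm_one)
  then show "norm (test_factor (Complex x y) / test_factor (Complex 0 y)) \<le> 1"
    unfolding eq norm_power by (intro power_le_one) auto
qed

text \<open>The test factor varies on the scale y + 1, the saddle has width 1 / sigma, and the
  quotient of the two is at most 1 / S, which tends to 0.\<close>

lemma inverse_fourier_test_limit:
  "((\<lambda>y. inverse_fourier (\<lambda>z. test_factor z / W z) (dP y) / (test_factor (Complex 0 y) * of_real (exp (- q y) / sqrt (sig2 y)))) \<longlongrightarrow> 1) at_top"
proof -
  define M where "M y v = test_factor (Complex (v / sqrt (sig2 y)) y) / test_factor (Complex 0 y)" for y v
  have "((\<lambda>y. \<integral>v. M y v * G y v \<partial>lborel) \<longlongrightarrow> of_real (sqrt (2 * pi))) at_top"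
  proof (rule saddle_limit)
    show "norm (M y v) \<le> 1" if "y > 0" for y v
      unfolding M_def by (rule test_factor_ratio(2)[OF that])
    show "M y \<in> borel_measurable borel" if "y > 0" for y
    proof -
      have "continuous_on UNIV (\<lambda>v. test_factor (Complex (v / sqrt (sig2 y)) y))"
        by (rule continuous_on_compose2[OF holomorphic_on_imp_continuous_on[OF test_factor_holomorphic]])
           (use that sig2_pos[OF that] in \<open>auto intro!: continuous_intros\<close>)
      then have [measurable]: "(\<lambda>v. test_factor (Complex (v / sqrt (sig2 y)) y)) \<in> borel_measurable borel"
        by (rule borel_measurable_continuous_onI)
      show ?thesis unfolding M_def by measurable
    qed
    fix v
    have "((\<lambda>y. v / sqrt (sig2 y) / (y + 1)) \<longlongrightarrow> 0) at_top"
    proof (rule Lim_null_comparison)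
      show "eventually (\<lambda>y. norm (v / sqrt (sig2 y) / (y + 1)) \<le> \<bar>v\<bar> * inverse (S y)) at_top"
        using eventually_gt_at_top[of 0]
      proof eventually_elim
        case (elim y)
        have sp: "sqrt (sig2 y) > 0" using sig2_pos[OF elim] by simp
        have "norm (v / sqrt (sig2 y) / (y + 1)) = \<bar>v\<bar> / (sqrt (sig2 y) * (y + 1))"
          using elim sp by (simp add: abs_mult)
        also have "\<dots> \<le> \<bar>v\<bar> / (sqrt (sig2 y) * y)"
          using elim sp by (intro divide_left_mono mult_left_mono mult_pos_pos) auto
        finally show ?case by (simp add: S_def divide_inverse)
      qed
      have "((\<lambda>y. \<bar>v\<bar> * inverse (S y)) \<longlongrightarrow> \<bar>v\<bar> * 0) at_top"
        by (intro tendsto_mult tendsto_const tendsto_inverse_0_at_top S_at_top)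
      then show "((\<lambda>y. \<bar>v\<bar> * inverse (S y)) \<longlongrightarrow> 0) at_top" by simp
    qed
    then have "((\<lambda>y. (1 / (1 - \<i> * of_real (v / sqrt (sig2 y) / (y + 1))))\<^sup>2) \<longlongrightarrow> (1 / (1 - \<i> * of_real 0))\<^sup>2) at_top"
      by (intro tendsto_intros) auto
    then have "((\<lambda>y. (1 / (1 - \<i> * complex_of_real (v / sqrt (sig2 y) / (y + 1))))\<^sup>2) \<longlongrightarrow> 1) at_top" by simp
    then show "((\<lambda>y. M y v) \<longlongrightarrow> 1) at_top"
    proof (rule Lim_transform_eventually)
      show "eventually (\<lambda>y. (1 / (1 - \<i> * complex_of_real (v / sqrt (sig2 y) / (y + 1))))\<^sup>2 = M y v) at_top"
        using eventually_gt_at_top[of 0] by eventually_elim (simp only: M_def test_factor_ratio(1))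
    qed
  qed
  then have "((\<lambda>y. of_real (1 / sqrt (2 * pi)) * (\<integral>v. M y v * G y v \<partial>lborel)) \<longlongrightarrow> of_real (1 / sqrt (2 * pi)) * of_real (sqrt (2 * pi))) at_top"
    by (intro tendsto_mult tendsto_const)
  moreover have "of_real (1 / sqrt (2 * pi)) * of_real (sqrt (2 * pi)) = (1 :: complex)"
    by (simp flip: of_real_mult)
  ultimately have "((\<lambda>y. of_real (1 / sqrt (2 * pi)) * (\<integral>v. M y v * G y v \<partial>lborel)) \<longlongrightarrow> 1) at_top" by simp
  then show ?thesis
  proof (rule Lim_transform_eventually)
    show "eventually (\<lambda>y. of_real (1 / sqrt (2 * pi)) * (\<integral>v. M y v * G y v \<partial>lborel)
       = inverse_fourier (\<lambda>z. test_factor z / W z) (dP y) / (test_factor (Complex 0 y) * of_real (exp (- q y) / sqrt (sig2 y)))) at_top"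
      using eventually_gt_at_top[of 0]
    proof eventually_elim
      case (elim y)
      have "exp (- q y) / sqrt (sig2 y) \<noteq> 0" using sig2_pos[OF elim] by simp
      then have ne': "complex_of_real (exp (- q y) / sqrt (sig2 y)) \<noteq> 0" by (simp only: of_real_eq_0_iff not_False_eq_True)
      have "Complex 0 y + \<i> \<noteq> 0" using elim by (simp add: complex_eq_iff)
      then have t: "test_factor (Complex 0 y) \<noteq> 0" by (simp add: test_factor_def)
      have "test_factor (Complex (v / sqrt (sig2 y)) y) * G y v = test_factor (Complex 0 y) * (M y v * G y v)" for v
        using t by (simp add: M_def)
      then have "(\<integral>v. test_factor (Complex (v / sqrt (sig2 y)) y) * G y v \<partial>lborel) = test_factor (Complex 0 y) * (\<integral>v. M y v * G y v \<partial>lborel)"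
        by (simp only: integral_mult_right_zero)
      then have "inverse_fourier (\<lambda>z. test_factor z / W z) (dP y) = of_real (1 / sqrt (2 * pi)) * of_real (exp (- q y) / sqrt (sig2 y)) *
        (test_factor (Complex 0 y) * (\<integral>v. M y v * G y v \<partial>lborel))"
        using inverse_fourier_saddle[OF test_factor_holomorphic norm_test_factor_le_1 elim] by (simp only: of_real_mult)
      moreover have "a * b * (c * d) / (c * b) = a * d" if "b \<noteq> 0" "c \<noteq> 0" for a b c d :: complex
        using that by simp
      ultimately show ?case using ne' t by (simp only: not_False_eq_True)
    qed
  qed
qed

end

section \<open>Upper and lower bounds for the extremal function\<close>

context regular_log_weight
begin

definition unit_ball :: "ennreal \<Rightarrow> (complex \<Rightarrow> complex) set" where
  "unit_ball p = {f \<in> weighted_hardy_space p W. weighted_hardy_norm p W f \<le> 1}"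

lemma test_quotient_in_unit_ball: "1 \<le> p \<Longrightarrow> (\<lambda>z. test_factor z / W z) \<in> unit_ball p"
proof -
  assume p: "1 \<le> p"
  have "(\<lambda>z. W z * (test_factor z / W z)) = test_factor"
    using outer_weight_nonzero by (auto simp: fun_eq_iff)
  moreover have "(\<lambda>z. test_factor z / W z) holomorphic_on upper_half_plane"
    by (intro holomorphic_intros test_factor_holomorphic holomorphic_outer_weight outer_weight_nonzero)
  ultimately show ?thesis
    using test_factor_in_hardy_ball[OF p]
    by (simp add: unit_ball_def weighted_hardy_space_def weighted_hardy_norm_def)
qed

text \<open>The integrand is W f times exp (- q) G, and the majorant of G serves as the weight in
  \<open>hardy_unit_ball\<close>. With c = G_const exp (- q), its integral c pi / sigma and its
  supremum c produce the two summands; 4 exceeds pi.\<close>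

lemma inverse_fourier_unit_ball_le:
  assumes p: "1 \<le> p" and f: "f \<in> unit_ball p" and y: "y > 0"
    and G: "\<And>v. norm (G y v) \<le> G_const / (1 + v\<^sup>2)"
  shows "norm (inverse_fourier f (dP y)) \<le> 4 * G_const * exp (- q y) * (1 + 1 / sqrt (sig2 y))"
proof -
  define \<sigma> where "\<sigma> = sqrt (sig2 y)"
  have s: "\<sigma> > 0" using sig2_pos[OF y] by (simp add: \<sigma>_def)
  define c where "c = G_const * exp (- q y)"
  have c: "c > 0" by (simp add: c_def G_const_def)
  have f': "f \<in> weighted_hardy_space p W" "weighted_hardy_norm p W f \<le> 1"
    using f by (auto simp: unit_ball_def)
  obtain C where C: "bounded_mean C f" using bounded_mean_over_W[OF p f'] by blast
  define w where "w x = c / (1 + (\<sigma> * x)\<^sup>2)" for x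
  have p1: "1 + u\<^sup>2 \<ge> 1" "1 + u\<^sup>2 > 0" for u :: real by (auto intro: add_pos_nonneg)
  have w: "w \<in> borel_measurable borel" "\<And>x. 0 \<le> w x" "\<And>x. w x \<le> c"
  proof -
    show "w \<in> borel_measurable borel" unfolding w_def[abs_def] by measurable
    show "0 \<le> w x" for x using c p1[of "\<sigma> * x"] by (simp add: w_def)
    show "w x \<le> c" for x
      unfolding w_def using c p1[of "\<sigma> * x"] by (simp add: pos_divide_le_eq)
  qed
  define h where "h x = f (Complex x y) * exp (- \<i> * of_real (dP y) * Complex x y)" for x
  have h_le: "norm (h x) \<le> norm (W (Complex x y) * f (Complex x y)) * w x" for x
  proof -
    have "h x = (W (Complex x y) * f (Complex x y)) * (1 / W (Complex x y) * exp (- \<i> * of_real (dP y) * Complex x y))"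
      using outer_weight_nonzero[of "Complex x y"] by (simp add: h_def)
    also have "\<dots> = (W (Complex x y) * f (Complex x y)) * (of_real (exp (- q y)) * G y (\<sigma> * x))"
      by (simp only: inverse_W_eq_G[OF y] \<sigma>_def)
    finally have "norm (h x) = norm (W (Complex x y) * f (Complex x y)) * (exp (- q y) * norm (G y (\<sigma> * x)))"
      by (simp add: norm_mult)
    also have "\<dots> \<le> norm (W (Complex x y) * f (Complex x y)) * (exp (- q y) * (G_const / (1 + (\<sigma> * x)\<^sup>2)))"
      by (intro mult_left_mono G) auto
    finally show ?thesis by (simp add: w_def c_def mult_ac)
  qed
  have h_int: "integrable lborel h"
  proof (rule Bochner_Integration.integrable_bound)
    show "integrable lborel (\<lambda>x. exp (dP y * y) *\<^sub>R f (Complex x y))"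
      using bounded_meanD(5)[OF C y] by simp
    have [measurable]: "(\<lambda>x. f (Complex x y)) \<in> borel_measurable borel"
      using bounded_meanD(6)[OF C y] by (rule borel_measurable_continuous_onI)
    have [measurable]: "(\<lambda>x. exp (- \<i> * of_real (dP y) * Complex x y)) \<in> borel_measurable borel"
      by (intro borel_measurable_continuous_onI continuous_intros)
    show "h \<in> borel_measurable lborel" unfolding h_def[abs_def] by measurable
    show "AE x in lborel. norm (h x) \<le> norm (exp (dP y * y) *\<^sub>R f (Complex x y))"
      by (simp add: h_def norm_mult)
  qed
  have "ennreal (norm (\<integral>x. h x \<partial>lborel)) \<le> (\<integral>\<^sup>+x. ennreal (norm (h x)) \<partial>lborel)"
    by (rule integral_norm_bound_ennreal[OF h_int])
  also have "\<dots> \<le> (\<integral>\<^sup>+x. ennreal (norm (W (Complex x y) * f (Complex x y)) * w x) \<partial>lborel)"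
    by (intro nn_integral_mono ennreal_leI h_le)
  also have "\<dots> \<le> (\<integral>\<^sup>+x. ennreal (w x) \<partial>lborel) + ennreal c"
    using f' by (intro hardy_unit_ball[OF p, of "\<lambda>z. W z * f z"] y w)
      (auto simp: weighted_hardy_space_def weighted_hardy_norm_def)
  also have "(\<integral>\<^sup>+x. ennreal (w x) \<partial>lborel) = (\<integral>\<^sup>+x. ennreal ((c / \<sigma>\<^sup>2) / ((x - 0)\<^sup>2 + (1 / \<sigma>)\<^sup>2)) \<partial>lborel)"
  proof (rule nn_integral_cong)
    fix x
    have "(c / \<sigma>\<^sup>2) / ((x - 0)\<^sup>2 + (1 / \<sigma>)\<^sup>2) = c / (\<sigma>\<^sup>2 * (x\<^sup>2 + (1 / \<sigma>)\<^sup>2))" by simp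
    moreover have "\<sigma>\<^sup>2 * (x\<^sup>2 + (1 / \<sigma>)\<^sup>2) = 1 + (\<sigma> * x)\<^sup>2"
      using s by (simp add: distrib_left power_mult_distrib power_divide)
    ultimately have "(c / \<sigma>\<^sup>2) / ((x - 0)\<^sup>2 + (1 / \<sigma>)\<^sup>2) = w x" by (simp only: w_def)
    then show "ennreal (w x) = ennreal ((c / \<sigma>\<^sup>2) / ((x - 0)\<^sup>2 + (1 / \<sigma>)\<^sup>2))" by (simp only:)
  qed
  also have "\<dots> = ennreal ((c / \<sigma>\<^sup>2) * pi / (1 / \<sigma>))"
    using s c by (intro nn_integral_inverse_quadratic) auto
  also have "(c / \<sigma>\<^sup>2) * pi / (1 / \<sigma>) = c * pi / \<sigma>"
    using s by (simp add: power2_eq_square)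
  finally have "ennreal (norm (\<integral>x. h x \<partial>lborel)) \<le> ennreal (c * pi / \<sigma> + c)"
    using s c by (subst ennreal_plus) auto
  then have le: "norm (\<integral>x. h x \<partial>lborel) \<le> c * pi / \<sigma> + c"
    using s c by (subst (asm) ennreal_le_iff) auto
  have "norm (inverse_fourier f (dP y)) = 1 / sqrt (2 * pi) * norm (\<integral>x. h x \<partial>lborel)"
    unfolding inverse_fourier_line[OF C y] h_def by (simp add: norm_mult norm_divide)
  also have "\<dots> \<le> 1 * (c * pi / \<sigma> + c)"
  proof (intro mult_mono le)
    have "1 \<le> 2 * pi" using pi_gt3 by simp
    then show "1 / sqrt (2 * pi) \<le> 1" by simp
  qed auto
  also have "\<dots> \<le> 4 * c * (1 + 1 / \<sigma>)"
  proof -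
    have "c * pi / \<sigma> \<le> c * 4 / \<sigma>" using c s pi_less_4 by (intro divide_right_mono mult_left_mono) auto
    then show ?thesis using c s by (simp add: distrib_left mult.commute[of c])
  qed
  finally show ?thesis by (simp add: c_def \<sigma>_def mult_ac)
qed

text \<open>Boundedness above is recorded as well, because without it a single member of the unit
  ball gives no lower bound for the real supremum in \<open>rho\<close>.\<close>

lemma eventually_rho_le:
  assumes p: "1 \<le> p"
  shows "eventually (\<lambda>y. bdd_above ((\<lambda>f. norm (inverse_fourier f (dP y))) ` unit_ball p) \<and>
    rho p W (dP y) \<le> 4 * G_const * exp (- q y) * (1 + 1 / sqrt (sig2 y))) at_top"
  using eventually_norm_G_le eventually_gt_at_top[of 0]
proof eventually_elim
  case (elim y)
  have le: "norm (inverse_fourier f (dP y)) \<le> 4 * G_const * exp (- q y) * (1 + 1 / sqrt (sig2 y))" if "f \<in> unit_ball p" for f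
    using inverse_fourier_unit_ball_le[OF p that elim(2)] elim(1) by blast
  have "unit_ball p \<noteq> {}" using test_quotient_in_unit_ball[OF p] by blast
  then have "rho p W (dP y) \<le> 4 * G_const * exp (- q y) * (1 + 1 / sqrt (sig2 y))"
    unfolding rho_def unit_ball_def[symmetric] by (rule cSUP_least) (rule le)
  moreover have "bdd_above ((\<lambda>f. norm (inverse_fourier f (dP y))) ` unit_ball p)"
    by (rule bdd_aboveI2) (rule le)
  ultimately show ?case by blast
qed

text \<open>The Fourier integral of the test quotient exceeds half of its asymptotic value, which
  accounts for the factor 2.\<close>

lemma eventually_rho_ge:
  assumes p: "1 \<le> p"
  shows "eventually (\<lambda>y. exp (- q y) / (2 * pi * (y + 1)\<^sup>2 * sqrt (sig2 y)) \<le> rho p W (dP y)) at_top"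
proof -
  let ?r = "\<lambda>y. inverse_fourier (\<lambda>z. test_factor z / W z) (dP y) / (test_factor (Complex 0 y) * of_real (exp (- q y) / sqrt (sig2 y)))"
  have "((\<lambda>y. norm (?r y)) \<longlongrightarrow> norm (1 :: complex)) at_top"
    by (intro tendsto_norm inverse_fourier_test_limit)
  then have "eventually (\<lambda>y. norm (?r y) > 1 / 2) at_top"
    by (rule order_tendstoD) simp
  then show ?thesis
    using eventually_rho_le[OF p] eventually_gt_at_top[of 0]
  proof eventually_elim
    case (elim y)
    have sp: "sqrt (sig2 y) > 0" using sig2_pos[OF elim(3)] by simp
    have "Complex 0 y + \<i> = \<i> * of_real (y + 1)" by (simp add: complex_eq_iff)
    then have "norm (test_factor (Complex 0 y)) = 1 / (pi * (y + 1)\<^sup>2)"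
      using elim(3) unfolding test_factor_def by (simp add: norm_divide norm_mult norm_power del: of_real_add)
    then have d: "norm (test_factor (Complex 0 y) * of_real (exp (- q y) / sqrt (sig2 y))) = exp (- q y) / (pi * (y + 1)\<^sup>2 * sqrt (sig2 y))"
      using sp by (simp only: norm_mult norm_of_real) simp
    have dp: "exp (- q y) / (pi * (y + 1)\<^sup>2 * sqrt (sig2 y)) > 0"
      using sp elim(3) by (intro divide_pos_pos mult_pos_pos) auto
    have "1 / 2 < norm (inverse_fourier (\<lambda>z. test_factor z / W z) (dP y)) / (exp (- q y) / (pi * (y + 1)\<^sup>2 * sqrt (sig2 y)))"
      using elim(1) unfolding norm_divide d .
    then have "1 / 2 * (exp (- q y) / (pi * (y + 1)\<^sup>2 * sqrt (sig2 y))) < norm (inverse_fourier (\<lambda>z. test_factor z / W z) (dP y))"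
      using dp by (simp only: pos_less_divide_eq)
    also have "\<dots> \<le> rho p W (dP y)"
      unfolding rho_def unit_ball_def[symmetric]
      using elim(2) by (intro cSUP_upper test_quotient_in_unit_ball p) auto
    finally show ?case by (simp add: mult_ac)
  qed
qed

text \<open>The factors beside exp (- q) are powers of y and sigma, and sigma lies between 1 / y and
  3 q / y for large y. The estimate is kept in terms of ln y and ln q, because ln y is o(q) in
  general and O(ln q) only under (vi).\<close>

lemma eventually_ln_rho:
  assumes p: "1 \<le> p"
  obtains C where "C \<ge> 0"
    "eventually (\<lambda>y. \<bar>ln (rho p W (dP y)) + q y\<bar> \<le> C + 2 * ln y + ln (q y)) at_top"
proof -
  define C1 where "C1 = ln (8 * G_const)"
  define C2 where "C2 = ln (24 * pi)"
  have gc: "G_const > 0" by (simp add: G_const_def)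
  have "eventually (\<lambda>y. \<bar>ln (rho p W (dP y)) + q y\<bar> \<le> (\<bar>C1\<bar> + \<bar>C2\<bar>) + 2 * ln y + ln (q y)) at_top"
    using eventually_rho_le[OF p] eventually_rho_ge[OF p] eventually_S_ge[of 1] eventually_q_ge[of 1] eventually_ge_at_top[of 1]
  proof eventually_elim
    case (elim y)
    define \<rho> where "\<rho> = rho p W (dP y)"
    have y: "y > 0" "y \<ge> 1" and q: "q y \<ge> 1" and S: "S y \<ge> 1" using elim by auto
    have sp: "sqrt (sig2 y) > 0" using sig2_pos[OF y(1)] by simp
    have sS: "sqrt (sig2 y) = S y / y" using y by (simp add: S_def)
    have inv: "1 / sqrt (sig2 y) = y / S y" by (simp add: sS)
    have yS: "y / S y \<le> y" using S y by (simp add: pos_divide_le_eq)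
    have "\<rho> \<le> 4 * G_const * exp (- q y) * (1 + y / S y)"
      using elim(1) by (simp add: \<rho>_def inv)
    also have "\<dots> \<le> 4 * G_const * exp (- q y) * (2 * y)"
      using yS y gc by (intro mult_left_mono) auto
    finally have up: "\<rho> \<le> (8 * G_const) * exp (- q y) * y" by simp
    \<comment> \<open>By \<open>sig2_le\<close> the square of S is at most 3 q, which for q >= 1 is
      at most (3 q)^2.\<close>
    have S3: "S y \<le> 3 * q y"
    proof (rule power2_le_imp_le)
      have "(S y)\<^sup>2 \<le> 3 * q y" using sig2_le[OF y(1)] by (simp add: S_squared[OF y(1)])
      also have "\<dots> = (3 * q y) * 1" by simp
      also have "\<dots> \<le> (3 * q y) * (3 * q y)" using q by (intro mult_left_mono) auto
      finally show "(S y)\<^sup>2 \<le> (3 * q y)\<^sup>2" by (simp add: power2_eq_square)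
    qed (use q in simp)
    have low: "exp (- q y) / ((24 * pi) * y * q y) \<le> \<rho>"
    proof -
      have "2 * pi * (y + 1)\<^sup>2 * sqrt (sig2 y) \<le> 2 * pi * (2 * y)\<^sup>2 * (3 * q y / y)"
        unfolding sS using y S S3 by (intro mult_mono power_mono divide_right_mono) auto
      also have "\<dots> = (24 * pi) * y * q y" using y by (simp add: power2_eq_square)
      finally have "exp (- q y) / ((24 * pi) * y * q y) \<le> exp (- q y) / (2 * pi * (y + 1)\<^sup>2 * sqrt (sig2 y))"
        using y sp by (intro divide_left_mono mult_pos_pos) (auto intro!: mult_pos_pos order_less_le_trans[OF zero_less_one q])
      then show ?thesis using elim(2) by (simp add: \<rho>_def)
    qed
    have lowpos: "exp (- q y) / ((24 * pi) * y * q y) > 0"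
      using y q by (intro divide_pos_pos mult_pos_pos) auto
    then have \<rho>: "\<rho> > 0" using low by linarith
    have "ln \<rho> \<le> ln ((8 * G_const) * exp (- q y) * y)"
      using up \<rho> by (intro ln_mono) auto
    also have "\<dots> = C1 - q y + ln y"
      using gc y unfolding C1_def by (subst ln_mult, simp, simp, subst ln_mult) auto
    finally have u: "ln \<rho> + q y \<le> C1 + ln y" by simp
    have "ln (exp (- q y) / ((24 * pi) * y * q y)) \<le> ln \<rho>"
      using low lowpos by (intro ln_mono) auto
    moreover have "ln (exp (- q y) / ((24 * pi) * y * q y)) = - q y - (C2 + ln y + ln (q y))"
    proof -
      have pos: "24 * pi > 0" "y > 0" "q y > 0" using y q by auto
      have "ln ((24 * pi) * y * q y) = C2 + ln y + ln (q y)"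
        using pos by (simp add: ln_mult C2_def)
      moreover have "ln (exp (- q y) / ((24 * pi) * y * q y)) = ln (exp (- q y)) - ln ((24 * pi) * y * q y)"
        using pos by (simp add: ln_div)
      ultimately show ?thesis by simp
    qed
    ultimately have l: "- (C2 + ln y + ln (q y)) \<le> ln \<rho> + q y" by simp
    have "ln y \<ge> 0" "ln (q y) \<ge> 0" using y q by auto
    then show ?case using u l unfolding \<rho>_def by linarith
  qed
  then show ?thesis by (intro that[of "\<bar>C1\<bar> + \<bar>C2\<bar>"]) auto
qed

text \<open>Here the growth condition in (ii) enters, through q >= \<open>\<phi>\<close> /
  40.\<close>

lemma ln_over_q: "((\<lambda>y. ln y / q y) \<longlongrightarrow> 0) at_top"
proof (rule Lim_null_comparison)
  show "eventually (\<lambda>y. norm (ln y / q y) \<le> 40 * inverse (\<phi> y / ln y)) at_top"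
    using eventually_gt_at_top[of 1] phi_at_top[unfolded filterlim_at_top_dense, rule_format, of 0]
  proof eventually_elim
    case (elim y)
    have l: "ln y > 0" using elim by simp
    have "q y \<ge> \<phi> y / 40" using elim by (intro q_ge_phi) simp
    moreover have "\<phi> y / 40 > 0" using elim by simp
    ultimately have "q y > 0" and le: "ln y / q y \<le> ln y / (\<phi> y / 40)"
      using l by (linarith, intro divide_left_mono mult_pos_pos) linarith+
    then show ?case using l by (simp add: mult.commute)
  qed
  have "((\<lambda>y. 40 * inverse (\<phi> y / ln y)) \<longlongrightarrow> 40 * 0) at_top"
    by (intro tendsto_mult tendsto_const tendsto_inverse_0_at_top growth)
  then show "((\<lambda>y. 40 * inverse (\<phi> y / ln y)) \<longlongrightarrow> 0) at_top" by simp
qed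

lemma ln_q_over_q: "((\<lambda>y. ln (q y) / q y) \<longlongrightarrow> 0) at_top"
proof -
  have "((\<lambda>x::real. ln x / x) \<longlongrightarrow> 0) at_top" by (rule ln_x_over_x_tendsto_0)
  then show ?thesis by (rule filterlim_compose[OF _ q_at_top])
qed

lemma ln_rho_ratio:
  assumes p: "1 \<le> p"
  shows "((\<lambda>y. ln (rho p W (dP y)) / (- q y)) \<longlongrightarrow> 1) at_top"
proof -
  obtain C where C: "C \<ge> 0" "eventually (\<lambda>y. \<bar>ln (rho p W (dP y)) + q y\<bar> \<le> C + 2 * ln y + ln (q y)) at_top"
    using eventually_ln_rho[OF p] by blast
  have "((\<lambda>y. ln (rho p W (dP y)) / (- q y) - 1) \<longlongrightarrow> 0) at_top"
  proof (rule Lim_null_comparison)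
    show "eventually (\<lambda>y. norm (ln (rho p W (dP y)) / (- q y) - 1) \<le> C * inverse (q y) + 2 * (ln y / q y) + ln (q y) / q y) at_top"
      using C(2) eventually_q_ge[of 1]
    proof eventually_elim
      case (elim y)
      have q: "q y > 0" using elim by simp
      have "ln (rho p W (dP y)) / (- q y) - 1 = - ((ln (rho p W (dP y)) + q y) / q y)"
        using q by (simp add: field_simps)
      then have "norm (ln (rho p W (dP y)) / (- q y) - 1) = \<bar>ln (rho p W (dP y)) + q y\<bar> / q y"
        using q by (simp add: abs_div)
      also have "\<dots> \<le> (C + 2 * ln y + ln (q y)) / q y" using elim q by (intro divide_right_mono) auto
      finally show ?case by (simp add: divide_inverse distrib_right mult.assoc)
    qed
    have "((\<lambda>y. C * inverse (q y) + 2 * (ln y / q y) + ln (q y) / q y) \<longlongrightarrow> C * 0 + 2 * 0 + 0) at_top"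
      by (intro tendsto_add tendsto_mult tendsto_const tendsto_inverse_0_at_top q_at_top ln_over_q ln_q_over_q)
    then show "((\<lambda>y. C * inverse (q y) + 2 * (ln y / q y) + ln (q y) / q y) \<longlongrightarrow> 0) at_top" by simp
  qed
  then show ?thesis by (rule LIM_zero_cancel)
qed

text \<open>Positive lower order says a ln y < ln (phi y) eventually, for some a > 0, and
  \<open>\<phi>\<close> is at most 40 q; so ln y is O(ln q).\<close>

lemma ln_rho_bigo:
  assumes p: "1 \<le> p" and lower_order: "Liminf at_top (\<lambda>t. ereal (ln (\<phi> t) / ln t)) > 0"
  obtains c where "eventually (\<lambda>y. \<bar>ln (rho p W (dP y)) + q y\<bar> \<le> c * \<bar>ln (q y)\<bar>) at_top"
proof -
  obtain C where C: "C \<ge> 0" "eventually (\<lambda>y. \<bar>ln (rho p W (dP y)) + q y\<bar> \<le> C + 2 * ln y + ln (q y)) at_top"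
    using eventually_ln_rho[OF p] by blast
  obtain a where a: "0 < ereal a" "ereal a < Liminf at_top (\<lambda>t. ereal (ln (\<phi> t) / ln t))"
    using ereal_dense2[OF lower_order] by blast
  have "eventually (\<lambda>t. ereal a < ereal (ln (\<phi> t) / ln t)) at_top"
    using less_LiminfD[OF a(2)] .
  then have "eventually (\<lambda>y. \<bar>ln (rho p W (dP y)) + q y\<bar> \<le> (C + 2 * (41 / a) + 1) * \<bar>ln (q y)\<bar>) at_top"
    using C(2) eventually_q_ge[of "exp 1"] eventually_gt_at_top[of 1] phi_at_top[unfolded filterlim_at_top_dense, rule_format, of 0]
  proof eventually_elim
    case (elim y)
    have ly: "ln y > 0" using elim by simp
    have lq: "ln (q y) \<ge> 1"
    proof -
      have "ln (exp 1) \<le> ln (q y)" using elim(3) by (intro ln_mono) auto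
      then show ?thesis by simp
    qed
    have "a * ln y \<le> ln (\<phi> y)" using elim(1) ly by (simp add: pos_less_divide_eq)
    also have "\<dots> \<le> ln (40 * q y)"
      using elim q_ge_phi[of y] by (intro ln_mono) auto
    also have "\<dots> = ln 40 + ln (q y)"
      using order_less_le_trans[OF exp_gt_zero elim(3)] by (simp add: ln_mult)
    \<comment> \<open>ln 40 is at most 39, and ln (q y) is at least 1 because q y was taken above
      exp 1.\<close>
    also have "\<dots> \<le> 40 * ln (q y) + ln (q y)"
      using lq ln_le_minus_one[of "40::real"] by simp
    finally have "ln y \<le> 41 / a * ln (q y)" using a(1) by (simp add: field_simps)
    moreover have "C \<le> C * ln (q y)" using C(1) lq mult_left_mono[of 1 "ln (q y)" C] by simp
    ultimately have "C + 2 * ln y + ln (q y) \<le> C * ln (q y) + 2 * (41 / a * ln (q y)) + ln (q y)" by linarith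
    also have "\<dots> = (C + 2 * (41 / a) + 1) * ln (q y)" by (simp add: algebra_simps)
    also have "ln (q y) = \<bar>ln (q y)\<bar>" using lq by simp
    finally show ?case using elim(2) by linarith
  qed
  then show ?thesis by (rule that)
qed

end

theorem theorem1p1:
  fixes p :: ennreal and \<phi> :: "real \<Rightarrow> real"
    and W :: "complex \<Rightarrow> complex" and \<rho> Q :: "real \<Rightarrow> real"
  assumes "1 \<le> p"
    and "log_weight \<phi>"
    and "filterlim (\<lambda>t. t * deriv \<phi> t /
           (t ^ 3 * (LBINT \<xi>:{t..}. \<phi> \<xi> / \<xi> ^ 4)) powr (2 / 3)) at_top at_top"
  defines "W \<equiv> outer_weight \<phi>"
  defines "\<rho> \<equiv> rho p W"
  defines "Q \<equiv> legendre_Q W"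
  shows "((\<lambda>s. ln (\<rho> s)) \<sim>[at_right 0] (\<lambda>s. - Q s)) \<and>
         (inverse_fourier (\<lambda>z. 1 / W z) \<sim>[at_right 0]
            (\<lambda>s. of_real (sqrt (deriv (deriv Q) s) * exp (- Q s)))) \<and>
         (Liminf at_top (\<lambda>t. ereal (ln (\<phi> t) / ln t)) > 0 \<longrightarrow>
            (\<lambda>s. ln (\<rho> s) + Q s) \<in> O[at_right 0](\<lambda>s. ln (Q s)))"
proof -
  interpret regular_log_weight \<phi>
    using assms(2,3) by (simp add: regular_log_weight_def regular_log_weight_axioms_def)
  note ev = eventually_dP_Y
  \<comment> \<open>All estimates are stated in the height y. As s tends to 0 from the right, Y s
    tends to infinity, and \<open>dP (Y s)\<close> equals s for small s, so they transfer to
    s.\<close>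
  have at_Y: "eventually (\<lambda>s. P (Y s)) (at_right 0)" if "eventually P at_top" for P
    using Y_at_top that by (rule eventually_compose_filterlim[rotated])
  have "((\<lambda>s. ln (rho p W (dP (Y s))) / (- q (Y s))) \<longlongrightarrow> 1) (at_right 0)"
    by (rule filterlim_compose[OF ln_rho_ratio[OF assms(1)] Y_at_top, folded W_def])
  then have "((\<lambda>s. ln (\<rho> s) / (- Q s)) \<longlongrightarrow> 1) (at_right 0)"
    by (rule Lim_transform_eventually)
       (use ev in eventually_elim, simp add: \<rho>_def Q_def W_def Y legendre_Q_eq)
  then have 1: "(\<lambda>s. ln (\<rho> s)) \<sim>[at_right 0] (\<lambda>s. - Q s)"
    by (rule asymp_equivI')
  have "((\<lambda>s. inverse_fourier (\<lambda>z. 1 / W z) (dP (Y s)) / of_real (exp (- q (Y s)) / sqrt (sig2 (Y s)))) \<longlongrightarrow> 1) (at_right 0)"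
    unfolding W_def by (rule filterlim_compose[OF inverse_fourier_inverse_W_limit Y_at_top])
  then have "((\<lambda>s. inverse_fourier (\<lambda>z. 1 / W z) s / of_real (sqrt (deriv (deriv Q) s) * exp (- Q s))) \<longlongrightarrow> 1) (at_right 0)"
    by (rule Lim_transform_eventually)
       (use ev in eventually_elim, simp add: Q_def W_def Y legendre_Q_eq deriv2_legendre_Q real_sqrt_divide)
  then have 2: "inverse_fourier (\<lambda>z. 1 / W z) \<sim>[at_right 0] (\<lambda>s. of_real (sqrt (deriv (deriv Q) s) * exp (- Q s)))"
    by (rule asymp_equivI')
  have 3: "(\<lambda>s. ln (\<rho> s) + Q s) \<in> O[at_right 0](\<lambda>s. ln (Q s))"
    if lower_order: "Liminf at_top (\<lambda>t. ereal (ln (\<phi> t) / ln t)) > 0"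
  proof -
    obtain c where "eventually (\<lambda>y. \<bar>ln (rho p (outer_weight \<phi>) (dP y)) + q y\<bar> \<le> c * \<bar>ln (q y)\<bar>) at_top"
      using ln_rho_bigo[OF assms(1) lower_order] by blast
    from at_Y[OF this] have "eventually (\<lambda>s. norm (ln (\<rho> s) + Q s) \<le> c * norm (ln (Q s))) (at_right 0)"
      using ev by eventually_elim (simp add: \<rho>_def Q_def W_def Y legendre_Q_eq)
    then show ?thesis by (rule bigoI)
  qed
  from 1 2 3 show ?thesis by blast
qed

end
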